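(* Let $k$ be a field of characteristic $0$ and, for $n\ge1$, let $\Phi_n:\mathrm{DRep}_n(k[x,y])^{\mathrm{GL}}\to k[x_1,\dots,x_n,y_1,\dots,y_n,\theta_1,\dots,\theta_n]^{S_n}$ be the derived Harish-Chandra homomorphism for $A=k[x,y]$. (i) For any $n\ge1$, the map $\mathrm H_\bullet(\Phi_n)$ induced on homology is degreewise surjective. (ii) The map $\mathrm H_\bullet(\Phi_\infty)$ is an isomorphism of bigraded commutative algebras.
   Context: $\mathrm{DRep}_n(k[x,y])$ is (represented by) the commutative DG algebra freely generated by $x_{ij},y_{ij}$ of homological degree $0$ and $\theta_{ij}$ of homological degree $1$ ($1\le i,j\le n$), with $d\theta_{ij}=\sum_{l}(x_{il}y_{lj}-y_{il}x_{lj})$, $dx_{ij}=dy_{ij}=0$. $\mathrm{GL}_n(k)$ acts by simultaneous conjugation of the matrices $\|x_{ij}\|,\|y_{ij}\|,\|\theta_{ij}\|$, and $\mathrm{DRep}_n(k[x,y])^{\mathrm{GL}}$ is the DG subalgebra of invariants. In $k[x_1,\dots,x_n,y_1,\dots,y_n,\theta_1,\dots,\theta_n]$ (graded commutative, zero differential), $x_i,y_i$ have degree $0$, $\theta_i$ degree $1$, and $S_n$ permutes the triples $(x_i,y_i,\theta_i)$. $\Phi_n$ is the restriction to invariants of the DG algebra map $x_{ij}\mapsto\delta_{ij}x_i$, $y_{ij}\mapsto\delta_{ij}y_i$, $\theta_{ij}\mapsto\delta_{ij}\theta_i$. All these algebras are bigraded: besides the homological degree they have a weight, with the $x$- and $y$-variables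 of weight $1$ and the $\theta$-variables of weight $2$; the maps $\Phi_n$ and the differentials preserve weight. Setting all variables with an index equal to $n$ to zero gives DG algebra maps from level $n$ to level $n-1$ on both sides, compatible with the $\Phi_n$. $\Phi_\infty:\varprojlim_n\mathrm{DRep}_n(k[x,y])^{\mathrm{GL}}\to\varprojlim_n k[x_1,\dots,x_n,y_1,\dots,y_n,\theta_1,\dots,\theta_n]^{S_n}$ is the induced map of projective limits, the limits being taken in the category of bigraded commutative DG algebras (i.e. bidegree by bidegree). *)

theory Defs
  imports
    "HOL-Library.Poly_Mapping"
    "HOL-Library.Product_Lexorder"
    "HOL-Combinatorics.Permutations"
    "HOL-Algebra.QuotRing"
    "HOL-Algebra.Module"
    "Jordan_Normal_Form.Matrix"
begin

section \<open>Bigraded DG algebras and their homology\<close>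

text \<open>
  A bigraded DG algebra over the field \<open>'k\<close>.  The set \<open>bicomp A i w\<close> is the component of
  homological degree \<open>i\<close> and weight \<open>w\<close>; the carrier is the direct sum of these components.
\<close>

record ('k, 'a) bgdga = "('k, 'a) module" +
  diff :: "'a \<Rightarrow> 'a"
  bicomp :: "nat \<Rightarrow> nat \<Rightarrow> 'a set"

definition cycles :: "('k, 'a) bgdga \<Rightarrow> 'a set" where
  "cycles A = {z \<in> carrier A. diff A z = \<zero>\<^bsub>A\<^esub>}"

definition boundaries :: "('k, 'a) bgdga \<Rightarrow> 'a set" where
  "boundaries A = diff A ` carrier A"

definition homology_class :: "('k, 'a) bgdga \<Rightarrow> 'a \<Rightarrow> 'a set" where
  "homology_class A z = boundaries A +>\<^bsub>A\<^esub> z"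

text \<open>
  Homology is the quotient ring of the ring of cycles by the ideal of boundaries, with the induced
  scalar multiplication and bigrading and with zero differential.
\<close>

definition homology :: "('k, 'a) bgdga \<Rightarrow> ('k, 'a set) bgdga" where
  "homology A =
    (let H = A\<lparr>carrier := cycles A\<rparr> Quot boundaries A in
      \<lparr>carrier = carrier H, monoid.mult = monoid.mult H, one = one H, zero = zero H, add = add H,
       smult = (\<lambda>c C. \<Union>z\<in>C. homology_class A (c \<odot>\<^bsub>A\<^esub> z)),
       diff = (\<lambda>_. zero H),
       bicomp = (\<lambda>i w. homology_class A ` (cycles A \<inter> bicomp A i w))\<rparr>)"

text \<open>
  The map \<open>[z] \<mapsto> [f z]\<close>; for a chain map \<open>f\<close> all the sets in the union coincide.
\<close>

definition homology_map ::
    "('k, 'a) bgdga \<Rightarrow> ('k, 'b) bgdga \<Rightarrow> ('a \<Rightarrow> 'b) \<Rightarrow> 'a set \<Rightarrow> 'b set" where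
  "homology_map A B f C = (\<Union>z\<in>C. homology_class B (f z))"

text \<open>The part of homological degree \<open>i\<close>, i.e. the direct sum over all weights.\<close>

definition degree_part :: "('k, 'a) bgdga \<Rightarrow> nat \<Rightarrow> 'a set" where
  "degree_part A i =
    {\<Oplus>\<^bsub>A\<^esub>w\<in>W. s w | W s. finite W \<and> (\<forall>w\<in>W. s w \<in> bicomp A i w)}"

definition degreewise_surjective ::
    "('k, 'a) bgdga \<Rightarrow> ('k, 'b) bgdga \<Rightarrow> ('a \<Rightarrow> 'b) \<Rightarrow> bool" where
  "degreewise_surjective A B h \<longleftrightarrow> (\<forall>i. h ` degree_part A i = degree_part B i)"

definition bigraded_algebra_iso ::
    "('k, 'a) bgdga \<Rightarrow> ('k, 'b) bgdga \<Rightarrow> ('a \<Rightarrow> 'b) \<Rightarrow> bool" where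
  "bigraded_algebra_iso A B h \<longleftrightarrow>
    h \<in> ring_iso A B \<and>
    (\<forall>c. \<forall>x\<in>carrier A. h (c \<odot>\<^bsub>A\<^esub> x) = c \<odot>\<^bsub>B\<^esub> h x) \<and>
    (\<forall>i w. h ` bicomp A i w = bicomp B i w)"

definition restrict_to :: "('k, 'a) bgdga \<Rightarrow> 'a set \<Rightarrow> ('k, 'a) bgdga" where
  "restrict_to A I =
    A\<lparr>carrier := carrier A \<inter> I, bicomp := (\<lambda>i w. bicomp A i w \<inter> I)\<rparr>"

text \<open>
  The inverse limit of a tower \<open>A 0 \<leftarrow> A 1 \<leftarrow> \<dots>\<close> with transition maps
  \<open>t m : A (m + 1) \<rightarrow> A m\<close> in bigraded DG algebras: it is formed in each bidegree
  separately, so its elements are finite sums of bihomogeneous compatible sequences.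
\<close>

definition lim_bicomp ::
    "(nat \<Rightarrow> ('k, 'a) bgdga) \<Rightarrow> (nat \<Rightarrow> 'a \<Rightarrow> 'a) \<Rightarrow> nat \<Rightarrow> nat \<Rightarrow> (nat \<Rightarrow> 'a) set" where
  "lim_bicomp A t i w = {f. \<forall>m. f m \<in> bicomp (A m) i w \<and> t m (f (Suc m)) = f m}"

definition inverse_limit ::
    "(nat \<Rightarrow> ('k, 'a) bgdga) \<Rightarrow> (nat \<Rightarrow> 'a \<Rightarrow> 'a) \<Rightarrow> ('k, nat \<Rightarrow> 'a) bgdga" where
  "inverse_limit A t =
    \<lparr>carrier = {\<lambda>m. \<Oplus>\<^bsub>A m\<^esub>p\<in>F. s p m | F s.
       finite F \<and> (\<forall>(i, w)\<in>F. s (i, w) \<in> lim_bicomp A t i w)},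
     monoid.mult = (\<lambda>f g m. f m \<otimes>\<^bsub>A m\<^esub> g m),
     one = (\<lambda>m. \<one>\<^bsub>A m\<^esub>),
     zero = (\<lambda>m. \<zero>\<^bsub>A m\<^esub>),
     add = (\<lambda>f g m. f m \<oplus>\<^bsub>A m\<^esub> g m),
     smult = (\<lambda>c f m. c \<odot>\<^bsub>A m\<^esub> f m),
     diff = (\<lambda>f m. diff (A m) (f m)),
     bicomp = lim_bicomp A t\<rparr>"


section \<open>Free graded commutative algebras\<close>

type_synonym ('v, 'k) mpoly = "('v \<Rightarrow>\<^sub>0 nat) \<Rightarrow>\<^sub>0 'k"

definition pvar :: "'v \<Rightarrow> ('v, 'k::zero_neq_one) mpoly" where
  "pvar v = Poly_Mapping.single (Poly_Mapping.single v 1) 1"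

definition pconst :: "'k::zero \<Rightarrow> ('v, 'k) mpoly" where
  "pconst c = Poly_Mapping.single 0 c"

definition poly_subst :: "('v \<Rightarrow> ('u, 'k) mpoly) \<Rightarrow> ('v, 'k::comm_ring_1) mpoly \<Rightarrow> ('u, 'k) mpoly"
  where "poly_subst \<phi> p =
    (\<Sum>m\<in>Poly_Mapping.keys p. pconst (Poly_Mapping.lookup p m) *
      (\<Prod>v\<in>Poly_Mapping.keys m. \<phi> v ^ Poly_Mapping.lookup m v))"

text \<open>
  The free graded commutative algebra on generators \<open>v :: 'v\<close> of degree 0 and \<open>s :: 'o\<close> of
  degree 1, i.e. the exterior algebra on the \<open>s\<close> over the polynomial ring in the \<open>v\<close>.
  An element is the family of its coefficients with respect to the basis
  \<open>\<theta>\<^sub>S = \<theta>\<^sub>s\<^sub>1 \<cdots> \<theta>\<^sub>s\<^sub>k\<close> for finite \<open>S = {s\<^sub>1 < \<dots> < s\<^sub>k}\<close>.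
\<close>

typedef (overloaded) ('v, 'o, 'k) gca =
  "{f :: 'o set \<Rightarrow> ('v, 'k::zero) mpoly. finite {S. f S \<noteq> 0} \<and> (\<forall>S. f S \<noteq> 0 \<longrightarrow> finite S)}"
  morphisms coeff_gca Abs_gca
  by (rule exI[of _ "\<lambda>_. 0"]) simp

setup_lifting type_definition_gca

definition support :: "('v, 'o, 'k::zero) gca \<Rightarrow> 'o set set" where
  "support f = {S. coeff_gca f S \<noteq> 0}"

lemma gca_eqI:
  fixes f g :: "('a, 'b, 'c::zero) gca"
  assumes "\<And>S. finite S \<Longrightarrow> coeff_gca f S = coeff_gca g S"
  shows "f = g"
proof -
  have "coeff_gca x S = 0" if "infinite S" for x :: "('a, 'b, 'c) gca" and S
    using coeff_gca[of x] that by blast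
  then have "coeff_gca f S = coeff_gca g S" for S
    using assms[of S] by (cases "finite S") simp_all
  then show ?thesis by (simp add: coeff_gca_inject[symmetric] fun_eq_iff)
qed

text \<open>\<open>\<theta>\<^sub>A \<theta>\<^sub>B = shuffle_sign A B \<theta>\<^bsub>A \<union> B\<^esub>\<close> for disjoint \<open>A\<close> and \<open>B\<close>.\<close>

definition shuffle_sign :: "'o::linorder set \<Rightarrow> 'o set \<Rightarrow> 'r::ring_1" where
  "shuffle_sign A B = (- 1) ^ card {(a, b) \<in> A \<times> B. b < a}"

lemma shuffle_sign_empty [simp]: "shuffle_sign {} B = 1" "shuffle_sign A {} = 1"
  by (simp_all add: shuffle_sign_def)

lemma shuffle_sign_Un_left:
  assumes "finite A" "finite B" "finite C" "A \<inter> B = {}"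
  shows "shuffle_sign (A \<union> B) C = shuffle_sign A C * shuffle_sign B C"
proof -
  have "{(a, c) \<in> (A \<union> B) \<times> C. c < a} = {(a, c) \<in> A \<times> C. c < a} \<union> {(a, c) \<in> B \<times> C. c < a}"
    by auto
  moreover have "finite {(a, c) \<in> A \<times> C. c < a}" "finite {(a, c) \<in> B \<times> C. c < a}"
    using assms by (auto intro: finite_subset[of _ "A \<times> C"] finite_subset[of _ "B \<times> C"])
  moreover have "{(a, c) \<in> A \<times> C. c < a} \<inter> {(a, c) \<in> B \<times> C. c < a} = {}"
    using assms by auto
  ultimately show ?thesis
    by (simp add: shuffle_sign_def card_Un_disjoint power_add)
qed

lemma shuffle_sign_Un_right:
  assumes "finite A" "finite B" "finite C" "B \<inter> C = {}"
  shows "shuffle_sign A (B \<union> C) = shuffle_sign A B * shuffle_sign A C"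
proof -
  have "{(a, c) \<in> A \<times> (B \<union> C). c < a} = {(a, c) \<in> A \<times> B. c < a} \<union> {(a, c) \<in> A \<times> C. c < a}"
    by auto
  moreover have "finite {(a, c) \<in> A \<times> B. c < a}" "finite {(a, c) \<in> A \<times> C. c < a}"
    using assms by (auto intro: finite_subset[of _ "A \<times> C"] finite_subset[of _ "A \<times> B"])
  moreover have "{(a, c) \<in> A \<times> B. c < a} \<inter> {(a, c) \<in> A \<times> C. c < a} = {}"
    using assms by auto
  ultimately show ?thesis
    by (simp add: shuffle_sign_def card_Un_disjoint power_add)
qed

instantiation gca :: (type, linorder, comm_ring_1) ring_1
begin

lift_definition zero_gca :: "('a, 'b, 'c) gca" is "\<lambda>_. 0" by simp

lift_definition one_gca :: "('a, 'b, 'c) gca" is "\<lambda>S. if S = {} then 1 else 0" by auto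

lift_definition plus_gca :: "('a, 'b, 'c) gca \<Rightarrow> ('a, 'b, 'c) gca \<Rightarrow> ('a, 'b, 'c) gca"
  is "\<lambda>f g S. f S + g S"
proof -
  fix f g :: "'b set \<Rightarrow> ('a, 'c) mpoly"
  assume *: "finite {S. f S \<noteq> 0} \<and> (\<forall>S. f S \<noteq> 0 \<longrightarrow> finite S)"
    "finite {S. g S \<noteq> 0} \<and> (\<forall>S. g S \<noteq> 0 \<longrightarrow> finite S)"
  have "{S. f S + g S \<noteq> 0} \<subseteq> {S. f S \<noteq> 0} \<union> {S. g S \<noteq> 0}" by auto
  then show "finite {S. f S + g S \<noteq> 0} \<and> (\<forall>S. f S + g S \<noteq> 0 \<longrightarrow> finite S)"
    using * by (metis (mono_tags, lifting) add.right_neutral finite_Un finite_subset)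
qed

lift_definition uminus_gca :: "('a, 'b, 'c) gca \<Rightarrow> ('a, 'b, 'c) gca"
  is "\<lambda>f S. - f S" by simp

lift_definition minus_gca :: "('a, 'b, 'c) gca \<Rightarrow> ('a, 'b, 'c) gca \<Rightarrow> ('a, 'b, 'c) gca"
  is "\<lambda>f g S. f S - g S"
proof -
  fix f g :: "'b set \<Rightarrow> ('a, 'c) mpoly"
  assume *: "finite {S. f S \<noteq> 0} \<and> (\<forall>S. f S \<noteq> 0 \<longrightarrow> finite S)"
    "finite {S. g S \<noteq> 0} \<and> (\<forall>S. g S \<noteq> 0 \<longrightarrow> finite S)"
  have "{S. f S - g S \<noteq> 0} \<subseteq> {S. f S \<noteq> 0} \<union> {S. g S \<noteq> 0}" by auto
  then show "finite {S. f S - g S \<noteq> 0} \<and> (\<forall>S. f S - g S \<noteq> 0 \<longrightarrow> finite S)"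
    using * by (metis (mono_tags, lifting) diff_self finite_Un finite_subset)
qed

lift_definition times_gca :: "('a, 'b, 'c) gca \<Rightarrow> ('a, 'b, 'c) gca \<Rightarrow> ('a, 'b, 'c) gca"
  is "\<lambda>f g S. \<Sum>A\<in>Pow S. shuffle_sign A (S - A) * f A * g (S - A)"
proof -
  fix f g :: "'b set \<Rightarrow> ('a, 'c) mpoly"
  assume *: "finite {S. f S \<noteq> 0} \<and> (\<forall>S. f S \<noteq> 0 \<longrightarrow> finite S)"
    "finite {S. g S \<noteq> 0} \<and> (\<forall>S. g S \<noteq> 0 \<longrightarrow> finite S)"
  let ?h = "\<lambda>S. \<Sum>A\<in>Pow S. shuffle_sign A (S - A) * f A * g (S - A)"
  have "\<exists>A B. f A \<noteq> 0 \<and> g B \<noteq> 0 \<and> S = A \<union> B" if "?h S \<noteq> 0" for S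
  proof -
    from that obtain A where "A \<in> Pow S" "shuffle_sign A (S - A) * f A * g (S - A) \<noteq> 0"
      by (metis (no_types, lifting) sum.neutral)
    then have "f A \<noteq> 0" "g (S - A) \<noteq> 0" "S = A \<union> (S - A)" by auto
    then show ?thesis by blast
  qed
  then have sub: "{S. ?h S \<noteq> 0} \<subseteq> (\<lambda>(A, B). A \<union> B) ` ({S. f S \<noteq> 0} \<times> {S. g S \<noteq> 0})"
    by force
  then have "finite {S. ?h S \<noteq> 0}"
    using * by (meson finite_SigmaI finite_imageI finite_subset)
  moreover have "\<forall>S. ?h S \<noteq> 0 \<longrightarrow> finite S"
    using sub * by auto
  ultimately show "finite {S. ?h S \<noteq> 0} \<and> (\<forall>S. ?h S \<noteq> 0 \<longrightarrow> finite S)" by blast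
qed

instance
proof
  fix f g h :: "('a, 'b, 'c) gca"
  show "f + g + h = f + (g + h)" by transfer (simp add: add.assoc)
  show "f + g = g + f" by transfer (simp add: add.commute)
  show "0 + f = f" by transfer simp
  show "- f + f = 0" by transfer simp
  show "f - g = f + - g" by transfer simp
  show "(f + g) * h = f * h + g * h"
    by transfer (simp add: algebra_simps sum.distrib)
  show "f * (g + h) = f * g + f * h"
    by transfer (simp add: algebra_simps sum.distrib)
  show "1 * f = f"
  proof (rule gca_eqI)
    fix S :: "'b set" assume "finite S"
    then have "coeff_gca (1 * f) S =
        (\<Sum>A\<in>Pow S. if A = {} then coeff_gca f S else 0)"
      unfolding times_gca.rep_eq one_gca.rep_eq by (intro sum.cong) auto
    also have "\<dots> = coeff_gca f S" using \<open>finite S\<close> by (subst sum.delta) auto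
    finally show "coeff_gca (1 * f) S = coeff_gca f S" .
  qed
  show "f * 1 = f"
  proof (rule gca_eqI)
    fix S :: "'b set" assume "finite S"
    then have "coeff_gca (f * 1) S =
        (\<Sum>A\<in>Pow S. if A = S then coeff_gca f S else 0)"
      unfolding times_gca.rep_eq one_gca.rep_eq by (intro sum.cong) auto
    also have "\<dots> = coeff_gca f S" using \<open>finite S\<close> by (subst sum.delta) auto
    finally show "coeff_gca (f * 1) S = coeff_gca f S" .
  qed
  show "(0 :: ('a, 'b, 'c) gca) \<noteq> 1"
    by transfer (metis zero_neq_one)
  show "f * g * h = f * (g * h)"
  proof (rule gca_eqI)
    fix S :: "'b set" assume S: "finite S"
    let ?f = "coeff_gca f" and ?g = "coeff_gca g" and ?h = "coeff_gca h"
    let ?s = "shuffle_sign :: 'b set \<Rightarrow> 'b set \<Rightarrow> ('a, 'c) mpoly"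
    have "coeff_gca (f * g * h) S =
        (\<Sum>(C, A)\<in>(SIGMA C:Pow S. Pow C).
          ?s C (S - C) * ?s A (C - A) * (?f A * ?g (C - A) * ?h (S - C)))"
      using S unfolding times_gca.rep_eq
      by (simp add: sum_distrib_left sum_distrib_right sum.Sigma finite_subset algebra_simps)
    also have "\<dots> = (\<Sum>(A, B)\<in>(SIGMA A:Pow S. Pow (S - A)).
          ?s A (S - A) * ?s B (S - A - B) * (?f A * ?g B * ?h (S - A - B)))"
    proof (rule sum.reindex_bij_witness
        [where i = "\<lambda>(A, B). (A \<union> B, A)" and j = "\<lambda>(C, A). (A, C - A)"]; clarsimp)
      fix C A assume "C \<subseteq> S" "A \<subseteq> C"
      then have fin: "finite C" "finite A" "finite (S - C)" "finite (C - A)"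
        using S by (auto intro: finite_subset)
      from \<open>C \<subseteq> S\<close> \<open>A \<subseteq> C\<close> have eq: "S - A - (C - A) = S - C"
        "C = A \<union> (C - A)" "S - A = (C - A) \<union> (S - C)" by auto
      have "?s C (S - C) = ?s A (S - C) * ?s (C - A) (S - C)"
        using shuffle_sign_Un_left[of A "C - A" "S - C"] fin eq(2) by auto
      moreover have "?s A (S - A) = ?s A (C - A) * ?s A (S - C)"
        using shuffle_sign_Un_right[of A "C - A" "S - C"] fin eq(3) by auto
      ultimately show "?s A (S - A) * ?s (C - A) (S - A - (C - A)) *
          (?f A * ?g (C - A) * ?h (S - A - (C - A))) =
          ?s C (S - C) * ?s A (C - A) * (?f A * ?g (C - A) * ?h (S - C))"
        unfolding eq(1) by (simp add: mult_ac)
    qed (auto simp: Un_Diff)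
    also have "\<dots> = coeff_gca (f * (g * h)) S"
      using S unfolding times_gca.rep_eq
      by (simp add: sum_distrib_left sum_distrib_right sum.Sigma finite_subset algebra_simps)
    finally show "coeff_gca (f * g * h) S = coeff_gca (f * (g * h)) S" .
  qed
qed

end

definition gca_poly :: "('v, 'k::zero) mpoly \<Rightarrow> ('v, 'o, 'k) gca" where
  "gca_poly p = Abs_gca (\<lambda>S. if S = {} then p else 0)"

lemma coeff_gca_poly: "coeff_gca (gca_poly p) S = (if S = {} then p else 0)"
  unfolding gca_poly_def by (subst Abs_gca_inverse) auto

definition theta_basis :: "'o set \<Rightarrow> ('v, 'o, 'k::zero_neq_one) gca" where
  "theta_basis T = Abs_gca (\<lambda>S. if S = T \<and> finite T then pconst 1 else 0)"

lemma coeff_theta_basis: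
  "coeff_gca (theta_basis T) S = (if S = T \<and> finite T then pconst 1 else 0)"
  unfolding theta_basis_def by (subst Abs_gca_inverse) auto

abbreviation theta :: "'o \<Rightarrow> ('v, 'o, 'k::zero_neq_one) gca" where
  "theta s \<equiv> theta_basis {s}"

definition gca_smult :: "'k \<Rightarrow> ('v, 'o::linorder, 'k::comm_ring_1) gca \<Rightarrow> ('v, 'o, 'k) gca" where
  "gca_smult c f = gca_poly (pconst c) * f"

text \<open>
  The algebra homomorphism with \<open>v \<mapsto> \<phi> v\<close> and \<open>\<theta>\<^sub>s \<mapsto> \<psi> s\<close>.  Since it
  is to preserve homological degrees, the images \<open>\<phi> v\<close> are polynomials.
\<close>

definition gca_hom ::
    "('v \<Rightarrow> ('u, 'k) mpoly) \<Rightarrow> ('o \<Rightarrow> ('u, 'p, 'k) gca) \<Rightarrow>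
     ('v, 'o::linorder, 'k::comm_ring_1) gca \<Rightarrow> ('u, 'p::linorder, 'k) gca" where
  "gca_hom \<phi> \<psi> f =
    (\<Sum>S\<in>support f. gca_poly (poly_subst \<phi> (coeff_gca f S)) *
      prod_list (map \<psi> (sorted_list_of_set S)))"

text \<open>
  The derivation of degree \<open>-1\<close> with \<open>v \<mapsto> 0\<close> and \<open>\<theta>\<^sub>s \<mapsto> \<delta> s\<close>.
  The graded Leibniz rule gives
  \<open>\<theta>\<^sub>s\<^sub>1 \<cdots> \<theta>\<^sub>s\<^sub>k \<mapsto> \<Sum>\<^sub>j (-1)\<^sup>j\<^sup>-\<^sup>1 \<delta> s\<^sub>j \<theta>\<^sub>s\<^sub>1 \<cdots> \<theta>\<^sub>s\<^sub>k\<close> with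
  \<open>\<theta>\<^sub>s\<^sub>j\<close> omitted in the \<open>j\<close>-th summand.
\<close>

definition gca_diff ::
    "('o \<Rightarrow> ('v, 'k) mpoly) \<Rightarrow>
     ('v, 'o::linorder, 'k::comm_ring_1) gca \<Rightarrow> ('v, 'o, 'k) gca" where
  "gca_diff \<delta> f =
    (\<Sum>S\<in>support f. \<Sum>s\<in>S.
      (- 1) ^ card {r \<in> S. r < s} * gca_poly (coeff_gca f S * \<delta> s) * theta_basis (S - {s}))"

text \<open>Elements involving only the generators in \<open>V\<close> and \<open>W\<close>.\<close>

definition gca_on :: "'v set \<Rightarrow> 'o set \<Rightarrow> ('v, 'o, 'k::zero) gca set" where
  "gca_on V W =
    {f. \<forall>S\<in>support f. S \<subseteq> W \<and> (\<forall>m\<in>Poly_Mapping.keys (coeff_gca f S). Poly_Mapping.keys m \<subseteq> V)}"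

text \<open>The generators \<open>v\<close> have weight 1 and the generators \<open>\<theta>\<^sub>s\<close> have weight 2.\<close>

definition gca_bihomogeneous :: "nat \<Rightarrow> nat \<Rightarrow> ('v, 'o, 'k::zero) gca set" where
  "gca_bihomogeneous i w =
    {f. \<forall>S\<in>support f. card S = i \<and>
      (\<forall>m\<in>Poly_Mapping.keys (coeff_gca f S).
        (\<Sum>v\<in>Poly_Mapping.keys m. Poly_Mapping.lookup m v) + 2 * card S = w)}"

definition free_bgdga ::
    "'v set \<Rightarrow> 'o set \<Rightarrow> ('o \<Rightarrow> ('v, 'k) mpoly) \<Rightarrow>
     ('k, ('v, 'o::linorder, 'k::comm_ring_1) gca) bgdga" where
  "free_bgdga V W \<delta> =
    \<lparr>carrier = gca_on V W, monoid.mult = (*), one = 1, zero = 0, add = (+),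
     smult = gca_smult, diff = gca_diff \<delta>,
     bicomp = (\<lambda>i w. gca_on V W \<inter> gca_bihomogeneous i w)\<rparr>"


section \<open>The derived Harish-Chandra homomorphism for \<open>k[x,y]\<close>\<close>

text \<open>
  Indices run over \<open>{0..<n}\<close> instead of \<open>{1..n}\<close>.  All levels \<open>n\<close> live in one
  algebra, on generators indexed by all natural numbers.
\<close>

datatype 'i xy = X 'i | Y 'i

type_synonym 'k mat_gca = "((nat \<times> nat) xy, nat \<times> nat, 'k) gca"
type_synonym 'k diag_gca = "(nat xy, nat, 'k) gca"

definition xy_vars :: "'i set \<Rightarrow> 'i xy set" where
  "xy_vars I = X ` I \<union> Y ` I"

definition DRep_diff :: "nat \<Rightarrow> nat \<times> nat \<Rightarrow> ((nat \<times> nat) xy, 'k::comm_ring_1) mpoly" where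
  "DRep_diff n = (\<lambda>(i, j). \<Sum>l<n.
    pvar (X (i, l)) * pvar (Y (l, j)) - pvar (Y (i, l)) * pvar (X (l, j)))"

definition DRep :: "nat \<Rightarrow> ('k::field_char_0, 'k mat_gca) bgdga" where
  "DRep n = free_bgdga (xy_vars ({..<n} \<times> {..<n})) ({..<n} \<times> {..<n}) (DRep_diff n)"

text \<open>
  For \<open>h\<close> the inverse of \<open>g\<close>: replace each generic matrix \<open>M\<close> among
  \<open>\<parallel>x\<^sub>i\<^sub>j\<parallel>, \<parallel>y\<^sub>i\<^sub>j\<parallel>, \<parallel>\<theta>\<^sub>i\<^sub>j\<parallel>\<close> by \<open>g M h\<close>.
\<close>

definition conj_act :: "nat \<Rightarrow> 'k mat \<Rightarrow> 'k mat \<Rightarrow> 'k::field_char_0 mat_gca \<Rightarrow> 'k mat_gca" where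
  "conj_act n g h =
    gca_hom
      (\<lambda>v. case v of
          X (i, j) \<Rightarrow> \<Sum>k<n. \<Sum>l<n. pconst (g $$ (i, k) * h $$ (l, j)) * pvar (X (k, l))
        | Y (i, j) \<Rightarrow> \<Sum>k<n. \<Sum>l<n. pconst (g $$ (i, k) * h $$ (l, j)) * pvar (Y (k, l)))
      (\<lambda>(i, j). \<Sum>k<n. \<Sum>l<n. gca_smult (g $$ (i, k) * h $$ (l, j)) (theta (k, l)))"

definition GL_invariants :: "nat \<Rightarrow> 'k::field_char_0 mat_gca set" where
  "GL_invariants n =
    {f. \<forall>g\<in>carrier_mat n n. \<forall>h\<in>carrier_mat n n.
      inverts_mat g h \<and> inverts_mat h g \<longrightarrow> conj_act n g h f = f}"

definition DRep_GL :: "nat \<Rightarrow> ('k::field_char_0, 'k mat_gca) bgdga" where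
  "DRep_GL n = restrict_to (DRep n) (GL_invariants n)"

definition perm_act :: "(nat \<Rightarrow> nat) \<Rightarrow> 'k::field_char_0 diag_gca \<Rightarrow> 'k diag_gca" where
  "perm_act \<pi> =
    gca_hom (\<lambda>v. case v of X i \<Rightarrow> pvar (X (\<pi> i)) | Y i \<Rightarrow> pvar (Y (\<pi> i))) (\<lambda>i. theta (\<pi> i))"

definition S_invariants :: "nat \<Rightarrow> 'k::field_char_0 diag_gca set" where
  "S_invariants n = {f. \<forall>\<pi>. \<pi> permutes {..<n} \<longrightarrow> perm_act \<pi> f = f}"

definition Diag_S :: "nat \<Rightarrow> ('k::field_char_0, 'k diag_gca) bgdga" where
  "Diag_S n = restrict_to (free_bgdga (xy_vars {..<n}) {..<n} (\<lambda>_. 0)) (S_invariants n)"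

text \<open>
  The formula for \<open>\<Phi>\<^sub>n\<close> does not depend on \<open>n\<close>; only its domain \<open>DRep_GL n\<close> does.
\<close>

definition harish_chandra :: "'k::field_char_0 mat_gca \<Rightarrow> 'k diag_gca" where
  "harish_chandra =
    gca_hom
      (\<lambda>v. case v of X (i, j) \<Rightarrow> if i = j then pvar (X i) else 0
                   | Y (i, j) \<Rightarrow> if i = j then pvar (Y i) else 0)
      (\<lambda>(i, j). if i = j then theta i else 0)"

text \<open>
  The transition maps from level \<open>n + 1\<close> to level \<open>n\<close>; the last index at level
  \<open>n + 1\<close> is \<open>n\<close>.
\<close>

definition DRep_trans :: "nat \<Rightarrow> 'k::field_char_0 mat_gca \<Rightarrow> 'k mat_gca" where
  "DRep_trans n =
    gca_hom
      (\<lambda>v. case v of X (i, j) \<Rightarrow> if i = n \<or> j = n then 0 else pvar (X (i, j))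
                   | Y (i, j) \<Rightarrow> if i = n \<or> j = n then 0 else pvar (Y (i, j)))
      (\<lambda>(i, j). if i = n \<or> j = n then 0 else theta (i, j))"

definition Diag_trans :: "nat \<Rightarrow> 'k::field_char_0 diag_gca \<Rightarrow> 'k diag_gca" where
  "Diag_trans n =
    gca_hom
      (\<lambda>v. case v of X i \<Rightarrow> if i = n then 0 else pvar (X i)
                   | Y i \<Rightarrow> if i = n then 0 else pvar (Y i))
      (\<lambda>i. if i = n then 0 else theta i)"

text \<open>The towers start at level 1, so entry \<open>m\<close> of a sequence belongs to level \<open>m + 1\<close>.\<close>

definition DRep_GL_infinity :: "('k::field_char_0, nat \<Rightarrow> 'k mat_gca) bgdga" where
  "DRep_GL_infinity = inverse_limit (\<lambda>m. DRep_GL (Suc m)) (\<lambda>m. DRep_trans (Suc m))"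

definition Diag_S_infinity :: "('k::field_char_0, nat \<Rightarrow> 'k diag_gca) bgdga" where
  "Diag_S_infinity = inverse_limit (\<lambda>m. Diag_S (Suc m)) (\<lambda>m. Diag_trans (Suc m))"

definition harish_chandra_infinity ::
    "(nat \<Rightarrow> 'k::field_char_0 mat_gca) \<Rightarrow> nat \<Rightarrow> 'k diag_gca" where
  "harish_chandra_infinity f = (\<lambda>m. harish_chandra (f m))"

end

theory Submission
 imports Defs "HOL-Library.Function_Algebras" "HOL-Library.Nat_Bijection" "Jordan_Normal_Form.Char_Poly"
begin

text \<open>
 Work in the big algebra on matrix entries.  Polarisation and invariance of the multilinear part express a
 stable invariant as a sum over all index maps of one word.  An invariant is determined by its restriction to diagonal
 \<open>x\<close>, where the differential becomes \<open>\<theta>\<^sub>p\<^sub>q \<mapsto> (x\<^sub>p - x\<^sub>q) y\<^sub>p\<^sub>q\<close>; the words that remain are permutation graphs,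
 whose complexes are Koszul complexes.  Averaging over cycles contracts them onto canonical cycles, one for each
 monomial of the diagonal algebra.  These are cycles for every \<open>n\<close>, and a triangularity argument by
 the number of indices gives surjectivity for every \<open>n\<close> and injectivity in the stable range.
\<close>

section \<open>Words in the generators\<close>

text \<open>The obstacle is that outside the stable range the invariants have no usable normal form,
  while surjectivity is asserted for every n. So cycles are built by a formula in which n is only
  the range of a summation: contracting a word over all index maps is GL-invariant for each n.
  Restriction to diagonal x is injective because matrices with distinct eigenvalues are dense; the
  algebraic form of this is that x_bb - x_aa is a nonzero divisor. After restriction theta_pq can
  only turn into y_pq times x_p or x_q, so the graph with an arc from row to column for each y or
  theta is preserved. On a cycle of length e the differences of consecutive x are boundaries up to
  the factor y, which leaves one x and one theta, the cycle means. With a copies of x and eps of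
  theta the cycle restricts on the diagonal to x^a theta^eps y^(e - eps): cycles of a permutation
  correspond to the monomials in the variables of one index, and exponents of y are encoded by cycle
  lengths. Index maps that are not injective only add terms with fewer indices; this is the
  triangularity.\<close>

abbreviation cs :: "'k => ('v, 'o, 'k::zero) gca" where
 "cs c \<equiv> gca_poly (pconst c)"

lemma coeff_zero [simp]: "coeff_gca 0 S = 0" by (simp add: zero_gca.rep_eq)

lemma coeff_add [simp]: "coeff_gca (f + g) S = coeff_gca f S + coeff_gca g S" by (simp add: plus_gca.rep_eq)

lemma coeff_uminus [simp]: "coeff_gca (- f) S = - coeff_gca f S" by (simp add: uminus_gca.rep_eq)

lemma coeff_diff [simp]: "coeff_gca (f - g) S = coeff_gca f S - coeff_gca g S" by (simp add: minus_gca.rep_eq)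

lemma coeff_sum: "coeff_gca (sum f A) S = (\<Sum>a\<in>A. coeff_gca (f a) S)"
 by (induction A rule: infinite_finite_induct) auto

lemma coeff_infinite: "infinite S ==> coeff_gca f S = 0" using coeff_gca[of f] by auto

lemma finite_support [simp, intro]: "finite (support f)" using coeff_gca[of f] by (simp add: support_def)

lemma in_support: "S : support f \<longleftrightarrow> coeff_gca f S ~= 0" by (simp add: support_def)

lemma finite_in_support: "S : support f ==> finite S" using coeff_gca[of f] by (auto simp: support_def)

lemma gca_poly_0 [simp]: "gca_poly 0 = 0" by (rule gca_eqI) (simp add: coeff_gca_poly)

lemma gca_poly_1 [simp]: "gca_poly 1 = 1" by (rule gca_eqI) (simp add: coeff_gca_poly one_gca.rep_eq)

lemma gca_poly_add: "gca_poly (p + q) = gca_poly p + gca_poly q" by (rule gca_eqI) (simp add: coeff_gca_poly)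

lemma gca_poly_diff: "gca_poly (p - q) = gca_poly p - gca_poly q" by (rule gca_eqI) (simp add: coeff_gca_poly)

lemma gca_poly_sum: "gca_poly (sum f A) = (\<Sum>a\<in>A. gca_poly (f a))"
 by (induction A rule: infinite_finite_induct) (auto simp: gca_poly_add)

lemma coeff_poly_times [simp]: "coeff_gca (gca_poly p * f) S = p * coeff_gca f S"
proof (cases "finite S")
 case True
 then have "coeff_gca (gca_poly p * f) S = (\<Sum>A\<in>Pow S. if A = {} then p * coeff_gca f S else 0)"
 unfolding times_gca.rep_eq by (intro sum.cong) (auto simp: coeff_gca_poly)
 also have "... = p * coeff_gca f S" using True by (subst sum.delta) auto
 finally show ?thesis .
qed (simp add: coeff_infinite)

lemma coeff_times_poly [simp]: "coeff_gca (f * gca_poly p) S = p * coeff_gca f S"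
proof (cases "finite S")
 case True
 then have "coeff_gca (f * gca_poly p) S = (\<Sum>A\<in>Pow S. if A = S then p * coeff_gca f S else 0)"
 unfolding times_gca.rep_eq by (intro sum.cong) (auto simp: coeff_gca_poly mult.commute)
 also have "... = p * coeff_gca f S" using True by (subst sum.delta) auto
 finally show ?thesis .
qed (simp add: coeff_infinite)

lemma gca_poly_mult: "gca_poly (p * q) = gca_poly p * gca_poly q" by (rule gca_eqI) (simp add: coeff_gca_poly)

lemma gca_poly_commute: "f * gca_poly p = gca_poly p * f" by (rule gca_eqI) simp

lemma poly_left_comm: "f * (gca_poly p * g) = gca_poly p * (f * g)" by (metis gca_poly_commute mult.assoc)

lemma pconst_add: "pconst (a + b) = pconst a + pconst b" by (simp add: pconst_def single_add)

lemma pconst_mult: "pconst (a * b) = pconst a * (pconst b :: ('v, 'k::comm_ring_1) mpoly)"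
 by (simp add: pconst_def mult_single)

lemma pconst_0 [simp]: "pconst 0 = 0" by (simp add: pconst_def)
lemma pconst_1 [simp]: "pconst 1 = 1" by (simp add: pconst_def)

lemma lookup_pconst_mult [simp]: "Poly_Mapping.lookup (pconst c * p) m = c * Poly_Mapping.lookup p m"
 for p :: "('v, 'k::comm_ring_1) mpoly"
 unfolding pconst_def mult_map_scale_conv_mult[symmetric] by (simp add: Poly_Mapping.map.rep_eq when_def)

lemma cs_simps [simp]: "cs 0 = 0" "cs 1 = 1" by simp_all

lemma cs_add: "cs (a + b) = cs a + cs b" by (simp add: pconst_add gca_poly_add)
lemma cs_mult: "cs (a * b) = cs a * cs b" for a :: "'k::comm_ring_1" by (simp add: pconst_mult gca_poly_mult)
lemma cs_uminus: "cs (- a) = - cs a" for a :: "'k::comm_ring_1" by (metis add.right_inverse add_eq_0_iff cs_add cs_simps(1))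
lemma cs_of_nat: "cs (of_nat n) = of_nat n" by (induction n) (auto simp: cs_add)
lemma cs_sum: "cs (sum f A) = (\<Sum>a\<in>A. cs (f a))" by (induction A rule: infinite_finite_induct) (auto simp: cs_add)
lemma cs_power: "cs (a ^ n) = cs a ^ n" for a :: "'k::comm_ring_1" by (induction n) (auto simp: cs_mult)

lemma cs_inverse: "a ~= 0 ==> cs (inverse a) * (cs a * f) = f" for a :: "'k::field_char_0"
 by (simp add: mult.assoc[symmetric] cs_mult[symmetric])

lemma cs_cancel: "cs a * f = cs a * g ==> a ~= 0 ==> f = g" for a :: "'k::field_char_0" by (metis cs_inverse)

text \<open>Characteristic different from 2 enters here. It turns anticommutation of an odd element
  with itself into vanishing of its square.\<close>

lemma gca_neg_self: "f = - f ==> f = 0" for f :: "('v, 'o::linorder, 'k::field_char_0) gca"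
proof -
 assume "f = - f"
 then have "f + f = 0" by (metis add.right_inverse)
 then have "cs (2::'k) * f = cs 2 * 0" using cs_add[of "1::'k" 1, where 'a='v and 'b='o] by (simp add: mult_2)
 then show ?thesis by (rule cs_cancel) simp
qed

lemma gca_smult_eq: "gca_smult c f = cs c * f" by (simp add: gca_smult_def)

lemma coeff_theta_times:
 assumes "finite S"
 shows "coeff_gca (theta s * f) S =
 (if s : S then shuffle_sign {s} (S - {s}) * coeff_gca f (S - {s}) else 0)"
proof -
 have "coeff_gca (theta s * f) S =
 (\<Sum>A\<in>Pow S. if A = {s} then shuffle_sign {s} (S - {s}) * coeff_gca f (S - {s}) else 0)"
 unfolding times_gca.rep_eq by (intro sum.cong) (auto simp: coeff_theta_basis)
 then show ?thesis using assms by (auto simp: sum.delta)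
qed

lemma theta_basis_empty [simp]: "theta_basis {} = 1" by (rule gca_eqI) (simp add: coeff_theta_basis one_gca.rep_eq)

lemma shuffle_sign_singletons: "shuffle_sign {s} {t} = (if t < s then -1 else 1)"
proof -
 have "{(a, b). (a = s & b = t) & b < a} = (if t < s then {(s, t)} else {})" by auto
 then show ?thesis by (auto simp: shuffle_sign_def)
qed

lemma theta_anticommute: "theta s * theta t = - (theta t * theta s :: ('v, 'o::linorder, 'k::comm_ring_1) gca)"
proof (rule gca_eqI)
 fix S :: "'o set" assume S: "finite S"
 show "coeff_gca (theta s * theta t) S = coeff_gca (- (theta t * theta s :: ('v, 'o, 'k) gca)) S"
 proof (cases "S = {s, t} & s ~= t")
 case True
 then have 1: "S - {s} = {t}" "S - {t} = {s}" "s : S" "t : S" by blast+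
 from True consider "s < t" | "t < s" by (meson linorder_neqE)
 then show ?thesis
 by cases (simp_all add: coeff_theta_times[OF S] coeff_theta_basis shuffle_sign_singletons 1 not_less less_imp_le)
 next
 case False
 then have 1: "s : S ==> S - {s} ~= {t}" "t : S ==> S - {t} ~= {s}" by blast+
 then show ?thesis by (simp add: coeff_theta_times[OF S] coeff_theta_basis)
 qed
qed

lemma theta_square [simp]: "theta s * theta s = 0"
proof (rule gca_eqI)
 fix S :: "'b set" assume S: "finite S"
 have 1: "S - {s} ~= {s}" by blast
 then show "coeff_gca (theta s * theta s) S = coeff_gca (0 :: ('a, 'b, 'c) gca) S"
 by (simp add: coeff_theta_times[OF S] coeff_theta_basis)
qed

lemma theta_times_basis:
 fixes T :: "'o::linorder set"
 assumes "finite T" "!!t. t : T ==> s < t"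
 shows "theta s * theta_basis T = (theta_basis (insert s T) :: ('v, 'o, 'k::comm_ring_1) gca)"
proof (rule gca_eqI)
 fix S :: "'o set" assume S: "finite S"
 have sT: "s ~: T" using assms by auto
 have "{(a, b) : {s} \<times> T. b < a} = {}" using assms by force
 then have sh: "shuffle_sign {s} T = (1 :: ('v, 'k) mpoly)" unfolding shuffle_sign_def by (metis card.empty power_0)
 show "coeff_gca (theta s * theta_basis T) S = coeff_gca (theta_basis (insert s T) :: ('v, 'o, 'k) gca) S"
 proof (cases "s : S & S - {s} = T")
 case True
 then have "insert s T = S" by auto
 then show ?thesis unfolding coeff_theta_times[OF S] coeff_theta_basis using True sh assms(1) S by simp
 next
 case False
 then have "S ~= insert s T" using sT by auto
 then show ?thesis using False by (auto simp: coeff_theta_times[OF S] coeff_theta_basis)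
 qed
qed

section \<open>Monomials as words, and sign-compatible functions of words\<close>

definition gl :: "'v + 'o => ('v, 'o, 'k::comm_ring_1) gca" where
 "gl = case_sum (%v. gca_poly (pvar v)) theta"

definition gw :: "('v + 'o::linorder) list => ('v, 'o, 'k::comm_ring_1) gca" where
 "gw w = prod_list (map gl w)"

lemma gw_simps [simp]: "gw [] = 1" "gw (a # w) = gl a * gw w" "gw (u @ w) = gw u * gw w" by (simp_all add: gw_def)

text \<open>
 A function on words which is compatible with graded commutativity extends to a linear map.
\<close>

definition supersym :: "(('v + 'o) list => 'x::ab_group_add) => bool" where
 "supersym F \<longleftrightarrow>
 (ALL u a b v. isl a \<or> isl b --> F (u @ a # b # v) = F (u @ b # a # v)) &
 (ALL u a b v. ~ isl a --> ~ isl b --> F (u @ a # b # v) = - F (u @ b # a # v)) &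
 (ALL u a v. ~ isl a --> F (u @ a # a # v) = 0)"

text \<open>The clause on repeated letters follows from swapping a letter with itself, so only swaps
  remain to be checked.\<close>

lemma supersymI:
 fixes F :: "('v + 'p) list => ('u, 'o::linorder, 'k::field_char_0) gca"
 assumes "!!u a b v. isl a \<or> isl b ==> F (u @ a # b # v) = F (u @ b # a # v)"
 and "!!u a b v. ~ isl a ==> ~ isl b ==> F (u @ a # b # v) = - F (u @ b # a # v)"
 shows "supersym F" unfolding supersym_def using assms gca_neg_self by blast

lemma supersym_even: "supersym F ==> isl a \<or> isl b ==> F (u @ a # b # v) = F (u @ b # a # v)"
 and supersym_odd: "supersym F ==> ~ isl a ==> ~ isl b ==> F (u @ a # b # v) = - F (u @ b # a # v)"
 and supersym_repeat: "supersym F ==> ~ isl a ==> F (u @ a # a # v) = 0" unfolding supersym_def by blast+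

lemma supersym_Cons: "supersym F ==> supersym (%w. F (a # w))"
 unfolding supersym_def by (intro conjI allI) (metis append_Cons)+

lemma supersym_append: "supersym F ==> supersym (%w. F (u @ w))"
 unfolding supersym_def by (intro conjI allI) (metis append_assoc)+

text \<open>Insertion of one odd letter into a sorted odd word. The sign is left open: what is
  deduced later, vanishing and the shape of supports, does not see it.\<close>

lemma supersym_insert_odd:
 fixes H :: "('v + 'o::linorder) list => 'x::ab_group_add"
 assumes "supersym H" "sorted_wrt (<) ss"
 shows "H (Inr s # map Inr ss) = 0 \<or> (EX ss'. sorted_wrt (<) ss' & mset ss' = mset (s # ss) &
 (H (Inr s # map Inr ss) = H (map Inr ss') \<or> H (Inr s # map Inr ss) = - H (map Inr ss')))" using assms
proof (induction ss arbitrary: H)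
 case Nil
 then show ?case by (intro disjI2 exI[of _ "[s]"]) auto
next
 case (Cons t ss)
 consider "s < t" | "s = t" | "t < s" by (meson linorder_less_linear)
 then show ?case
 proof cases
 case 1
 then have "sorted_wrt (<) (s # t # ss)" using Cons.prems(2) by auto
 then show ?thesis by (intro disjI2 exI[of _ "s # t # ss"]) auto
 next
 case 2
 then show ?thesis using supersym_repeat[OF Cons.prems(1), of "Inr s" "[]"] by simp
 next
 case 3
 have sw: "H (Inr s # map Inr (t # ss)) = - H (Inr t # Inr s # map Inr ss)"
 using supersym_odd[OF Cons.prems(1), of "Inr s" "Inr t" "[]"] by simp
 have ss: "sorted_wrt (<) ss" using Cons.prems(2) by simp
 from Cons.IH[OF supersym_Cons[OF Cons.prems(1), of "Inr t"] ss] consider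
 "H (Inr t # Inr s # map Inr ss) = 0" |
 ss' where "sorted_wrt (<) ss'" "mset ss' = mset (s # ss)"
 "H (Inr t # Inr s # map Inr ss) = H (Inr t # map Inr ss') \<or>
 H (Inr t # Inr s # map Inr ss) = - H (Inr t # map Inr ss')" by auto
 then show ?thesis
 proof cases
 case 1 then show ?thesis using sw by simp
 next
 case 2
 have "set ss' = insert s (set ss)" using 2(2) by (metis list.set(2) mset_eq_setD)
 then have "sorted_wrt (<) (t # ss')" using 2(1) 3 Cons.prems(2) by auto
 moreover have "mset (t # ss') = mset (s # t # ss)" using 2(2) by simp
 ultimately show ?thesis using 2(3) sw by (intro disjI2 exI[of _ "t # ss'"]) auto
 qed
 qed
qed

lemma supersym_move_odd:
 assumes "supersym H"
 shows "H (Inr s # map Inl vs @ r) = H (map Inl vs @ Inr s # r)" using assms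
proof (induction vs arbitrary: H)
 case (Cons v vs)
 have "H (Inr s # map Inl (v # vs) @ r) = H (Inl v # Inr s # map Inl vs @ r)"
 using supersym_even[OF Cons.prems, of "Inr s" "Inl v" "[]"] by simp
 also have "... = H (Inl v # map Inl vs @ Inr s # r)" using Cons.IH[OF supersym_Cons[OF Cons.prems, of "Inl v"]] by simp
 finally show ?case by simp
qed simp

text \<open>Letters are moved one by one into normal form; a repeated odd letter gives 0. Even
  letters are only collected in front, since their order is immaterial by
  \<open>supersym_even_mset\<close>.\<close>

lemma supersym_normal:
 fixes H :: "('v + 'o::linorder) list => 'x::ab_group_add"
 assumes "supersym H"
 shows "H w = 0 \<or> (EX vs ss. sorted_wrt (<) ss & mset (map Inl vs @ map Inr ss) = mset w &
 (H w = H (map Inl vs @ map Inr ss) \<or> H w = - H (map Inl vs @ map Inr ss)))" using assms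
proof (induction w arbitrary: H)
 case Nil
 then show ?case by (intro disjI2 exI[of _ "[]"]) auto
next
 case (Cons a w)
 from Cons.IH[OF supersym_Cons[OF Cons.prems, of a]] consider
 "H (a # w) = 0" | vs ss where "sorted_wrt (<) ss" "mset (map Inl vs @ map Inr ss) = mset w"
 "H (a # w) = H (a # map Inl vs @ map Inr ss) \<or> H (a # w) = - H (a # map Inl vs @ map Inr ss)" by auto
 then show ?case
 proof cases
 case 1 then show ?thesis by simp
 next
 case 2
 show ?thesis
 proof (cases a)
 case (Inl v)
 then show ?thesis using 2 by (intro disjI2 exI[of _ "v # vs"] exI[of _ ss]) auto
 next
 case (Inr s)
 have e: "H (a # map Inl vs @ map Inr ss) = H (map Inl vs @ Inr s # map Inr ss)"
 using supersym_move_odd[OF Cons.prems] Inr by simp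
 from supersym_insert_odd[OF supersym_append[OF Cons.prems, of "map Inl vs"] 2(1), of s]
 consider "H (map Inl vs @ Inr s # map Inr ss) = 0" |
 ss' where "sorted_wrt (<) ss'" "mset ss' = mset (s # ss)"
 "H (map Inl vs @ Inr s # map Inr ss) = H (map Inl vs @ map Inr ss') \<or>
 H (map Inl vs @ Inr s # map Inr ss) = - H (map Inl vs @ map Inr ss')" by auto
 then show ?thesis
 proof cases
 case 1 then show ?thesis using e 2(3) by auto
 next
 case 3: 2
 have "mset (map Inr ss') = mset (Inr s # map Inr ss)" using 3(2) by simp
 then have "mset (map Inl vs @ map Inr ss') = mset (a # w)" using 2(2) Inr by (simp flip: 2(2))
 then show ?thesis using e 2(3) 3 by (intro disjI2 exI[of _ vs] exI[of _ ss']) auto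
 qed
 qed
 qed
qed

text \<open>The difference of the two functions is again compatible with swaps and vanishes on
  canonical words, so by the normal form it vanishes on all words.\<close>

lemma supersym_eqI:
 fixes F G :: "('v + 'o::linorder) list => 'x::ab_group_add"
 assumes F: "supersym F" and G: "supersym G"
 and can: "!!vs ss. sorted_wrt (<) ss ==> F (map Inl vs @ map Inr ss) = G (map Inl vs @ map Inr ss)"
 shows "F w = G w"
proof -
 have "supersym (%w. F w - G w)" unfolding supersym_def
 proof (intro conjI allI impI)
 fix u v and a b :: "'v + 'o"
 show "F (u @ a # b # v) - G (u @ a # b # v) = F (u @ b # a # v) - G (u @ b # a # v)"
 if "isl a \<or> isl b" using supersym_even[OF F that, of u v] supersym_even[OF G that, of u v] by metis
 show "F (u @ a # b # v) - G (u @ a # b # v) = - (F (u @ b # a # v) - G (u @ b # a # v))"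
 if "~ isl a" "~ isl b" unfolding supersym_odd[OF F that, of u v] supersym_odd[OF G that, of u v] by simp
 show "F (u @ a # a # v) - G (u @ a # a # v) = 0" if "~ isl a"
 unfolding supersym_repeat[OF F that] supersym_repeat[OF G that] by simp
 qed
 from supersym_normal[OF this, of w] can show ?thesis by auto
qed

text \<open>Adjacent transpositions generate all permutations: the first letter of one list is
  carried to the front of the other, and the induction continues behind it.\<close>

lemma swap_invariant_mset:
 assumes "!!u a b v. F (u @ a # b # v) = F (u @ b # a # v)" "mset xs = mset ys"
 shows "F xs = F ys" using assms
proof (induction xs arbitrary: ys F)
 case (Cons x xs)
 then obtain y1 y2 where ys: "ys = y1 @ x # y2" by (metis list.set_intros(1) mset_eq_setD split_list)
 have "F (y1 @ x # y2) = F (x # y1 @ y2)" using Cons.prems(1)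
 proof (induction y1 arbitrary: F)
 case (Cons z y1)
 have "F ((z # y1) @ x # y2) = F (z # x # y1 @ y2)" using Cons.IH[of "%w. F (z # w)"] Cons.prems by (metis append_Cons)
 also have "... = F (x # z # y1 @ y2)" using Cons.prems[of "[]"] by simp
 finally show ?case by simp
 qed simp
 moreover have "F (x # xs) = F (x # y1 @ y2)"
 using Cons.IH[of "%w. F (x # w)" "y1 @ y2"] Cons.prems ys by (metis (no_types, lifting) append_Cons mset.simps(2) mset_append union_mset_add_mset_right add_mset_add_single add_left_cancel add_right_cancel)
 ultimately show ?case using ys by simp
qed simp

lemma supersym_even_mset:
 assumes "supersym F" "mset vs = mset vs'"
 shows "F (map Inl vs @ r) = F (map Inl vs' @ r)"
proof (rule swap_invariant_mset[of "%vs. F (map Inl vs @ r)", OF _ assms(2)])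
 fix u a b v
 show "F (map Inl (u @ a # b # v) @ r) = F (map Inl (u @ b # a # v) @ r)"
 using supersym_even[OF assms(1), of "Inl a" "Inl b" "map Inl u" "map Inl v @ r"] by simp
qed

section \<open>Exponent vectors and linear extension from words\<close>

definition expo :: "'v list => 'v \<Rightarrow>\<^sub>0 nat" where
 "expo vs = (\<Sum>v\<leftarrow>vs. Poly_Mapping.single v 1)"

lemma lookup_expo: "Poly_Mapping.lookup (expo vs) v = count (mset vs) v"
 by (induction vs) (auto simp: expo_def lookup_add lookup_single when_def)

lemma expo_eq_iff: "expo vs = expo vs' \<longleftrightarrow> mset vs = mset vs'"
 by (metis lookup_expo multiset_eqI poly_mapping_eqI expo_def mset_map sum_mset_sum_list)

lemma ex_expo: "EX vs. expo vs = m"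
proof (induction m rule: update_induct)
 case const
 have "expo [] = Poly_Mapping.single undefined 0" by (simp add: expo_def)
 then show ?case by (metis expo_def single_zero list.map(1) sum_list.Nil)
next
 case (update m v n)
 then obtain vs where vs: "expo vs = m" by blast
 have "expo (vs @ replicate n v) = Poly_Mapping.update v n m" using update(1) by (intro poly_mapping_eqI)
 (auto simp: lookup_expo lookup_update vs[symmetric] in_keys_iff)
 then show ?case by blast
qed

text \<open>Some listing of the exponent vector; by \<open>supersym_even_mset\<close> functions
  compatible with swaps do not depend on the choice.\<close>

definition vlist :: "('v \<Rightarrow>\<^sub>0 nat) => 'v list" where
 "vlist m = (SOME vs. expo vs = m)"

lemma expo_vlist [simp]: "expo (vlist m) = m" unfolding vlist_def by (rule someI_ex[OF ex_expo])

lemma mset_vlist_expo: "mset (vlist (expo vs)) = mset vs" using expo_eq_iff expo_vlist by metis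

lemma gw_even: "gw (map Inl vs) = gca_poly (Poly_Mapping.single (expo vs) 1)"
proof (induction vs)
 case (Cons v vs)
 then show ?case by (simp add: gl_def gca_poly_mult[symmetric] pvar_def mult_single expo_def)
qed (simp add: expo_def)

lemma gw_odd: "sorted_wrt (<) ss ==> gw (map Inr ss) = theta_basis (set ss)"
 by (induction ss) (simp_all add: gl_def theta_times_basis)

lemma gw_canonical:
 "sorted_wrt (<) ss ==>
 gw (map Inl vs @ map Inr ss) = gca_poly (Poly_Mapping.single (expo vs) 1) * theta_basis (set ss)"
 by (simp add: gw_even gw_odd)

lemma prod_list_supersym:
 fixes g :: "'v + 'p => ('u, 'o::linorder, 'k::field_char_0) gca"
 assumes "!!a b. isl a ==> g a * g b = g b * g a"
 and "!!a b. ~ isl a ==> ~ isl b ==> g a * g b = - (g b * g a)"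
 shows "supersym (%w. prod_list (map g w))"
proof (rule supersymI)
 fix u v and a b :: "'v + 'p" assume "isl a \<or> isl b"
 then have "g a * g b = g b * g a" using assms(1)[of a b] assms(1)[of b a] by auto
 then have "g a * (g b * x) = g b * (g a * x)" for x unfolding mult.assoc[symmetric] by simp
 then show "prod_list (map g (u @ a # b # v)) = prod_list (map g (u @ b # a # v))" by simp
next
 fix u v and a b :: "'v + 'p" assume "~ isl a" "~ isl b"
 then have "g a * (g b * x) = - (g b * (g a * x))" for x
 unfolding mult.assoc[symmetric] assms(2)[OF \<open>~ isl a\<close> \<open>~ isl b\<close>] by simp
 then show "prod_list (map g (u @ a # b # v)) = - prod_list (map g (u @ b # a # v))" by simp
qed

lemma gl_comm_even: "isl a ==> gl a * f = f * gl a" by (cases a) (auto simp: gl_def gca_poly_commute)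

lemma gl_anticommute: "~ isl a ==> ~ isl b ==> gl a * gl b = - (gl b * gl a)"
 by (cases a; cases b) (auto simp: gl_def intro: theta_anticommute)

lemma supersym_gw: "supersym (gw :: _ => ('v, 'o::linorder, 'k::field_char_0) gca)"
 unfolding gw_def by (rule prod_list_supersym) (erule gl_comm_even, erule (1) gl_anticommute)

abbreviation canw :: "('v \<Rightarrow>\<^sub>0 nat) => 'o::linorder set => ('v + 'o) list" where
 "canw m S \<equiv> map Inl (vlist m) @ map Inr (sorted_list_of_set S)"

text \<open>\<open>F\<close> is evaluated at one canonical word for each basis monomial. That every
  word is then mapped to its own value is \<open>glift_gw\<close>, and it is there that
  compatibility with swaps is used.\<close>

definition glift :: "(('v + 'o::linorder) list => ('u, 'p::linorder, 'k::field_char_0) gca) =>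
 ('v, 'o, 'k) gca => ('u, 'p, 'k) gca" where
 "glift F f = (\<Sum>S\<in>support f. \<Sum>m\<in>Poly_Mapping.keys (coeff_gca f S).
 cs (Poly_Mapping.lookup (coeff_gca f S) m) * F (canw m S))"

definition glin :: "(('v, 'o::linorder, 'k::field_char_0) gca => ('u, 'p::linorder, 'k) gca) => bool" where
 "glin L \<longleftrightarrow> (ALL f g. L (f + g) = L f + L g) & (ALL c f. L (cs c * f) = cs c * L f)"

text \<open>The support of a sum can be smaller than the union of the supports; all three sums are
  therefore taken over the union, where additivity is termwise.\<close>

lemma sum_support_add:
 assumes "!!S p q. \<psi> S (p + q) = \<psi> S p + (\<psi> S q :: 'x::ab_group_add)"
 shows "(\<Sum>S\<in>support (f + g). \<psi> S (coeff_gca (f + g) S)) =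
 (\<Sum>S\<in>support f. \<psi> S (coeff_gca f S)) + (\<Sum>S\<in>support g. \<psi> S (coeff_gca g S))"
proof -
 have z: "\<psi> S 0 = 0" for S using assms[of S 0 0] by simp
 let ?U = "support f \<union> support g"
 have e: "(\<Sum>S\<in>support h. \<psi> S (coeff_gca h S)) = (\<Sum>S\<in>?U. \<psi> S (coeff_gca h S))"
 if "support h \<subseteq> ?U" for h
 using that by (intro sum.mono_neutral_left finite_UnI finite_support) (auto simp: support_def z)
 have "support (f + g) \<subseteq> ?U" by (auto simp: support_def)
 then show ?thesis using e[of f] e[of g] e[of "f + g"] by (simp add: assms sum.distrib)
qed

lemma sum_keys_add:
 assumes "!!m a b. \<psi> m (a + b) = \<psi> m a + (\<psi> m b :: 'x::ab_group_add)"
 shows "(\<Sum>m\<in>Poly_Mapping.keys (p + q). \<psi> m (Poly_Mapping.lookup (p + q) m)) =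
 (\<Sum>m\<in>Poly_Mapping.keys p. \<psi> m (Poly_Mapping.lookup p m)) +
 (\<Sum>m\<in>Poly_Mapping.keys q. \<psi> m (Poly_Mapping.lookup q m))"
proof -
 have z: "\<psi> m 0 = 0" for m using assms[of m 0 0] by simp
 show ?thesis by (intro setsum_keys_plus_distrib) (simp_all add: z assms)
qed

lemma support_poly_times: "support (gca_poly p * f) \<subseteq> support f" by (auto simp: support_def)

lemma sum_support_scale:
 assumes "!!S. \<psi> S 0 = (0 :: 'x::ab_group_add)"
 shows "(\<Sum>S\<in>support (gca_poly p * f). \<psi> S (coeff_gca (gca_poly p * f) S)) =
 (\<Sum>S\<in>support f. \<psi> S (p * coeff_gca f S))" using support_poly_times[of p f]
 by (subst sum.mono_neutral_left[of "support f" "support (gca_poly p * f)"])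
 (auto simp: assms in_support)

lemma glin_glift:
 fixes F :: "('v + 'o::linorder) list => ('u, 'p::linorder, 'k::field_char_0) gca"
 shows "glin (glift F)" unfolding glin_def
proof (intro conjI allI)
 fix f g :: "('v, 'o, 'k) gca" and c :: 'k
 let ?k = "%S p. \<Sum>m\<in>Poly_Mapping.keys p. cs (Poly_Mapping.lookup p m) * F (canw m S)"
 have add: "?k S (p + q) = ?k S p + ?k S q" for S p q
 by (rule sum_keys_add[where \<psi> = "%m a. cs a * F (canw m S)"]) (simp add: cs_add algebra_simps)
 show "glift F (f + g) = glift F f + glift F g" unfolding glift_def by (rule sum_support_add[of ?k, OF add])
 have sc: "?k S (pconst c * p) = cs c * ?k S p" for S p
 proof -
 have "?k S (pconst c * p) = (\<Sum>m\<in>Poly_Mapping.keys p. cs (c * Poly_Mapping.lookup p m) * F (canw m S))"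
 by (intro sum.mono_neutral_cong_left) (auto simp: in_keys_iff)
 then show ?thesis by (simp add: cs_mult sum_distrib_left mult.assoc)
 qed
 show "glift F (cs c * f) = cs c * glift F f" unfolding glift_def
 by (subst sum_support_scale[of ?k], simp, unfold sc, simp add: sum_distrib_left)
qed

lemma glin_add: "glin L ==> L (f + g) = L f + L g"
 and glin_cs: "glin L ==> L (cs c * f) = cs c * L f" by (auto simp: glin_def)

lemma glin_0: "glin L ==> L 0 = 0" by (metis add_cancel_right_right glin_add)

lemma glin_uminus: "glin L ==> L (- f) = - L f" by (metis add.right_inverse add_eq_0_iff glin_0 glin_add)

lemma glin_diff: "glin L ==> L (f - g) = L f - L g" by (simp only: diff_conv_add_uminus glin_add glin_uminus)

lemma glin_sum: "glin L ==> L (sum f A) = (\<Sum>a\<in>A. L (f a))"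
 by (induction A rule: infinite_finite_induct) (auto simp: glin_0 glin_add)

lemma canw_gw:
 assumes "finite S"
 shows "gw (canw m S) = gca_poly (Poly_Mapping.single m 1) * theta_basis S"
 using gw_canonical[of "sorted_list_of_set S" "vlist m"] assms by simp

lemma mpoly_expand: "p = (\<Sum>m\<in>Poly_Mapping.keys p. pconst (Poly_Mapping.lookup p m) * Poly_Mapping.single m (1::'k::comm_ring_1))"
 by (rule poly_mapping_eqI)
 (auto simp: lookup_sum lookup_single when_def sum.delta in_keys_iff if_distrib cong: if_cong)

lemma gca_expand_support:
 fixes f :: "('v, 'o::linorder, 'k::comm_ring_1) gca"
 shows "f = (\<Sum>S\<in>support f. gca_poly (coeff_gca f S) * theta_basis S)"
proof (rule gca_eqI)
 fix T :: "'o set" assume T: "finite T"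
 have "coeff_gca (\<Sum>S\<in>support f. gca_poly (coeff_gca f S) * theta_basis S) T =
 (\<Sum>S\<in>support f. if S = T then coeff_gca f T else 0)"
 unfolding coeff_sum using T by (intro sum.cong) (auto simp: coeff_theta_basis)
 then show "coeff_gca f T = coeff_gca (\<Sum>S\<in>support f. gca_poly (coeff_gca f S) * theta_basis S) T"
 by (auto simp: sum.delta in_support)
qed

lemma gca_expand:
 fixes f :: "('v, 'o::linorder, 'k::comm_ring_1) gca"
 shows "f = (\<Sum>S\<in>support f. \<Sum>m\<in>Poly_Mapping.keys (coeff_gca f S).
 cs (Poly_Mapping.lookup (coeff_gca f S) m) * gw (canw m S))"
proof -
 have "(\<Sum>m\<in>Poly_Mapping.keys p. cs (Poly_Mapping.lookup p m) * gw (canw m S)) = gca_poly p * theta_basis S"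
 if "finite S" for p :: "('v, 'k) mpoly" and S :: "'o set"
 proof -
 have "(\<Sum>m\<in>Poly_Mapping.keys p. cs (Poly_Mapping.lookup p m) * gw (canw m S)) =
 gca_poly (\<Sum>m\<in>Poly_Mapping.keys p. pconst (Poly_Mapping.lookup p m) * Poly_Mapping.single m 1) * theta_basis S"
 using that by (simp add: canw_gw gca_poly_sum gca_poly_mult sum_distrib_right mult.assoc del: gw_simps)
 then show ?thesis using mpoly_expand[of p] by simp
 qed
 then show ?thesis using gca_expand_support[of f] finite_in_support[of _ f] by (metis (no_types, lifting) sum.cong)
qed

lemma gca_induct [case_names add word]:
 assumes "!!f g. P f ==> P g ==> P (f + g)" "!!c w. P (cs c * gw w)"
 shows "P f"
proof -
 have z: "P 0" using assms(2)[of 0] by simp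
 have s: "P (sum h A)" if "!!a. a : A ==> P (h a)" for A and h :: "'z => _"
 using that by (induction A rule: infinite_finite_induct) (auto simp: z assms(1))
 show ?thesis by (subst gca_expand) (intro s assms(2))
qed

lemma glin_eqI:
 assumes "glin L" "glin M" "!!w. L (gw w) = M (gw w)"
 shows "L f = M f" by (induction f rule: gca_induct) (simp_all add: assms glin_add glin_cs)

lemma single_neq_0: "Poly_Mapping.single m (1::'k::comm_ring_1) ~= 0" by (metis lookup_single_eq lookup_zero zero_neq_one)

text \<open>As functions of the word both sides are compatible with swaps, so only canonical words
  matter. Such a word is a single basis element, and \<open>glift\<close> returns \<open>F\<close>
  at a word that differs from it only in the order of the even letters.\<close>

lemma glift_gw:
 fixes F :: "('v + 'o::linorder) list => ('u, 'p::linorder, 'k::field_char_0) gca"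
 assumes F: "supersym F"
 shows "glift F (gw w) = F w"
proof -
 have "supersym (%w. glift F (gw w))" using supersym_gw glin_glift[of F] unfolding supersym_def
 by (metis (no_types, lifting) glin_0 glin_uminus)
 then show ?thesis
 proof (rule supersym_eqI[OF _ F])
 fix vs ss assume ss: "sorted_wrt (<) (ss :: 'o list)"
 let ?f = "gw (map Inl vs @ map Inr ss) :: ('v, 'o, 'k) gca"
 have c: "coeff_gca ?f S = (if S = set ss then Poly_Mapping.single (expo vs) 1 else 0)" for S
 using ss by (auto simp: gw_even gw_odd coeff_theta_basis)
 then have "support ?f = {set ss}" by (auto simp: support_def single_neq_0)
 moreover have "sorted_list_of_set (set ss) = ss"
 using ss by (metis sorted_list_of_set.idem_if_sorted_distinct strict_sorted_iff)
 ultimately have "glift F ?f = F (map Inl (vlist (expo vs)) @ map Inr ss)" unfolding glift_def by (simp add: c del: gw_simps)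
 also have "... = F (map Inl vs @ map Inr ss)" by (rule supersym_even_mset[OF F mset_vlist_expo])
 finally show "glift F ?f = F (map Inl vs @ map Inr ss)" .
 qed
qed

lemma glin_id: "glin (%f. f)" by (simp add: glin_def)

lemma glin_comp: "glin L ==> glin M ==> glin (%f. L (M f))" by (simp add: glin_def)

lemma glin_plus: "glin L ==> glin M ==> glin (%f. L f + M f)" by (simp add: glin_def algebra_simps)

lemma glin_minus: "glin L ==> glin M ==> glin (%f. L f - M f)" by (simp add: glin_def algebra_simps)

lemma glin_mult_left: "glin L ==> glin (%f. g * L f)"
 by (simp add: glin_def algebra_simps) (metis gca_poly_commute mult.assoc)

lemma glin_SUM: "(!!a. a : A ==> glin (L a)) ==> glin (%f. \<Sum>a\<in>A. L a f)"
 by (simp add: glin_def sum.distrib sum_distrib_left)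

lemma glin_scale: "glin L ==> glin (%f. cs c * L f)" by (rule glin_mult_left)

section \<open>Homomorphisms, derivations and filters\<close>

definition ghom :: "(('v, 'o::linorder, 'k::field_char_0) gca => ('u, 'p::linorder, 'k) gca) => bool" where
 "ghom L \<longleftrightarrow> glin L & L 1 = 1 & (ALL f g. L (f * g) = L f * L g)"

lemma ghom_glin: "ghom L ==> glin L"
 and ghom_1: "ghom L ==> L 1 = 1"
 and ghom_mult: "ghom L ==> L (f * g) = L f * L g" by (simp_all add: ghom_def)

lemma ghom_prod_list: "ghom L ==> L (prod_list xs) = prod_list (map L xs)" by (induction xs) (simp_all add: ghom_1 ghom_mult)

lemma ghom_gw: "ghom L ==> L (gw w) = prod_list (map (%a. L (gl a)) w)" by (simp add: gw_def ghom_prod_list o_def)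

lemma ghom_eqI: "ghom L ==> ghom M ==> (!!a. L (gl a) = M (gl a)) ==> L f = M f"
 by (rule glin_eqI) (simp_all add: ghom_glin ghom_gw)

lemma ghom_comp: "ghom L ==> ghom M ==> ghom (%f. L (M f))" by (simp add: ghom_def glin_comp)

lemma ghom_id: "ghom (%f. f)" by (simp add: ghom_def glin_id)

lemma ghomI:
 assumes "glin L" "L 1 = 1" "!!u v. L (gw u * gw v) = L (gw u) * L (gw v)"
 shows "ghom L"
proof -
 have "L (f * gw v) = L f * L (gw v)" for f v by (induction f rule: gca_induct)
 (simp_all add: assms(3) distrib_right glin_add[OF assms(1)] glin_cs[OF assms(1)] mult.assoc)
 then have 1: "L (cs c * (f * gw v)) = cs c * (L f * L (gw v))" for c f v unfolding glin_cs[OF assms(1)] by simp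
 have "L (f * g) = L f * L g" for f g by (induction g rule: gca_induct)
 (simp_all only: distrib_left glin_add[OF assms(1)] 1
 poly_left_comm[of f] poly_left_comm[of "L f"] glin_cs[OF assms(1), of _ "gw w" for w])
 then show ?thesis using assms by (simp add: ghom_def)
qed

definition hl :: "('v => ('u, 'k) mpoly) => ('o => ('u, 'p, 'k) gca) => 'v + 'o => ('u, 'p::linorder, 'k::comm_ring_1) gca" where
 "hl \<phi> \<psi> = case_sum (%v. gca_poly (\<phi> v)) \<psi>"

lemma hl_simps [simp]: "hl \<phi> \<psi> (Inl v) = gca_poly (\<phi> v)" "hl \<phi> \<psi> (Inr s) = \<psi> s"
 by (simp_all add: hl_def)

text \<open>The condition under which \<open>gca_hom\<close>, which multiplies images of odd
  generators in increasing order only, becomes multiplicative.\<close>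

definition anticomm :: "('o => ('u, 'p::linorder, 'k::comm_ring_1) gca) => bool" where
 "anticomm \<psi> \<longleftrightarrow> (ALL s t. \<psi> s * \<psi> t = - (\<psi> t * \<psi> s))"

lemma poly_subst_add: "poly_subst \<phi> (p + q) = poly_subst \<phi> p + poly_subst \<phi> q" unfolding poly_subst_def
 by (rule sum_keys_add[where \<psi> = "%m a. pconst a * (\<Prod>v\<in>Poly_Mapping.keys m. \<phi> v ^ Poly_Mapping.lookup m v)"])
 (simp add: pconst_add algebra_simps)

lemma poly_subst_pconst_mult: "poly_subst \<phi> (pconst c * p) = pconst c * poly_subst \<phi> p"
proof -
 have "poly_subst \<phi> (pconst c * p) = (\<Sum>m\<in>Poly_Mapping.keys p. pconst (c * Poly_Mapping.lookup p m) *
 (\<Prod>v\<in>Poly_Mapping.keys m. \<phi> v ^ Poly_Mapping.lookup m v))"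
 unfolding poly_subst_def by (intro sum.mono_neutral_cong_left) (auto simp: in_keys_iff)
 then show ?thesis by (simp add: poly_subst_def pconst_mult sum_distrib_left mult.assoc)
qed

lemma poly_subst_monomial: "poly_subst \<phi> (Poly_Mapping.single (expo vs) 1) = prod_list (map \<phi> vs)"
proof -
 have "Poly_Mapping.keys (expo vs) = set_mset (mset vs)" by (auto simp: in_keys_iff lookup_expo)
 then have "(\<Prod>v\<in>Poly_Mapping.keys (expo vs). \<phi> v ^ Poly_Mapping.lookup (expo vs) v) = prod_list (map \<phi> vs)"
 by (simp add: lookup_expo image_prod_mset_multiplicity flip: prod_mset_prod_list)
 then show ?thesis by (simp add: poly_subst_def)
qed

lemma glin_gca_hom: "glin (gca_hom \<phi> \<psi>)" unfolding glin_def
proof (intro conjI allI)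
 fix f g c
 let ?k = "%S p. gca_poly (poly_subst \<phi> p) * prod_list (map \<psi> (sorted_list_of_set S))"
 show "gca_hom \<phi> \<psi> (f + g) = gca_hom \<phi> \<psi> f + gca_hom \<phi> \<psi> g" unfolding gca_hom_def
 by (rule sum_support_add[of ?k]) (simp add: poly_subst_add gca_poly_add distrib_right)
 show "gca_hom \<phi> \<psi> (cs c * f) = cs c * gca_hom \<phi> \<psi> f" unfolding gca_hom_def
 by (subst sum_support_scale[of ?k])
 (simp_all add: poly_subst_def[of _ 0] poly_subst_pconst_mult gca_poly_mult sum_distrib_left mult.assoc)
qed

lemma gca_poly_prod_list: "gca_poly (prod_list ps) = prod_list (map gca_poly ps)"
 by (induction ps) (simp_all add: gca_poly_mult)

lemma support_canonical:
 assumes "sorted_wrt (<) (ss :: 'o::linorder list)"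
 shows "coeff_gca (gw (map Inl vs @ map Inr ss)) S =
 (if S = set ss then Poly_Mapping.single (expo vs) (1::'k::comm_ring_1) else 0)"
 and "support (gw (map Inl vs @ map Inr ss) :: ('v, 'o, 'k) gca) = {set ss}"
 and "sorted_list_of_set (set ss) = ss"
proof -
 show c: "coeff_gca (gw (map Inl vs @ map Inr ss)) S =
 (if S = set ss then Poly_Mapping.single (expo vs) (1::'k) else 0)" for S
 using assms by (auto simp: gw_even gw_odd coeff_theta_basis)
 show "support (gw (map Inl vs @ map Inr ss) :: ('v, 'o, 'k) gca) = {set ss}"
 by (auto simp: in_support c single_neq_0 simp del: gw_simps split: if_splits)
 show "sorted_list_of_set (set ss) = ss" using assms by (metis sorted_list_of_set.idem_if_sorted_distinct strict_sorted_iff)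
qed

lemma gw_swap_even: "isl a \<or> isl b ==> gw (u @ a # b # v) = (gw (u @ b # a # v) :: ('v, 'o::linorder, 'k::field_char_0) gca)"
 and gw_swap_odd: "~ isl a ==> ~ isl b ==> gw (u @ a # b # v) = - (gw (u @ b # a # v) :: ('v, 'o::linorder, 'k::field_char_0) gca)"
 by (rule supersym_even[OF supersym_gw], assumption) (rule supersym_odd[OF supersym_gw], assumption+)

lemma supersym_glin:
 assumes "glin L"
 shows "supersym (%w. L (gw w))"
proof (rule supersymI)
 fix u v a b
 show "L (gw (u @ a # b # v)) = L (gw (u @ b # a # v))" if "isl a \<or> isl b" unfolding gw_swap_even[OF that] ..
 show "L (gw (u @ a # b # v)) = - L (gw (u @ b # a # v))" if "~ isl a" "~ isl b"
 unfolding gw_swap_odd[OF that] glin_uminus[OF assms] ..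
qed

text \<open>The defining formula covers sorted words; both sides respect swaps, so this is
  enough.\<close>

lemma gca_hom_gw:
 fixes \<phi> :: "'v => ('u, 'k::field_char_0) mpoly"
 fixes \<psi> :: "'o::linorder => ('u, 'p::linorder, 'k::field_char_0) gca"
 assumes "anticomm \<psi>"
 shows "gca_hom \<phi> \<psi> (gw w) = prod_list (map (hl \<phi> \<psi>) w)"
proof (rule supersym_eqI)
 show "supersym (%w. gca_hom \<phi> \<psi> (gw w))" by (rule supersym_glin[OF glin_gca_hom])
 show "supersym (%w. prod_list (map (hl \<phi> \<psi>) w))"
 proof (rule prod_list_supersym)
 show "hl \<phi> \<psi> a * hl \<phi> \<psi> b = hl \<phi> \<psi> b * hl \<phi> \<psi> a" if "isl a" for a b
 using that by (cases a) (simp_all add: gca_poly_commute)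
 show "hl \<phi> \<psi> a * hl \<phi> \<psi> b = - (hl \<phi> \<psi> b * hl \<phi> \<psi> a)" if "~ isl a" "~ isl b" for a b
 proof -
 obtain s t where "a = Inr s" "b = Inr t" using \<open>~ isl a\<close> \<open>~ isl b\<close> by (metis isl_def sum.exhaust)
 moreover have "\<psi> s * \<psi> t = - (\<psi> t * \<psi> s)" using assms unfolding anticomm_def by blast
 ultimately show ?thesis by simp
 qed
 qed
 fix vs :: "'v list" and ss :: "'o list" assume ss: "sorted_wrt (<) ss"
 have "gca_hom \<phi> \<psi> (gw (map Inl vs @ map Inr ss)) =
 gca_poly (poly_subst \<phi> (Poly_Mapping.single (expo vs) 1)) * prod_list (map \<psi> ss)"
 unfolding gca_hom_def support_canonical(2)[OF ss] support_canonical(1)[OF ss] by (simp add: support_canonical(3)[OF ss])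
 then show "gca_hom \<phi> \<psi> (gw (map Inl vs @ map Inr ss)) = prod_list (map (hl \<phi> \<psi>) (map Inl vs @ map Inr ss))"
 by (simp add: poly_subst_monomial gca_poly_prod_list o_def)
qed

lemma ghom_gca_hom:
 fixes \<psi> :: "'o::linorder => ('u, 'p::linorder, 'k::field_char_0) gca"
 assumes "anticomm \<psi>"
 shows "ghom (gca_hom \<phi> \<psi>)"
proof (rule ghomI[OF glin_gca_hom])
 show "gca_hom \<phi> \<psi> 1 = 1" using gca_hom_gw[OF assms, of \<phi> "[]"] by simp
 show "gca_hom \<phi> \<psi> (gw u * gw v) = gca_hom \<phi> \<psi> (gw u) * gca_hom \<phi> \<psi> (gw v)" for u v
 using gca_hom_gw[OF assms, of \<phi> "u @ v"] gca_hom_gw[OF assms, of \<phi> u] gca_hom_gw[OF assms, of \<phi> v] by simp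
qed

lemma gca_hom_gl: "anticomm \<psi> ==> gca_hom \<phi> \<psi> (gl a) = hl \<phi> \<psi> a"
 for \<psi> :: "'o::linorder => ('u, 'p::linorder, 'k::field_char_0) gca" using gca_hom_gw[of \<psi> \<phi> "[a]"] by simp

section \<open>Elements linear in the odd generators, and the parity automorphism\<close>

definition deg1 :: "('v, 'o, 'k::zero) gca set" where
 "deg1 = {f. ALL S. card S ~= 1 --> coeff_gca f S = 0}"

lemma deg1_theta [simp]: "theta s : deg1" by (auto simp: deg1_def coeff_theta_basis)

lemma deg1_0 [simp]: "0 : deg1" by (auto simp: deg1_def)

lemma deg1_add: "f : deg1 ==> g : deg1 ==> f + g : deg1"
 and deg1_diff: "f : deg1 ==> g : deg1 ==> f - g : deg1"
 and deg1_uminus: "f : deg1 ==> - f : deg1"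
 and deg1_poly: "f : deg1 ==> gca_poly p * f : deg1" by (auto simp: deg1_def)

lemma deg1_sum: "(!!a. a : A ==> f a : deg1) ==> sum f A : deg1"
 by (induction A rule: infinite_finite_induct) (auto intro: deg1_add)

lemma deg1_expand:
 fixes f :: "('v, 'o::linorder, 'k::comm_ring_1) gca"
 assumes "f : deg1"
 shows "f = (\<Sum>S\<in>support f. gca_poly (coeff_gca f S) * theta (the_elem S))"
proof -
 have "S = {the_elem S}" if "S : support f" for S
 proof -
 have "card S = 1" using that assms by (auto simp: in_support deg1_def)
 then show ?thesis by (metis card_1_singletonE the_elem_eq)
 qed
 then show ?thesis using gca_expand_support[of f] by (metis (no_types, lifting) sum.cong)
qed

lemma deg1_anticommute:
 fixes f g :: "('v, 'o::linorder, 'k::comm_ring_1) gca"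
 assumes "f : deg1" "g : deg1"
 shows "f * g = - (g * f)"
proof -
 have t: "theta s * g = - (g * theta s)" for s
 proof -
 have "theta s * (gca_poly p * theta t) = - ((gca_poly p * theta t) * theta s)" for p :: "('v, 'k) mpoly" and t
 unfolding poly_left_comm theta_anticommute[of s t] by (simp add: mult.assoc)
 then show ?thesis
 by (subst (1 2) deg1_expand[OF assms(2)]) (simp add: sum_distrib_left sum_distrib_right sum_negf[symmetric])
 qed
 have "gca_poly p * theta s * g = - (g * (gca_poly p * theta s))" for p :: "('v, 'k) mpoly" and s
 unfolding poly_left_comm mult.assoc t by simp
 then show ?thesis
 by (subst (1 2) deg1_expand[OF assms(1)]) (simp add: sum_distrib_left sum_distrib_right sum_negf[symmetric])
qed

lemma anticommI: "(!!s. \<psi> s : deg1) ==> anticomm \<psi>"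
 for \<psi> :: "'o::linorder => ('u, 'p::linorder, 'k::comm_ring_1) gca"
 unfolding anticomm_def using deg1_anticommute by blast

text \<open>The parity automorphism: it acts as \<open>(-1)^i\<close> in homological degree i and
  thus carries the sign of the graded Leibniz rule.\<close>

definition gi :: "('v, 'o::linorder, 'k::field_char_0) gca => ('v, 'o, 'k) gca" where
 "gi = gca_hom pvar (%s. - theta s)"

lemma ghom_gi: "ghom gi" unfolding gi_def by (intro ghom_gca_hom anticommI deg1_uminus deg1_theta)

lemma gi_gl: "gi (gl a) = (if isl a then gl a else - gl a)"
 unfolding gi_def by (subst gca_hom_gl, intro anticommI deg1_uminus deg1_theta, cases a)
 (auto simp: gl_def)

text \<open>
 The derivation with values \<open>e a\<close> on the generators; it is odd if \<open>od\<close> holds and even otherwise.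
\<close>

definition tw :: "bool => ('v, 'o::linorder, 'k::field_char_0) gca => ('v, 'o, 'k) gca" where
 "tw od f = (if od then gi f else f)"

lemma ghom_tw: "ghom (tw od)" unfolding tw_def by (cases od) (simp_all add: ghom_gi ghom_id)

lemma tw_gl: "tw od (gl a) = (if od & ~ isl a then - gl a else gl a)" by (simp add: tw_def gi_gl)

fun dw :: "bool => ('v + 'o => ('v, 'o, 'k) gca) => ('v + 'o::linorder) list => ('v, 'o, 'k::field_char_0) gca" where
 "dw od e [] = 0"
| "dw od e (a # w) = e a * gw w + tw od (gl a) * dw od e w"

text \<open>Exactly what makes the Leibniz expansions of a b and of plus or minus b a agree, hence
  the condition for the values \<open>e\<close> to extend to a derivation.\<close>

definition der_ok :: "bool => ('v + 'o => ('v, 'o::linorder, 'k::field_char_0) gca) => bool" where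
 "der_ok od e \<longleftrightarrow> (ALL a b. e a * gl b + tw od (gl a) * e b =
 (if isl a \<or> isl b then 1 else - 1) * (e b * gl a + tw od (gl b) * e a))"

text \<open>Swapping two neighbours affects the terms in which one of them is differentiated, which
  \<open>der_ok\<close> compares, and those in which a later letter is, where the twisted neighbours
  commute with the same sign as before.\<close>

lemma supersym_dw:
 fixes e :: "'v + 'o::linorder => ('v, 'o, 'k::field_char_0) gca"
 assumes "der_ok od e"
 shows "supersym (dw od e)"
proof -
 let ?s = "%a b :: 'v + 'o. if isl a \<or> isl b then 1 else - 1 :: ('v, 'o, 'k) gca"
 have "dw od e (u @ a # b # v) = ?s a b * dw od e (u @ b # a # v)" for u a b v
 proof (induction u)
 case Nil
 have 1: "(e a * gl b + tw od (gl a) * e b) * gw v = ?s a b * ((e b * gl a + tw od (gl b) * e a) * gw v)"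
 using assms unfolding der_ok_def mult.assoc[symmetric] by metis
 have "tw od (gl a) * tw od (gl b) = ?s a b * (tw od (gl b) * tw od (gl a))"
 proof (cases "isl a \<or> isl b")
 case True
 then have "gl a * gl b = (gl b * gl a :: ('v, 'o, 'k) gca)"
 using gl_comm_even[of a "gl b :: ('v, 'o, 'k) gca"] gl_comm_even[of b "gl a :: ('v, 'o, 'k) gca"] by auto
 then show ?thesis using True by (simp add: tw_gl)
 next
 case False
 then have "gl a * gl b = - (gl b * gl a :: ('v, 'o, 'k) gca)" using gl_anticommute[of a b] by blast
 then show ?thesis using False by (simp add: tw_gl)
 qed
 then have 2: "tw od (gl a) * tw od (gl b) * dw od e v = ?s a b * (tw od (gl b) * tw od (gl a) * dw od e v)"
 by (simp add: mult.assoc)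
 have "dw od e (a # b # v) = (e a * gl b + tw od (gl a) * e b) * gw v + tw od (gl a) * tw od (gl b) * dw od e v"
 by (simp add: algebra_simps)
 also have "... = ?s a b * ((e b * gl a + tw od (gl b) * e a) * gw v + tw od (gl b) * tw od (gl a) * dw od e v)"
 unfolding 1 2 by (simp add: distrib_left)
 also have "... = ?s a b * dw od e (b # a # v)" by (simp add: algebra_simps)
 finally show ?case by simp
 next
 case (Cons c u)
 have g: "gw (u @ a # b # v) = ?s a b * (gw (u @ b # a # v) :: ('v, 'o, 'k) gca)"
 using gw_swap_even[of a b u v] gw_swap_odd[of a b u v] by (auto simp del: gw_simps)
 show ?case unfolding append_Cons dw.simps g Cons.IH by (auto simp: algebra_simps simp del: gw_simps)
 qed
 note sw = this
 show ?thesis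
 proof (rule supersymI)
 fix u v and a b :: "'v + 'o"
 show "dw od e (u @ a # b # v) = dw od e (u @ b # a # v)" if "isl a \<or> isl b" using trans[OF sw[of u a b v]] that by simp
 show "dw od e (u @ a # b # v) = - dw od e (u @ b # a # v)" if "~ isl a" "~ isl b"
 using trans[OF sw[of u a b v]] that by simp
 qed
qed

definition gder :: "bool => ('v + 'o => ('v, 'o, 'k) gca) => ('v, 'o::linorder, 'k::field_char_0) gca => ('v, 'o, 'k) gca" where
 "gder od e = glift (dw od e)"

lemma glin_gder: "glin (gder od e)" by (simp add: gder_def glin_glift)

lemma gder_gw: "der_ok od e ==> gder od e (gw w) = dw od e w" unfolding gder_def by (rule glift_gw[OF supersym_dw])

lemma gder_gl: "der_ok od e ==> gder od e (gl a) = e a" using gder_gw[of od e "[a]"] by simp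

lemma dw_append: "dw od e (u @ v) = dw od e u * gw v + tw od (gw u) * dw od e v"
 by (induction u) (simp_all add: ghom_1[OF ghom_tw] ghom_mult[OF ghom_tw] algebra_simps)

lemma gder_mult:
 assumes ok: "der_ok od e"
 shows "gder od e (f * g) = gder od e f * g + tw od f * gder od e g"
proof -
 have 1: "gder od e (f * gw v) = gder od e f * gw v + tw od f * gder od e (gw v)" for f v
 proof (induction f rule: gca_induct)
 case (add f g)
 then show ?case by (simp add: distrib_right glin_add[OF glin_gder] glin_add[OF ghom_glin[OF ghom_tw]])
 next
 case (word c w)
 have "gder od e (gw w * gw v) = dw od e (w @ v)" using gder_gw[OF ok, of "w @ v"] by simp
 then show ?case by (simp add: mult.assoc glin_cs[OF glin_gder] glin_cs[OF ghom_glin[OF ghom_tw]] gder_gw[OF ok]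
 dw_append distrib_left)
 qed
 show ?thesis
 proof (induction g rule: gca_induct)
 case (add g h)
 then show ?case by (simp add: distrib_left glin_add[OF glin_gder])
 next
 case (word c w)
 show ?case by (simp add: poly_left_comm glin_cs[OF glin_gder] 1 distrib_left)
 qed
qed

lemma gder_1: "gder od e 1 = 0" if "der_ok od e" using gder_gw[OF that, of "[]"] by simp

definition dval :: "('o => ('v, 'k) mpoly) => 'v + 'o => ('v, 'o::linorder, 'k::comm_ring_1) gca" where
 "dval \<delta> = case_sum (%_. 0) (%s. gca_poly (\<delta> s))"

lemma dval_simps [simp]: "dval \<delta> (Inl v) = 0" "dval \<delta> (Inr s) = gca_poly (\<delta> s)"
 by (simp_all add: dval_def)

lemma der_ok_dval: "der_ok True (dval \<delta>)" unfolding der_ok_def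
proof (intro allI)
 fix a b :: "'a + 'b"
 show "dval \<delta> a * gl b + tw True (gl a) * dval \<delta> b =
 (if isl a \<or> isl b then 1 else - 1) * (dval \<delta> b * gl a + tw True (gl b) * dval \<delta> a)"
 by (cases a; cases b) (simp_all add: tw_gl gca_poly_commute)
qed

lemma glin_gd: "glin (gca_diff \<delta>)" unfolding glin_def
proof (intro conjI allI)
 fix f g c
 let ?k = "%S p. \<Sum>s\<in>S. (- 1) ^ card {r : S. r < s} * gca_poly (p * \<delta> s) * theta_basis (S - {s})"
 show "gca_diff \<delta> (f + g) = gca_diff \<delta> f + gca_diff \<delta> g" unfolding gca_diff_def
 by (rule sum_support_add[of ?k]) (simp add: gca_poly_add distrib_right distrib_left sum.distrib)
 have sc: "?k S (pconst c * p) = cs c * ?k S p" for S p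
 by (simp add: gca_poly_mult sum_distrib_left mult.assoc poly_left_comm[of "(-1) ^ n" for n])
 show "gca_diff \<delta> (cs c * f) = cs c * gca_diff \<delta> f" unfolding gca_diff_def
 by (subst sum_support_scale[of ?k], simp, unfold sc, simp add: sum_distrib_left)
qed

text \<open>Induction on the smallest odd letter: it adds one to the number of smaller letters for
  every other deletion, and this extra sign is the one that the Leibniz rule puts in front of the
  rest of the word.\<close>

lemma gca_diff_odd_word:
 fixes \<delta> :: "'o::linorder => ('v, 'k::field_char_0) mpoly"
 assumes "sorted_wrt (<) ss"
 shows "(\<Sum>s\<in>set ss. (- 1) ^ card {r : set ss. r < s} * gca_poly (\<delta> s) * theta_basis (set ss - {s})) =
 dw True (dval \<delta>) (map Inr ss)" using assms
proof (induction ss)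
 case (Cons s ss)
 let ?S = "set ss"
 have lt: "!!t. t : ?S ==> s < t" and nin: "s ~: ?S" using Cons.prems by auto
 have 0: "{r : set (s # ss). r < s} = {}" using lt by (auto dest: less_asym)
 have 1: "card {r : set (s # ss). r < t} = Suc (card {r : ?S. r < t})" if "t : ?S" for t
 proof -
 have "{r : set (s # ss). r < t} = insert s {r : ?S. r < t}" using lt that by auto
 then show ?thesis using nin by simp
 qed
 have 2: "theta_basis (set (s # ss) - {t}) = theta s * (theta_basis (?S - {t}) :: ('v, 'o, 'k) gca)" if "t : ?S" for t
 proof -
 have "set (s # ss) - {t} = insert s (?S - {t})" using nin that by auto
 then show ?thesis by (simp only:) (rule theta_times_basis[symmetric], use lt in auto)
 qed
 have "(\<Sum>t\<in>?S. (- 1) ^ card {r : set (s # ss). r < t} * gca_poly (\<delta> t) * theta_basis (set (s # ss) - {t})) =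
 (\<Sum>t\<in>?S. - theta s * ((- 1) ^ card {r : ?S. r < t} * gca_poly (\<delta> t) * theta_basis (?S - {t})))"
 proof (rule sum.cong[OF refl])
 fix t assume t: "t : ?S"
 have c: "theta s * ((-1) ^ n * x) = (-1) ^ n * (theta s * x)" for n and x :: "('v, 'o, 'k) gca" by (cases "even n") auto
 show "(- 1) ^ card {r : set (s # ss). r < t} * gca_poly (\<delta> t) * theta_basis (set (s # ss) - {t}) =
 - theta s * ((- 1) ^ card {r : ?S. r < t} * gca_poly (\<delta> t) * (theta_basis (?S - {t}) :: ('v, 'o, 'k) gca))"
 unfolding 1[OF t] 2[OF t] by (simp add: mult.assoc c poly_left_comm)
 qed
 also have "... = - theta s * dw True (dval \<delta>) (map Inr ss)" using Cons by (simp add: sum_negf flip: sum_distrib_left)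
 finally have 3: "(\<Sum>t\<in>?S. (- 1) ^ card {r : set (s # ss). r < t} * gca_poly (\<delta> t) * theta_basis (set (s # ss) - {t})) =
 - theta s * dw True (dval \<delta>) (map Inr ss)" .
 have 4: "(\<Sum>t\<in>set (s # ss). h t) = h s + sum h ?S" for h :: "'o => ('v, 'o, 'k) gca" using nin by simp
 have "set (s # ss) - {s} = ?S" using nin by auto
 moreover have "gw (map Inr ss) = (theta_basis ?S :: ('v, 'o, 'k) gca)" using Cons.prems by (simp add: gw_odd)
 ultimately show ?case unfolding 4 3 0 by (simp add: tw_gl) (simp add: gl_def)
qed simp

lemma gca_diff_eq_gder: "gca_diff \<delta> f = gder True (dval \<delta>) f"
 for f :: "('v, 'o::linorder, 'k::field_char_0) gca"
proof (rule glin_eqI[OF glin_gd glin_gder])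
 fix w :: "('v + 'o) list"
 show "gca_diff \<delta> (gw w) = gder True (dval \<delta>) (gw w)" unfolding gder_gw[OF der_ok_dval]
 proof (rule supersym_eqI[OF _ supersym_dw[OF der_ok_dval]])
 show "supersym (%w. gca_diff \<delta> (gw w))" by (rule supersym_glin[OF glin_gd])
 fix vs :: "'v list" and ss :: "'o list" assume ss: "sorted_wrt (<) ss"
 have ev: "dw True (dval \<delta>) (map Inl vs @ v) = gw (map Inl vs) * dw True (dval \<delta>) v" for v
 by (induction vs) (simp_all add: tw_gl mult.assoc)
 have c: "(-1) ^ n * (gca_poly p * x) = gca_poly p * ((-1) ^ n * x)" for n p and x :: "('v, 'o, 'k) gca"
 by (cases "even n") auto
 have "gca_diff \<delta> (gw (map Inl vs @ map Inr ss)) = gca_poly (Poly_Mapping.single (expo vs) 1) *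
 (\<Sum>s\<in>set ss. (- 1) ^ card {r : set ss. r < s} * gca_poly (\<delta> s) * theta_basis (set ss - {s}))"
 unfolding gca_diff_def support_canonical(2)[OF ss] support_canonical(1)[OF ss]
 by (simp add: sum_distrib_left gca_poly_mult mult.assoc c)
 then show "gca_diff \<delta> (gw (map Inl vs @ map Inr ss)) = dw True (dval \<delta>) (map Inl vs @ map Inr ss)"
 unfolding ev gca_diff_odd_word[OF ss] gw_even .
 qed
qed

lemma gca_diff_gl: "gca_diff \<delta> (gl a) = dval \<delta> a"
 and gca_diff_mult: "gca_diff \<delta> (f * g) = gca_diff \<delta> f * g + gi f * gca_diff \<delta> g"
 and gca_diff_1: "gca_diff \<delta> 1 = 0" unfolding gca_diff_eq_gder
 using gder_gl[OF der_ok_dval] gder_mult[OF der_ok_dval] gder_1[OF der_ok_dval] by (auto simp: tw_def)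

lemma glin_eq_on_poly:
 assumes "glin L" "glin M" "!!vs. L (gw (map Inl vs)) = M (gw (map Inl vs))"
 shows "L (gca_poly p) = M (gca_poly p)"
proof -
 have "L (gca_poly (Poly_Mapping.single m 1)) = M (gca_poly (Poly_Mapping.single m 1))" for m
 proof -
 obtain vs where "expo vs = m" using ex_expo by blast
 then show ?thesis using assms(3)[of vs] by (simp add: gw_even)
 qed
 then have "L (gca_poly (\<Sum>m\<in>Poly_Mapping.keys p. pconst (Poly_Mapping.lookup p m) * Poly_Mapping.single m 1)) =
 M (gca_poly (\<Sum>m\<in>Poly_Mapping.keys p. pconst (Poly_Mapping.lookup p m) * Poly_Mapping.single m 1))"
 by (simp add: gca_poly_sum gca_poly_mult glin_sum[OF assms(1)] glin_sum[OF assms(2)]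
 glin_cs[OF assms(1)] glin_cs[OF assms(2)])
 then show ?thesis using mpoly_expand[of p] by simp
qed

lemma glin_zero: "glin (%_. 0)" by (simp add: glin_def)

lemma gi_poly: "gi (gca_poly p) = gca_poly p"
proof (rule glin_eq_on_poly[OF ghom_glin[OF ghom_gi] glin_id])
 show "gi (gw (map Inl vs)) = gw (map Inl vs)" for vs :: "'a list"
 by (induction vs) (simp_all add: ghom_1[OF ghom_gi] ghom_mult[OF ghom_gi] gi_gl)
qed

lemma gca_diff_poly: "gca_diff \<delta> (gca_poly p) = (0 :: ('a, 'b::linorder, 'c::field_char_0) gca)"
proof (rule glin_eq_on_poly[OF glin_gd glin_zero])
 show "gca_diff \<delta> (gw (map Inl vs)) = 0" for vs :: "'a list"
 by (induction vs) (simp_all add: gca_diff_1 gca_diff_mult gca_diff_gl)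
qed

lemma gi_gi: "gi (gi f) = f" by (rule ghom_eqI[OF ghom_comp[OF ghom_gi ghom_gi] ghom_id])
 (simp add: gi_gl glin_uminus[OF ghom_glin[OF ghom_gi]])

lemma glin_neg: "glin L ==> glin (%f. - L f)" by (simp add: glin_def)

lemma gca_diff_gi: "gca_diff \<delta> (gi f) = - gi (gca_diff \<delta> f)"
proof (rule glin_eqI[where L = "%f. gca_diff \<delta> (gi f)" and M = "%f. - gi (gca_diff \<delta> f)"])
 fix w :: "('a + 'b) list"
 show "gca_diff \<delta> (gi (gw w)) = - gi (gca_diff \<delta> (gw w))"
 proof (induction w)
 case (Cons a w)
 have "gca_diff \<delta> (gi (gl a)) = - gi (dval \<delta> a)"
 by (cases a) (simp_all add: gi_gl gca_diff_gl gi_poly glin_0[OF ghom_glin[OF ghom_gi]] glin_uminus[OF glin_gd])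
 then show ?case using Cons by (simp add: gca_diff_mult gca_diff_gl ghom_mult[OF ghom_gi] glin_add[OF ghom_glin[OF ghom_gi]])
 qed (simp add: ghom_1[OF ghom_gi] gca_diff_1 glin_0[OF ghom_glin[OF ghom_gi]])
qed (intro glin_neg glin_comp[OF glin_gd ghom_glin[OF ghom_gi]] glin_comp[OF ghom_glin[OF ghom_gi] glin_gd])+

lemma gca_diff_diff: "gca_diff \<delta> (gca_diff \<delta> f) = (0 :: ('a, 'b::linorder, 'c::field_char_0) gca)"
proof (rule glin_eqI[where L = "%f. gca_diff \<delta> (gca_diff \<delta> f)" and M = "%_. 0"])
 fix w :: "('a + 'b) list"
 show "gca_diff \<delta> (gca_diff \<delta> (gw w)) = 0"
 proof (induction w)
 case (Cons a w)
 have 1: "gca_diff \<delta> (dval \<delta> a) = 0" "gi (dval \<delta> a) = dval \<delta> a"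
 by (cases a; simp add: glin_0[OF glin_gd] gca_diff_poly gi_poly glin_0[OF ghom_glin[OF ghom_gi]])+
 show ?case using Cons 1 by (simp add: gca_diff_mult gca_diff_gl gca_diff_gi glin_add[OF glin_gd])
 qed (simp add: gca_diff_1 glin_0[OF glin_gd])
qed (intro glin_zero glin_comp[OF glin_gd glin_gd])+

text \<open>An induction along the word with the graded Leibniz rule. The alphabet \<open>A\<close>
  leaves room for maps that respect the differentials only on letters with indices below n.\<close>

lemma chain_map:
 assumes L: "ghom L" and gi: "!!a. L (gi (gl a)) = gi (L (gl a))"
 and d: "!!a. a : A ==> L (dval \<delta> a) = gca_diff \<delta>' (L (gl a))" and w: "set w \<subseteq> A"
 shows "L (gca_diff \<delta> (gw w)) = gca_diff \<delta>' (L (gw w))" using w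
proof (induction w)
 case (Cons a w)
 then show ?case by (simp add: gca_diff_mult gca_diff_gl d ghom_mult[OF L] gi glin_add[OF ghom_glin[OF L]])
qed (simp add: gca_diff_1 ghom_1[OF L] glin_0[OF ghom_glin[OF L]])

text \<open>Projection onto the monomials whose multiset of letters satisfies \<open>Q\<close>; it
  is well defined because swaps keep the multiset. Degrees, weights, index sets and graphs are all
  read off from that multiset.\<close>

definition gfilter :: "(('v + 'o) multiset => bool) => ('v, 'o::linorder, 'k::field_char_0) gca => ('v, 'o, 'k) gca" where
 "gfilter Q = glift (%w. if Q (mset w) then gw w else 0)"

lemma glin_gf: "glin (gfilter Q)" by (simp add: gfilter_def glin_glift)

lemma gfilter_gw:
 fixes w :: "('v + 'o::linorder) list"
 shows "gfilter Q (gw w) = (if Q (mset w) then gw w else (0 :: ('v, 'o, 'k::field_char_0) gca))" unfolding gfilter_def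
proof (rule glift_gw, rule supersymI)
 fix u v and a b :: "'v + 'o"
 let ?z = "0 :: ('v, 'o, 'k) gca"
 have m: "mset (u @ a # b # v) = mset (u @ b # a # v)" by simp
 show "(if Q (mset (u @ a # b # v)) then gw (u @ a # b # v) else ?z) =
 (if Q (mset (u @ b # a # v)) then gw (u @ b # a # v) else ?z)" if "isl a \<or> isl b"
 unfolding m by (subst gw_swap_even[OF that]) (rule refl)
 show "(if Q (mset (u @ a # b # v)) then gw (u @ a # b # v) else ?z) =
 - (if Q (mset (u @ b # a # v)) then gw (u @ b # a # v) else ?z)" if "~ isl a" "~ isl b"
 unfolding m by (subst gw_swap_odd[OF that]) simp
qed

lemma gfilter_gfilter: "gfilter Q (gfilter R f) = gfilter (%M. Q M & R M) f"
 by (rule glin_eqI[OF glin_comp[OF glin_gf glin_gf] glin_gf])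
 (simp add: gfilter_gw glin_0[OF glin_gf])

lemmas gfilter_add = glin_add[OF glin_gf]
 and gfilter_cs = glin_cs[OF glin_gf]
 and gfilter_0 [simp] = glin_0[OF glin_gf]
 and gfilter_sum = glin_sum[OF glin_gf]
 and gfilter_diff = glin_diff[OF glin_gf]

definition gsp :: "(('v + 'o) multiset => bool) => ('v, 'o::linorder, 'k::field_char_0) gca set" where
 "gsp Q = {f. gfilter Q f = f}"

lemma gsp_gw: "Q (mset w) ==> gw w : gsp Q" by (simp add: gsp_def gfilter_gw)

lemma gsp_0 [simp]: "0 : gsp Q" by (simp add: gsp_def)

lemma gsp_add: "f : gsp Q ==> g : gsp Q ==> f + g : gsp Q"
 and gsp_diff: "f : gsp Q ==> g : gsp Q ==> f - g : gsp Q"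
 and gsp_cs: "f : gsp Q ==> cs c * f : gsp Q" by (simp_all add: gsp_def gfilter_add gfilter_diff gfilter_cs)

lemma gsp_sum: "(!!a. a : A ==> f a : gsp Q) ==> sum f A : gsp Q" by (simp add: gsp_def gfilter_sum)

lemma gfilter_in_gsp: "gfilter Q f : gsp Q" by (simp add: gsp_def gfilter_gfilter)

lemma gsp_induct [consumes 1, case_names add word]:
 assumes "f : gsp Q" "!!f g. P f ==> P g ==> P (f + g)" "!!c w. Q (mset w) ==> P (cs c * gw w)" "P 0"
 shows "P f"
proof -
 have "P (gfilter Q g)" for g by (induction g rule: gca_induct) (auto simp: gfilter_add gfilter_cs gfilter_gw assms)
 from this[of f] show ?thesis using assms(1) by (simp add: gsp_def)
qed

lemma glin_on_gsp:
 assumes "glin L" "glin M" "f : gsp Q" "!!w. Q (mset w) ==> L (gw w) = M (gw w)"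
 shows "L f = M f" using assms(3) by (induction rule: gsp_induct) (simp_all add: assms glin_add glin_cs glin_0)

lemma glin_maps_gsp:
 assumes "glin L" "f : gsp Q" "!!w. Q (mset w) ==> L (gw w) : gsp R"
 shows "L f : gsp R"
 using assms(2) by (induction rule: gsp_induct) (simp_all add: assms glin_add glin_cs glin_0 gsp_add gsp_cs)

lemma gsp_mono: "f : gsp Q ==> (!!M. Q M ==> R M) ==> f : gsp R"
 by (induction rule: gsp_induct) (auto intro: gsp_add gsp_cs gsp_gw)

lemma gsp_mult:
 assumes "f : gsp Q" "g : gsp R" "!!M N. Q M ==> R N ==> T (M + N)"
 shows "f * g : gsp T"
proof -
 have 1: "f * gw w : gsp T" if "R (mset w)" for w using assms(1)
 proof (induction rule: gsp_induct)
 case (word c u)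
 have "cs c * (gw u * gw w) : gsp T" using gsp_cs[OF gsp_gw[of T "u @ w"], of c] assms(3)[OF word that] by simp
 then show ?case by (simp add: mult.assoc)
 qed (simp_all add: distrib_right gsp_add)
 show ?thesis using assms(2) by (induction rule: gsp_induct) (simp_all add: distrib_left gsp_add poly_left_comm gsp_cs 1)
qed

lemma gfilter_eq_self: "f : gsp Q ==> (!!M. Q M ==> R M) ==> gfilter R f = f" using gsp_mono[of f Q R] by (simp add: gsp_def)

lemma gfilter_eq_0: "f : gsp Q ==> (!!M. Q M ==> ~ R M) ==> gfilter R f = 0"
 using glin_on_gsp[OF glin_gf, of "%_. 0" f Q R] by (simp add: glin_def gfilter_gw)

lemma gfilter_partition:
 assumes "f : gsp (%M. h M : A)" "finite A"
 shows "f = (\<Sum>a\<in>A. gfilter (%M. h M = a) f)" by (rule glin_on_gsp[OF glin_id glin_SUM[OF glin_gf] assms(1)])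
 (simp add: gfilter_gw assms(2) sum.delta)

lemma ex_key: "p ~= 0 ==> EX m. m : Poly_Mapping.keys p" by (metis in_keys_iff lookup_zero poly_mapping_eqI)

text \<open>The bridge from spans of words to conditions on supports and exponents, in which
  \<open>gca_on\<close> and \<open>gca_bihomogeneous\<close> are phrased.\<close>

lemma gsp_iff:
 fixes f :: "('v, 'o::linorder, 'k::field_char_0) gca"
 assumes R: "!!vs ss. sorted_wrt (<) ss ==> Q (mset (map Inl vs @ map Inr ss)) \<longleftrightarrow> R (set ss) (expo vs)"
 shows "f : gsp Q \<longleftrightarrow> (\<forall>S\<in>support f. \<forall>m\<in>Poly_Mapping.keys (coeff_gca f S). R S m)"
proof
 assume "f : gsp Q"
 then show "\<forall>S\<in>support f. \<forall>m\<in>Poly_Mapping.keys (coeff_gca f S). R S m"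
 proof (induction rule: gsp_induct)
 case (add f g)
 show ?case
 proof (intro ballI)
 fix S m assume "S : support (f + g)" "m : Poly_Mapping.keys (coeff_gca (f + g) S)"
 then have "m : Poly_Mapping.keys (coeff_gca f S) \<or> m : Poly_Mapping.keys (coeff_gca g S)"
 using Poly_Mapping.keys_add[of "coeff_gca f S" "coeff_gca g S"] by auto
 then show "R S m" using add by (auto simp: in_support)
 qed
 next
 case (word c w)
 \<comment> \<open>A word is zero or, up to sign, a single basis monomial, so its support has at
   most one element.\<close>
 from supersym_normal[OF supersym_gw, of w] consider "gw w = (0 :: ('v, 'o, 'k) gca)" |
 vs ss where "sorted_wrt (<) ss" "mset (map Inl vs @ map Inr ss) = mset w"
 "gw w = (gw (map Inl vs @ map Inr ss) :: ('v, 'o, 'k) gca) \<or> gw w = - (gw (map Inl vs @ map Inr ss) :: ('v, 'o, 'k) gca)"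
 by blast
 then show ?case
 proof cases
 case 1
 then show ?thesis by (simp add: in_support)
 next
 case 2
 have r: "R (set ss) (expo vs)" using R[OF 2(1), of vs] word unfolding 2(2) by simp
 have "coeff_gca (gw w :: ('v, 'o, 'k) gca) S = 0 \<or> S = set ss &
 Poly_Mapping.keys (coeff_gca (gw w :: ('v, 'o, 'k) gca) S) = {expo vs}" for S
 using 2(3) by (auto simp: support_canonical(1)[OF 2(1)] simp del: gw_simps split: if_splits)
 moreover have "Poly_Mapping.keys (pconst c * p) \<subseteq> Poly_Mapping.keys p" for p :: "('v, 'k) mpoly"
 by (auto simp: in_keys_iff)
 ultimately have "S = set ss & m = expo vs"
 if "S : support (cs c * gw w :: ('v, 'o, 'k) gca)" "m : Poly_Mapping.keys (coeff_gca (cs c * gw w :: ('v, 'o, 'k) gca) S)" for S m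
 using that unfolding in_support coeff_poly_times by (metis empty_iff insert_iff keys_zero mult_zero_right subsetD)
 then show ?thesis using r by blast
 qed
 qed (simp add: in_support)
next
 assume r: "\<forall>S\<in>support f. \<forall>m\<in>Poly_Mapping.keys (coeff_gca f S). R S m"
 show "f : gsp Q"
 proof (subst gca_expand, intro gsp_sum gsp_cs gsp_gw)
 fix S m assume "S : support f" "m : Poly_Mapping.keys (coeff_gca f S)"
 then show "Q (mset (canw m S))" using R[of "sorted_list_of_set S" "vlist m"] r finite_in_support[of S f] by simp
 qed
qed

text \<open>A nonzero coefficient has at least one monomial, so a condition on \<open>S\<close>
  alone may be moved under the quantifier over monomials.\<close>

lemma support_ball_conj:
 "(\<forall>S\<in>support f. \<forall>m\<in>Poly_Mapping.keys (coeff_gca f S). P S & R S m) \<longleftrightarrow>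
 (\<forall>S\<in>support f. P S & (\<forall>m\<in>Poly_Mapping.keys (coeff_gca f S). R S m))"
proof (rule ball_cong[OF refl])
 fix S assume "S : support f"
 then obtain m where "m : Poly_Mapping.keys (coeff_gca f S)" using ex_key[of "coeff_gca f S"] by (auto simp: in_support)
 then show "(\<forall>m\<in>Poly_Mapping.keys (coeff_gca f S). P S & R S m) \<longleftrightarrow>
 P S & (\<forall>m\<in>Poly_Mapping.keys (coeff_gca f S). R S m)" by auto
qed

lemma gca_on_eq: "gca_on V W = gsp (%M. set_mset M \<subseteq> Inl ` V \<union> Inr ` W)"
proof -
 have "f : gca_on V W \<longleftrightarrow> f : gsp (%M. set_mset M \<subseteq> Inl ` V \<union> Inr ` W)"
 for f :: "('a, 'b, 'c) gca"
 proof -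
 have k: "Poly_Mapping.keys (expo vs) = set vs" for vs :: "'a list" by (auto simp: in_keys_iff lookup_expo)
 have "f : gsp (%M. set_mset M \<subseteq> Inl ` V \<union> Inr ` W) \<longleftrightarrow>
 (\<forall>S\<in>support f. \<forall>m\<in>Poly_Mapping.keys (coeff_gca f S). S \<subseteq> W & Poly_Mapping.keys m \<subseteq> V)"
 by (rule gsp_iff) (auto simp: k)
 also have "... \<longleftrightarrow> f : gca_on V W" unfolding gca_on_def support_ball_conj by simp
 finally show ?thesis by blast
 qed
 then show ?thesis by blast
qed

definition nev :: "('v + 'o) multiset => nat" where "nev M = size (filter_mset isl M)"
definition nod :: "('v + 'o) multiset => nat" where "nod M = size (filter_mset (%a. ~ isl a) M)"

lemma nev_simps [simp]: "nev {#} = 0" "nev (add_mset a M) = (if isl a then 1 else 0) + nev M" "nev (M + N) = nev M + nev N"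
 by (simp_all add: nev_def)
lemma nod_simps [simp]: "nod {#} = 0" "nod (add_mset a M) = (if isl a then 0 else 1) + nod M" "nod (M + N) = nod M + nod N"
 by (simp_all add: nod_def)

lemma gca_bihomogeneous_eq: "gca_bihomogeneous i w = gsp (%M. nod M = i & nev M + 2 * nod M = w)"
proof -
 have "f : gca_bihomogeneous i w \<longleftrightarrow> f : gsp (%M. nod M = i & nev M + 2 * nod M = w)"
 for f :: "('a, 'b, 'c) gca"
 proof -
 have k: "(\<Sum>v\<in>Poly_Mapping.keys (expo vs). Poly_Mapping.lookup (expo vs) v) = length vs" for vs :: "'a list"
 proof -
 have "Poly_Mapping.keys (expo vs) = set vs" by (auto simp: in_keys_iff lookup_expo)
 then show ?thesis by (simp add: lookup_expo size_multiset_overloaded_eq[symmetric] flip: size_mset set_mset_mset)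
 qed
 have e: "nev (mset (map Inl vs @ map Inr ss)) = length vs" "nod (mset (map Inl vs @ map Inr ss)) = length ss"
 for vs :: "'a list" and ss :: "'b list" by (induction vs; induction ss; simp)+
 have "f : gsp (%M. nod M = i & nev M + 2 * nod M = w) \<longleftrightarrow>
 (\<forall>S\<in>support f. \<forall>m\<in>Poly_Mapping.keys (coeff_gca f S). card S = i &
 (\<Sum>v\<in>Poly_Mapping.keys m. Poly_Mapping.lookup m v) + 2 * card S = w)"
 proof (rule gsp_iff)
 fix vs :: "'a list" and ss :: "'b list" assume "sorted_wrt (<) ss"
 then have "card (set ss) = length ss" by (simp add: distinct_card strict_sorted_iff)
 then show "(nod (mset (map Inl vs @ map Inr ss)) = i &
 nev (mset (map Inl vs @ map Inr ss)) + 2 * nod (mset (map Inl vs @ map Inr ss)) = w) =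
 (card (set ss) = i & (\<Sum>v\<in>Poly_Mapping.keys (expo vs). Poly_Mapping.lookup (expo vs) v) + 2 * card (set ss) = w)"
 unfolding e k by simp
 qed
 also have "... \<longleftrightarrow> f : gca_bihomogeneous i w" unfolding gca_bihomogeneous_def support_ball_conj by simp
 finally show ?thesis by blast
 qed
 then show ?thesis by blast
qed

section \<open>Matrix letters and index substitutions\<close>

text \<open>One image function serves even and odd letters alike, and an even letter may go to any
  central element; \<open>good\<close> makes the result multiplicative.\<close>

definition lhom :: "('v + 'o => ('u, 'p, 'k) gca) => ('v, 'o::linorder, 'k::field_char_0) gca => ('u, 'p::linorder, 'k) gca" where
 "lhom g = glift (%w. prod_list (map g w))"

definition good :: "('v + 'o => ('u, 'p::linorder, 'k::comm_ring_1) gca) => bool" where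
 "good g \<longleftrightarrow> (ALL a. isl a --> (ALL f. g a * f = f * g a)) & (ALL a. ~ isl a --> g a : deg1)"

lemma glin_lhom: "glin (lhom g)" by (simp add: lhom_def glin_glift)

lemma lhom_gw:
 fixes g :: "'v + 'o::linorder => ('u, 'p::linorder, 'k::field_char_0) gca"
 assumes "good g"
 shows "lhom g (gw w) = prod_list (map g w)" unfolding lhom_def
proof (rule glift_gw, rule prod_list_supersym)
 show "g a * g b = g b * g a" if "isl a" for a b using assms that unfolding good_def by blast
 show "g a * g b = - (g b * g a)" if "~ isl a" "~ isl b" for a b
 using assms that unfolding good_def by (intro deg1_anticommute) blast+
qed

lemma ghom_lhom:
 fixes g :: "'v + 'o::linorder => ('u, 'p::linorder, 'k::field_char_0) gca"
 assumes "good g"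
 shows "ghom (lhom g)"
proof (rule ghomI[OF glin_lhom])
 show "lhom g 1 = 1" using lhom_gw[OF assms, of "[]"] by simp
 show "lhom g (gw u * gw v) = lhom g (gw u) * lhom g (gw v)" for u v
 using lhom_gw[OF assms, of "u @ v"] lhom_gw[OF assms, of u] lhom_gw[OF assms, of v] by simp
qed

lemma lhom_gl: "good g ==> lhom g (gl a) = g a"
 for g :: "'v + 'o::linorder => ('u, 'p::linorder, 'k::field_char_0) gca" using lhom_gw[of g "[a]"] by simp

lemma good_gl: "isl b = isl a ==> isl a ==> gl b * f = f * gl b" "isl b = isl a ==> ~ isl a ==> gl b : deg1"
 by (simp add: gl_comm_even) (cases b; simp add: gl_def)

lemma good_sum:
 fixes \<rho> :: "'v + 'o => 'r => 'u + 'p::linorder" and c :: "'v + 'o => 'r => 'k::field_char_0"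
 assumes "!!a r. r : A ==> isl (\<rho> a r) = isl a"
 shows "good (%a. \<Sum>r\<in>A. cs (c a r) * gl (\<rho> a r))" unfolding good_def
proof (intro conjI allI impI)
 fix a :: "'v + 'o" and f :: "('u, 'p, 'k) gca" assume "isl a"
 then have 1: "cs (c a r) * gl (\<rho> a r) * f = f * (cs (c a r) * gl (\<rho> a r))" if "r : A" for r
 using gl_comm_even[of "\<rho> a r" f] assms[OF that, of a] by (simp add: mult.assoc poly_left_comm[of f])
 show "(\<Sum>r\<in>A. cs (c a r) * gl (\<rho> a r)) * f = f * (\<Sum>r\<in>A. cs (c a r) * gl (\<rho> a r))"
 unfolding sum_distrib_left sum_distrib_right by (rule sum.cong[OF refl 1])
next
 fix a :: "'v + 'o" assume a: "~ isl a"
 show "(\<Sum>r\<in>A. cs (c a r) * gl (\<rho> a r)) : deg1"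
 proof (intro deg1_sum deg1_poly)
 fix r assume "r : A"
 then show "gl (\<rho> a r) : deg1" using good_gl(2)[of "\<rho> a r" a] a assms by blast
 qed
qed

lemma good_lmap:
 assumes "!!a. isl (\<rho> a) = isl a"
 shows "good (%a. gl (\<rho> a) :: ('u, 'p::linorder, 'k::field_char_0) gca)"
proof -
 have "good (%a. \<Sum>r\<in>{()}. cs (1 :: 'k) * (gl (\<rho> a) :: ('u, 'p, 'k) gca))"
 by (rule good_sum[of "{()}" "%a _. \<rho> a"]) (rule assms)
 then show ?thesis by simp
qed

definition lmap :: "('v + 'o => 'u + 'p) => ('v, 'o::linorder, 'k::field_char_0) gca => ('u, 'p::linorder, 'k) gca" where
 "lmap \<rho> = lhom (%a. gl (\<rho> a))"

lemma ghom_lmap: "(!!a. isl (\<rho> a) = isl a) ==> ghom (lmap \<rho>)" unfolding lmap_def by (intro ghom_lhom good_lmap)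

lemma lmap_gw: "(!!a. isl (\<rho> a) = isl a) ==> lmap \<rho> (gw w) = gw (map \<rho> w)"
 unfolding lmap_def by (subst lhom_gw, intro good_lmap) (simp_all add: gw_def o_def)

text \<open>Letters are handled as triples of kind, row and column, so that everything done with
  indices is uniform in x, y and theta.\<close>

datatype kind = KX | KY | KT

type_synonym letter = "(nat \<times> nat) xy + nat \<times> nat"

fun mk :: "kind => nat => nat => letter" where
 "mk KX p q = Inl (X (p, q))" | "mk KY p q = Inl (Y (p, q))" | "mk KT p q = Inr (p, q)"

fun kd :: "letter => kind" where
 "kd (Inl (X _)) = KX" | "kd (Inl (Y _)) = KY" | "kd (Inr _) = KT"

fun rw :: "letter => nat" where
 "rw (Inl (X i)) = fst i" | "rw (Inl (Y i)) = fst i" | "rw (Inr i) = fst i"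

fun cl :: "letter => nat" where
 "cl (Inl (X i)) = snd i" | "cl (Inl (Y i)) = snd i" | "cl (Inr i) = snd i"

lemma mk_simps [simp]: "kd (mk k p q) = k" "rw (mk k p q) = p" "cl (mk k p q) = q" by (cases k; simp)+

lemma mk_collapse [simp]: "mk (kd a) (rw a) (cl a) = a" by (cases a rule: kd.cases) auto

lemma mk_eq_iff [simp]: "mk k p q = mk k' p' q' \<longleftrightarrow> k = k' & p = p' & q = q'" by (metis mk_simps)

lemma letter_eqI: "kd a = kd b ==> rw a = rw b ==> cl a = cl b ==> a = b" by (metis mk_collapse)

lemma isl_mk [simp]: "isl (mk k p q) \<longleftrightarrow> k ~= KT" by (cases k) auto

lemma isl_kd: "isl a \<longleftrightarrow> kd a ~= KT" by (cases a rule: kd.cases) auto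

definition idxs :: "letter multiset => nat set" where
 "idxs M = rw ` set_mset M \<union> cl ` set_mset M"

lemma idxs_simps [simp]: "idxs {#} = {}" "idxs (add_mset a M) = {rw a, cl a} \<union> idxs M" "idxs (M + N) = idxs M \<union> idxs N"
 by (auto simp: idxs_def)

lemma finite_idxs [simp]: "finite (idxs M)" by (simp add: idxs_def)

definition rl :: "(nat => nat) => letter => letter" where
 "rl i a = mk (kd a) (i (rw a)) (i (cl a))"

lemma rl_simps [simp]: "kd (rl i a) = kd a" "rw (rl i a) = i (rw a)" "cl (rl i a) = i (cl a)"
 "isl (rl i a) = isl a" "rl i (mk k p q) = mk k (i p) (i q)" by (simp_all add: rl_def isl_kd)

lemma rl_rl: "rl i (rl j a) = rl (i \<circ> j) a" by (simp add: rl_def)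

lemma rl_cong: "i (rw a) = j (rw a) ==> i (cl a) = j (cl a) ==> rl i a = rl j a" by (simp add: rl_def)

lemma rl_id [simp]: "rl (%x. x) a = a" "rl id a = a" by (simp_all add: rl_def)

definition relabel :: "(nat => nat) => 'k::field_char_0 mat_gca => 'k mat_gca" where
 "relabel i = lmap (rl i)"

lemma ghom_rlb: "ghom (relabel i)" unfolding relabel_def by (rule ghom_lmap) simp

lemmas glin_rlb = ghom_glin[OF ghom_rlb]

lemma relabel_gw: "relabel i (gw w) = gw (map (rl i) w)" unfolding relabel_def by (rule lmap_gw) simp

lemma relabel_gl: "relabel i (gl a) = gl (rl i a)" using relabel_gw[of i "[a]"] by simp

lemma relabel_relabel: "relabel i (relabel j f) = relabel (i \<circ> j) f"
 by (rule glin_eqI[OF glin_comp[OF glin_rlb glin_rlb] glin_rlb])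
 (simp add: relabel_gw rl_rl o_def del: gw_simps)

lemma map_rl_id [simp]: "map (rl (%x. x)) w = w" by (simp add: map_idI)

lemma map_rl_cong:
 assumes "!!p. p : idxs (mset w) ==> i p = j p"
 shows "map (rl i) w = map (rl j) w" using assms by (intro map_cong refl rl_cong) (auto simp: idxs_def)

lemma relabel_cong:
 assumes "f : gsp (%M. idxs M \<subseteq> P)" "!!p. p : P ==> i p = j p"
 shows "relabel i f = relabel j f"
proof (rule glin_on_gsp[OF glin_rlb glin_rlb assms(1)])
 fix w assume "idxs (mset w) \<subseteq> P"
 then show "relabel i (gw w) = relabel j (gw w)" unfolding relabel_gw using map_rl_cong[of w i j] assms(2) by (metis subsetD)
qed

lemma idxs_map_rl [simp]: "idxs (image_mset (rl i) M) = i ` idxs M" by (auto simp: idxs_def image_image image_Un)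

lemma relabel_gsp_idxs:
 assumes "f : gsp (%M. idxs M \<subseteq> P)" "i ` P \<subseteq> R"
 shows "relabel i f : gsp (%M. idxs M \<subseteq> R)"
proof (rule glin_maps_gsp[OF glin_rlb assms(1)])
 fix w assume "idxs (mset w) \<subseteq> P"
 then show "relabel i (gw w) : gsp (%M. idxs M \<subseteq> R)" unfolding relabel_gw using assms(2) by (intro gsp_gw) auto
qed

text \<open>Contraction over all index maps. On a word in which each index of \<open>P\<close> is
  once a row and once a column it is, up to order and sign, a product of traces of words in the
  generic matrices.\<close>

definition rsum :: "nat set => nat => 'k::field_char_0 mat_gca => 'k mat_gca" where
 "rsum P n f = (\<Sum>i\<in>P \<rightarrow>\<^sub>E {..<n}. relabel i f)"

lemma glin_rsum: "glin (rsum P n)" unfolding rsum_def by (intro glin_SUM glin_rlb)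

lemma finite_PiE_nat [simp]: "finite P ==> finite (P \<rightarrow>\<^sub>E {..<n::nat})" by (intro finite_PiE) auto

lemma rsum_idxs: "f : gsp (%M. idxs M \<subseteq> P) ==> rsum P n f : gsp (%M. idxs M \<subseteq> {..<n})"
 unfolding rsum_def by (intro gsp_sum relabel_gsp_idxs) (auto dest: PiE_mem)

lemma rsum_reindex:
 assumes f: "f : gsp (%M. idxs M \<subseteq> P)" and b: "bij_betw \<pi> P R"
 shows "rsum R n (relabel \<pi> f) = rsum P n f"
proof -
 let ?t = "%i. restrict (i \<circ> \<pi>) P" and ?u = "%j. restrict (j \<circ> inv_into P \<pi>) R"
 have im: "\<pi> p : R" "inv_into P \<pi> (\<pi> p) = p" if "p : P" for p using b that by (auto simp: bij_betw_def)
 have im2: "inv_into P \<pi> r : P" "\<pi> (inv_into P \<pi> r) = r" if "r : R" for r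
 using b that by (auto simp: bij_betw_def inv_into_into f_inv_into_f)
 have "(\<Sum>i\<in>R \<rightarrow>\<^sub>E {..<n}. relabel i (relabel \<pi> f)) = (\<Sum>j\<in>P \<rightarrow>\<^sub>E {..<n}. relabel j f)"
 proof (rule sum.reindex_bij_witness[where i = ?u and j = ?t])
 fix i assume i: "i : R \<rightarrow>\<^sub>E {..<n}"
 show "?u (?t i) = i" using i im2 by (intro ext) (auto simp: PiE_def extensional_def)
 show "?t i : P \<rightarrow>\<^sub>E {..<n}" using i im by auto
 show "relabel (?t i) f = relabel i (relabel \<pi> f)" unfolding relabel_relabel by (rule relabel_cong[OF f]) simp
 next
 fix j assume j: "j : P \<rightarrow>\<^sub>E {..<n}"
 show "?t (?u j) = j" using j im by (intro ext) (auto simp: PiE_def extensional_def)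
 show "?u j : R \<rightarrow>\<^sub>E {..<n}" using j im2 by auto
 qed
 then show ?thesis by (simp add: rsum_def)
qed

lemma prod_list_sum_lists:
 fixes F :: "'a => 'b => 'c::ring_1"
 assumes "finite A"
 shows "prod_list (map (%a. \<Sum>r\<in>A. F a r) w) =
 (\<Sum>rs\<in>{rs. length rs = length w & set rs \<subseteq> A}. prod_list (map2 F w rs))"
proof (induction w)
 case (Cons a w)
 let ?L = "{rs. length rs = length w & set rs \<subseteq> A}"
 have fin: "finite ?L" using finite_lists_length_eq[OF assms, of "length w"] by (simp add: conj_commute)
 have "(\<Sum>rs\<in>{rs. length rs = length (a # w) & set rs \<subseteq> A}. prod_list (map2 F (a # w) rs)) =
 (\<Sum>(r, rs)\<in>A \<times> ?L. F a r * prod_list (map2 F w rs))"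
 by (rule sum.reindex_bij_witness[where i = "%(r, rs). r # rs" and j = "%rs. (hd rs, tl rs)"])
 (auto simp: length_Suc_conv)
 also have "... = (\<Sum>r\<in>A. F a r) * (\<Sum>rs\<in>?L. prod_list (map2 F w rs))"
 unfolding sum_product by (rule sum.cartesian_product[symmetric])
 finally show ?case using Cons by simp
next
 case Nil
 have "{rs :: 'b list. length rs = length ([] :: 'a list) & set rs \<subseteq> A} = {[]}" by auto
 then show ?case by (simp only:) simp
qed

text \<open>The letters have different indices \<open>r a\<close>, so choosing a summand for each
  letter is the same as choosing a function on the set of indices.\<close>

lemma prod_list_sum_PiE:
 fixes F :: "'a => 'b => 'c::ring_1"
 assumes "finite A" "distinct (map r w)"
 shows "prod_list (map (%a. \<Sum>k\<in>A. F a k) w) =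
 (\<Sum>\<kappa>\<in>r ` set w \<rightarrow>\<^sub>E A. prod_list (map (%a. F a (\<kappa> (r a))) w))" using assms(2)
proof (induction w)
 case (Cons a w)
 let ?P = "r ` set w"
 have nin: "r a ~: ?P" using Cons.prems by auto
 have "(\<Sum>\<kappa>\<in>insert (r a) ?P \<rightarrow>\<^sub>E A. prod_list (map (%a. F a (\<kappa> (r a))) (a # w))) =
 (\<Sum>(k, \<kappa>)\<in>A \<times> (?P \<rightarrow>\<^sub>E A). prod_list (map (%b. F b ((\<kappa>(r a := k)) (r b))) (a # w)))"
 unfolding PiE_insert_eq by (subst sum.reindex[OF inj_combinator[OF nin]]) (simp add: case_prod_unfold o_def)
 also have "... = (\<Sum>(k, \<kappa>)\<in>A \<times> (?P \<rightarrow>\<^sub>E A). F a k * prod_list (map (%b. F b (\<kappa> (r b))) w))"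
 proof -
 have "map (%b. F b ((\<kappa>(r a := k)) (r b))) w = map (%b. F b (\<kappa> (r b))) w" for k \<kappa>
 proof (intro map_cong refl)
 fix x assume "x : set w"
 then have "r x ~= r a" using nin by (metis imageI)
 then show "F x ((\<kappa>(r a := k)) (r x)) = F x (\<kappa> (r x))" by simp
 qed
 then show ?thesis by (intro sum.cong refl) (simp only: case_prod_unfold list.map prod_list.Cons fun_upd_same)
 qed
 also have "... = (\<Sum>k\<in>A. F a k) * (\<Sum>\<kappa>\<in>?P \<rightarrow>\<^sub>E A. prod_list (map (%b. F b (\<kappa> (r b))) w))"
 unfolding sum_product by (rule sum.cartesian_product[symmetric])
 finally show ?case using Cons by simp
qed simp

lemma prod_list_cs: "prod_list (map (%a. cs (c a) * F a) w) = cs (prod_list (map c w)) * prod_list (map F w)"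
 for c :: "'a => 'k::field_char_0"
proof (induction w)
 case (Cons a w)
 then show ?case by (simp add: cs_mult mult.assoc poly_left_comm[of "F a"])
qed simp

section \<open>One-sided multiplication of the generic matrices\<close>

text \<open>Left multiplication of all generic matrices by \<open>V\<close>; \<open>rV\<close> is
  right multiplication. Unlike conjugation they make sense for singular \<open>V\<close>, and
  polarisation needs singular ones.\<close>

definition lV :: "nat => (nat => nat => 'k) => 'k::field_char_0 mat_gca => 'k mat_gca" where
 "lV n V = lhom (%a. \<Sum>r<n. cs (V (rw a) r) * gl (mk (kd a) r (cl a)))"

definition rV :: "nat => (nat => nat => 'k) => 'k::field_char_0 mat_gca => 'k mat_gca" where
 "rV n V = lhom (%a. \<Sum>r<n. cs (V r (cl a)) * gl (mk (kd a) (rw a) r))"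

lemma good_lV: "good (%a. \<Sum>r<n. cs (V (rw a) r) * gl (mk (kd a) r (cl a)) :: 'k::field_char_0 mat_gca)"
 by (rule good_sum) (simp add: isl_kd)

lemma good_rV: "good (%a. \<Sum>r<n. cs (V r (cl a)) * gl (mk (kd a) (rw a) r) :: 'k::field_char_0 mat_gca)"
 by (rule good_sum) (simp add: isl_kd)

lemmas ghom_lV = ghom_lhom[OF good_lV, folded lV_def]
lemmas ghom_rV = ghom_lhom[OF good_rV, folded rV_def]
lemmas lV_gw = lhom_gw[OF good_lV, folded lV_def]
lemmas rV_gw = lhom_gw[OF good_rV, folded rV_def]
lemmas lV_gl = lhom_gl[OF good_lV, folded lV_def]
lemmas rV_gl = lhom_gl[OF good_rV, folded rV_def]
lemmas glin_lV = ghom_glin[OF ghom_lV]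
lemmas glin_rV = ghom_glin[OF ghom_rV]

definition cj :: "nat => (nat => nat => 'k) => (nat => nat => 'k) => letter => 'k::field_char_0 mat_gca" where
 "cj n g h a = (\<Sum>k<n. \<Sum>l<n. cs (g (rw a) k * h l (cl a)) * gl (mk (kd a) k l))"

lemma cj_anticomm: "anticomm (%(i, j). \<Sum>k<n. \<Sum>l<n. gca_smult (g $$ (i, k) * h $$ (l, j)) (theta (k, l)))"
 by (intro anticommI) (auto intro!: deg1_sum deg1_poly simp: gca_smult_def)

lemma ghom_ca: "ghom (conj_act n g h)" unfolding conj_act_def by (rule ghom_gca_hom[OF cj_anticomm])

lemma conj_act_gl: "conj_act n g h (gl a) = cj n (%i j. g $$ (i, j)) (%i j. h $$ (i, j)) a"
 unfolding conj_act_def gca_hom_gl[OF cj_anticomm] by (cases a rule: kd.cases)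
 (auto simp: cj_def hl_def gl_def gca_poly_sum gca_poly_mult gca_smult_def)

lemmas glin_ca = ghom_glin[OF ghom_ca]

abbreviation below :: "nat => letter multiset => bool" where
 "below n M \<equiv> idxs M \<subseteq> {..<n}"

lemma ghom_eq_on_idxs:
 assumes "ghom L" "ghom L'" "f : gsp (%M. idxs M \<subseteq> P)"
 and "!!a. rw a : P ==> cl a : P ==> L (gl a) = L' (gl a)"
 shows "L f = L' f"
proof (rule glin_on_gsp[OF ghom_glin[OF assms(1)] ghom_glin[OF assms(2)] assms(3)])
 fix w assume "idxs (mset w) \<subseteq> P"
 then show "L (gw w) = L' (gw w)"
 by (induction w) (simp_all add: assms(4) ghom_mult[OF assms(1)] ghom_mult[OF assms(2)] ghom_1[OF assms(1)] ghom_1[OF assms(2)])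
qed

lemma inverts_mat_sum:
 assumes "g : carrier_mat n n" "h : carrier_mat n n" "inverts_mat g h" "p < n" "q < n"
 shows "(\<Sum>l<n. g $$ (p, l) * h $$ (l, q)) = (if p = q then 1 else 0 :: 'k::field_char_0)"
proof -
 have "(g * h) $$ (p, q) = (1\<^sub>m n) $$ (p, q)" using assms by (simp add: inverts_mat_def)
 then show ?thesis using assms by (simp add: scalar_prod_def atLeast0LessThan)
qed

text \<open>Substituting M g for M in g M h gives g M g h = g M. Conjugation fixes f, so right
  multiplication by g has the effect of left multiplication.\<close>

lemma lV_eq_rV_invertible:
 assumes f: "f : GL_invariants n" "f : gsp (below n)"
 and gh: "g : carrier_mat n n" "h : carrier_mat n n" "inverts_mat g h" "inverts_mat h g"
 shows "lV n (%i j. g $$ (i, j)) f = rV n (%i j. g $$ (i, j)) f"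
proof -
 let ?G = "%i j. g $$ (i, j)"
 have "conj_act n g h f = f" using f(1) gh by (auto simp: GL_invariants_def)
 then have "rV n ?G f = rV n ?G (conj_act n g h f)" by simp
 also have "... = lV n ?G f"
 proof (rule ghom_eq_on_idxs[OF ghom_comp[OF ghom_rV ghom_ca] ghom_lV f(2)])
 fix a assume a: "rw a : {..<n}" "cl a : {..<n}"
 have "rV n ?G (conj_act n g h (gl a)) =
 (\<Sum>k<n. \<Sum>l<n. cs (g $$ (rw a, k) * h $$ (l, cl a)) * (\<Sum>r<n. cs (g $$ (r, l)) * gl (mk (kd a) k r)))"
 unfolding conj_act_gl cj_def by (simp add: glin_sum[OF glin_rV] glin_cs[OF glin_rV] rV_gl)
 also have "... = (\<Sum>k<n. \<Sum>r<n. \<Sum>l<n. cs (g $$ (rw a, k) * (g $$ (r, l) * h $$ (l, cl a))) * gl (mk (kd a) k r))"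
 proof (rule sum.cong[OF refl])
 fix k
 show "(\<Sum>l<n. cs (g $$ (rw a, k) * h $$ (l, cl a)) * (\<Sum>r<n. cs (g $$ (r, l)) * gl (mk (kd a) k r))) =
 (\<Sum>r<n. \<Sum>l<n. cs (g $$ (rw a, k) * (g $$ (r, l) * h $$ (l, cl a))) * gl (mk (kd a) k r))"
 unfolding sum_distrib_left mult.assoc[symmetric] cs_mult[symmetric] by (subst sum.swap) (simp add: mult_ac)
 qed
 also have "... = (\<Sum>k<n. \<Sum>r<n. cs (g $$ (rw a, k) * (if r = cl a then 1 else 0)) * gl (mk (kd a) k r))"
 proof (intro sum.cong refl)
 fix k r assume "r : {..<n}"
 then show "(\<Sum>l<n. cs (g $$ (rw a, k) * (g $$ (r, l) * h $$ (l, cl a))) * gl (mk (kd a) k r)) =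
 cs (g $$ (rw a, k) * (if r = cl a then 1 else 0)) * gl (mk (kd a) k r)" using inverts_mat_sum[OF gh(1-3), of r "cl a"] a
 by (simp only: sum_distrib_right[symmetric] cs_sum[symmetric] sum_distrib_left[symmetric] lessThan_iff)
 qed
 also have "... = (\<Sum>k<n. \<Sum>r<n. if r = cl a then cs (g $$ (rw a, k)) * gl (mk (kd a) k r) else 0)"
 by (intro sum.cong refl) simp
 also have "... = lV n ?G (gl a)" using a by (simp add: lV_gl sum.delta)
 finally show "rV n ?G (conj_act n g h (gl a)) = lV n ?G (gl a)" .
 qed
 finally show ?thesis ..
qed

text \<open>Polynomial dependence on a scalar, witnessed by a list of exponents and coefficients, so
  that a sum of families is a concatenation of lists.\<close>

definition polyfam :: "('k => ('v, 'o::linorder, 'k::field_char_0) gca) => bool" where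
 "polyfam \<phi> \<longleftrightarrow> (\<exists>L :: (nat \<times> ('v, 'o, 'k) gca) list. ALL t. \<phi> t = (\<Sum>(j, F)\<leftarrow>L. cs (t ^ j) * F))"

lemma polyfam_const: "polyfam (%_. F)" unfolding polyfam_def by (rule exI[of _ "[(0, F)]"]) simp

lemma polyfam_cs: "polyfam (%t. cs t)" unfolding polyfam_def by (rule exI[of _ "[(1, 1)]"]) simp

lemma polyfam_add: "polyfam \<phi> ==> polyfam \<psi> ==> polyfam (%t. \<phi> t + \<psi> t)" unfolding polyfam_def
proof (elim exE)
 fix L L' assume "ALL t. \<phi> t = (\<Sum>(j, F)\<leftarrow>L. cs (t ^ j) * F)" "ALL t. \<psi> t = (\<Sum>(j, F)\<leftarrow>L'. cs (t ^ j) * F)"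
 then show "EX L. ALL t. \<phi> t + \<psi> t = (\<Sum>(j, F)\<leftarrow>L. cs (t ^ j) * F)"
 by (intro exI[of _ "L @ L'"]) simp
qed

lemma polyfam_sum: "(!!a. a : A ==> polyfam (\<phi> a)) ==> polyfam (%t. \<Sum>a\<in>A. \<phi> a t)"
 by (induction A rule: infinite_finite_induct) (auto intro: polyfam_add polyfam_const)

lemma polyfam_mult: "polyfam \<phi> ==> polyfam \<psi> ==> polyfam (%t. \<phi> t * \<psi> t)"
proof -
 assume "polyfam \<phi>" and \<psi>: "polyfam \<psi>"
 then obtain L where L: "!!t. \<phi> t = (\<Sum>(j, F)\<leftarrow>L. cs (t ^ j) * F)" unfolding polyfam_def by blast
 from \<psi> obtain L' where L': "!!t. \<psi> t = (\<Sum>(j, F)\<leftarrow>L'. cs (t ^ j) * F)" unfolding polyfam_def by blast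
 have 1: "cs (t ^ j) * F * (\<Sum>(i, G)\<leftarrow>L'. cs (t ^ i) * G) = (\<Sum>(i, G)\<leftarrow>map (%(i, G). (j + i, F * G)) L'. cs (t ^ i) * G)"
 for t j F
 proof (induction L')
 case (Cons x L')
 obtain i G where x: "x = (i, G)" by (cases x)
 have "cs (t ^ j) * F * (cs (t ^ i) * G) = cs (t ^ (j + i)) * (F * G)"
 by (simp add: power_add cs_mult mult.assoc poly_left_comm[of F])
 then show ?case using Cons by (simp add: x distrib_left)
 qed simp
 have "polyfam (%t. (\<Sum>(j, F)\<leftarrow>L. cs (t ^ j) * F) * (\<Sum>(i, G)\<leftarrow>L'. cs (t ^ i) * G))"
 proof (induction L)
 case Nil
 show ?case using polyfam_const[of 0] by simp
 next
 case (Cons x L)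
 obtain j F where x: "x = (j, F)" by (cases x)
 have "polyfam (%t. cs (t ^ j) * F * (\<Sum>(i, G)\<leftarrow>L'. cs (t ^ i) * G))" unfolding polyfam_def 1 by blast
 from polyfam_add[OF this Cons] show ?case by (simp add: x distrib_right)
 qed
 then show ?thesis by (simp add: L L')
qed

lemma polyfam_scale: "polyfam \<phi> ==> polyfam (%t. cs c * \<phi> t)" by (rule polyfam_mult[OF polyfam_const])

lemma polyfam_prod_list: "(!!a. a : set w ==> polyfam (\<phi> a)) ==> polyfam (%t. prod_list (map (%a. \<phi> a t) w))"
 by (induction w) (auto intro: polyfam_const polyfam_mult)

lemma polyfam_coeff:
 assumes "polyfam \<phi>"
 shows "EX P. ALL t. Poly_Mapping.lookup (coeff_gca (\<phi> t) S) m = poly P t"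
proof -
 from assms obtain L where L: "!!t. \<phi> t = (\<Sum>(j, F)\<leftarrow>L. cs (t ^ j) * F)" unfolding polyfam_def by blast
 have "EX P. ALL t. Poly_Mapping.lookup (coeff_gca (\<Sum>(j, F)\<leftarrow>L. cs (t ^ j) * F) S) m = poly P t"
 proof (induction L)
 case Nil
 show ?case by (intro exI[of _ 0]) simp
 next
 case (Cons x L)
 obtain j F where x: "x = (j, F)" by (cases x)
 from Cons obtain P where "ALL t. Poly_Mapping.lookup (coeff_gca (\<Sum>(j, F)\<leftarrow>L. cs (t ^ j) * F) S) m = poly P t" by blast
 then show ?case by (intro exI[of _ "P + monom (Poly_Mapping.lookup (coeff_gca F S) m) j"])
 (simp add: x lookup_add poly_monom)
 qed
 then show ?thesis by (simp add: L)
qed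

text \<open>Each coefficient of the difference is a polynomial in t with infinitely many
  zeros.\<close>

lemma polyfam_eq:
 fixes \<phi> \<psi> :: "'k::field_char_0 => ('v, 'o::linorder, 'k) gca"
 assumes "polyfam \<phi>" "polyfam \<psi>" "infinite T" "!!t. t : T ==> \<phi> t = \<psi> t"
 shows "\<phi> t = \<psi> t"
proof (rule gca_eqI, rule poly_mapping_eqI)
 fix S m
 obtain P where P: "!!t. Poly_Mapping.lookup (coeff_gca (\<phi> t) S) m = poly P t" using polyfam_coeff[OF assms(1)] by blast
 obtain Q where Q: "!!t. Poly_Mapping.lookup (coeff_gca (\<psi> t) S) m = poly Q t" using polyfam_coeff[OF assms(2)] by blast
 have "T \<subseteq> {t. poly (P - Q) t = 0}"
 proof
 fix t assume "t : T"
 then have "poly P t = poly Q t" using assms(4)[of t] P[of t] Q[of t] by simp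
 then show "t : {t. poly (P - Q) t = 0}" by simp
 qed
 then have "P - Q = 0" using poly_roots_finite[of "P - Q"] assms(3) finite_subset by blast
 then show "Poly_Mapping.lookup (coeff_gca (\<phi> t) S) m = Poly_Mapping.lookup (coeff_gca (\<psi> t) S) m"
 by (simp add: P Q)
qed

lemma lV_polyfam:
 assumes "!!p q. EX a b. ALL t. V t p q = a + t * b"
 shows "polyfam (%t. lV n (V t) f)" "polyfam (%t. rV n (V t) f)"
proof -
 have 1: "polyfam (%t. cs (V t p q) * F)" for p q F
 proof -
 obtain a b where "!!t. V t p q = a + t * b" using assms by blast
 then show ?thesis by (simp add: cs_add cs_mult) (intro polyfam_mult polyfam_add polyfam_const polyfam_cs)
 qed
 show "polyfam (%t. lV n (V t) f)" by (induction f rule: gca_induct)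
 (auto simp: glin_add[OF glin_lV] glin_cs[OF glin_lV] lV_gw intro!: polyfam_add polyfam_scale polyfam_prod_list polyfam_sum 1)
 show "polyfam (%t. rV n (V t) f)" by (induction f rule: gca_induct)
 (auto simp: glin_add[OF glin_rV] glin_cs[OF glin_rV] rV_gw intro!: polyfam_add polyfam_scale polyfam_prod_list polyfam_sum 1)
qed

text \<open>The determinant of t + A is the characteristic polynomial of -A at t, which is monic and
  so has finitely many zeros.\<close>

lemma finite_singular_shift:
 fixes A :: "'k::field_char_0 mat"
 assumes A: "A : carrier_mat n n"
 shows "finite {t. det (t \<cdot>\<^sub>m 1\<^sub>m n + A) = 0}"
proof -
 have "t \<cdot>\<^sub>m 1\<^sub>m n + A = - char_matrix (- A) t" for t
 using A by (intro eq_matI) (auto simp: char_matrix_def)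
 then have "det (t \<cdot>\<^sub>m 1\<^sub>m n + A) = poly (char_poly (- A)) t" for t
 using char_poly_matrix[of "- A" n t] A by simp
 moreover have "char_poly (- A) ~= 0" using degree_monic_char_poly[of "- A" n] A by auto
 ultimately show ?thesis using poly_roots_finite by simp
qed

text \<open>With t + V in place of V both sides depend polynomially on t, and they agree whenever
  that matrix is invertible, that is for all but finitely many t. Putting t = 0 covers singular V as
  well.\<close>

lemma GL_balanced:
 assumes f: "f : GL_invariants n" "f : gsp (below n)"
 shows "lV n V f = rV n V (f :: 'k::field_char_0 mat_gca)"
proof -
 define A where "A = mat n n (%(i, j). V i j)"
 have A: "A : carrier_mat n n" by (simp add: A_def)
 \<comment> \<open>Entries outside the n by n block are 0 so that every entry is affine in t, also
   out there; by \<open>cl\<close> the values outside do not affect f.\<close>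
 define W where "W t i j = (if i < n & j < n then (t \<cdot>\<^sub>m 1\<^sub>m n + A) $$ (i, j) else 0)" for t i j
 have W: "W t i j = (if i < n & j < n then (if i = j then t else 0) + V i j else 0)" for t i j by (simp add: W_def A_def)
 have lin: "EX a b. ALL t. W t p q = a + t * b" for p q unfolding W by (rule exI[of _ "if p < n & q < n then V p q else 0"],
 rule exI[of _ "if p < n & q < n & p = q then 1 else 0"]) auto
 have cl: "lV n V' f = lV n V'' f" "rV n V' f = rV n V'' f" if "!!i j. i < n ==> j < n ==> V' i j = V'' i j" for V' V''
 by (rule ghom_eq_on_idxs[OF ghom_lV ghom_lV f(2)], simp add: lV_gl that)
 (rule ghom_eq_on_idxs[OF ghom_rV ghom_rV f(2)], simp add: rV_gl that)
 let ?T = "{t. det (t \<cdot>\<^sub>m 1\<^sub>m n + A) ~= 0}"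
 have "infinite ?T"
 proof
 assume "finite ?T"
 then have "finite (?T \<union> {t. det (t \<cdot>\<^sub>m 1\<^sub>m n + A) = 0})" using finite_singular_shift[OF A] by blast
 moreover have "?T \<union> {t. det (t \<cdot>\<^sub>m 1\<^sub>m n + A) = 0} = UNIV" by auto
 ultimately show False using infinite_UNIV_char_0[where 'a='k] by simp
 qed
 moreover have "lV n (W t) f = rV n (W t) f" if t: "t : ?T" for t
 proof -
 let ?g = "t \<cdot>\<^sub>m 1\<^sub>m n + A"
 have g: "?g : carrier_mat n n" using A by simp
 from det_non_zero_imp_unit[OF g, of "()"] t have "?g : Units (ring_mat TYPE('k) n ())" by simp
 then obtain h where "h : carrier_mat n n" "h * ?g = 1\<^sub>m n" "?g * h = 1\<^sub>m n"
 by (auto simp: Units_def ring_mat_def)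
 then have "lV n (%i j. ?g $$ (i, j)) f = rV n (%i j. ?g $$ (i, j)) f"
 using g by (intro lV_eq_rV_invertible[OF f g]) (auto simp: inverts_mat_def)
 then show ?thesis using cl[of "W t" "%i j. ?g $$ (i, j)"] by (simp add: W_def)
 qed
 ultimately have "lV n (W 0) f = rV n (W 0) f"
 by (intro polyfam_eq[where t = 0 and T = ?T and \<phi> = "%t. lV n (W t) f" and \<psi> = "%t. rV n (W t) f"]
 lV_polyfam[OF lin])
 then show ?thesis using cl[of "W 0" V] by (simp add: W)
qed

section \<open>The first fundamental theorem in the stable range\<close>

abbreviation rws :: "letter multiset => nat multiset" where "rws M \<equiv> image_mset rw M"
abbreviation cls :: "letter multiset => nat multiset" where "cls M \<equiv> image_mset cl M"

lemma gsp_conj: "f : gsp Q ==> f : gsp R ==> f : gsp (%M. Q M & R M)"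
 unfolding gsp_def mem_Collect_eq gfilter_gfilter[symmetric] by simp

lemma gsp_ball:
 assumes "finite A" "!!a. a : A ==> f : gsp (Q a)" "f : gsp R"
 shows "f : gsp (%M. R M & (\<forall>a\<in>A. Q a M))" using assms(1,2)
proof (induction A rule: finite_induct)
 case (insert a A)
 then have "f : gsp (Q a)" "f : gsp (%M. R M & (\<forall>a\<in>A. Q a M))" by simp_all
 then have "f : gsp (%M. Q a M & (R M & (\<forall>a\<in>A. Q a M)))" by (rule gsp_conj)
 then show ?case by (rule gsp_mono) auto
qed (use assms(3) in simp)

lemma gfilter_gsp: "f : gsp R ==> gfilter Q f : gsp (%M. Q M & R M)"
proof (rule glin_maps_gsp[OF glin_gf])
 fix w assume "R (mset w)"
 then show "gfilter Q (gw w) : gsp (%M. Q M & R M)" by (cases "Q (mset w)") (simp_all add: gfilter_gw gsp_gw)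
qed

text \<open>Doubling row a from the left and doubling column a from the right have the same effect
  on f, so in each monomial a occurs as a row as often as it occurs as a column.\<close>

lemma GL_torus_balanced:
 assumes f: "f : GL_invariants n" "f : gsp (%M. below n M & size M = m)" and a: "a < n"
 shows "f : gsp (%M. count (rws M) a = count (cls M) a)"
proof -
 have fb: "f : gsp (below n)" by (rule gsp_mono[OF f(2)]) auto
 define V :: "nat => nat => 'a" where "V p r = (if p = r then if p = a then 2 else 1 else 0)" for p r
 let ?h = "%M. (count (rws M) a, count (cls M) a)"
 have lr: "lV n V f = rV n V f" by (rule GL_balanced[OF f(1) fb])
 have L: "lV n V (gw w) = cs (2 ^ count (rws (mset w)) a) * gw w" if "below n (mset w)" for w using that
 proof (induction w)
 case (Cons b w)
 have "lV n V (gl b) = (\<Sum>r<n. if r = rw b then cs (V (rw b) (rw b)) * gl b else 0)"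
 unfolding lV_gl by (rule sum.cong[OF refl]) (auto simp: V_def)
 then have "lV n V (gl b) = cs (V (rw b) (rw b)) * gl b" using Cons.prems by (simp add: sum.delta)
 then have "lV n V (gw (b # w)) = cs (V (rw b) (rw b)) * gl b * (cs (2 ^ count (rws (mset w)) a) * gw w)"
 using Cons by (simp add: ghom_mult[OF ghom_lV])
 also have "... = cs (V (rw b) (rw b) * 2 ^ count (rws (mset w)) a) * gw (b # w)"
 by (simp add: cs_mult mult.assoc poly_left_comm[of "gl b"])
 also have "V (rw b) (rw b) * 2 ^ count (rws (mset w)) a = 2 ^ count (rws (mset (b # w))) a" by (simp add: V_def)
 finally show ?case .
 qed (simp add: ghom_1[OF ghom_lV])
 have R: "rV n V (gw w) = cs (2 ^ count (cls (mset w)) a) * gw w" if "below n (mset w)" for w using that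
 proof (induction w)
 case (Cons b w)
 have "rV n V (gl b) = (\<Sum>r<n. if r = cl b then cs (V (cl b) (cl b)) * gl b else 0)"
 unfolding rV_gl by (rule sum.cong[OF refl]) (auto simp: V_def)
 then have "rV n V (gl b) = cs (V (cl b) (cl b)) * gl b" using Cons.prems by (simp add: sum.delta)
 then have "rV n V (gw (b # w)) = cs (V (cl b) (cl b)) * gl b * (cs (2 ^ count (cls (mset w)) a) * gw w)"
 using Cons by (simp add: ghom_mult[OF ghom_rV])
 also have "... = cs (V (cl b) (cl b) * 2 ^ count (cls (mset w)) a) * gw (b # w)"
 by (simp add: cs_mult mult.assoc poly_left_comm[of "gl b"])
 also have "V (cl b) (cl b) * 2 ^ count (cls (mset w)) a = 2 ^ count (cls (mset (b # w))) a" by (simp add: V_def)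
 finally show ?case .
 qed (simp add: ghom_1[OF ghom_rV])
 have z: "gfilter (%M. ?h M = (j, l)) f = 0" if "j ~= l" for j l
 proof -
 let ?F = "gfilter (%M. ?h M = (j, l)) f"
 have "gfilter (%M. ?h M = (j, l)) (lV n V f) = cs (2 ^ j) * ?F"
 by (rule glin_on_gsp[OF glin_comp[OF glin_gf glin_lV] glin_scale[OF glin_gf] fb])
 (simp add: L gfilter_cs gfilter_gw)
 moreover have "gfilter (%M. ?h M = (j, l)) (rV n V f) = cs (2 ^ l) * ?F"
 by (rule glin_on_gsp[OF glin_comp[OF glin_gf glin_rV] glin_scale[OF glin_gf] fb])
 (simp add: R gfilter_cs gfilter_gw)
 ultimately have "cs (2 ^ j) * ?F = cs (2 ^ l) * ?F" using lr by simp
 then have "cs (2 ^ j - 2 ^ l) * ?F = cs (2 ^ j - 2 ^ l) * 0"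
 proof -
 have "cs (2 ^ j - 2 ^ l :: 'a) = (cs (2 ^ j) - cs (2 ^ l) :: 'a mat_gca)"
 by (simp only: diff_conv_add_uminus cs_add cs_uminus)
 then show ?thesis using \<open>cs (2 ^ j) * ?F = cs (2 ^ l) * ?F\<close>
 by (simp only: left_diff_distrib diff_self mult_zero_right)
 qed
 \<comment> \<open>Different powers of 2 are different scalars because the characteristic is 0, so
   the powers separate the multiplicities.\<close>
 moreover have "(2 :: 'a) ^ j - 2 ^ l ~= 0"
 proof
 assume "(2 :: 'a) ^ j - 2 ^ l = 0"
 then have "of_nat (2 ^ j) = (of_nat (2 ^ l) :: 'a)" by simp
 then have "(2::nat) ^ j = 2 ^ l" by (simp only: of_nat_eq_iff)
 then show False using that by simp
 qed
 ultimately show ?thesis by (rule cs_cancel)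
 qed
 have "f : gsp (%M. ?h M : {..m} \<times> {..m})"
 by (rule gsp_mono[OF f(2)]) (metis (no_types, lifting) SigmaI atMost_iff count_le_size size_image_mset)
 then have "f = (\<Sum>jl\<in>{..m} \<times> {..m}. gfilter (%M. ?h M = jl) f)" by (rule gfilter_partition) simp
 also have "... : gsp (%M. count (rws M) a = count (cls M) a)"
 proof (rule gsp_sum)
 fix jl :: "nat \<times> nat"
 obtain j l where jl: "jl = (j, l)" by (cases jl)
 show "gfilter (%M. ?h M = jl) f : gsp (%M. count (rws M) a = count (cls M) a)"
 proof (cases "j = l")
 case True
 show ?thesis by (rule gsp_mono[OF gfilter_in_gsp]) (use True jl in auto)
 next
 case False
 then show ?thesis using z jl by simp
 qed
 qed
 finally show ?thesis .
qed

section \<open>The multilinear part and polarisation\<close>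

definition dist :: "nat set => letter multiset => bool" where
 "dist P M \<longleftrightarrow> rws M = mset_set P & cls M = mset_set P"

lemma dist_idxs: "dist P M ==> finite P ==> idxs M = P"
 unfolding dist_def idxs_def by (metis finite_set_mset_mset_set set_image_mset sup.idem)

text \<open>Only the rows are prescribed; for an invariant the columns follow from
  \<open>GL_torus_balanced\<close>, as \<open>dist_part_dist\<close> shows.\<close>

definition dist_part :: "nat => 'k::field_char_0 mat_gca => 'k mat_gca" where
 "dist_part m = gfilter (%M. rws M = mset_set {..<m})"

lemma dist_part_dist:
 assumes f: "f : GL_invariants n" "f : gsp (%M. below n M & size M = m)" and "m <= n"
 shows "dist_part m f : gsp (dist {..<m})"
proof -
 have "f : gsp (%M. (below n M & size M = m) & (\<forall>a\<in>{..<n}. count (rws M) a = count (cls M) a))"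
 by (rule gsp_ball[OF _ _ f(2)]) (auto intro: GL_torus_balanced[OF f])
 then have "dist_part m f : gsp (%M. rws M = mset_set {..<m} &
 ((below n M & size M = m) & (\<forall>a\<in>{..<n}. count (rws M) a = count (cls M) a)))"
 unfolding dist_part_def by (rule gfilter_gsp)
 then show ?thesis
 proof (rule gsp_mono)
 fix M assume M: "rws M = mset_set {..<m} &
 ((below n M & size M = m) & (\<forall>a\<in>{..<n}. count (rws M) a = count (cls M) a))"
 have "cls M = rws M"
 proof (rule multiset_eqI)
 fix a
 show "count (cls M) a = count (rws M) a"
 proof (cases "a < n")
 case False
 then have "a ~: idxs M" using M by auto
 then have "a \<notin># cls M" "a \<notin># rws M" by (auto simp: idxs_def)
 then show ?thesis by (simp only: not_in_iff)
 next
 case True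
 have "\<forall>a\<in>{..<n}. count (rws M) a = count (cls M) a" using M by blast
 then show ?thesis using True by (metis lessThan_iff)
 qed
 qed
 then show "dist {..<m} M" using M by (simp add: dist_def)
 qed
qed

text \<open>The matrix of the index map \<open>i\<close>, padded by zero columns. On the left it
  lets a letter in row p move to any row of the fibre of \<open>i\<close> over p; on the right it
  sends column r to column \<open>i r\<close> and kills the columns from m on.\<close>

definition sel :: "(nat => nat) => nat => nat => nat => 'k::field_char_0" where
 "sel i m p r = (if r < m & i r = p then 1 else 0)"

abbreviation sr :: "letter => nat => letter" where "sr a r \<equiv> mk (kd a) r (cl a)"
abbreviation rr :: "(nat => nat) => letter => letter" where "rr i a \<equiv> mk (kd a) (i (rw a)) (cl a)"
abbreviation rc :: "(nat => nat) => letter => letter" where "rc i a \<equiv> mk (kd a) (rw a) (i (cl a))"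

lemma ghom_rr: "ghom (lmap (rr i) :: 'k::field_char_0 mat_gca => 'k mat_gca)"
 and lmap_rr_gw: "lmap (rr i) (gw w) = (gw (map (rr i) w) :: 'k::field_char_0 mat_gca)"
 by (rule ghom_lmap, simp add: isl_kd) (rule lmap_gw, simp add: isl_kd)

lemma sel_word:
 assumes "m <= n"
 shows "lV n (sel i m) (gw w) =
 (\<Sum>rs\<in>{rs. length rs = length w & set rs \<subseteq> {..<m}}.
 if map i rs = map rw w then gw (map2 sr w rs) else (0 :: 'k::field_char_0 mat_gca))"
proof -
 let ?F = "%a r. if i r = rw a then gl (sr a r) else (0 :: 'k mat_gca)"
 have "(\<Sum>r<n. cs (sel i m (rw a) r) * gl (sr a r)) = (\<Sum>r<m. ?F a r)" for a
 proof -
 have "(\<Sum>r<m. ?F a r) = (\<Sum>r<n. cs (sel i m (rw a) r) * gl (sr a r))"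
 by (rule sum.mono_neutral_cong_left) (use assms in \<open>auto simp: sel_def\<close>)
 then show ?thesis ..
 qed
 then have "lV n (sel i m) (gw w) = prod_list (map (%a. \<Sum>r<m. ?F a r) w)" unfolding lV_gw by simp
 also have "... = (\<Sum>rs\<in>{rs. length rs = length w & set rs \<subseteq> {..<m}}. prod_list (map2 ?F w rs))"
 by (rule prod_list_sum_lists) simp
 also have "... = (\<Sum>rs\<in>{rs. length rs = length w & set rs \<subseteq> {..<m}}.
 if map i rs = map rw w then gw (map2 sr w rs) else 0)"
 proof (rule sum.cong[OF refl])
 fix rs assume "rs : {rs. length rs = length w & set rs \<subseteq> {..<m}}"
 then have "length w = length rs" by simp
 then show "prod_list (map2 ?F w rs) = (if map i rs = map rw w then gw (map2 sr w rs) else 0)"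
 by (induction w rs rule: list_induct2) auto
 qed
 finally show ?thesis .
qed

text \<open>An arrangement of \<open>{..<m}\<close> meets every argument exactly once, so the values
  along it determine the map.\<close>

lemma ex1_section:
 assumes rs: "mset rs = mset_set {..<m}" and ys: "length ys = m" "set ys \<subseteq> {..<n}"
 shows "\<exists>!i. i : {..<m} \<rightarrow>\<^sub>E {..<n} & map i rs = ys"
proof -
 have d: "distinct rs" "set rs = {..<m}" "length rs = m"
 using rs by (metis count_mset_set(3) distinct_count_atmost_1 finite_lessThan count_mset_set(1) mset_set_set set_mset_mset finite_set_mset_mset_set)
 (metis rs finite_lessThan finite_set_mset_mset_set set_mset_mset, metis rs card_lessThan size_mset size_mset_set)
 define i where "i = restrict (%r. the (map_of (zip rs ys) r)) {..<m}"
 have i: "i (rs ! k) = ys ! k" if "k < m" for k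
 using that d ys map_of_zip_nth[of rs ys k] nth_mem[of k rs] by (simp add: i_def)
 have "map i rs = ys" using d ys i by (intro nth_equalityI) auto
 moreover have "i : {..<m} \<rightarrow>\<^sub>E {..<n}"
 proof
 fix r assume "r : {..<m}"
 then obtain k where "k < m" "rs ! k = r" using d by (metis in_set_conv_nth)
 moreover have "ys ! k : {..<n}" using \<open>k < m\<close> ys nth_mem[of k ys] by blast
 ultimately show "i r : {..<n}" using i[of k] by simp
 qed (auto simp: i_def)
 moreover have "j = i" if "j : {..<m} \<rightarrow>\<^sub>E {..<n}" "map j rs = ys" for j
 proof
 fix r show "j r = i r"
 proof (cases "r < m")
 case True
 then have "r : set rs" using d by simp
 then show ?thesis using that(2) \<open>map i rs = ys\<close> by (metis map_eq_conv)
 qed (use that(1) in \<open>auto simp: i_def PiE_def extensional_def\<close>)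
 qed
 ultimately show ?thesis by blast
qed

text \<open>The arrangements of \<open>{..<m}\<close>. Polarisation reproduces a word once for each
  of them, so their number is the constant to divide by.\<close>

definition arr :: "nat => nat list set" where
 "arr m = {rs. mset rs = mset_set {..<m}}"

lemma finite_arr: "finite (arr m)" and arr_nonempty: "arr m ~= {}"
proof -
 have "set rs \<subseteq> {..<m} & length rs = m" if "rs : arr m" for rs
 using that unfolding arr_def by (metis (mono_tags, lifting) mem_Collect_eq card_lessThan finite_lessThan finite_set_mset_mset_set order_refl set_mset_mset size_mset size_mset_set)
 then have "arr m \<subseteq> {rs. set rs \<subseteq> {..<m} & length rs = m}" by blast
 then show "finite (arr m)" using finite_lists_length_eq[of "{..<m}" m] finite_subset by blast
 have "[0..<m] : arr m" by (simp add: arr_def atLeast0LessThan)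
 then show "arr m ~= {}" by blast
qed

text \<open>The left factor spreads the rows of \<open>w\<close> in all ways compatible with
  \<open>i\<close>, the filter keeps those whose new rows form an arrangement of
  \<open>{..<m}\<close>, and \<open>rr i\<close> restores the old rows. Exactly one \<open>i\<close>
  is compatible with a given arrangement, so each arrangement contributes one copy of
  \<open>w\<close>.\<close>

lemma polarization:
 assumes w: "length w = m" "below n (mset w)" and "m <= n"
 shows "(\<Sum>i\<in>{..<m} \<rightarrow>\<^sub>E {..<n}. lmap (rr i) (gfilter (%M. rws M = mset_set {..<m}) (lV n (sel i m) (gw w)))) =
 (of_nat (card (arr m)) * gw w :: 'k::field_char_0 mat_gca)"
proof -
 let ?L = "{rs. length rs = length w & set rs \<subseteq> {..<m}}"
 let ?Q = "%M. rws M = mset_set {..<m}"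
 have fL: "finite ?L" using finite_lists_length_eq[of "{..<m}" "length w"] by (simp add: conj_commute)
 have arrL: "arr m \<subseteq> ?L"
 unfolding arr_def using w by (auto; metis card_lessThan finite_lessThan finite_set_mset_mset_set lessThan_iff set_mset_mset size_mset size_mset_set)
 have 1: "lmap (rr i) (gfilter ?Q (lV n (sel i m) (gw w))) =
 (\<Sum>rs\<in>arr m. if map i rs = map rw w then gw w else (0 :: 'k mat_gca))" for i
 proof -
 have g: "lmap (rr i) (gfilter ?Q (if map i rs = map rw w then gw (map2 sr w rs) else 0)) =
 (if map i rs = map rw w & rs : arr m then gw w else (0 :: 'k mat_gca))" if "length rs = length w" for rs
 proof -
 have r: "rws (mset (map2 sr w rs)) = mset rs" using that[symmetric] by (induction w rs rule: list_induct2) auto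
 have "map (rr i) (map2 sr w rs) = w" if "map i rs = map rw w"
 using \<open>length rs = length w\<close>[symmetric] that by (induction w rs rule: list_induct2) auto
 then show ?thesis
 using r by (auto simp: gfilter_gw arr_def lmap_rr_gw glin_0[OF ghom_glin[OF ghom_rr]] glin_0[OF glin_gf] simp del: mset_map)
 qed
 have "lmap (rr i) (gfilter ?Q (lV n (sel i m) (gw w))) =
 (\<Sum>rs\<in>?L. if map i rs = map rw w & rs : arr m then gw w else (0 :: 'k mat_gca))"
 unfolding sel_word[OF assms(3)] gfilter_sum glin_sum[OF ghom_glin[OF ghom_rr]] by (rule sum.cong[OF refl], rule g) simp
 also have "... = (\<Sum>rs\<in>arr m. if map i rs = map rw w then gw w else 0)"
 by (rule sum.mono_neutral_cong_right[OF fL arrL]) auto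
 finally show ?thesis .
 qed
 have 2: "(\<Sum>i\<in>{..<m} \<rightarrow>\<^sub>E {..<n}. if map i rs = map rw w then gw w else (0 :: 'k mat_gca)) = gw w"
 if "rs : arr m" for rs
 proof -
 have "set (map rw w) \<subseteq> {..<n}" using w by (auto simp: idxs_def)
 then have "\<exists>!i. i : {..<m} \<rightarrow>\<^sub>E {..<n} & map i rs = map rw w"
 using that w by (intro ex1_section) (auto simp: arr_def)
 then obtain i where i: "i : {..<m} \<rightarrow>\<^sub>E {..<n}" "map i rs = map rw w"
 "!!j. j : {..<m} \<rightarrow>\<^sub>E {..<n} ==> map j rs = map rw w ==> j = i" by metis
 have "(\<Sum>j\<in>{..<m} \<rightarrow>\<^sub>E {..<n}. if map j rs = map rw w then gw w else (0 :: 'k mat_gca)) =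
 (\<Sum>j\<in>{..<m} \<rightarrow>\<^sub>E {..<n}. if j = i then gw w else 0)"
 proof (rule sum.cong[OF refl])
 fix j assume j: "j : {..<m} \<rightarrow>\<^sub>E {..<n}"
 have "map j rs = map rw w \<longleftrightarrow> j = i" using i(2) i(3)[OF j] by (rule_tac iffI) (assumption, simp only:)
 then show "(if map j rs = map rw w then gw w else (0 :: 'k mat_gca)) = (if j = i then gw w else 0)" by simp
 qed
 then show ?thesis using i(1) by (simp add: sum.delta)
 qed
 have "(\<Sum>i\<in>{..<m} \<rightarrow>\<^sub>E {..<n}. \<Sum>rs\<in>arr m. if map i rs = map rw w then gw w else (0 :: 'k mat_gca)) =
 (\<Sum>rs\<in>arr m. gw w)" by (subst sum.swap, rule sum.cong[OF refl]) (rule 2)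
 then show ?thesis unfolding 1 by simp
qed

lemma sel_right_word:
 assumes "m <= n" "i : {..<m} \<rightarrow>\<^sub>E {..<n}"
 shows "rV n (sel i m) (gw w) = (if cl ` set w \<subseteq> {..<m} then gw (map (rc i) w) else (0 :: 'k::field_char_0 mat_gca))"
proof (induction w)
 case (Cons a w)
 have "rV n (sel i m) (gl a) = (if cl a < m then gl (rc i a) else (0 :: 'k mat_gca))"
 proof (cases "cl a < m")
 case True
 then have "i (cl a) < n" using assms(2) by auto
 then have "(\<Sum>r<n. cs (sel i m r (cl a)) * gl (mk (kd a) (rw a) r)) =
 (\<Sum>r<n. if r = i (cl a) then gl (rc i a) else (0 :: 'k mat_gca))"
 using True by (intro sum.cong refl) (auto simp: sel_def)
 then show ?thesis using True \<open>i (cl a) < n\<close> by (simp add: rV_gl sum.delta)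
 qed (simp add: rV_gl sel_def)
 then show ?case using Cons by (simp add: ghom_mult[OF ghom_rV])
qed (simp add: ghom_1[OF ghom_rV])

text \<open>By \<open>GL_balanced\<close> the left multiplication in \<open>polarization\<close> may
  be exchanged for right multiplication, which commutes with the filter on rows. Then
  \<open>rr i\<close> renames the rows and the right factor the columns of the multilinear part by
  the same \<open>i\<close>. The bound on m provides m different rows.\<close>

theorem stable_fft:
 assumes f: "f : GL_invariants n" "f : gsp (%M. below n M & size M = m)" and mn: "m <= n"
 shows "f = rsum {..<m} n (cs (inverse (of_nat (card (arr m)))) * dist_part m (f :: 'k::field_char_0 mat_gca))"
proof -
 let ?Q = "%M. rws M = mset_set {..<m}"
 let ?c = "of_nat (card (arr m)) :: 'k"
 have c: "?c ~= 0" using finite_arr arr_nonempty by (simp add: card_eq_0_iff)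
 have fb: "f : gsp (below n)" by (rule gsp_mono[OF f(2)]) auto
 have 1: "lmap (rr i) (gfilter ?Q (lV n (sel i m) f)) = relabel i (dist_part m f)"
 if i: "i : {..<m} \<rightarrow>\<^sub>E {..<n}" for i
 proof -
 have "gfilter ?Q (lV n (sel i m) f) = gfilter ?Q (rV n (sel i m) f)" by (simp add: GL_balanced[OF f(1) fb])
 also have "... = rV n (sel i m) (gfilter ?Q f)"
 proof (rule glin_eqI[OF glin_comp[OF glin_gf glin_rV] glin_comp[OF glin_rV glin_gf]])
 fix w :: "letter list"
 have r: "rws (mset (map (rc i) w)) = rws (mset w)" by (induction w) auto
 show "gfilter ?Q (rV n (sel i m) (gw w)) = rV n (sel i m) (gfilter ?Q (gw w :: 'k mat_gca))"
 using r by (auto simp: sel_right_word[OF mn i] gfilter_gw glin_0[OF glin_rV] simp del: mset_map)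
 qed
 finally have "lmap (rr i) (gfilter ?Q (lV n (sel i m) f)) = lmap (rr i) (rV n (sel i m) (dist_part m f))"
 by (simp add: dist_part_def)
 also have "... = relabel i (dist_part m f)"
 proof (rule glin_on_gsp[OF glin_comp[OF ghom_glin[OF ghom_rr] glin_rV] glin_rlb dist_part_dist[OF f mn]])
 fix w assume w: "dist {..<m} (mset w)"
 have "cl ` set w = set_mset (cls (mset w))" by simp
 also have "... = {..<m}" using w by (simp only: dist_def finite_set_mset_mset_set finite_lessThan)
 finally have "cl ` set w \<subseteq> {..<m}" by simp
 moreover have "map (rr i) (map (rc i) w) = map (rl i) w" by (simp add: rl_def)
 ultimately show "lmap (rr i) (rV n (sel i m) (gw w)) = relabel i (gw w :: 'k mat_gca)"
 by (simp add: sel_right_word[OF mn i] lmap_rr_gw relabel_gw del: gw_simps map_map)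
 qed
 finally show ?thesis .
 qed
 have "(\<Sum>i\<in>{..<m} \<rightarrow>\<^sub>E {..<n}. lmap (rr i) (gfilter ?Q (lV n (sel i m) f))) = cs ?c * f"
 proof (rule glin_on_gsp[OF glin_SUM[OF glin_comp[OF ghom_glin[OF ghom_rr] glin_comp[OF glin_gf glin_lV]]] glin_scale[OF glin_id] f(2)])
 fix w assume w: "below n (mset w) & size (mset w) = m"
 show "(\<Sum>i\<in>{..<m} \<rightarrow>\<^sub>E {..<n}. lmap (rr i) (gfilter ?Q (lV n (sel i m) (gw w)))) = cs ?c * (gw w :: 'k mat_gca)"
 using polarization[of w m n] w mn by (simp add: cs_of_nat)
 qed
 then have "cs ?c * f = rsum {..<m} n (dist_part m f)" unfolding rsum_def using 1 by simp
 then have "cs (inverse ?c) * (cs ?c * f) = rsum {..<m} n (cs (inverse ?c) * dist_part m f)"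
 by (simp add: glin_cs[OF glin_rsum])
 then show ?thesis using cs_inverse[OF c, of f] by simp
qed

section \<open>Invariants from words with distinct indices\<close>

lemma prod_list_distinct_map:
 fixes h :: "nat => 'k::comm_ring_1"
 assumes "image_mset r (mset w) = mset_set P" "finite P"
 shows "prod_list (map (%a. h (r a)) w) = (\<Prod>p\<in>P. h p)"
proof -
 have "prod_list (map (%a. h (r a)) w) = prod_mset (image_mset h (image_mset r (mset w)))"
 by (simp flip: prod_mset_prod_list add: multiset.map_comp o_def)
 then show ?thesis using assms by (simp add: prod_unfold_prod_mset)
qed

lemma distinct_of_mset_set: "image_mset r (mset w) = mset_set P ==> finite P ==> distinct (map r w) & r ` set w = P"
 by (metis (no_types, lifting) distinct_count_atmost_1 finite_set_mset_mset_set count_mset_set(1) count_mset_set(3)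
 mset_map set_map set_mset_mset)

text \<open>Summing over the index map first, each index p contributes the entry
  \<open>(\<mu> p, \<kappa> p)\<close> of the product h g of the inverse pair, which forces the new
  row and column labels to agree. The argument is the same for every n; this is what makes
  surjectivity accessible below the stable range.\<close>

theorem rsum_GL_invariant:
 assumes G: "G : gsp (dist P)" and P: "finite P"
 shows "rsum P n G : GL_invariants n" unfolding GL_invariants_def
proof (rule CollectI, intro ballI impI)
 fix g h :: "'a mat" assume gh: "g : carrier_mat n n" "h : carrier_mat n n" "inverts_mat g h & inverts_mat h g"
 let ?E = "P \<rightarrow>\<^sub>E {..<n}"
 let ?g = "%i j. g $$ (i, j)" and ?h = "%i j. h $$ (i, j)"
 show "conj_act n g h (rsum P n G) = rsum P n G"
 proof (rule glin_on_gsp[OF glin_comp[OF glin_ca glin_rsum] glin_rsum G])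
 fix w assume "dist P (mset w)"
 then have w: "rws (mset w) = mset_set P" "cls (mset w) = mset_set P" by (auto simp: dist_def)
 note dr = distinct_of_mset_set[OF w(1) P] and dc = distinct_of_mset_set[OF w(2) P]
 have word: "conj_act n g h (gw (map (rl i) w)) = (\<Sum>\<kappa>\<in>?E. \<Sum>\<mu>\<in>?E.
 cs (\<Prod>p\<in>P. g $$ (i p, \<kappa> p) * h $$ (\<mu> p, i p)) * gw (map (%a. mk (kd a) (\<kappa> (rw a)) (\<mu> (cl a))) w))" for i
 proof -
 have "conj_act n g h (gw (map (rl i) w)) = prod_list (map (%a. \<Sum>k<n. \<Sum>l<n.
 cs (g $$ (i (rw a), k) * h $$ (l, i (cl a))) * gl (mk (kd a) k l)) w)"
 by (simp add: ghom_gw[OF ghom_ca] conj_act_gl cj_def o_def)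
 also have "... = (\<Sum>\<kappa>\<in>?E. \<Sum>\<mu>\<in>?E. prod_list (map (%a.
 cs (g $$ (i (rw a), \<kappa> (rw a)) * h $$ (\<mu> (cl a), i (cl a))) * gl (mk (kd a) (\<kappa> (rw a)) (\<mu> (cl a)))) w))"
 using prod_list_sum_PiE[of "{..<n}" rw w "%a k. \<Sum>l<n. cs (g $$ (i (rw a), k) * h $$ (l, i (cl a))) * (gl (mk (kd a) k l) :: 'a mat_gca)"]
 prod_list_sum_PiE[of "{..<n}" cl w "%a l. cs (g $$ (i (rw a), \<kappa> (rw a)) * h $$ (l, i (cl a))) * (gl (mk (kd a) (\<kappa> (rw a)) l) :: 'a mat_gca)" for \<kappa>]
 dr dc by simp
 also have "... = (\<Sum>\<kappa>\<in>?E. \<Sum>\<mu>\<in>?E.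
 cs (\<Prod>p\<in>P. g $$ (i p, \<kappa> p) * h $$ (\<mu> p, i p)) * gw (map (%a. mk (kd a) (\<kappa> (rw a)) (\<mu> (cl a))) w))"
 proof -
 have "prod_list (map (%a. u a * v a) w) = prod_list (map u w) * prod_list (map v w)" for u v :: "letter => 'a"
 by (induction w) (auto simp: algebra_simps)
 then have "prod_list (map (%a. g $$ (i (rw a), \<kappa> (rw a)) * h $$ (\<mu> (cl a), i (cl a))) w) =
 (\<Prod>p\<in>P. g $$ (i p, \<kappa> p) * h $$ (\<mu> p, i p))" for \<kappa> \<mu>
 using prod_list_distinct_map[OF w(1) P, of "%p. g $$ (i p, \<kappa> p)"]
 prod_list_distinct_map[OF w(2) P, of "%p. h $$ (\<mu> p, i p)"] by (simp add: prod.distrib)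
 then show ?thesis by (intro sum.cong refl) (simp add: prod_list_cs gw_def o_def)
 qed
 finally show ?thesis .
 qed
 have delta: "(\<Sum>i\<in>?E. \<Prod>p\<in>P. g $$ (i p, \<kappa> p) * h $$ (\<mu> p, i p)) = (if \<kappa> = \<mu> then 1 else 0)"
 if kl: "\<kappa> : ?E" "\<mu> : ?E" for \<kappa> \<mu>
 proof -
 have "(\<Sum>i\<in>?E. \<Prod>p\<in>P. g $$ (i p, \<kappa> p) * h $$ (\<mu> p, i p)) =
 (\<Prod>p\<in>P. \<Sum>j<n. g $$ (j, \<kappa> p) * h $$ (\<mu> p, j))" by (rule prod_sum_PiE[symmetric]) (auto simp: P)
 also have "... = (\<Prod>p\<in>P. if \<mu> p = \<kappa> p then 1 else 0)"
 proof (rule prod.cong[OF refl])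
 fix p assume "p : P"
 then have "\<mu> p < n" "\<kappa> p < n" using kl by auto
 then show "(\<Sum>j<n. g $$ (j, \<kappa> p) * h $$ (\<mu> p, j)) = (if \<mu> p = \<kappa> p then 1 else 0)"
 using inverts_mat_sum[OF gh(2,1), of "\<mu> p" "\<kappa> p"] gh(3) by (simp add: mult.commute)
 qed
 also have "... = (if \<kappa> = \<mu> then 1 else 0)"
 proof (cases "\<kappa> = \<mu>")
 case False
 then obtain p where "p : P" "\<mu> p ~= \<kappa> p" using PiE_ext[OF kl] by metis
 then show ?thesis using False P by (simp only: if_False) (rule prod_zero, auto)
 qed simp
 finally show ?thesis .
 qed
 have "conj_act n g h (rsum P n (gw w)) = (\<Sum>i\<in>?E. \<Sum>\<kappa>\<in>?E. \<Sum>\<mu>\<in>?E.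
 cs (\<Prod>p\<in>P. g $$ (i p, \<kappa> p) * h $$ (\<mu> p, i p)) * gw (map (%a. mk (kd a) (\<kappa> (rw a)) (\<mu> (cl a))) w))"
 by (simp add: rsum_def glin_sum[OF glin_ca] relabel_gw word del: gw_simps)
 also have "... = (\<Sum>\<kappa>\<in>?E. \<Sum>\<mu>\<in>?E. \<Sum>i\<in>?E.
 cs (\<Prod>p\<in>P. g $$ (i p, \<kappa> p) * h $$ (\<mu> p, i p)) * gw (map (%a. mk (kd a) (\<kappa> (rw a)) (\<mu> (cl a))) w))"
 by (subst sum.swap, rule sum.cong[OF refl], rule sum.swap)
 also have "... = (\<Sum>\<kappa>\<in>?E. \<Sum>\<mu>\<in>?E. if \<mu> = \<kappa> then gw (map (rl \<kappa>) w) else 0)"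
 proof (intro sum.cong refl)
 fix \<kappa> \<mu> assume kl: "\<kappa> : ?E" "\<mu> : ?E"
 show "(\<Sum>i\<in>?E. cs (\<Prod>p\<in>P. g $$ (i p, \<kappa> p) * h $$ (\<mu> p, i p)) * gw (map (%a. mk (kd a) (\<kappa> (rw a)) (\<mu> (cl a))) w)) =
 (if \<mu> = \<kappa> then gw (map (rl \<kappa>) w) else (0 :: 'a mat_gca))"
 unfolding sum_distrib_right[symmetric] cs_sum[symmetric] delta[OF kl] by (auto simp: rl_def[abs_def])
 qed
 also have "... = rsum P n (gw w)" using P by (simp add: rsum_def relabel_gw sum.delta del: gw_simps)
 finally show "conj_act n g h (rsum P n (gw w)) = rsum P n (gw w)" .
 qed
qed

section \<open>Invariants are determined by their restriction to diagonal \<open>x\<close>\<close>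

lemma gsp_bounded: "EX N. f : gsp (%M. size M <= N)"
proof (induction f rule: gca_induct)
 case (add f g)
 then obtain N K where "f : gsp (%M. size M <= N)" "g : gsp (%M. size M <= K)" by blast
 then have "f : gsp (%M. size M <= max N K)" "g : gsp (%M. size M <= max N K)" by (auto elim: gsp_mono)
 then show ?case by (metis gsp_add)
next
 case (word c w)
 have "gw w : gsp (%M. size M <= length w)" by (rule gsp_gw) simp
 then show ?case by (metis gsp_cs)
qed

lemma gsp_nat_0:
 fixes h :: "('v + 'o::linorder) multiset => nat"
 assumes z: "!!k. 0 < k ==> gfilter (%M. h M = k) f = 0" and b: "!!M. h M <= size M"
 shows "f : gsp (%M. h M = 0)"
proof -
 obtain N where "f : gsp (%M. size M <= N)" using gsp_bounded by blast
 then have "f : gsp (%M. h M : {..N})"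
 proof (rule gsp_mono)
 fix M :: "('v + 'o) multiset" assume "size M <= N"
 then show "h M : {..N}" using b[of M] by simp
 qed
 then have "f = (\<Sum>k\<in>{..N}. gfilter (%M. h M = k) f)" by (rule gfilter_partition) simp
 also have "... = (\<Sum>k\<in>{..N}. if k = 0 then gfilter (%M. h M = 0) f else 0)"
 by (rule sum.cong[OF refl]) (use z in auto)
 also have "... = gfilter (%M. h M = 0) f" by (simp add: sum.delta)
 finally show ?thesis using gfilter_in_gsp by metis
qed

lemma der_ok_good: "good e ==> der_ok False e" unfolding der_ok_def tw_def if_False
proof (intro allI)
 fix a b :: "'a + 'b"
 assume g: "good e"
 have gb: "gl b : deg1" if "~ isl b" for b :: "'a + 'b" using good_gl(2)[of b b] that by simp
 consider "isl a" | "~ isl a" "isl b" | "~ isl a" "~ isl b" by blast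
 then show "e a * gl b + gl a * e b = (if isl a \<or> isl b then 1 else - 1) * (e b * gl a + gl b * e a)"
 proof cases
 case 1
 then have "e a * gl b = gl b * e a" using g unfolding good_def by blast
 then show ?thesis using 1 gl_comm_even[OF 1, of "e b"] by simp
 next
 case 2
 then have "e b * gl a = gl a * e b" using g unfolding good_def by blast
 then show ?thesis using 2 gl_comm_even[OF 2(2), of "e a"] by simp
 next
 case 3
 then have "e a : deg1" "e b : deg1" using g unfolding good_def by blast+
 then have "e a * gl b = - (gl b * e a)" "gl a * e b = - (e b * gl a)" using 3 gb deg1_anticommute by blast+
 then show ?thesis using 3 by simp
 qed
qed

lemma good_diff: "good e ==> good e' ==> good (%a. e a - e' a)"
 by (simp add: good_def left_diff_distrib right_diff_distrib deg1_diff)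

lemma good_if: "good e ==> good (%a. if R a then e a else 0)" by (simp add: good_def)

lemma dw_diff: "dw od (%a. e a - e' a) w = dw od e w - dw od e' w"
proof (induction w)
 case (Cons a w)
 show ?case unfolding dw.simps Cons by (simp add: algebra_simps)
qed simp

lemma gsp_uminus: "f : gsp Q ==> - f : gsp Q" using gsp_diff[OF gsp_0, of f Q] by simp

lemma gl_gsp: "K {#a#} ==> gl a : gsp K" using gsp_gw[of K "[a]"] by simp

lemma gsp_1: "K {#} ==> 1 : gsp K" using gsp_gw[of K "[]"] by simp

lemma tw_gl_gsp: "tw od (gl a) : gsp (%M. M = {#a#})" unfolding tw_gl by (auto intro!: gsp_uminus gl_gsp)

text \<open>A derivation removes one letter and inserts the letters of its value there; all counts
  of letters in derivatives go through this.\<close>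

lemma dw_gsp:
 assumes "!!a. e a : gsp (K a)"
 shows "dw od e w : gsp (%M. EX a N. a \<in># mset w & K a N & M = mset w - {#a#} + N)"
proof (induction w)
 case (Cons b w)
 have "gw w : gsp (%M. M = mset w)" by (rule gsp_gw) simp
 with assms[of b] have "e b * gw w : gsp (%M. EX a N. a \<in># mset (b # w) & K a N & M = mset (b # w) - {#a#} + N)"
 by (rule gsp_mult) (metis add_mset_remove_trivial list.set_intros(1) mset.simps(2) set_mset_mset union_commute)
 moreover have "tw od (gl b) * dw od e w : gsp (%M. EX a N. a \<in># mset (b # w) & K a N & M = mset (b # w) - {#a#} + N)"
 proof (rule gsp_mult[OF tw_gl_gsp Cons])
 fix M N assume "M = {#b#}" "EX a K'. a \<in># mset w & K a K' & N = mset w - {#a#} + K'"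
 then obtain a K' where a: "a \<in># mset w" "K a K'" "N = mset w - {#a#} + K'" by blast
 then obtain W where W: "mset w = add_mset a W" by (metis insert_DiffM)
 then have "mset (b # w) - {#a#} + K' = add_mset b (W + K')" by (simp add: add_mset_commute[of b a])
 moreover have "N = W + K'" unfolding a(3) W by simp
 ultimately have "M + N = mset (b # w) - {#a#} + K'" unfolding \<open>M = {#b#}\<close> by simp
 moreover have "a \<in># mset (b # w)" using a(1) by simp
 ultimately show "EX a N'. a \<in># mset (b # w) & K a N' & M + N = mset (b # w) - {#a#} + N'" using a(2) by blast
 qed
 ultimately show ?case by (simp add: gsp_add)
qed simp

section \<open>Partial derivatives in an even variable\<close>

definition pder :: "'v => ('v, 'o::linorder, 'k::field_char_0) gca => ('v, 'o, 'k) gca" where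
 "pder v = gder False (%a. if a = Inl v then 1 else 0)"

lemma pder_ok: "der_ok False (%a. if a = Inl v then 1 else 0)" by (rule der_ok_good) (auto simp: good_def)

lemma pder_mult: "pder v (f * g) = pder v f * g + f * pder v g"
 unfolding pder_def gder_mult[OF pder_ok] by (simp add: tw_def)

lemma pder_gl: "pder v (gl a) = (if a = Inl v then 1 else 0)" unfolding pder_def gder_gl[OF pder_ok] by simp

lemma pder_1: "pder v 1 = 0" unfolding pder_def by (rule gder_1[OF pder_ok])

lemma glin_pder: "glin (pder v)" unfolding pder_def by (rule glin_gder)

lemma pder_gw: "pder v (gw w) = dw False (%a. if a = Inl v then 1 else 0) w" unfolding pder_def by (rule gder_gw[OF pder_ok])

lemma euler:
 fixes w :: "('v + 'o::linorder) list"
 shows "gl (Inl v) * pder v (gw w) = (of_nat (count (mset w) (Inl v)) * gw w :: ('v, 'o, 'k::field_char_0) gca)"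
proof (induction w)
 case (Cons a w)
 let ?g = "gl a :: ('v, 'o, 'k) gca"
 have "gl (Inl v) * pder v (gw (a # w) :: ('v, 'o, 'k) gca) = gl (Inl v) * (pder v (gl a) * gw w) + gl (Inl v) * gl a * pder v (gw w)"
 by (simp add: pder_mult distrib_left mult.assoc)
 also have "gl (Inl v) * ?g * pder v (gw w) = ?g * (gl (Inl v) * pder v (gw w))"
 unfolding mult.assoc[symmetric] by (subst gl_comm_even[of "Inl v" "gl a"]) simp_all
 also have "?g * (gl (Inl v) * pder v (gw w)) = of_nat (count (mset w) (Inl v)) * (?g * gw w)"
 by (simp only: Cons mult_of_nat_commute mult.assoc)
 finally show ?case by (cases "a = Inl v") (simp_all add: pder_gl distrib_right del: gw_simps(1))
qed (simp add: pder_1)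

text \<open>Each derivative lowers the number of letters, and an element has monomials of bounded
  size.\<close>

lemma pder_nilpotent:
 fixes f :: "('v, 'o::linorder, 'k::field_char_0) gca"
 shows "EX N. (pder v ^^ N) f = 0"
proof -
 obtain N where N: "f : gsp (%M. size M <= N)" using gsp_bounded by blast
 have step: "pder v g : gsp (%M. size M + 1 <= k)" if "g : gsp (%M. size M <= k)" for g :: "('v, 'o, 'k) gca" and k
 proof (rule glin_maps_gsp[OF glin_pder that])
 fix w :: "('v + 'o) list" assume w: "size (mset w) <= k"
 have "dw False (%a. if a = Inl v then 1 else 0 :: ('v, 'o, 'k) gca) w : gsp (%M. EX a N. a \<in># mset w & N = {#} & M = mset w - {#a#} + N)"
 by (intro dw_gsp) (auto intro: gsp_1)
 then show "pder v (gw w :: ('v, 'o, 'k) gca) : gsp (%M. size M + 1 <= k)" unfolding pder_gw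
 by (rule gsp_mono) (use w in \<open>auto simp: size_Diff_singleton Suc_le_eq\<close>, metis Suc_pred length_pos_if_in_set less_eq_Suc_le)
 qed
 have "(pder v ^^ j) f : gsp (%M. size M + j <= N)" for j
 proof (induction j)
 case (Suc j)
 have "(pder v ^^ j) f : gsp (%M. size M <= N - j)" by (rule gsp_mono[OF Suc]) auto
 from step[OF this] have "(pder v ^^ Suc j) f : gsp (%M. size M + 1 <= N - j)" by simp
 then show ?case by (rule gsp_mono) auto
 qed (use N in simp)
 from this[of "Suc N"] have "(pder v ^^ Suc N) f : gsp (%_. False)" by (rule gsp_mono) auto
 then have "(pder v ^^ Suc N) f = 0" using gfilter_eq_0[of _ "%_. False" "%_. False"] unfolding gsp_def by fastforce
 then show ?thesis by blast
qed

text \<open>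
 If \<open>\<partial>u = 1\<close> and \<open>u g = 0\<close> then \<open>u \<partial>\<^sup>k\<^sup>+\<^sup>1 g = - (k + 1) \<partial>\<^sup>k g\<close>, so local nilpotency of \<open>\<partial>\<close> forces \<open>g = 0\<close>.
\<close>

lemma nonzero_divisor:
 assumes u: "pder v u = 1" and g: "u * g = 0"
 shows "g = 0"
proof -
 let ?d = "%k. (pder v ^^ k) g"
 have rec: "u * ?d (Suc k) = - (of_nat (Suc k) * ?d k)" for k
 proof (induction k)
 case 0
 have "pder v (u * g) = 0" using g glin_0[OF glin_pder] by simp
 then show ?case by (simp add: pder_mult u eq_neg_iff_add_eq_0 add.commute)
 next
 case (Suc k)
 have "pder v (of_nat n * h) = of_nat n * pder v h" for n h
 using glin_cs[OF glin_pder, of v "of_nat n" h] by (simp add: cs_of_nat)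
 then have "pder v (u * ?d (Suc k)) = - (of_nat (Suc k) * ?d (Suc k))"
 unfolding Suc glin_uminus[OF glin_pder] by (simp del: of_nat_Suc)
 then have "?d (Suc k) + u * ?d (Suc (Suc k)) = - (of_nat (Suc k) * ?d (Suc k))" by (simp add: pder_mult u del: of_nat_Suc)
 then have "u * ?d (Suc (Suc k)) = - (of_nat (Suc k) * ?d (Suc k)) - ?d (Suc k)" by (metis add_diff_cancel_left')
 then show ?case by (simp add: algebra_simps)
 qed
 have dn: "?d k = 0" if "?d (Suc k) = 0" for k
 proof -
 have "of_nat (Suc k) * ?d k = 0" using rec[of k] that by (metis mult_zero_right neg_equal_0_iff_equal)
 then have "cs (of_nat (Suc k)) * ?d k = cs (of_nat (Suc k)) * 0" by (simp add: cs_of_nat del: of_nat_Suc)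
 then show ?thesis by (rule cs_cancel) (simp del: of_nat_Suc)
 qed
 obtain N where N: "?d N = 0" using pder_nilpotent[of v g] by (elim exE)
 have "?d 0 = 0" if "?d N = 0" for N using that
 proof (induction N)
 case (Suc N)
 then show ?case using dn[of N] by blast
 qed
 from this[OF N] show ?thesis by simp
qed

text \<open>By Euler's identity the variable times its derivative multiplies the part of degree k in
  v by k, which is invertible for k > 0.\<close>

lemma pder_zero_no_var:
 assumes "pder v f = 0"
 shows "f : gsp (%M. count M (Inl v) = 0)"
proof (rule gsp_nat_0)
 fix k :: nat assume k: "0 < k"
 have "gfilter (%M. count M (Inl v) = k) (gl (Inl v) * pder v f) = cs (of_nat k) * gfilter (%M. count M (Inl v) = k) f"
 proof (rule glin_eqI[OF glin_comp[OF glin_gf glin_mult_left[OF glin_pder]] glin_scale[OF glin_gf]])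
 fix w :: "('a + 'b) list"
 show "gfilter (%M. count M (Inl v) = k) (gl (Inl v) * pder v (gw w)) =
 cs (of_nat k) * gfilter (%M. count M (Inl v) = k) (gw w :: ('a, 'b, 'c) gca)"
 unfolding euler cs_of_nat[symmetric] gfilter_cs by (simp add: gfilter_gw del: gw_simps)
 qed
 then have "cs (of_nat k) * gfilter (%M. count M (Inl v) = k) f = cs (of_nat k) * 0" using assms by simp
 then show "gfilter (%M. count M (Inl v) = k) f = 0" by (rule cs_cancel) (use k in simp)
qed (rule count_le_size)

text \<open>The first-order effect of left multiplication by 1 + t E_ab, with E_ab the elementary
  matrix; \<open>er\<close> is the one of right multiplication.\<close>

definition el :: "nat => nat => letter => 'k::field_char_0 mat_gca" where
 "el a b l = (if rw l = a then gl (mk (kd l) b (cl l)) else 0)"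

definition er :: "nat => nat => letter => 'k::field_char_0 mat_gca" where
 "er a b l = (if cl l = b then gl (mk (kd l) (rw l) a) else 0)"

lemma good_el: "good (el a b)" and good_er: "good (er a b)"
 unfolding el_def[abs_def] er_def[abs_def] by (intro good_if good_lmap; simp add: isl_kd)+

lemma prod_first_order:
 "\<exists>\<phi>. polyfam \<phi> & (ALL t. prod_list (map (%l. gl l + cs t * e l) w) = gw w + cs t * dw False e w + cs (t ^ 2) * \<phi> t)"
proof (induction w)
 case Nil
 show ?case by (intro exI[of _ "%_. 0"]) (simp add: polyfam_const)
next
 case (Cons l w)
 then obtain \<phi> where \<phi>: "polyfam \<phi>"
 "!!t. prod_list (map (%l. gl l + cs t * e l) w) = gw w + cs t * dw False e w + cs (t ^ 2) * \<phi> t" by blast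
 let ?\<psi> = "%t. e l * dw False e w + gl l * \<phi> t + cs t * (e l * \<phi> t)"
 have "polyfam ?\<psi>" by (intro polyfam_add polyfam_mult polyfam_const polyfam_cs \<phi>(1))
 moreover have "prod_list (map (%l. gl l + cs t * e l) (l # w)) = gw (l # w) + cs t * dw False e (l # w) + cs (t ^ 2) * ?\<psi> t" for t
 by (simp add: \<phi>(2) tw_def distrib_left distrib_right mult.assoc poly_left_comm[of "gl l"]
 poly_left_comm[of "e l"] power2_eq_square cs_mult add_ac)
 ultimately show ?case by blast
qed

lemma first_order_expansion:
 assumes L: "!!t. ghom (L t)" and f: "f : gsp (below n)" and ok: "good e"
 and gl: "!!t l. rw l < n ==> cl l < n ==> L t (gl l) = gl l + cs t * e l"
 shows "\<exists>\<phi>. polyfam \<phi> & (ALL t. L t f = f + cs t * gder False e f + cs (t ^ 2) * \<phi> t)" using f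
proof (induction rule: gsp_induct)
 case (add f g)
 then obtain \<phi> \<psi> where "polyfam \<phi>" "polyfam \<psi>" "!!t. L t f = f + cs t * gder False e f + cs (t ^ 2) * \<phi> t"
 "!!t. L t g = g + cs t * gder False e g + cs (t ^ 2) * \<psi> t" by blast
 then show ?case
 by (intro exI[of _ "%t. \<phi> t + \<psi> t"]) (simp add: polyfam_add glin_add[OF ghom_glin[OF L]] glin_add[OF glin_gder] distrib_left)
next
 case (word c w)
 obtain \<phi> where \<phi>: "polyfam \<phi>"
 "!!t. prod_list (map (%l. gl l + cs t * e l) w) = gw w + cs t * dw False e w + cs (t ^ 2) * \<phi> t"
 using prod_first_order by blast
 have "L t (gw w) = prod_list (map (%l. gl l + cs t * e l) w)" for t
 unfolding ghom_gw[OF L] using word by (intro arg_cong[where f = prod_list] map_cong refl gl) (auto simp: idxs_def)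
 then show ?case by (intro exI[of _ "%t. cs c * \<phi> t"])
 (simp add: \<phi> polyfam_scale glin_cs[OF ghom_glin[OF L]] glin_cs[OF glin_gder] gder_gw[OF der_ok_good[OF ok]]
 distrib_left poly_left_comm[of "cs c"])
qed (intro exI[of _ "%_. 0"], simp add: polyfam_const glin_0[OF ghom_glin[OF L]] glin_0[OF glin_gder])

text \<open>The comparison of the coefficients of t in \<open>GL_balanced\<close> for the matrix 1 +
  t E_ab.\<close>

lemma GL_infinitesimal:
 assumes f: "f : GL_invariants n" "f : gsp (below n)" and ab: "a < n" "b < n"
 shows "gder False (el a b) f = gder False (er a b) (f :: 'k::field_char_0 mat_gca)"
proof -
 define V :: "'k => nat => nat => 'k" where
 "V t p r = (if p = r then 1 else 0) + (if p = a & r = b then t else 0)" for t p r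
 have "lV n (V t) (gl l) = gl l + cs t * el a b l" if "rw l < n" "cl l < n" for t l
 proof -
 have "lV n (V t) (gl l) = (\<Sum>r<n. if r = rw l then gl l else 0) + (\<Sum>r<n. if r = b then cs t * el a b l else 0)"
 unfolding lV_gl sum.distrib[symmetric] by (rule sum.cong[OF refl]) (auto simp: V_def el_def cs_add distrib_right)
 then show ?thesis using that ab by (simp add: sum.delta)
 qed
 from first_order_expansion[where L = "%t. lV n (V t)", OF ghom_lV f(2) good_el this] obtain \<phi> where
 \<phi>: "polyfam \<phi>" "!!t. lV n (V t) f = f + cs t * gder False (el a b) f + cs (t ^ 2) * \<phi> t" by blast
 have "rV n (V t) (gl l) = gl l + cs t * er a b l" if "rw l < n" "cl l < n" for t l
 proof -
 have "rV n (V t) (gl l) = (\<Sum>r<n. if r = cl l then gl l else 0) + (\<Sum>r<n. if r = a then cs t * er a b l else 0)"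
 unfolding rV_gl sum.distrib[symmetric] by (rule sum.cong[OF refl]) (auto simp: V_def er_def cs_add distrib_right)
 then show ?thesis using that ab by (simp add: sum.delta)
 qed
 from first_order_expansion[where L = "%t. rV n (V t)", OF ghom_rV f(2) good_er this] obtain \<psi> where
 \<psi>: "polyfam \<psi>" "!!t. rV n (V t) f = f + cs t * gder False (er a b) f + cs (t ^ 2) * \<psi> t" by blast
 let ?L = "%t. gder False (el a b) f + cs t * \<phi> t" and ?R = "%t. gder False (er a b) f + cs t * \<psi> t"
 \<comment> \<open>After division by t the two families agree for all nonzero t, hence also at t =
   0, where only the first-order terms are left.\<close>
 have "?L 0 = ?R 0"
 proof (rule polyfam_eq[where T = "UNIV - {0}"])
 show "polyfam ?L" "polyfam ?R" by (intro polyfam_add polyfam_mult polyfam_const polyfam_cs \<phi>(1) \<psi>(1))+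
 show "infinite (UNIV - {0 :: 'k})" using infinite_UNIV_char_0[where 'a='k] by simp
 fix t :: 'k assume t: "t : UNIV - {0}"
 have "lV n (V t) f = rV n (V t) f" by (rule GL_balanced[OF f])
 then have "cs t * ?L t = cs t * ?R t"
 unfolding \<phi>(2) \<psi>(2) by (simp add: distrib_left power2_eq_square cs_mult mult.assoc add.assoc)
 then show "?L t = ?R t" by (rule cs_cancel) (use t in simp)
 qed
 then show ?thesis by simp
qed

definition isoff :: "letter => bool" where
 "isoff l \<longleftrightarrow> kd l = KX & rw l ~= cl l"

definition off :: "letter multiset => nat" where
 "off M = size (filter_mset isoff M)"

lemma off_simps [simp]: "off {#} = 0" "off (add_mset a M) = (if isoff a then 1 else 0) + off M" "off (M + N) = off M + off N"
 by (simp_all add: off_def)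

lemma off_le: "off M <= size M" by (simp add: off_def size_filter_mset_lesseq)

lemma off_remove: "a \<in># M ==> off (M - {#a#}) + (if isoff a then 1 else 0) = off M"
 by (metis add.commute insert_DiffM off_simps(2))

definition res :: "'k::field_char_0 mat_gca => 'k mat_gca" where
 "res = gfilter (%M. off M = 0)"

lemma ghom_res: "ghom res"
proof (rule ghomI)
 show "glin res" unfolding res_def by (rule glin_gf)
 show "res 1 = 1" using gfilter_gw[of "%M. off M = 0" "[]"] by (simp add: res_def)
 fix u v
 have "res (gw (u @ v)) = res (gw u) * res (gw v)" unfolding res_def gfilter_gw by (auto simp del: gw_simps(2))
 then show "res (gw u * gw v) = res (gw u) * res (gw v)" by simp
qed

lemma res_gw: "res (gw w) = (if off (mset w) = 0 then gw w else 0)" unfolding res_def gfilter_gw ..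

lemmas glin_res = ghom_glin[OF ghom_res]

lemma res_gl: "res (gl a) = (if isoff a then 0 else gl a)" using res_gw[of "[a]"] by (auto split: if_splits)

lemma res_id: "f : gsp (%M. off M = 0) ==> res f = f" by (simp add: gsp_def res_def)

text \<open>By \<open>GL_infinitesimal\<close> the derivation \<open>el - er\<close> kills f.
  Suppose all terms of f have at least j + 1 off-diagonal x. Among the terms with j of them, the
  derivative of f is x_bb - x_aa times the partial derivative in x_ab of the part with exactly j +
  1. Cancelling the nonzero divisor, that part contains no x_ab; as a and b are arbitrary, it is
  0.\<close>

theorem res_injective:
 assumes f: "f : GL_invariants n" "f : gsp (below n)" and r: "res f = 0"
 shows "f = (0 :: 'k::field_char_0 mat_gca)"
proof -
 have step: "f : gsp (%M. off M \<ge> Suc (Suc j))" if fj: "f : gsp (%M. off M \<ge> Suc j)" for j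
 proof -
 let ?g = "gfilter (%M. off M = Suc j) f"
 have no: "?g : gsp (%M. count M (mk KX a b) = 0)" if ab: "a < n" "b < n" "a ~= b" for a b
 proof -
 let ?u = "gl (mk KX b b) - gl (mk KX a a) :: 'k mat_gca"
 let ?eD = "%l. el a b l - er a b l :: 'k mat_gca"
 \<comment> \<open>The part of \<open>?eD\<close> that lowers the number of off-diagonal x: its
   value at the letter x_ab.\<close>
 let ?e0 = "%l. if l = mk KX a b then ?u else 0"
 have good0: "good ?e0" unfolding good_def
 proof (intro conjI allI impI)
 fix l and h :: "'k mat_gca"
 show "?e0 l * h = h * ?e0 l" using gl_comm_even[of "mk KX b b" h] gl_comm_even[of "mk KX a a" h]
 by (simp add: left_diff_distrib right_diff_distrib)
 qed auto
 have goodD: "good ?eD" by (rule good_diff[OF good_el good_er])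
 have Df: "gder False ?eD f = 0"
 proof -
 have "gder False ?eD f = gder False (el a b) f - gder False (er a b) f"
 by (rule glin_eqI[OF glin_gder glin_minus[OF glin_gder glin_gder]])
 (simp add: gder_gw[OF der_ok_good[OF goodD]] gder_gw[OF der_ok_good[OF good_el]]
 gder_gw[OF der_ok_good[OF good_er]] dw_diff)
 then show ?thesis using GL_infinitesimal[OF f ab(1,2)] by simp
 qed
 \<comment> \<open>Away from x_ab neither \<open>el\<close> nor \<open>er\<close> makes an
   off-diagonal x diagonal.\<close>
 have hi: "gder False ?eD f - gder False ?e0 f : gsp (%M. off M \<ge> Suc j)"
 proof (rule glin_maps_gsp[OF glin_minus[OF glin_gder glin_gder] fj])
 fix w :: "letter list" assume w: "Suc j <= off (mset w)"
 have "?eD l - ?e0 l : gsp (%M. off M \<ge> (if isoff l then 1 else 0))" for l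
 proof (cases "l = mk KX a b")
 case True
 then show ?thesis by (simp add: el_def er_def)
 next
 case False
 have "el a b l : gsp (%M. off M \<ge> (if isoff l then 1 else 0))" if "~ (kd l = KX & rw l = a & cl l = b)"
 using that by (auto simp: el_def isoff_def intro!: gl_gsp)
 moreover have "er a b l : gsp (%M. off M \<ge> (if isoff l then 1 else 0))" if "~ (kd l = KX & rw l = a & cl l = b)"
 using that by (auto simp: er_def isoff_def intro!: gl_gsp)
 moreover have "~ (kd l = KX & rw l = a & cl l = b)" using False by (metis mk_collapse)
 ultimately have "?eD l : gsp (%M. off M \<ge> (if isoff l then 1 else 0))" by (intro gsp_diff) blast+
 then show ?thesis using False by (simp only: if_False diff_zero)
 qed
 then have "dw False (%l. ?eD l - ?e0 l) w : gsp (%M. EX a N. a \<in># mset w &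
 off N \<ge> (if isoff a then 1 else 0) & M = mset w - {#a#} + N)" by (rule dw_gsp)
 then have "dw False (%l. ?eD l - ?e0 l) w : gsp (%M. off M \<ge> Suc j)"
 proof (rule gsp_mono)
 fix M assume "EX a N. a \<in># mset w & off N \<ge> (if isoff a then 1 else 0) & M = mset w - {#a#} + N"
 then obtain a N where "a \<in># mset w" "off N \<ge> (if isoff a then 1 else 0)" "M = mset w - {#a#} + N" by blast
 moreover from this have "off M = off (mset w - {#a#}) + off N" by (simp only: off_simps)
 ultimately show "off M \<ge> Suc j" using off_remove[of a "mset w"] w by linarith
 qed
 then show "gder False ?eD (gw w) - gder False ?e0 (gw w) : gsp (%M. off M \<ge> Suc j)"
 unfolding gder_gw[OF der_ok_good[OF goodD]] gder_gw[OF der_ok_good[OF good0]] dw_diff[symmetric] .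
 qed
 have e0: "gder False ?e0 h = ?u * pder (X (a, b)) h" for h
 proof (rule glin_eqI[OF glin_gder glin_mult_left[OF glin_pder]])
 fix w :: "letter list"
 show "gder False ?e0 (gw w) = ?u * pder (X (a, b)) (gw w)"
 proof (induction w)
 case (Cons l w)
 have "?u * gl l = gl l * ?u"
 by (simp add: left_diff_distrib right_diff_distrib gl_comm_even[of "Inl (X (b, b))"] gl_comm_even[of "Inl (X (a, a))"])
 then have c: "?u * (gl l * y) = gl l * (?u * y)" for y unfolding mult.assoc[symmetric] by (simp only:)
 have D: "gder False ?e0 (gl l * gw w) = ?e0 l * gw w + gl l * gder False ?e0 (gw w)"
 by (simp only: gder_mult[OF der_ok_good[OF good0]] gder_gl[OF der_ok_good[OF good0]] tw_def if_False)
 have P: "pder (X (a, b)) (gl l * gw w) = (if l = mk KX a b then 1 else 0) * gw w + (gl l * pder (X (a, b)) (gw w) :: 'k mat_gca)"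
 by (simp add: pder_mult pder_gl)
 show ?case unfolding gw_simps(2) D P Cons distrib_left c
 by (cases "l = mk KX a b") (simp_all only: if_True if_False mult_1 mult_zero_left mult_zero_right simp_thms)
 qed (simp only: gw_simps(1) gder_1[OF der_ok_good[OF good0]] pder_1 mult_zero_right)
 qed
 have "gfilter (%M. off M = j) (gder False ?e0 f) = gder False ?e0 ?g"
 proof (rule glin_eqI[OF glin_comp[OF glin_gf glin_gder] glin_comp[OF glin_gder glin_gf]])
 fix w :: "letter list"
 have "?e0 l : gsp (%M. off M + 1 = (if isoff l then 1 else 0))" for l
 using ab(3) by (auto simp: isoff_def intro!: gsp_diff gl_gsp)
 then have 1: "dw False ?e0 w : gsp (%M. EX a N. a \<in># mset w &
 off N + 1 = (if isoff a then 1 else 0) & M = mset w - {#a#} + N)" by (rule dw_gsp)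
 have 2: "dw False ?e0 w : gsp (%M. off M + 1 = off (mset w))"
 proof (rule gsp_mono[OF 1])
 fix M assume "EX a N. a \<in># mset w & off N + 1 = (if isoff a then 1 else 0) & M = mset w - {#a#} + N"
 then obtain a N where "a \<in># mset w" "off N + 1 = (if isoff a then 1 else 0)" "M = mset w - {#a#} + N" by blast
 moreover from this have "off M = off (mset w - {#a#}) + off N" by (simp only: off_simps)
 ultimately show "off M + 1 = off (mset w)" using off_remove[of a "mset w"] by linarith
 qed
 show "gfilter (%M. off M = j) (gder False ?e0 (gw w)) = gder False ?e0 (gfilter (%M. off M = Suc j) (gw w))"
 proof (cases "off (mset w) = Suc j")
 case True
 then have "gfilter (%M. off M = Suc j) (gw w) = (gw w :: 'k mat_gca)" by (simp add: gfilter_gw del: gw_simps)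
 then show ?thesis unfolding gder_gw[OF der_ok_good[OF good0]]
 by (simp only: gder_gw[OF der_ok_good[OF good0]]) (rule gfilter_eq_self[OF 2], use True in simp)
 next
 case False
 then have "gfilter (%M. off M = Suc j) (gw w) = (0 :: 'k mat_gca)" by (simp add: gfilter_gw del: gw_simps)
 then show ?thesis unfolding gder_gw[OF der_ok_good[OF good0]]
 by (simp only: glin_0[OF glin_gder]) (rule gfilter_eq_0[OF 2], use False in simp)
 qed
 qed
 moreover have "gfilter (%M. off M = j) (gder False ?e0 f) = 0"
 proof -
 have "gder False ?e0 f = 0 - (gder False ?eD f - gder False ?e0 f)" using Df by simp
 then show ?thesis using gfilter_eq_0[OF hi, of "%M. off M = j"] by (simp only: gfilter_diff gfilter_0) simp
 qed
 ultimately have u0: "?u * pder (X (a, b)) ?g = 0" by (simp only: e0)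
 have "pder (X (b, b)) ?u = 1" using ab(3) by (simp add: glin_diff[OF glin_pder] pder_gl)
 then have "pder (X (a, b)) ?g = 0" by (rule nonzero_divisor[OF _ u0])
 then show ?thesis using pder_zero_no_var[of "X (a, b)"] by simp
 qed
 have "?g : gsp (%M. (off M = Suc j & below n M) &
 (\<forall>ab\<in>{(a, b). a < n & b < n & a ~= b}. count M (mk KX (fst ab) (snd ab)) = 0))"
 proof (rule gsp_ball)
 have "{(a, b). a < n & b < n & a ~= b} \<subseteq> {..<n} \<times> {..<n}" by auto
 then show "finite {(a, b). a < n & b < n & a ~= b}" by (rule finite_subset) simp
 show "?g : gsp (%M. off M = Suc j & below n M)" by (rule gfilter_gsp[OF f(2)])
 qed (use no in auto)
 then have "?g : gsp (%_. False)"
 proof (rule gsp_mono)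
 fix M assume M: "(off M = Suc j & below n M) &
 (\<forall>ab\<in>{(a, b). a < n & b < n & a ~= b}. count M (mk KX (fst ab) (snd ab)) = 0)"
 then have "size (filter_mset isoff M) ~= 0" by (simp add: off_def)
 then obtain l where "l \<in># filter_mset isoff M" by (metis multiset_nonemptyE size_empty)
 then have l: "l \<in># M" "isoff l" by simp_all
 then have "rw l < n" "cl l < n" "rw l ~= cl l" "l = mk KX (rw l) (cl l)" using M mk_collapse[of l]
 by (auto simp: idxs_def isoff_def)
 then have "count M l = 0" using M by force
 then show False using l(1) by (metis count_greater_zero_iff less_numeral_extra(3))
 qed
 then have "?g = 0" using gfilter_eq_0[of ?g "%_. False" "%_. False"] by (auto simp: gsp_def)
 have "f = gfilter (%M. off M \<ge> Suc (Suc j)) f + ?g" by (rule glin_on_gsp[OF glin_id glin_plus[OF glin_gf glin_gf] fj])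
 (auto simp: gfilter_gw simp del: gw_simps)
 then show ?thesis using \<open>?g = 0\<close> gfilter_in_gsp[of "%M. off M \<ge> Suc (Suc j)" f] by simp
 qed
 have "f = gfilter (%M. off M \<ge> Suc 0) f + gfilter (%M. off M = 0) f"
 by (rule glin_eqI[OF glin_id glin_plus[OF glin_gf glin_gf]]) (auto simp: gfilter_gw simp del: gw_simps)
 then have "f : gsp (%M. off M \<ge> Suc 0)" using r gfilter_in_gsp[of "%M. off M \<ge> Suc 0" f] by (simp add: res_def)
 then have all: "f : gsp (%M. off M \<ge> Suc j)" for j by (induction j) (use step in auto)
 obtain N where "f : gsp (%M. size M <= N)" using gsp_bounded by blast
 from gsp_conj[OF this all[of N]] have "f : gsp (%_. False)" by (rule gsp_mono) (metis off_le le_trans not_less_eq_eq)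
 then show ?thesis using gfilter_eq_0[of f "%_. False" "%_. False"] by (auto simp: gsp_def)
qed

section \<open>Words with diagonal \<open>x\<close>\<close>

text \<open>The differential that is left on words with diagonal x. There is no sum over a middle
  index, so it does not depend on n and commutes with every relabelling.\<close>

definition dB :: "'k::field_char_0 mat_gca => 'k mat_gca" where
 "dB = gca_diff (%(p, q). (pvar (X (p, p)) - pvar (X (q, q))) * pvar (Y (p, q)))"

lemma glin_dB: "glin dB" unfolding dB_def by (rule glin_gd)

lemma gl_poly: "gca_poly (pvar v) = gl (Inl v)" by (simp add: gl_def)

lemma dval_dB: "dval (%(p, q). (pvar (X (p, p)) - pvar (X (q, q))) * pvar (Y (p, q))) a =
 (if kd a = KT then (gl (mk KX (rw a) (rw a)) - gl (mk KX (cl a) (cl a))) * gl (mk KY (rw a) (cl a))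
 else (0 :: 'k::field_char_0 mat_gca))" by (cases a rule: kd.cases) (auto simp: gca_poly_mult gca_poly_diff gl_poly)

lemma dB_gw: "dB (gw w) = dw True (dval (%(p, q). (pvar (X (p, p)) - pvar (X (q, q))) * pvar (Y (p, q)))) w"
 unfolding dB_def gca_diff_eq_gder by (rule gder_gw[OF der_ok_dval])

lemma ghom_gi_commute:
 assumes "ghom L" "!!a. isl a ==> gi (L (gl a)) = L (gl a)" "!!a. ~ isl a ==> gi (L (gl a)) = - L (gl a)"
 shows "L (gi (gl a)) = gi (L (gl a))"
 using assms(2,3)[of a] by (cases "isl a") (simp_all add: gi_gl glin_uminus[OF ghom_glin[OF assms(1)]])

lemma relabel_dB: "relabel i (dB f) = dB (relabel i (f :: 'k::field_char_0 mat_gca))"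
proof (rule glin_eqI[OF glin_comp[OF glin_rlb glin_dB] glin_comp[OF glin_dB glin_rlb]])
 fix w :: "letter list"
 show "relabel i (dB (gw w)) = dB (relabel i (gw w :: 'k mat_gca))" unfolding dB_def
 proof (rule chain_map[OF ghom_rlb _ _ subset_UNIV])
 fix a :: letter
 show "relabel i (gi (gl a)) = gi (relabel i (gl a :: 'k mat_gca))"
 by (rule ghom_gi_commute[OF ghom_rlb]) (simp_all add: relabel_gl gi_gl)
 show "relabel i (dval (%(p, q). (pvar (X (p, p)) - pvar (X (q, q))) * pvar (Y (p, q))) a) =
 gca_diff (%(p, q). (pvar (X (p, p)) - pvar (X (q, q))) * pvar (Y (p, q))) (relabel i (gl a :: 'k mat_gca))"
 unfolding relabel_gl gca_diff_gl dval_dB rl_simps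
 by (simp only: ghom_mult[OF ghom_rlb] glin_diff[OF glin_rlb] relabel_gl rl_simps glin_0[OF glin_rlb] if_distrib[of "relabel i"])
 qed
qed

lemma rsum_dB: "rsum P n (dB f) = dB (rsum P n f)" unfolding rsum_def by (simp add: relabel_dB glin_sum[OF glin_dB])

text \<open>In the sum over l of x_pl y_lq - y_pl x_lq only l = p survives in the first term and l =
  q in the second.\<close>

lemma res_diff:
 assumes "f : gsp (below n)"
 shows "res (gca_diff (DRep_diff n) f) = dB (res (f :: 'k::field_char_0 mat_gca))"
proof (rule glin_on_gsp[OF glin_comp[OF glin_res glin_gd] glin_comp[OF glin_dB glin_res] assms])
 fix w assume w: "below n (mset w)"
 show "res (gca_diff (DRep_diff n) (gw w)) = dB (res (gw w :: 'k mat_gca))" unfolding dB_def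
 proof (rule chain_map[OF ghom_res])
 show "res (gi (gl a)) = gi (res (gl a :: 'k mat_gca))" for a :: letter
 by (rule ghom_gi_commute[OF ghom_res]) (simp_all add: res_gl gi_gl glin_0[OF ghom_glin[OF ghom_gi]])
 show "set w \<subseteq> {a. rw a < n & cl a < n}" using w by (auto simp: idxs_def)
 fix a assume a: "a : {a. rw a < n & cl a < n}"
 show "res (dval (DRep_diff n) a) =
 gca_diff (%(p, q). (pvar (X (p, p)) - pvar (X (q, q))) * pvar (Y (p, q))) (res (gl a :: 'k mat_gca))"
 proof (cases "kd a = KT")
 case False
 then have "dval (DRep_diff n) a = (0 :: 'k mat_gca)" by (cases a rule: kd.cases) auto
 then show ?thesis using False by (simp add: res_gl glin_0[OF glin_res] gca_diff_gl dval_dB glin_0[OF glin_gd])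
 next
 case True
 then obtain p q where pq: "a = Inr (p, q)" by (cases a rule: kd.cases) auto
 have "res (dval (DRep_diff n) a) = (\<Sum>l<n. (if p = l then gl (mk KX p p) * gl (mk KY p q) else 0) -
 (if l = q then gl (mk KY p q) * gl (mk KX q q) else (0 :: 'k mat_gca)))" unfolding pq dval_simps DRep_diff_def
 by (simp add: gca_poly_sum gca_poly_diff gca_poly_mult gl_poly glin_sum[OF glin_res] glin_diff[OF glin_res] ghom_mult[OF ghom_res] res_gl isoff_def)
 (rule sum.cong, auto)
 also have "... = gl (mk KX p p) * gl (mk KY p q) - gl (mk KY p q) * gl (mk KX q q)"
 using a pq by (simp add: sum_subtractf sum.delta sum.delta')
 also have "... = (gl (mk KX p p) - gl (mk KX q q)) * gl (mk KY p q)"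
 by (simp add: left_diff_distrib gl_comm_even[of "Inl (X (q, q))"])
 finally show ?thesis using True unfolding gca_diff_gl res_gl
 by (simp add: pq isoff_def gca_diff_gl gca_poly_mult gca_poly_diff gl_poly)
 qed
 qed
qed

lemma dB_gsp:
 assumes Q: "!!K p q r. r : {p, q} ==> Q (add_mset (mk KT p q) K) ==> Q (add_mset (mk KX r r) (add_mset (mk KY p q) K))"
 and f: "f : gsp Q"
 shows "dB f : gsp Q"
proof (rule glin_maps_gsp[OF glin_dB f])
 fix w :: "letter list" assume w: "Q (mset w)"
 let ?K = "%a N. kd a = KT & (\<exists>r\<in>{rw a, cl a}. N = {#mk KX r r, mk KY (rw a) (cl a)#})"
 let ?dv = "dval (%(p, q). (pvar (X (p, p)) - pvar (X (q, q))) * pvar (Y (p, q))) :: letter => 'a mat_gca"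
 have "?dv a : gsp (?K a)" for a
 proof (cases "kd a = KT")
 case True
 have "gl (mk KX r r) * gl (mk KY (rw a) (cl a)) : (gsp (?K a) :: 'a mat_gca set)" if "r : {rw a, cl a}" for r
 using gsp_gw[of "?K a" "[mk KX r r, mk KY (rw a) (cl a)]"] that True by auto
 then show ?thesis unfolding dval_dB using True by (auto simp: left_diff_distrib intro!: gsp_diff)
 qed (simp add: dval_dB)
 then have "dw True ?dv w : gsp (%M. EX a N. a \<in># mset w & ?K a N & M = mset w - {#a#} + N)" by (rule dw_gsp)
 then have "dw True ?dv w : gsp Q"
 proof (rule gsp_mono)
 fix M assume "EX a N. a \<in># mset w & ?K a N & M = mset w - {#a#} + N"
 then obtain a r where a: "a \<in># mset w" "kd a = KT" "r : {rw a, cl a}"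
 "M = mset w - {#a#} + {#mk KX r r, mk KY (rw a) (cl a)#}" by blast
 then obtain K where K: "mset w = add_mset a K" by (metis insert_DiffM)
 have "a = mk KT (rw a) (cl a)" using mk_collapse[of a] a(2) by simp
 then have "Q (add_mset (mk KT (rw a) (cl a)) K)" using w K by simp
 then have "Q (add_mset (mk KX r r) (add_mset (mk KY (rw a) (cl a)) K))" by (rule Q[OF a(3)])
 moreover have "M = add_mset (mk KX r r) (add_mset (mk KY (rw a) (cl a)) K)" unfolding a(4) K by simp
 ultimately show "Q M" by simp
 qed
 then show "dB (gw w :: 'a mat_gca) : gsp Q" unfolding dB_gw .
qed

lemma gfilter_commute:
 assumes L: "glin L" and "!!f. f : gsp Q ==> L f : gsp Q" "!!f. f : gsp (%M. ~ Q M) ==> L f : gsp (%M. ~ Q M)"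
 shows "gfilter Q (L f) = L (gfilter Q f)"
proof (rule glin_eqI[OF glin_comp[OF glin_gf L] glin_comp[OF L glin_gf]])
 fix w
 show "gfilter Q (L (gw w)) = L (gfilter Q (gw w))"
 proof (cases "Q (mset w)")
 case True
 then have "L (gw w) : gsp Q" by (intro assms(2) gsp_gw)
 then show ?thesis using True by (simp only: gsp_def mem_Collect_eq gfilter_gw if_True)
 next
 case False
 then have "L (gw w) : gsp (%M. ~ Q M)" by (intro assms(3) gsp_gw)
 then have "gfilter Q (L (gw w)) = 0" by (rule gfilter_eq_0)
 then show ?thesis using False by (simp only: gfilter_gw if_False glin_0[OF L])
 qed
qed

lemma dB_gfilter:
 assumes Q: "!!K p q r. r : {p, q} ==> Q (add_mset (mk KX r r) (add_mset (mk KY p q) K)) \<longleftrightarrow> Q (add_mset (mk KT p q) K)"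
 shows "gfilter Q (dB f) = dB (gfilter Q f)" by (rule gfilter_commute[OF glin_dB]) (rule dB_gsp, use Q in blast, assumption)+

section \<open>Words as graphs; contracting and splitting x arcs\<close>

definition dgx :: "letter => bool" where "dgx l \<longleftrightarrow> kd l = KX & rw l = cl l"

text \<open>A letter is read as an arc from its row to its column. Diagonal x letters are weights at
  a vertex and are set aside; diagonal y and theta letters stay, as loops.\<close>

definition odm :: "letter multiset => letter multiset" where "odm M = filter_mset (%l. ~ dgx l) M"

lemma odm_simps [simp]: "odm {#} = {#}" "odm (M + N) = odm M + odm N"
 "odm (add_mset l M) = (if dgx l then odm M else add_mset l (odm M))" by (simp_all add: odm_def)

definition simple :: "nat multiset => bool" where "simple A \<longleftrightarrow> (ALL a. count A a <= 1)"

lemma simple_add: "simple (add_mset a A) \<longleftrightarrow> a \<notin># A & simple A"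
proof
 assume s: "simple (add_mset a A)"
 then have "count (add_mset a A) a <= 1" unfolding simple_def by blast
 then have 1: "count A a = 0" by simp
 have "count A b <= 1" for b using s unfolding simple_def by (cases "b = a") (use 1 in simp, metis count_add_mset)
 then show "a \<notin># A & simple A" using 1 by (simp add: simple_def count_eq_zero_iff)
next
 assume "a \<notin># A & simple A"
 then show "simple (add_mset a A)" by (auto simp: simple_def count_eq_zero_iff)
qed

text \<open>The arcs form a permutation graph on some of the vertices in \<open>P\<close>: no vertex
  is left twice or entered twice, and the same vertices are left and entered. In \<open>pt\<close>
  the off-diagonal x are gone as well.\<close>

definition pg :: "nat set => letter multiset => bool" where
 "pg P M \<longleftrightarrow> idxs M = P & rws (odm M) = cls (odm M) & simple (rws (odm M))"

definition pt :: "nat set => letter multiset => bool" where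
 "pt P M \<longleftrightarrow> pg P M & off M = 0"

abbreviation col :: "nat => nat => nat => nat" where "col p q r \<equiv> (if r = p then q else r)"

lemma rsum_gw: "rsum P n (gw w) = (\<Sum>i\<in>P \<rightarrow>\<^sub>E {..<n}. gw (map (rl i) w))"
 by (simp add: rsum_def relabel_gw del: gw_simps)

text \<open>An off-diagonal x_pq survives restriction only for index maps with equal values at p and
  q; summing over these means identifying p with q and summing over maps on
  \<open>Q\<close>.\<close>

lemma merge:
 assumes Q: "finite Q" "p ~: Q" "q : Q"
 shows "res (rsum (insert p Q) n (gw (mk KX p q # v))) =
 res (rsum Q n (gw (mk KX q q # map (rl (col p q)) v)) :: 'k::field_char_0 mat_gca)"
proof -
 have "res (rsum (insert p Q) n (gw (mk KX p q # v))) =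
 (\<Sum>(y, i)\<in>{..<n} \<times> (Q \<rightarrow>\<^sub>E {..<n}). res (gw (map (rl (i(p := y))) (mk KX p q # v)) :: 'k mat_gca))"
 unfolding rsum_gw PiE_insert_eq glin_sum[OF glin_res]
 by (subst sum.reindex[OF inj_combinator[OF Q(2)]]) (simp only: o_def case_prod_unfold)
 also have "... = (\<Sum>y<n. \<Sum>i\<in>Q \<rightarrow>\<^sub>E {..<n}. res (gw (map (rl (i(p := y))) (mk KX p q # v))))"
 by (rule sum.cartesian_product[symmetric])
 also have "... = (\<Sum>i\<in>Q \<rightarrow>\<^sub>E {..<n}. \<Sum>y<n. res (gw (map (rl (i(p := y))) (mk KX p q # v))))"
 by (rule sum.swap)
 also have "... = (\<Sum>i\<in>Q \<rightarrow>\<^sub>E {..<n}. res (gw (map (rl i) (mk KX q q # map (rl (col p q)) v))))"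
 proof (rule sum.cong[OF refl])
 fix i assume i: "i : Q \<rightarrow>\<^sub>E {..<n}"
 then have iq: "i q < n" using Q(3) by auto
 have pq: "p ~= q" using Q by auto
 have m: "map (rl i) (map (rl (col p q)) v) = map (rl (i(p := i q))) v"
 unfolding map_map by (intro map_cong refl) (auto simp: rl_def)
 have "(\<Sum>y<n. res (gw (map (rl (i(p := y))) (mk KX p q # v)) :: 'k mat_gca)) =
 (\<Sum>y<n. if y = i q then gl (mk KX (i q) (i q)) * res (gw (map (rl (i(p := i q))) v)) else 0)"
 by (rule sum.cong[OF refl]) (use pq in \<open>auto simp: ghom_mult[OF ghom_res] res_gl isoff_def rl_def\<close>)
 also have "... = res (gw (map (rl i) (mk KX q q # map (rl (col p q)) v)))"
 using iq unfolding list.map(2) m by (simp add: sum.delta ghom_mult[OF ghom_res] res_gl isoff_def rl_def)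
 finally show "(\<Sum>y<n. res (gw (map (rl (i(p := y))) (mk KX p q # v)) :: 'k mat_gca)) =
 res (gw (map (rl i) (mk KX q q # map (rl (col p q)) v)))" .
 qed
 also have "... = res (rsum Q n (gw (mk KX q q # map (rl (col p q)) v)))" unfolding rsum_gw glin_sum[OF glin_res] ..
 finally show ?thesis .
qed

lemma gw_pull_even: "isl a ==> gw (u @ a # v) = gw (a # u @ v)"
proof (induction u)
 case (Cons b u)
 have c: "gl b * (gl a * x) = gl a * (gl b * x)" for x
 by (simp only: mult.assoc[symmetric] gl_comm_even[OF Cons.prems, of "gl b"])
 show ?case by (simp only: append_Cons gw_simps(2) Cons.IH[OF Cons.prems] c)
qed simp

text \<open>Off-diagonal x arcs are contracted one after another. Each contraction shortens a cycle
  of the graph and removes an index, so the graph stays a permutation graph and the process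
  ends.\<close>

lemma pg_merge:
 assumes "finite P" "pg P (mset w)"
 shows "EX P' w'. finite P' & card P' <= card P & pt P' (mset w') &
 res (rsum P n (gw w)) = (res (rsum P' n (gw w')) :: 'k::field_char_0 mat_gca)" using assms
proof (induction "card P" arbitrary: P w rule: less_induct)
 case less
 show ?case
 proof (cases "off (mset w) = 0")
 case True
 then show ?thesis using less.prems by (intro exI[of _ P] exI[of _ w]) (simp add: pt_def)
 next
 case False
 then have "size (filter_mset isoff (mset w)) ~= 0" by (simp add: off_def)
 then obtain x where "x \<in># filter_mset isoff (mset w)" by (metis multiset_nonemptyE size_empty)
 then have "x : set w" "isoff x" by simp_all
 then obtain u v0 where w: "w = u @ x # v0" by (meson split_list)
 define p q v where "p = rw x" and "q = cl x" and "v = u @ v0"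
 have x: "x = mk KX p q" "p ~= q" using \<open>isoff x\<close> mk_collapse[of x] by (auto simp: p_def q_def isoff_def)
 have gww: "gw w = (gw (mk KX p q # v) :: 'k mat_gca)"
 unfolding w x(1)[symmetric] v_def by (rule gw_pull_even) (simp add: x(1))
 have M: "mset w = add_mset (mk KX p q) (mset v)" by (simp add: w v_def x(1))
 let ?V = "mset v" and ?B = "odm (mset v)"
 have ndx: "~ dgx (mk KX p q)" using x(2) by (simp add: dgx_def)
 from less.prems(2) have idP: "insert p (insert q (idxs ?V)) = P"
 and rc: "add_mset p (rws ?B) = add_mset q (cls ?B)" and si: "simple (add_mset p (rws ?B))"
 unfolding pg_def M using ndx by auto
 let ?Q = "P - {p}"
 have Q: "finite ?Q" "p ~: ?Q" "q : ?Q" "insert p ?Q = P" using less.prems(1) idP x(2) by auto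
 obtain r0 where r0: "rws ?B = add_mset q r0" "cls ?B = add_mset p r0" using rc x(2) by (auto simp: add_eq_conv_ex)
 have nr: "p \<notin># r0" "q \<notin># r0" "simple r0" using si unfolding r0 by (auto simp: simple_add)
 let ?c = "col p q"
 let ?w' = "mk KX q q # map (rl ?c) v"
 have r0c: "image_mset ?c r0 = r0" using nr(1) by (intro multiset.map_ident_strong) auto
 \<comment> \<open>The only arc that can become a diagonal x is x_qp, the return arc of a cycle of
   length two.\<close>
 have dx: "~ dgx (rl ?c l) \<longleftrightarrow> l ~= mk KX q p" if "l \<in># ?B" for l
 proof -
 have "rw l \<in># rws ?B" using that by auto
 then have rp: "rw l ~= p" using r0(1) nr(1) x(2) by auto
 have nd: "~ dgx l" using that by (simp add: odm_def)
 show ?thesis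
 proof
 assume "~ dgx (rl ?c l)"
 then show "l ~= mk KX q p" using x(2) by (auto simp: dgx_def)
 next
 assume ne: "l ~= mk KX q p"
 show "~ dgx (rl ?c l)"
 proof
 assume "dgx (rl ?c l)"
 then have "kd l = KX" "?c (rw l) = ?c (cl l)" by (auto simp: dgx_def)
 then have "rw l = q & cl l = p" using nd rp by (auto simp: dgx_def split: if_splits)
 then show False using ne mk_collapse[of l] \<open>kd l = KX\<close> by metis
 qed
 qed
 qed
 have od': "odm (mset ?w') = image_mset (rl ?c) (filter_mset (%l. l ~= mk KX q p) ?B)"
 proof -
 have d: "dgx (rl ?c l)" if "dgx l" for l using that by (simp add: dgx_def)
 have "odm (mset ?w') = image_mset (rl ?c) (filter_mset (%l. ~ dgx (rl ?c l)) ?V)"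
 by (simp add: dgx_def[of "Inl _"] odm_def filter_mset_image_mset o_def)
 also have "filter_mset (%l. ~ dgx (rl ?c l)) ?V = filter_mset (%l. ~ dgx (rl ?c l)) ?B"
 unfolding odm_def filter_filter_mset using d by (intro filter_mset_cong refl) auto
 also have "... = filter_mset (%l. l ~= mk KX q p) ?B" by (rule filter_mset_cong[OF refl]) (rule dx)
 finally show ?thesis .
 qed
 have rw': "rws (image_mset (rl ?c) N) = image_mset ?c (rws N)" "cls (image_mset (rl ?c) N) = image_mset ?c (cls N)" for N
 by (simp_all add: image_mset.compositionality o_def)
 have pg': "pg ?Q (mset ?w')"
 proof (cases "mk KX q p \<in># ?B")
 case False
 then have f: "filter_mset (%l. l ~= mk KX q p) ?B = ?B" by (intro filter_mset_eq_conv[THEN iffD2]) auto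
 have "idxs (mset ?w') = ?Q" using idP x(2) by (auto simp: idxs_def image_image image_Un)
 then show ?thesis unfolding pg_def od' f rw' r0 image_mset_add_mset r0c using nr x(2) by (simp add: simple_add)
 next
 case True
 then obtain B0 where B0: "?B = add_mset (mk KX q p) B0" by (metis insert_DiffM)
 have rc0: "rws B0 = r0" "cls B0 = r0" using r0 unfolding B0 by simp_all
 have "mk KX q p \<notin># B0"
 proof
 assume "mk KX q p \<in># B0"
 then have "q \<in># rws B0" by force
 then show False using rc0 nr by simp
 qed
 then have f: "filter_mset (%l. l ~= mk KX q p) ?B = B0" unfolding B0 by (auto simp: filter_mset_eq_conv)
 have "idxs (mset ?w') = ?Q" using idP x(2) by (auto simp: idxs_def image_image image_Un)
 then show ?thesis unfolding pg_def od' f rw' rc0 r0c using nr by simp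
 qed
 have "card ?Q < card P" using Q less.prems(1) by (metis card_insert_disjoint lessI)
 from less.hyps[OF this Q(1) pg'] obtain P' w' where
 "finite P'" "card P' <= card ?Q" "pt P' (mset w')"
 "res (rsum ?Q n (gw ?w')) = (res (rsum P' n (gw w')) :: 'k mat_gca)" by blast
 moreover have "res (rsum P n (gw w)) = (res (rsum ?Q n (gw ?w')) :: 'k mat_gca)"
 unfolding gww using merge[OF Q(1,2,3), of n v] unfolding Q(4) .
 ultimately show ?thesis using \<open>card ?Q < card P\<close> by (intro exI[of _ P'] exI[of _ w']) simp
 qed
qed

lemma dist_pg:
 assumes "dist P M" "finite P"
 shows "pg P M"
proof -
 have "rws M = rws (odm M) + rws (filter_mset dgx M)" "cls M = cls (odm M) + cls (filter_mset dgx M)"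
 unfolding image_mset_union[symmetric] odm_def by (metis multiset_partition union_commute)+
 moreover have "rws (filter_mset dgx M) = cls (filter_mset dgx M)" by (intro image_mset_cong) (simp add: dgx_def)
 ultimately have "rws (odm M) = cls (odm M)" "rws (odm M) \<subseteq># mset_set P"
 using assms(1) by (simp_all add: dist_def) (metis add_right_cancel, metis mset_subset_eq_add_left)
 moreover have "count (mset_set P) a <= 1" for a by (simp add: count_mset_set')
 ultimately show ?thesis using dist_idxs[OF assms] unfolding pg_def simple_def by (metis le_trans mset_subset_eq_count)
qed

text \<open>The reverse of \<open>pg_merge\<close>: while some column is repeated, a diagonal x_qq
  is pulled apart into an arc from a new index p to q. This ends in a word of type
  \<open>dist\<close>, whose contraction is GL-invariant, and by \<open>merge\<close> the
  restriction has not changed.\<close>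

lemma pg_lift:
 assumes "finite P" "pg P (mset w)"
 shows "EX F. F : GL_invariants n & F : gsp (below n) &
 res F = (res (rsum P n (gw w)) :: 'k::field_char_0 mat_gca)" using assms
proof (induction "size (filter_mset dgx (mset w))" arbitrary: P w rule: less_induct)
 case less
 show ?case
 proof (cases "dist P (mset w)")
 case True
 then have "(gw w :: 'k mat_gca) : gsp (dist P)" by (rule gsp_gw)
 moreover from this have "(gw w :: 'k mat_gca) : gsp (%M. idxs M \<subseteq> P)"
 by (rule gsp_mono) (use dist_idxs less.prems(1) in blast)
 ultimately show ?thesis
 using rsum_GL_invariant[of "gw w :: 'k mat_gca" P n] rsum_idxs[of "gw w :: 'k mat_gca" P n] less.prems(1) by blast
 next
 case False
 let ?M = "mset w"
 have idP: "idxs ?M = P" and rc: "rws (odm ?M) = cls (odm ?M)" and "simple (rws (odm ?M))"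
 using less.prems(2) unfolding pg_def by blast+
 then have si: "simple (cls (odm ?M))" by (simp only: rc[symmetric])
 have dd: "cls ?M = cls (odm ?M) + cls (filter_mset dgx ?M)" "rws ?M = rws (odm ?M) + rws (filter_mset dgx ?M)"
 unfolding image_mset_union[symmetric] odm_def by (metis multiset_partition union_commute)+
 have rcd: "rws (filter_mset dgx ?M) = cls (filter_mset dgx ?M)" by (intro image_mset_cong) (simp add: dgx_def)
 \<comment> \<open>If no column were repeated, rows and columns would both run through
   \<open>P\<close> once and the word would be of type \<open>dist\<close>.\<close>
 have "~ simple (cls ?M)"
 proof
 assume s: "simple (cls ?M)"
 have "set_mset (cls ?M) = P"
 proof -
 have "rws ?M = cls ?M" using dd rc rcd by simp
 then have "set_mset (rws ?M) = set_mset (cls ?M)" by simp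
 then show ?thesis using idP by (simp add: idxs_def)
 qed
 then have "cls ?M = mset_set P" using s less.prems(1)
 by (intro multiset_eqI) (metis count_eq_zero_iff count_mset_set(1,3) le_neq_implies_less less_one simple_def)
 then show False using False dd rc rcd by (simp add: dist_def)
 qed
 then obtain q where q2: "count (cls ?M) q \<ge> 2" unfolding simple_def by (metis Suc_1 not_less_eq_eq One_nat_def)
 have "count (cls (odm ?M)) q <= 1" using si by (simp add: simple_def)
 moreover have "count (cls ?M) q = count (cls (odm ?M)) q + count (cls (filter_mset dgx ?M)) q"
 by (subst dd(1)) (rule count_union)
 ultimately have "count (cls (filter_mset dgx ?M)) q ~= 0" using q2 by linarith
 then have "q \<in># cls (filter_mset dgx ?M)" by (metis count_eq_zero_iff)
 then obtain x where x: "x : set w" "dgx x" "cl x = q" by auto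
 have xm: "x = mk KX q q" using x mk_collapse[of x] by (simp add: dgx_def)
 obtain u v0 where w: "w = u @ x # v0" using x(1) by (meson split_list)
 define v where "v = u @ v0"
 have gww: "gw w = (gw (mk KX q q # v) :: 'k mat_gca)" unfolding w xm v_def by (rule gw_pull_even) simp
 have M: "?M = add_mset (mk KX q q) (mset v)" by (simp add: w v_def xm)
 have dq: "dgx (mk KX q q)" by (simp add: dgx_def)
 let ?B = "odm (mset v)"
 have odv: "odm ?M = ?B" unfolding M using dq by simp
 have cq: "q \<in># cls (mset v)"
 proof -
 have "count (cls (mset v)) q \<ge> 1" using q2 unfolding M by simp
 then show ?thesis by (metis count_eq_zero_iff not_one_le_zero)
 qed
 \<comment> \<open>The letter to be redirected into the new index p, so that the step into q goes
   through p. An arc into q is preferred; another diagonal x_qq is taken only if no arc enters q,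
   and then a cycle of length two through q arises.\<close>
 obtain l where l: "l : set v" "cl l = q" and ldg: "dgx l ==> q \<notin># cls ?B"
 proof (cases "q \<in># cls ?B")
 case True
 then obtain l where "l \<in># ?B" "cl l = q" by auto
 then show ?thesis using that[of l] by (auto simp: odm_def)
 next
 case False
 from cq obtain l where "l : set v" "cl l = q" by auto
 then show ?thesis using that[of l] False by blast
 qed
 obtain v1 v2 where v: "v = v1 @ l # v2" using l(1) by (meson split_list)
 obtain p where p: "p ~: P" using ex_new_if_finite[OF _ less.prems(1)] infinite_UNIV_nat by blast
 have idv: "idxs (mset v) \<subseteq> P" "q : P" using idP unfolding M by auto
 have pv: "p ~: idxs (mset v)" "p ~= q" using p idv by auto
 let ?l = "mk (kd l) (rw l) p"
 let ?v' = "v1 @ ?l # v2"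
 let ?w' = "mk KX p q # ?v'"
 have pl: "rw l ~= p" using pv(1) unfolding v by (auto simp: idxs_def)
 have bk: "map (rl (col p q)) ?v' = v"
 proof -
 have id: "rl (col p q) a = a" if "a : set v1 \<or> a : set v2" for a
 proof -
 have "rw a ~= p" "cl a ~= p" using that pv(1) unfolding v by (auto simp: idxs_def)
 then show ?thesis by (simp add: rl_def)
 qed
 have "rl (col p q) ?l = l" using pl l(2) mk_collapse[of l] by (simp add: rl_def)
 moreover have "map (rl (col p q)) v1 = v1" "map (rl (col p q)) v2 = v2" using id by (simp_all add: map_idI)
 ultimately show ?thesis unfolding v by simp
 qed
 have e: "res (rsum (insert p P) n (gw ?w')) = (res (rsum P n (gw w)) :: 'k mat_gca)"
 using merge[OF less.prems(1) p idv(2), of n ?v'] unfolding bk gww .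
 have ndl: "~ dgx ?l" using pl by (simp add: dgx_def)
 have ndp: "~ dgx (mk KX p q)" using pv(2) by (simp add: dgx_def)
 have "size (filter_mset dgx (mset ?w')) <= size (filter_mset dgx (mset v))" unfolding v using ndl ndp by simp
 then have sz: "size (filter_mset dgx (mset ?w')) < size (filter_mset dgx ?M)" unfolding M using dq by simp
 have idw': "idxs (mset ?w') = insert p P" using idP pl l(2) mk_simps unfolding M v by auto
 have pP: "p \<notin># rws (odm ?M)" "p \<notin># cls (odm ?M)" using p idP by (auto simp: idxs_def odm_def)
 have "rws (odm (mset ?w')) = cls (odm (mset ?w')) & simple (rws (odm (mset ?w')))"
 proof (cases "dgx l")
 case True
 then have lq: "rw l = q" using l(2) by (simp add: dgx_def)
 have B: "?B = odm (mset v1) + odm (mset v2)" unfolding v using True by simp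
 have "odm (mset ?w') = add_mset (mk KX p q) (add_mset ?l ?B)" unfolding B using ndl ndp by simp
 then show ?thesis using rc si pP ldg[OF True] pv(2) unfolding odv by (simp add: lq simple_add add_mset_commute)
 next
 case False
 have B: "?B = add_mset l (odm (mset v1) + odm (mset v2))" unfolding v using False by simp
 have w': "odm (mset ?w') = add_mset (mk KX p q) (add_mset ?l (odm (mset v1) + odm (mset v2)))" using ndl ndp by simp
 show ?thesis using rc si pP pv(2) unfolding odv w' B by (simp add: l(2) simple_add add_mset_commute)
 qed
 then have "pg (insert p P) (mset ?w')" unfolding pg_def using idw' by blast
 from less.hyps[OF sz _ this] less.prems(1) obtain F where
 "F : GL_invariants n" "F : gsp (below n)" "res F = (res (rsum (insert p P) n (gw ?w')) :: 'k mat_gca)" by blast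
 then show ?thesis unfolding e by blast
 qed
qed

text \<open>The image of an index map on fewer than \<open>card P\<close> indices is too small to be
  \<open>P\<close>.\<close>

lemma rsum_filter_small:
 assumes g: "g : gsp (%M. idxs M \<subseteq> P')" "finite P'" "card P' < card P"
 shows "gfilter (%M. idxs M = P) (rsum P' n g) = 0"
proof (rule gfilter_eq_0)
 show "rsum P' n g : gsp (%M. card (idxs M) <= card P')"
 proof (rule glin_maps_gsp[OF glin_rsum g(1)])
 fix w assume w: "idxs (mset w) \<subseteq> P'"
 have "card (i ` idxs (mset w)) <= card P'" for i :: "nat => nat"
 by (meson card_image_le card_mono finite_idxs g(2) le_trans w)
 then show "rsum P' n (gw w) : gsp (%M. card (idxs M) <= card P')" unfolding rsum_gw by (intro gsp_sum gsp_gw) simp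
 qed
qed (use g(3) in auto)

text \<open>An index map from \<open>P\<close> onto \<open>P\<close> is a permutation, so the part
  with full index set is a symmetrisation. This is the leading term in all arguments by the number
  of indices.\<close>

lemma rsum_filter_top:
 assumes g: "g : gsp (%M. idxs M = P)" and P: "finite P" "P \<subseteq> {..<n}"
 shows "gfilter (%M. idxs M = P) (rsum P n g) = (\<Sum>\<pi> | \<pi> permutes P. relabel \<pi> g)"
proof (rule glin_on_gsp[OF glin_comp[OF glin_gf glin_rsum] glin_SUM[OF glin_rlb] g])
 fix w assume w: "idxs (mset w) = P"
 let ?ext = "%i x. if x : P then i x else x"
 have "gfilter (%M. idxs M = P) (rsum P n (gw w)) =
 (\<Sum>i\<in>P \<rightarrow>\<^sub>E {..<n}. if i ` P = P then gw (map (rl i) w) else 0)"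
 unfolding rsum_gw gfilter_sum gfilter_gw by (simp add: w del: gw_simps)
 also have "... = (\<Sum>i\<in>{i : P \<rightarrow>\<^sub>E {..<n}. i ` P = P}. gw (map (rl i) w))"
 by (rule sum.mono_neutral_cong_right) (use P in auto)
 also have "... = (\<Sum>\<pi> | \<pi> permutes P. relabel \<pi> (gw w))"
 proof (rule sum.reindex_bij_witness[where i = "%\<pi>. restrict \<pi> P" and j = ?ext])
 fix i assume i: "i : {i : P \<rightarrow>\<^sub>E {..<n}. i ` P = P}"
 show "restrict (?ext i) P = i" using i by (intro ext) (auto simp: PiE_def extensional_def)
 have "bij_betw i P P" using i P(1) by (simp add: bij_betw_def eq_card_imp_inj_on)
 then have "bij_betw (?ext i) P P" by (rule bij_betw_cong[THEN iffD1, rotated]) simp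
 then show "?ext i : {\<pi>. \<pi> permutes P}" by (simp add: bij_imp_permutes)
 show "relabel (?ext i) (gw w) = gw (map (rl i) w)"
 unfolding relabel_gw by (intro arg_cong[where f = gw] map_rl_cong) (simp add: w)
 next
 fix \<pi> assume "\<pi> : {\<pi>. \<pi> permutes P}"
 then have \<pi>: "\<pi> permutes P" by simp
 show "?ext (restrict \<pi> P) = \<pi>" using \<pi> by (intro ext) (auto simp: permutes_def)
 show "restrict \<pi> P : {i : P \<rightarrow>\<^sub>E {..<n}. i ` P = P}"
 using permutes_image[OF \<pi>] P(2) by (auto simp: image_restrict_eq)
 qed
 finally show "gfilter (%M. idxs M = P) (rsum P n (gw w)) = (\<Sum>\<pi> | \<pi> permutes P. relabel \<pi> (gw w))" .
qed

section \<open>The Koszul complex of a permutation\<close>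

text \<open>A common multiple of the cycle lengths of every permutation of \<open>R\<close>. One
  period of this length serves all cycles at once.\<close>

definition per :: "nat set => nat" where "per R = fact (card R)"

lemma per_pos: "per R > 0" by (simp add: per_def)

text \<open>By the pigeonhole principle p returns after at most \<open>card R\<close> steps, and
  such a number divides the factorial.\<close>

lemma funpow_per:
 assumes t: "t permutes R" and R: "finite R"
 shows "(t ^^ per R) p = p"
proof (cases "p : R")
 case False
 then have "(t ^^ k) p = p" for k by (induction k) (use t in \<open>auto simp: permutes_def\<close>)
 then show ?thesis .
next
 case True
 have inR: "(t ^^ k) p : R" for k by (induction k) (use True permutes_in_image[OF t] in auto)
 have "~ inj_on (%k. (t ^^ k) p) {..card R}"
 proof
 assume "inj_on (%k. (t ^^ k) p) {..card R}"
 then have "card ((%k. (t ^^ k) p) ` {..card R}) = Suc (card R)" by (simp add: card_image)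
 moreover have "card ((%k. (t ^^ k) p) ` {..card R}) <= card R" by (rule card_mono[OF R]) (use inR in auto)
 ultimately show False by simp
 qed
 then obtain a b where ab: "a <= card R" "b <= card R" "a ~= b" "(t ^^ a) p = (t ^^ b) p" unfolding inj_on_def by auto
 then obtain a b where ab: "a < b" "b <= card R" "(t ^^ a) p = (t ^^ b) p" by (metis linorder_neqE_nat)
 have "(t ^^ a) ((t ^^ (b - a)) p) = (t ^^ a) p"
 using ab(1,3) by (simp add: funpow_add[symmetric, unfolded o_def, THEN fun_cong] flip: o_apply[of "t ^^ a"])
 moreover have "inj (t ^^ a)" using t by (metis permutes_inj inj_fn)
 ultimately have fix1: "(t ^^ (b - a)) p = p" by (simp add: inj_eq)
 have "(b - a) dvd fact (card R)" using ab by (intro dvd_fact) auto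
 then obtain c where "per R = (b - a) * c" by (auto simp: per_def)
 moreover have "(t ^^ ((b - a) * c)) p = p" by (induction c) (simp_all add: funpow_add fix1)
 ultimately show ?thesis by simp
qed

text \<open>The period is a multiple of the cycle length, so every point of a cycle is met equally
  often and this is the mean of the letter over its cycle.\<close>

definition avl :: "(nat => nat) => nat set => letter => 'k::field_char_0 mat_gca" where
 "avl t R l = (\<Sum>k<per R. cs (1 / of_nat (per R)) * gl (rl (t ^^ k) l))"

definition nu :: "(nat => nat) => nat set => 'k::field_char_0 mat_gca => 'k mat_gca" where
 "nu t R = lhom (avl t R)"

lemma good_avl: "good (avl t R :: letter => 'k::field_char_0 mat_gca)" unfolding avl_def by (rule good_sum) simp

lemmas ghom_nu = ghom_lhom[OF good_avl, folded nu_def]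
lemmas nu_gl = lhom_gl[OF good_avl, folded nu_def]
lemmas glin_nu = ghom_glin[OF ghom_nu]

lemma avl_fixed:
 assumes "t (rw l) = rw l" "t (cl l) = cl l"
 shows "avl t R l = (gl l :: 'k::field_char_0 mat_gca)"
proof -
 have "(t ^^ k) (rw l) = rw l" "(t ^^ k) (cl l) = cl l" for k by (induction k) (simp_all add: assms)
 then have "rl (t ^^ k) l = l" for k by (simp add: rl_def)
 moreover have "of_nat (per R) * (cs (1 / of_nat (per R)) * gl l) = (gl l :: 'k mat_gca)"
 using per_pos[of R] by (simp add: cs_of_nat[symmetric] mult.assoc[symmetric] cs_mult[symmetric])
 ultimately show ?thesis by (simp add: avl_def)
qed

lemma sum_cyclic_shift:
 fixes a :: "nat => 'a::ab_group_add"
 assumes "a M = a 0"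
 shows "(\<Sum>k<M. a (Suc k)) = (\<Sum>k<M. a k)"
 using sum.lessThan_Suc_shift[of a M] sum.lessThan_Suc[of a M] assms by simp

lemma avl_rl:
 assumes t: "t permutes R" "finite R"
 shows "avl t R (rl (t ^^ j) l) = (avl t R l :: 'k::field_char_0 mat_gca)"
proof (induction j)
 case (Suc j)
 let ?a = "%k. cs (1 / of_nat (per R)) * gl (rl (t ^^ k) (rl (t ^^ j) l)) :: 'k mat_gca"
 have "avl t R (rl (t ^^ Suc j) l) = (\<Sum>k<per R. ?a (Suc k))"
 unfolding avl_def by (intro sum.cong refl) (simp add: rl_rl o_def funpow_swap1)
 also have "... = (\<Sum>k<per R. ?a k)" by (rule sum_cyclic_shift) (simp add: rl_def funpow_per[OF t])
 also have "... = avl t R (rl (t ^^ j) l)" unfolding avl_def ..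
 also note Suc
 finally show ?case .
qed simp

lemma of_nat_left_commute: "x * (of_nat k * y) = of_nat k * (x * y :: 'a::ring_1)"
 by (simp only: mult.assoc[symmetric] mult_of_nat_commute[of k x, symmetric])

text \<open>Summation by parts with weights falling from M to 1.\<close>

lemma weighted_telescope:
 "(\<Sum>k<M. cs (of_nat (M - k)) * (a k - a (Suc k))) = of_nat M * a 0 - (\<Sum>k<M. a (Suc k) :: ('v, 'o::linorder, 'k::field_char_0) gca)"
proof (induction M)
 case (Suc M)
 have "(\<Sum>k<Suc M. cs (of_nat (Suc M - k)) * (a k - a (Suc k))) =
 (\<Sum>k<Suc M. cs (of_nat (M - k)) * (a k - a (Suc k)) + (a k - a (Suc k)))"
 proof (rule sum.cong[OF refl])
 fix k assume "k : {..<Suc M}"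
 then have "Suc M - k = Suc (M - k)" by auto
 then show "cs (of_nat (Suc M - k)) * (a k - a (Suc k)) = cs (of_nat (M - k)) * (a k - a (Suc k)) + (a k - a (Suc k))"
 by (simp add: cs_add distrib_right)
 qed
 also have "... = (\<Sum>k<M. cs (of_nat (M - k)) * (a k - a (Suc k))) + (a 0 - a (Suc M))"
 unfolding sum.distrib sum_lessThan_telescope' by simp
 finally show ?case unfolding Suc by (simp add: algebra_simps)
qed simp

text \<open>The weights are chosen so that the Koszul differential of this element is x_p minus the
  cycle mean of x, by \<open>weighted_telescope\<close>.\<close>

definition lam :: "(nat => nat) => nat set => nat => 'k::field_char_0 mat_gca" where
 "lam t R p = (\<Sum>k<per R. cs (of_nat (per R - k) / of_nat (per R)) * gl (mk KT ((t ^^ k) p) ((t ^^ k) p)))"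

text \<open>The Koszul differential for the differences of x along the cycles of \<open>t\<close>;
  the diagonal theta at p stands for the arc that leaves p.\<close>

definition dK :: "(nat => nat) => 'k::field_char_0 mat_gca => 'k mat_gca" where
 "dK t = gca_diff (%(p, q). if p = q then pvar (X (p, p)) - pvar (X (t p, t p)) else 0)"

definition hv :: "(nat => nat) => nat set => letter => 'k::field_char_0 mat_gca" where
 "hv t R l = (if dgx l & rw l : R then lam t R (rw l) else 0)"

definition hK :: "(nat => nat) => nat set => 'k::field_char_0 mat_gca => 'k mat_gca" where
 "hK t R = gder True (hv t R)"

lemma lam_deg1: "lam t R p : deg1" unfolding lam_def by (intro deg1_sum deg1_poly) (simp add: gl_def)

lemma der_ok_hv: "der_ok True (hv t R :: letter => 'k::field_char_0 mat_gca)" unfolding der_ok_def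
proof (intro allI)
 fix a b :: letter
 let ?e = "hv t R :: letter => 'k mat_gca"
 have d: "?e a : deg1" for a by (simp add: hv_def lam_deg1)
 have z: "?e a = 0" if "~ isl a" for a using that by (auto simp: hv_def dgx_def isl_kd)
 have o: "gl a : deg1" if "~ isl a" for a :: letter using good_gl(2)[of a a] that by simp
 consider "isl a" "isl b" | "isl a" "~ isl b" | "~ isl a" "isl b" | "~ isl a" "~ isl b" by blast
 then show "?e a * gl b + tw True (gl a) * ?e b = (if isl a \<or> isl b then 1 else - 1) * (?e b * gl a + tw True (gl b) * ?e a)"
 proof cases
 case 1
 then show ?thesis by (simp add: tw_gl gl_comm_even[of a "?e b"] gl_comm_even[of b "?e a"] add.commute)
 next
 case 2
 then show ?thesis using deg1_anticommute[OF d o, of b a] by (simp add: tw_gl z)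
 next
 case 3
 then show ?thesis using deg1_anticommute[OF d o, of a b] by (simp add: tw_gl z)
 next
 case 4
 then show ?thesis by (simp add: z)
 qed
qed

lemma hK_mult: "hK t R (f * g) = hK t R f * g + gi f * hK t R g"
 unfolding hK_def gder_mult[OF der_ok_hv] by (simp add: tw_def)
lemma hK_gl: "hK t R (gl a) = hv t R a" unfolding hK_def by (rule gder_gl[OF der_ok_hv])
lemma hK_1: "hK t R 1 = 0" unfolding hK_def by (rule gder_1[OF der_ok_hv])
lemma glin_hK: "glin (hK t R)" unfolding hK_def by (rule glin_gder)
lemma dK_mult: "dK t (f * g) = dK t f * g + gi f * dK t g" unfolding dK_def by (rule gca_diff_mult)
lemma dK_gl: "dK t (gl a) = (if kd a = KT & rw a = cl a then gl (mk KX (rw a) (rw a)) - gl (mk KX (t (rw a)) (t (rw a))) else 0)"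
 unfolding dK_def gca_diff_gl by (cases a rule: kd.cases) (auto simp: gca_poly_diff gl_poly)
lemma glin_dK: "glin (dK t)" unfolding dK_def by (rule glin_gd)
lemma dK_dK: "dK t (dK t f) = 0" unfolding dK_def by (rule gca_diff_diff)
lemma dK_gi: "dK t (gi f) = - gi (dK t f)" unfolding dK_def by (rule gca_diff_gi)

lemmas glin_gi = ghom_glin[OF ghom_gi]

lemma hK_gi: "hK t R (gi f) = - gi (hK t R (f :: 'k::field_char_0 mat_gca))"
proof (rule glin_eqI[where L = "%f. hK t R (gi f)" and M = "%f. - gi (hK t R f)"])
 fix w :: "letter list"
 show "hK t R (gi (gw w)) = - gi (hK t R (gw w :: 'k mat_gca))"
 proof (induction w)
 case (Cons a w)
 have l: "gi (lam t R p) = - (lam t R p :: 'k mat_gca)" for p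
 unfolding lam_def glin_sum[OF glin_gi] glin_cs[OF glin_gi] gi_gl by (simp add: sum_negf)
 have "hK t R (gi (gl a)) = - gi (hv t R a :: 'k mat_gca)"
 unfolding gi_gl by (cases "isl a") (auto simp: hK_gl hv_def l dgx_def isl_kd glin_uminus[OF glin_hK] glin_0[OF glin_gi])
 then show ?case unfolding gw_simps(2) ghom_mult[OF ghom_gi] hK_mult hK_gl Cons glin_add[OF glin_gi] by (simp add: gi_gi)
 qed (simp add: ghom_1[OF ghom_gi] hK_1 glin_0[OF glin_gi])
qed (intro glin_neg glin_comp[OF glin_hK glin_gi] glin_comp[OF glin_gi glin_hK])+

text \<open>The graded commutator of two odd derivations is an even derivation. On letters it is the
  identity minus the cycle mean, so on products it counts deviations from the mean.\<close>

definition EK :: "(nat => nat) => nat set => 'k::field_char_0 mat_gca => 'k mat_gca" where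
 "EK t R f = dK t (hK t R f) + hK t R (dK t f)"

lemma glin_EK: "glin (EK t R)"
 unfolding EK_def[abs_def] by (intro glin_plus glin_comp[OF glin_dK glin_hK] glin_comp[OF glin_hK glin_dK])

lemma EK_mult: "EK t R (f * g) = EK t R f * g + f * EK t R g"
 unfolding EK_def hK_mult dK_mult glin_add[OF glin_dK] glin_add[OF glin_hK] dK_gi hK_gi gi_gi by (simp add: algebra_simps)

lemma EK_1: "EK t R 1 = 0" using EK_mult[of t R 1 1] by simp

definition klet :: "nat set => nat set => letter => bool" where
 "klet R P l \<longleftrightarrow> rw l = cl l & (kd l = KX & rw l : P \<or> kd l = KT & rw l : R)"

text \<open>\<open>P\<close> holds all indices and \<open>R\<close> those that carry an arc; the
  indices in \<open>P - R\<close>, called bare, occur in diagonal x letters only.\<close>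

locale permutation_graph =
 fixes t :: "nat => nat" and R P :: "nat set"
 assumes t: "t permutes R" and P: "finite P" "R \<subseteq> P"
begin

lemma R: "finite R" using P by (rule rev_finite_subset)

lemma tk: "(t ^^ k) p : R \<longleftrightarrow> p : R"
 by (induction k arbitrary: p) (simp_all add: permutes_in_image[OF t] funpow_swap1)

lemma t_fix: "p ~: R ==> t p = p" using t by (auto simp: permutes_def)

lemma scaled_telescope:
 fixes a :: "nat => 'k::field_char_0 mat_gca"
 assumes "a (per R) = a 0"
 shows "(\<Sum>k<per R. cs (of_nat (per R - k) / of_nat (per R)) * (a k - a (Suc k))) =
 a 0 - (\<Sum>k<per R. cs (1 / of_nat (per R)) * a k)"
proof -
 let ?M = "of_nat (per R) :: 'k"
 have "(\<Sum>k<per R. cs (of_nat (per R - k) / ?M) * (a k - a (Suc k))) =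
 cs (1 / ?M) * (\<Sum>k<per R. cs (of_nat (per R - k)) * (a k - a (Suc k)))"
 unfolding sum_distrib_left mult.assoc[symmetric] cs_mult[symmetric] by simp
 also have "... = cs (1 / ?M) * (cs ?M * a 0 - (\<Sum>k<per R. a k))"
 by (simp only: weighted_telescope sum_cyclic_shift[of a, OF assms]) (simp only: cs_of_nat)
 also have "... = a 0 - (\<Sum>k<per R. cs (1 / ?M) * a k)"
 using per_pos[of R] by (simp add: right_diff_distrib sum_distrib_left mult.assoc[symmetric] cs_mult[symmetric])
 finally show ?thesis .
qed

text \<open>For x at p the value is \<open>dK t (lam t R p)\<close>, for theta at p it is
  \<open>lam t R p - lam t R (t p)\<close>; both are the same weighted telescoping sum. An x at a
  bare index is its own mean and gives 0.\<close>

lemma EK_gl: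
 assumes l: "klet R P l"
 shows "EK t R (gl l) = gl l - (avl t R l :: 'k::field_char_0 mat_gca)"
proof -
 define p where "p = rw l"
 have lp: "rw l = p" "cl l = p" using l by (auto simp: klet_def p_def)
 have l_eq: "l = mk (kd l) p p" using mk_collapse[of l] lp by simp
 have av: "avl t R l = (\<Sum>k<per R. cs (1 / of_nat (per R)) * gl (mk (kd l) ((t ^^ k) p) ((t ^^ k) p)) :: 'k mat_gca)"
 unfolding avl_def rl_def lp ..
 show ?thesis
 proof (cases "kd l = KX & p ~: R")
 case True
 then have "avl t R l = (gl l :: 'k mat_gca)" by (intro avl_fixed) (simp_all add: lp t_fix)
 then show ?thesis using True lp by (simp add: EK_def hK_gl hv_def dK_gl glin_0[OF glin_dK] glin_0[OF glin_hK])
 next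
 case False
 then have pR: "p : R" using l lp by (auto simp: klet_def)
 let ?a = "%k. gl (mk (kd l) ((t ^^ k) p) ((t ^^ k) p)) :: 'k mat_gca"
 have "EK t R (gl l) = (\<Sum>k<per R. cs (of_nat (per R - k) / of_nat (per R)) * (?a k - ?a (Suc k)))"
 proof (cases "kd l = KX")
 case True
 have "EK t R (gl l) = dK t (lam t R p :: 'k mat_gca)"
 using True pR lp by (simp add: EK_def hK_gl hv_def dK_gl dgx_def glin_0[OF glin_hK])
 also have "... = (\<Sum>k<per R. cs (of_nat (per R - k) / of_nat (per R)) * (?a k - ?a (Suc k)))"
 unfolding lam_def glin_sum[OF glin_dK] glin_cs[OF glin_dK] dK_gl True by simp
 finally show ?thesis .
 next
 case kT: False
 then have T: "kd l = KT" using l by (auto simp: klet_def)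
 have "t p : R" using tk[of 1 p] pR by simp
 then have "EK t R (gl l) = lam t R p - (lam t R (t p) :: 'k mat_gca)"
 using T pR lp by (simp add: EK_def hK_gl hv_def dK_gl dgx_def glin_0[OF glin_dK] glin_diff[OF glin_hK] mk_simps(1-3)
 del: mk.simps)
 also have "... = (\<Sum>k<per R. cs (of_nat (per R - k) / of_nat (per R)) * (?a k - ?a (Suc k)))"
 unfolding lam_def T by (simp add: sum_subtractf[symmetric] right_diff_distrib funpow_swap1)
 finally show ?thesis .
 qed
 also have "... = ?a 0 - (\<Sum>k<per R. cs (1 / of_nat (per R)) * ?a k)"
 by (rule scaled_telescope) (simp add: funpow_per[OF t R])
 finally show ?thesis unfolding av using l_eq by simp
 qed
qed

lemma klet_rl: "klet R P l ==> klet R P (rl (t ^^ k) l)"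
proof -
 assume l: "klet R P l"
 have "(t ^^ k) p : P" if "p : P" for p
 proof (cases "p : R")
 case True then show ?thesis using tk[of k p] P(2) by blast
 next
 case False
 then have "(t ^^ k) p = p" by (induction k) (simp_all add: t_fix)
 then show ?thesis using that by simp
 qed
 then show ?thesis using l by (auto simp: klet_def tk)
qed

lemma EK_avl: "klet R P l ==> EK t R (avl t R l) = (0 :: 'k::field_char_0 mat_gca)"
proof -
 assume l: "klet R P l"
 have "EK t R (avl t R l) = (\<Sum>k<per R. cs (1 / of_nat (per R)) * (gl (rl (t ^^ k) l) - (avl t R l :: 'k mat_gca)))"
 unfolding avl_def[of t R l] glin_sum[OF glin_EK] glin_cs[OF glin_EK]
 by (intro sum.cong refl) (simp add: EK_gl[OF klet_rl[OF l]] avl_rl[OF t R] avl_def[of t R l, symmetric])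
 also have "... = avl t R l - of_nat (per R) * (cs (1 / of_nat (per R)) * avl t R l)"
 by (simp add: right_diff_distrib sum_subtractf avl_def[of t R l, symmetric])
 also have "of_nat (per R) * (cs (1 / of_nat (per R)) * avl t R l) = (avl t R l :: 'k mat_gca)"
 using per_pos[of R] by (simp add: cs_of_nat[symmetric] mult.assoc[symmetric] cs_mult[symmetric])
 finally show ?thesis by simp
qed

definition bare :: "letter => bool" where
 "bare l \<longleftrightarrow> dgx l & rw l : P - R"

text \<open>The second clause keeps track of the index set: a bare index is visible only through its
  diagonal x letters, so at least one has to be there.\<close>

definition kq :: "letter multiset => bool" where
 "kq M \<longleftrightarrow> (\<forall>l\<in>#M. klet R P l) & (\<forall>p\<in>P - R. mk KX p p \<in># M)"

text \<open>A filtration whose level k is spanned by products of a bare word, cycle means and at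
  most k deviations of letters from their means. It takes the place of an eigenspace decomposition
  of \<open>EK\<close>.\<close>

inductive V :: "nat => 'k::field_char_0 mat_gca => bool" where
 unit: "kq (mset b) ==> \<forall>l\<in>set b. bare l ==> V 0 (gw b)"
| null: "klet R P l ==> V k f ==> V k (avl t R l * f)"
| eig: "klet R P l ==> V k f ==> V (Suc k) ((gl l - avl t R l) * f)"
| add: "V k f ==> V k g ==> V k (f + g)"
| scale: "V k f ==> V k (cs c * f)"
| up: "V k f ==> V (Suc k) f"

lemma V_diff: "V k f ==> V k g ==> V k (f - g)" using V.add[OF _ V.scale[of k g "-1"], of f] by (simp add: cs_uminus)

lemma EK_bare: "\<forall>l\<in>set b. bare l ==> EK t R (gw b) = (0 :: 'k::field_char_0 mat_gca)"
proof (induction b)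
 case (Cons l b)
 have "klet R P l" using Cons.prems by (auto simp: bare_def klet_def dgx_def)
 moreover have "avl t R l = (gl l :: 'k mat_gca)" using Cons.prems by (intro avl_fixed) (auto simp: bare_def dgx_def t_fix)
 ultimately have "EK t R (gl l) = (0 :: 'k mat_gca)" by (simp add: EK_gl)
 then show ?case using Cons by (simp add: EK_mult)
qed (simp add: EK_1)

text \<open>\<open>EK\<close> is a derivation that vanishes on bare letters and on means and fixes
  deviations, so it multiplies a product of k deviations by k, up to lower level. There is no level
  below 0, hence the separate clause.\<close>

lemma V_EK: "V k (f :: 'k::field_char_0 mat_gca) ==>
 (k = 0 --> EK t R f = 0) & (ALL j. k = Suc j --> V j (EK t R f - of_nat k * f))"
proof (induction rule: V.induct)
 case (unit b)
 then show ?case by (simp add: EK_bare del: gw_simps)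
next
 case (null l k f)
 have e: "EK t R (avl t R l * f) = avl t R l * EK t R f" by (simp add: EK_mult EK_avl[OF null(1)])
 have "EK t R (avl t R l * f) - of_nat k * (avl t R l * f) = avl t R l * (EK t R f - of_nat k * f)"
 unfolding e by (simp only: right_diff_distrib of_nat_left_commute)
 then have "V j (EK t R (avl t R l * f) - of_nat k * (avl t R l * f))" if "k = Suc j" for j
 using V.null[OF null(1)] null(3) that by metis
 then show ?case using null(3) e by simp
next
 case (eig l k f)
 let ?y = "gl l - avl t R l :: 'k mat_gca"
 have "EK t R ?y = ?y" by (simp add: glin_diff[OF glin_EK] EK_gl[OF eig(1)] EK_avl[OF eig(1)])
 then have e: "EK t R (?y * f) - of_nat (Suc k) * (?y * f) = ?y * (EK t R f - of_nat k * f)"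
 by (simp add: EK_mult right_diff_distrib distrib_right of_nat_left_commute)
 have "V k (?y * (EK t R f - of_nat k * f))"
 proof (cases k)
 case 0
 then have "EK t R f - of_nat k * f = 0" using eig by simp
 then show ?thesis using V.scale[OF eig(2), of 0] 0 by simp
 next
 case (Suc j)
 then show ?thesis using eig V.eig[OF eig(1), of j] by simp
 qed
 then show ?case unfolding e by simp
next
 case (add k f g)
 have "EK t R (f + g) - of_nat k * (f + g) = (EK t R f - of_nat k * f) + (EK t R g - of_nat k * g)"
 by (simp add: glin_add[OF glin_EK] algebra_simps)
 then have "V j (EK t R (f + g) - of_nat k * (f + g))" if "k = Suc j" for j
 using V.add[of j "EK t R f - of_nat k * f" "EK t R g - of_nat k * g"] add(3,4) that by metis
 then show ?case using add(3,4) glin_add[OF glin_EK, of t R f g] by auto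
next
 case (scale k f c)
 have "EK t R (cs c * f) - of_nat k * (cs c * f) = cs c * (EK t R f - of_nat k * f)"
 by (simp add: glin_cs[OF glin_EK] right_diff_distrib of_nat_left_commute)
 then have "V j (EK t R (cs c * f) - of_nat k * (cs c * f))" if "k = Suc j" for j
 using V.scale[of j "EK t R f - of_nat k * f" c] scale(2) that by metis
 then show ?case using scale(2) glin_cs[OF glin_EK, of t R c f] by auto
next
 case (up k f)
 have "V k (EK t R f - of_nat (Suc k) * f)"
 proof (cases k)
 case 0
 then have "EK t R f - of_nat (Suc k) * f = cs (- 1) * f" using up by (simp add: cs_uminus)
 then show ?thesis using V.scale[OF up(1), of "-1"] by simp
 next
 case (Suc j)
 then have "V k (EK t R f - of_nat k * f)" using up by (auto intro: V.up)
 from V_diff[OF this up(1)] show ?thesis by (simp add: distrib_right diff_diff_eq add.commute)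
 qed
 then show ?case by simp
qed

lemma kq_add: "klet R P l ==> kq M ==> kq (add_mset l M)" by (auto simp: kq_def)

lemma avl_gsp: "klet R P l ==> avl t R l : gsp (%M. EX l'. klet R P l' & M = {#l'#})"
 unfolding avl_def by (intro gsp_sum gsp_cs gl_gsp) (use klet_rl in blast)

lemma V_gsp: "V k (f :: 'k::field_char_0 mat_gca) ==> f : gsp kq"
proof (induction rule: V.induct)
 case (unit b)
 then show ?case by (intro gsp_gw)
next
 case (null l k f)
 show ?case by (rule gsp_mult[OF avl_gsp[OF null(1)] null(3)]) (auto intro: kq_add)
next
 case (eig l k f)
 have "gl l - avl t R l : (gsp (%M. EX l'. klet R P l' & M = {#l'#}) :: 'k mat_gca set)"
 by (intro gsp_diff avl_gsp gl_gsp eig(1)) (use eig(1) in blast)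
 then show ?case by (rule gsp_mult[OF _ eig(3)]) (auto intro: kq_add)
qed (auto intro: gsp_add gsp_cs)

lemma gw_partition_even:
 assumes "!!l. l : set w ==> Q l ==> isl l"
 shows "gw w = gw (filter (%l. ~ Q l) w) * (gw (filter Q w) :: 'k::field_char_0 mat_gca)" using assms
proof (induction w)
 case (Cons l w)
 show ?case
 proof (cases "Q l")
 case True
 then have "isl l" using Cons.prems by simp
 then have "gl l * (gw (filter (%l. ~ Q l) w) * x) = gw (filter (%l. ~ Q l) w) * (gl l * x :: 'k mat_gca)" for x
 unfolding mult.assoc[symmetric] by (subst gl_comm_even) simp_all
 then show ?thesis using Cons True by simp
 qed (use Cons in \<open>simp add: mult.assoc\<close>)
qed simp

text \<open>Each letter is its cycle mean plus its deviation. Bare letters coincide with their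
  means, so they are collected at the end of the word and serve as the starting point.\<close>

lemma V_of_gsp:
 assumes "f : gsp kq"
 shows "EX k. V k (f :: 'k::field_char_0 mat_gca)"
proof -
 have up: "V (k + j) f" if "V k f" for k j and f :: "'k mat_gca" by (induction j) (use that V.up in auto)
 show ?thesis using assms
 proof (induction rule: gsp_induct)
 case (add f g)
 then obtain k j where "V k f" "V j g" by blast
 then have "V (k + j) f" "V (k + j) g" using up[of k f j] up[of j g k] by (simp_all add: add.commute)
 then show ?case using V.add by blast
 next
 case (word c w)
 let ?b = "filter bare w" and ?u = "filter (%l. ~ bare l) w"
 have lets: "klet R P l" if "l : set w" for l using word that by (auto simp: kq_def)
 have "V 0 (gw ?b)" using word by (intro V.unit) (auto simp: kq_def bare_def dgx_def)
 have 1: "EX k. V k (gw u * gw ?b :: 'k mat_gca)" if "\<forall>l\<in>set u. klet R P l" for u using that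
 proof (induction u)
 case Nil
 then show ?case using \<open>V 0 (gw ?b)\<close> by auto
 next
 case (Cons l u)
 then obtain k where k: "V k (gw u * gw ?b :: 'k mat_gca)" by auto
 have l: "klet R P l" using Cons.prems by simp
 have "V (Suc k) (avl t R l * (gw u * gw ?b) + (gl l - avl t R l) * (gw u * gw ?b :: 'k mat_gca))"
 using V.add[OF V.up[OF V.null[OF l k]] V.eig[OF l k]] .
 then show ?case by (intro exI[of _ "Suc k"]) (simp add: distrib_right[symmetric] mult.assoc)
 qed
 have "gw w = gw ?u * (gw ?b :: 'k mat_gca)" by (rule gw_partition_even) (auto simp: bare_def dgx_def isl_kd)
 moreover obtain k where "V k (gw ?u * gw ?b :: 'k mat_gca)" using 1[of ?u] lets by auto
 ultimately have "V k (cs c * gw w :: 'k mat_gca)" by (simp only: V.scale)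
 then show ?case by blast
 next
 show "EX k. V k (0 :: 'k mat_gca)"
 proof -
 \<comment> \<open>Zero enters a level only as a multiple of some member, so one is exhibited: the
   word with every bare x once.\<close>
 obtain bs where bs: "set bs = (%p. mk KX p p) ` (P - R)" using finite_list[of "(%p. mk KX p p) ` (P - R)"] P(1) by auto
 have "V 0 (gw bs :: 'k mat_gca)" by (rule V.unit) (auto simp: kq_def bs klet_def bare_def dgx_def)
 then show ?thesis using V.scale[of 0 _ 0] by fastforce
 qed
 qed
qed

lemma V0_nu: "V 0 (f :: 'k::field_char_0 mat_gca) ==> \<exists>g\<in>gsp kq. f = nu t R g"
proof (induction "0 :: nat" f rule: V.induct)
 case (unit b)
 have "nu t R (gw b) = (gw b :: 'k mat_gca)" using unit(2)
 proof (induction b)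
 case (Cons l b)
 have "avl t R l = (gl l :: 'k mat_gca)" using Cons.prems by (intro avl_fixed) (auto simp: bare_def dgx_def t_fix)
 then show ?case using Cons by (simp add: ghom_mult[OF ghom_nu] nu_gl)
 qed (simp add: ghom_1[OF ghom_nu])
 then show ?case using gsp_gw[of kq b] unit(1) by metis
next
 case (null l f)
 then obtain g where g: "g : gsp kq" "f = nu t R g" by blast
 have "gl l * g : gsp kq" by (rule gsp_mult[OF gl_gsp[of "%M. M = {#l#}"] g(1)]) (auto intro: kq_add null(1))
 then show ?case by (intro bexI[of _ "gl l * g"]) (simp_all add: g ghom_mult[OF ghom_nu] nu_gl)
next
 case (add f g)
 then obtain f' g' where "f' : gsp kq" "f = nu t R f'" "g' : gsp kq" "g = nu t R g'" by blast
 then show ?case by (intro bexI[of _ "f' + g'"]) (simp_all add: gsp_add glin_add[OF glin_nu])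
next
 case (scale f c)
 then obtain g where "g : gsp kq" "f = nu t R g" by blast
 then show ?case by (intro bexI[of _ "cs c * g"]) (simp_all add: gsp_cs glin_cs[OF glin_nu])
qed

lemma hK_gsp: "f : gsp kq ==> hK t R f : (gsp kq :: 'k::field_char_0 mat_gca set)"
proof (rule glin_maps_gsp[OF glin_hK])
 fix w assume w: "kq (mset w)"
 let ?K = "%a N. dgx a & rw a : R & (\<exists>p\<in>R. N = {#mk KT p p#})"
 have "hv t R a : (gsp (?K a) :: 'k mat_gca set)" for a
 unfolding hv_def lam_def by (auto intro!: gsp_sum gsp_cs gl_gsp simp: tk)
 then have "dw True (hv t R) w : (gsp (%M. EX a N. a \<in># mset w & ?K a N & M = mset w - {#a#} + N) :: 'k mat_gca set)"
 by (rule dw_gsp)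
 then have "dw True (hv t R) w : (gsp kq :: 'k mat_gca set)"
 proof (rule gsp_mono)
 fix M assume "EX a N. a \<in># mset w & ?K a N & M = mset w - {#a#} + N"
 then obtain a p where a: "a \<in># mset w" "dgx a" "rw a : R" "p : R" "M = mset w - {#a#} + {#mk KT p p#}" by blast
 obtain K where K: "mset w = add_mset a K" using a(1) by (metis insert_DiffM)
 have "M = add_mset (mk KT p p) K" unfolding a(5) K by simp
 \<comment> \<open>The letter that the homotopy replaces sits on \<open>R\<close>, so the bare x
   letters are kept.\<close>
 moreover have "mk KX q q \<in># K" if "q : P - R" for q
 proof -
 have "mk KX q q \<in># add_mset a K" using w that unfolding K kq_def by blast
 moreover have "a ~= mk KX q q" using a(3) that by auto
 ultimately show ?thesis by auto
 qed
 ultimately show "kq M" using w a(4) unfolding K kq_def by (auto simp: klet_def)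
 qed
 then show "hK t R (gw w) : (gsp kq :: 'k mat_gca set)" unfolding hK_def gder_gw[OF der_ok_hv] .
qed

text \<open>For a cycle f of level k, \<open>EK t R f\<close> is a boundary, so k f is a boundary
  minus \<open>EK t R f - k f\<close>, which is a cycle of lower level. Division by k uses
  characteristic 0. Level 0 consists of values of the averaging homomorphism.\<close>

theorem koszul_homology:
 assumes "f : gsp kq" "dK t f = (0 :: 'k::field_char_0 mat_gca)"
 shows "\<exists>g\<in>gsp kq. \<exists>H\<in>gsp kq. f = nu t R g + dK t H"
proof -
 have dE: "dK t (EK t R f) = EK t R (dK t f)" for f :: "'k mat_gca"
 unfolding EK_def glin_add[OF glin_dK] dK_dK glin_0[OF glin_hK] by simp
 have "EX v. V 0 v & (\<exists>H\<in>gsp kq. f = v + dK t H)" if "V k f" "dK t f = 0" for k and f :: "'k mat_gca" using that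
 proof (induction k arbitrary: f)
 case 0
 then show ?case by (intro exI[of _ f]) (auto intro!: bexI[of _ 0] simp: glin_0[OF glin_dK])
 next
 case (Suc k)
 let ?e = "EK t R f - of_nat (Suc k) * f"
 let ?c = "of_nat (Suc k) :: 'k"
 have V: "V k ?e" using V_EK[OF Suc.prems(1)] by blast
 have "dK t (of_nat (Suc k) * f) = of_nat (Suc k) * dK t f" using glin_cs[OF glin_dK, of t ?c f] by (simp only: cs_of_nat)
 then have "dK t ?e = 0" unfolding glin_diff[OF glin_dK] dE Suc.prems(2) by (simp add: glin_0[OF glin_EK])
 from Suc.IH[OF V this] obtain v H where vH: "V 0 v" "H : gsp kq" "?e = v + dK t H" by blast
 have Ef: "EK t R f = dK t (hK t R f)" unfolding EK_def Suc.prems(2) by (simp add: glin_0[OF glin_hK])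
 have "cs ?c * f = dK t (hK t R f) - (v + dK t H)" unfolding vH(3)[symmetric] Ef[symmetric] cs_of_nat by simp
 then have "cs (inverse ?c) * (cs ?c * f) = cs (inverse ?c) * (dK t (hK t R f) - (v + dK t H))" by simp
 then have "f = cs (inverse ?c) * (dK t (hK t R f) - (v + dK t H))" using cs_inverse[of ?c f] by (simp del: of_nat_Suc)
 also have "... = cs (- inverse ?c) * v + dK t (cs (inverse ?c) * (hK t R f - H))"
 by (simp add: glin_cs[OF glin_dK] glin_diff[OF glin_dK] cs_uminus algebra_simps)
 finally show ?case using V.scale[OF vH(1)] gsp_cs[OF gsp_diff[OF hK_gsp[OF V_gsp[OF Suc.prems(1)]] vH(2)]] by blast
 qed
 then show ?thesis using V_of_gsp[OF assms(1)] assms(2) V0_nu by metis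
qed

end

section \<open>From permutation words to the Koszul complex\<close>

lemma gl_odd_move: "~ isl a ==> gl a * gw v = gi (gw v) * (gl a :: ('v, 'o::linorder, 'k::field_char_0) gca)"
proof (induction v)
 case (Cons b v)
 have "gl a * gl b = gi (gl b) * (gl a :: ('v, 'o, 'k) gca)"
 proof (cases "isl b")
 case True
 then show ?thesis using gl_comm_even[of b "gl a :: ('v, 'o, 'k) gca"] by (simp add: gi_gl)
 next
 case False
 have "gl a * gl b = - (gl b * gl a :: ('v, 'o, 'k) gca)" by (rule gl_anticommute[OF Cons.prems False])
 then show ?thesis using False by (simp add: gi_gl)
 qed
 then have "gl a * gl b * gw v = gi (gl b) * (gl a * gw v :: ('v, 'o, 'k) gca)" by (simp only: mult.assoc)
 then show ?case using Cons by (simp only: gw_simps ghom_mult[OF ghom_gi] mult.assoc simp_thms)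
qed (simp add: ghom_1[OF ghom_gi])

lemma gw_repeat:
 assumes "~ distinct (filter (%a. ~ isl a) w)"
 shows "gw w = (0 :: ('v, 'o::linorder, 'k::field_char_0) gca)" using assms
proof (induction w)
 case (Cons a w)
 show ?case
 proof (cases "distinct (filter (%a. ~ isl a) w)")
 case False
 then show ?thesis using Cons by simp
 next
 case True
 then have a: "~ isl a" "a : set w" using Cons.prems by (auto split: if_splits)
 then obtain u v where w: "w = u @ a # v" by (meson split_list)
 have "gl a * (gw u * (gl a * gw v)) = gi (gw u) * (gl a * gl a) * (gw v :: ('v, 'o, 'k) gca)"
 unfolding mult.assoc[symmetric] gl_odd_move[OF a(1), of u] ..
 moreover have "gl a * gl a = (0 :: ('v, 'o, 'k) gca)" by (rule gca_neg_self) (rule gl_anticommute[OF a(1) a(1)])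
 ultimately show ?thesis by (simp add: w)
 qed
qed simp

lemma gw_even_mset:
 assumes "\<forall>x\<in>set xs. isl x" "mset xs = mset ys"
 shows "gw xs = (gw ys :: ('v, 'o::linorder, 'k::field_char_0) gca)"
proof -
 have "\<forall>x\<in>set ys. isl x" using assms by (metis mset_eq_setD)
 then have e: "map Inl (map projl xs) = xs" "map Inl (map projl ys) = ys" using assms(1) by (auto simp: map_idI)
 have "gw (map Inl (map projl xs) @ []) = (gw (map Inl (map projl ys) @ []) :: ('v, 'o, 'k) gca)"
 by (rule supersym_even_mset[OF supersym_gw]) (use assms(2) in simp)
 then show ?thesis unfolding append_Nil2 e .
qed

definition tgr :: "(nat => nat) => letter => letter" where
 "tgr t l = (if kd l = KT then mk KT (rw l) (t (rw l)) else l)"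

definition tdg :: "letter => letter" where
 "tdg l = (if kd l = KT then mk KT (rw l) (rw l) else l)"

definition trows :: "letter list => nat set" where
 "trows u = rw ` {l : set u. kd l = KT}"

lemma mset_sorted_list_of_set [simp]: "mset (sorted_list_of_set S) = mset_set S"
 by (metis mset_sorted_list_of_multiset sorted_list_of_mset_set)

definition ylist :: "(nat => nat) => nat set => letter list" where
 "ylist t S = map (%p. mk KY p (t p)) (sorted_list_of_set S)"

text \<open>On a fixed permutation every index of \<open>R\<close> carries exactly one arc, so the y
  arcs are determined by the thetas: they fill the rows that no theta uses.\<close>

definition Hw :: "(nat => nat) => nat set => letter list => letter list" where
 "Hw t R u = map (tgr t) u @ ylist t (R - trows u)"

definition Hz :: "(nat => nat) => nat set => 'k::field_char_0 mat_gca => 'k mat_gca" where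
 "Hz t R = glift (%u. gw (Hw t R u))"

lemma glin_Hz: "glin (Hz t R)" by (simp add: Hz_def glin_glift)

lemma isl_tgr: "isl (tgr t l) = isl l" by (simp add: tgr_def isl_kd)

lemma Hz_gw: "Hz t R (gw u) = (gw (Hw t R u) :: 'k::field_char_0 mat_gca)" unfolding Hz_def
proof (rule glift_gw, rule supersymI)
 fix u v and a b :: letter
 have s: "trows (u @ a # b # v) = trows (u @ b # a # v)" by (auto simp: trows_def)
 show "gw (Hw t R (u @ a # b # v)) = (gw (Hw t R (u @ b # a # v)) :: 'k mat_gca)" if "isl a \<or> isl b"
 unfolding Hw_def s map_append list.map append_assoc append_Cons by (rule gw_swap_even) (use that isl_tgr in blast)
 show "gw (Hw t R (u @ a # b # v)) = - (gw (Hw t R (u @ b # a # v)) :: 'k mat_gca)" if "~ isl a" "~ isl b"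
 unfolding Hw_def s map_append list.map append_assoc append_Cons by (rule gw_swap_odd) (use that isl_tgr in blast)+
qed

text \<open>Forgets the arcs: a theta on an arc of \<open>t\<close> is recorded at its row, and a y
  on such an arc becomes 1. All other arcs, and every x arc, go to 0.\<close>

definition kapv :: "(nat => nat) => nat set => letter => 'k::field_char_0 mat_gca" where
 "kapv t R l = (if dgx l then gl l else if rw l : R & cl l = t (rw l) then
 (case kd l of KX => 0 | KY => 1 | KT => gl (mk KT (rw l) (rw l))) else 0)"

lemma good_kapv: "good (kapv t R :: letter => 'k::field_char_0 mat_gca)" unfolding good_def
proof (intro conjI allI impI)
 fix a :: letter and f :: "'k mat_gca"
 show "kapv t R a * f = f * kapv t R a" if "isl a"
 using that by (auto simp: kapv_def gl_comm_even[of a f] isl_kd split: kind.splits)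
 show "(kapv t R a :: 'k mat_gca) : deg1" if "~ isl a" using that by (auto simp: kapv_def isl_kd dgx_def gl_def)
qed

definition kap :: "(nat => nat) => nat set => 'k::field_char_0 mat_gca => 'k mat_gca" where
 "kap t R = lhom (kapv t R)"

lemmas ghom_kap = ghom_lhom[OF good_kapv, folded kap_def]
lemmas kap_gl = lhom_gl[OF good_kapv, folded kap_def]
lemmas glin_kap = ghom_glin[OF ghom_kap]

text \<open>On the arc from p to \<open>t p\<close> the differential of theta is the difference of
  the x at p and at \<open>t p\<close>, times y; with y turned into 1 this is the Koszul
  differential.\<close>

lemma kap_dB: "kap t R (dB f) = dK t (kap t R (f :: 'k::field_char_0 mat_gca))"
proof (rule glin_eqI[OF glin_comp[OF glin_kap glin_dB] glin_comp[OF glin_dK glin_kap]])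
 fix w :: "letter list"
 show "kap t R (dB (gw w)) = dK t (kap t R (gw w :: 'k mat_gca))" unfolding dB_def dK_def
 proof (rule chain_map[OF ghom_kap _ _ subset_UNIV], fold dK_def)
 fix a :: letter
 show "kap t R (gi (gl a)) = gi (kap t R (gl a :: 'k mat_gca))" by (rule ghom_gi_commute[OF ghom_kap])
 (auto simp: kap_gl kapv_def isl_kd dgx_def gi_gl glin_0[OF glin_gi] ghom_1[OF ghom_gi] split: kind.splits)
 have "dgx (mk KX p p)" for p by (simp add: dgx_def)
 then show "kap t R (dval (%(p, q). (pvar (X (p, p)) - pvar (X (q, q))) * pvar (Y (p, q))) a) = dK t (kap t R (gl a :: 'k mat_gca))"
 unfolding dval_dB kap_gl
 by (auto simp: kapv_def glin_0[OF glin_kap] glin_0[OF glin_dK] ghom_mult[OF ghom_kap] glin_diff[OF glin_kap] kap_gl dK_gl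
 dgx_def isl_kd gca_diff_1[folded dK_def] simp del: mk.simps split: kind.splits)
 (simp_all add: dK_def gca_diff_1)
 qed
qed

definition arcs :: "letter multiset => (nat \<times> nat) set" where
 "arcs M = (%l. (rw l, cl l)) ` set_mset (odm M)"

lemma arcs_simps [simp]: "arcs {#} = {}" "arcs (add_mset l M) = (if dgx l then {} else {(rw l, cl l)}) \<union> arcs M"
 by (auto simp: arcs_def)

text \<open>The differential turns a theta arc into a parallel y arc and a diagonal x at one of its
  ends, so neither the graph nor the index set changes.\<close>

lemma pt_exchange: "r : {p, q} ==> pt P (add_mset (mk KX r r) (add_mset (mk KY p q) K)) \<longleftrightarrow> pt P (add_mset (mk KT p q) K)"
 by (auto simp: pt_def pg_def dgx_def isoff_def simp del: mk.simps)

lemma arcs_exchange: "arcs (add_mset (mk KX r r) (add_mset (mk KY p q) K)) = arcs (add_mset (mk KT p q) K)"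
 by (simp add: dgx_def del: mk.simps)

lemma not_isoff: "off M = 0 ==> l \<in># M ==> ~ isoff l" using off_remove[of l M] by auto

lemma off_eq_0: "(!!l. l \<in># M ==> ~ isoff l) ==> off M = 0" by (induction M) auto

lemma odd_off0: "l \<in># odm M ==> off M = 0 ==> kd l ~= KX"
 using not_isoff[of M l] by (auto simp: odm_def isoff_def dgx_def)

context permutation_graph
begin

text \<open>Words on \<open>P\<close> whose arcs are precisely the graph of \<open>t\<close> on
  \<open>R\<close>; each arc may be a y or a theta.\<close>

definition aw :: "letter multiset => bool" where
 "aw M \<longleftrightarrow> pt P M & rws (odm M) = mset_set R & (\<forall>l\<in>#odm M. cl l = t (rw l))"

lemma tR: "p : R ==> t p : R" using permutes_in_image[OF t] by simp

lemma at_letter: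
 assumes "aw M" "l \<in># M"
 shows "dgx l & rw l : P \<or> ~ dgx l & kd l ~= KX & rw l : R & cl l = t (rw l)"
proof (cases "dgx l")
 case True
 then show ?thesis using assms by (auto simp: aw_def pt_def pg_def idxs_def)
next
 case False
 then have l: "l \<in># odm M" using assms(2) by (simp add: odm_def)
 then have "rw l \<in># rws (odm M)" by simp
 moreover have "rws (odm M) = mset_set R" using assms(1) by (simp add: aw_def)
 ultimately have "rw l : R" using R by (simp only: elem_mset_set)
 then show ?thesis using False l assms(1) odd_off0[OF l] by (auto simp: aw_def pt_def)
qed

lemma kap_word:
 assumes "\<forall>l\<in>set w. dgx l \<or> ~ dgx l & kd l ~= KX & rw l : R & cl l = t (rw l)"
 shows "kap t R (gw w) = (gw (map tdg (filter (%l. kd l ~= KY) w)) :: 'k::field_char_0 mat_gca)" using assms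
proof (induction w)
 case (Cons l w)
 have "kap t R (gl l) = (if kd l = KY then 1 else gl (tdg l) :: 'k mat_gca)"
 unfolding kap_gl using Cons.prems by (cases "kd l") (auto simp: kapv_def tdg_def dgx_def)
 then show ?case using Cons by (simp add: ghom_mult[OF ghom_kap])
qed (simp add: ghom_1[OF ghom_kap])

text \<open>Every index of \<open>R\<close> is left by exactly one arc, a y or a theta; hence the
  rows of the y letters are the complement of those of the thetas.\<close>

lemma at_rows:
 assumes "aw (mset w)"
 shows "mset (filter (%l. kd l = KY) w) = mset (ylist t (R - trows w))"
 and "image_mset rw (mset (filter (%l. kd l = KY) w)) + image_mset rw (mset (filter (%l. kd l = KT) w)) = mset_set R"
proof -
 let ?y = "filter (%l. kd l = KY) w" and ?th = "filter (%l. kd l = KT) w"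
 have "odm (mset w) = mset ?y + mset ?th"
 proof -
 have "odm (mset w) = filter_mset (%l. kd l = KY \<or> kd l = KT) (mset w)" unfolding odm_def
 proof (rule filter_mset_cong[OF refl])
 fix l assume "l \<in># mset w"
 from at_letter[OF assms this] show "~ dgx l \<longleftrightarrow> kd l = KY \<or> kd l = KT"
 by (cases "kd l") (auto simp: dgx_def)
 qed
 also have "... = mset ?y + mset ?th" by (induction w) auto
 finally show ?thesis .
 qed
 then show rows: "image_mset rw (mset ?y) + image_mset rw (mset ?th) = mset_set R" using assms by (simp add: aw_def)
 have tr: "trows w = set_mset (image_mset rw (mset ?th))" by (auto simp: trows_def)
 have ry: "image_mset rw (mset ?y) = mset_set (R - trows w)"
 proof (rule multiset_eqI)
 fix p
 have c: "count (image_mset rw (mset ?y)) p + count (image_mset rw (mset ?th)) p = count (mset_set R) p"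
 unfolding rows[symmetric] by (rule count_union[symmetric])
 have th: "count (image_mset rw (mset ?th)) p = 0 \<longleftrightarrow> p ~: trows w" unfolding tr by (rule count_eq_zero_iff)
 have key: "y = (if p : R - trows w then 1 else 0)"
 if "y + z = (if p : R then 1 else 0)" "z = 0 \<longleftrightarrow> p ~: trows w" for y z :: nat
 using that by (auto split: if_splits)
 have cc: "count (mset_set R) p = (if p : R then 1 else 0)" "count (mset_set (R - trows w)) p = (if p : R - trows w then 1 else 0)"
 using R by (simp_all add: count_mset_set')
 show "count (image_mset rw (mset ?y)) p = count (mset_set (R - trows w)) p"
 unfolding cc(2) by (rule key[OF c[unfolded cc(1)] th])
 qed
 have "mset ?y = image_mset (%p. mk KY p (t p)) (image_mset rw (mset ?y))"
 proof -
 have "mk KY (rw l) (t (rw l)) = l" if "l \<in># mset ?y" for l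
 proof -
 have "l \<in># mset w" "kd l = KY" using that by auto
 then have "cl l = t (rw l)" using at_letter[OF assms, of l] by (auto simp: dgx_def)
 then show ?thesis using mk_collapse[of l] \<open>kd l = KY\<close> by simp
 qed
 then show ?thesis by (simp only: image_mset.compositionality o_def) (metis (no_types, lifting) multiset.map_ident_strong)
 qed
 also have "... = mset (ylist t (R - trows w))" unfolding ry ylist_def using R by simp
 finally show "mset ?y = mset (ylist t (R - trows w))" .
qed

lemma Hz_kap:
 assumes "f : gsp aw"
 shows "Hz t R (kap t R f) = (f :: 'k::field_char_0 mat_gca)"
proof (rule glin_on_gsp[OF glin_comp[OF glin_Hz glin_kap] glin_id assms])
 fix w assume w: "aw (mset w)"
 let ?n = "filter (%l. kd l ~= KY) w"
 have let_w: "dgx l \<or> ~ dgx l & kd l ~= KX & rw l : R & cl l = t (rw l)" if "l : set w" for l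
 using at_letter[OF w, of l] that by auto
 have k: "kap t R (gw w) = (gw (map tdg ?n) :: 'k mat_gca)" using let_w by (intro kap_word) blast
 have m: "map (tgr t) (map tdg ?n) = ?n" unfolding map_map
 proof (rule map_idI)
 fix l assume "l : set ?n"
 then have "l : set w" by simp
 show "(tgr t \<circ> tdg) l = l"
 proof (cases "kd l = KT")
 case True
 then have "cl l = t (rw l)" using let_w[OF \<open>l : set w\<close>] by (auto simp: dgx_def)
 then show ?thesis using True mk_collapse[of l] by (simp add: tgr_def tdg_def del: mk.simps)
 qed (simp add: tgr_def tdg_def)
 qed
 have tr: "trows (map tdg ?n) = trows w"
 proof -
 have "map rw (filter (%l. kd l = KT) (map tdg (filter (%l. kd l ~= KY) v))) = map rw (filter (%l. kd l = KT) v)" for v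
 by (induction v) (auto simp: tdg_def simp del: mk.simps)
 from arg_cong[OF this[of w], of set] show ?thesis by (simp only: trows_def set_map set_filter)
 qed
 have "Hz t R (kap t R (gw w)) = gw ?n * (gw (ylist t (R - trows w)) :: 'k mat_gca)" unfolding k Hz_gw Hw_def m tr by simp
 also have "gw (ylist t (R - trows w)) = (gw (filter (%l. kd l = KY) w) :: 'k mat_gca)"
 by (rule gw_even_mset[OF _ at_rows(1)[OF w, symmetric]]) (simp add: ylist_def isl_kd)
 also have "gw ?n * ... = (gw w :: 'k mat_gca)" by (rule gw_partition_even[symmetric]) (simp add: isl_kd)
 finally show "Hz t R (kap t R (gw w)) = (gw w :: 'k mat_gca)" .
qed

lemma kap_Hz:
 assumes "f : gsp kq"
 shows "kap t R (Hz t R f) = (f :: 'k::field_char_0 mat_gca)"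
proof (rule glin_on_gsp[OF glin_comp[OF glin_kap glin_Hz] glin_id assms])
 fix u assume u: "kq (mset u)"
 have 1: "kap t R (gw (map (tgr t) u)) = (gw u :: 'k mat_gca)" if "\<forall>l\<in>set u. klet R P l" using that
 proof (induction u)
 case (Cons l u)
 then have l: "klet R P l" by simp
 have "kap t R (gl (tgr t l)) = (gl l :: 'k mat_gca)"
 proof (cases "kd l = KT")
 case True
 then have "l = mk KT (rw l) (rw l)" using l mk_collapse[of l] by (simp add: klet_def)
 then show ?thesis using True l unfolding kap_gl by (auto simp: kapv_def tgr_def klet_def dgx_def simp del: mk.simps)
 next
 case False
 then show ?thesis using l unfolding kap_gl by (auto simp: kapv_def tgr_def klet_def dgx_def)
 qed
 then show ?case using Cons by (simp add: ghom_mult[OF ghom_kap])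
 qed (simp add: ghom_1[OF ghom_kap])
 have 2: "kap t R (gw (map (%p. mk KY p (t p)) ps)) = (1 :: 'k mat_gca)" if "set ps \<subseteq> R" for ps
 using that by (induction ps) (simp_all add: ghom_1[OF ghom_kap] ghom_mult[OF ghom_kap] kap_gl kapv_def dgx_def del: mk.simps)
 have "kap t R (gw (ylist t (R - trows u))) = (1 :: 'k mat_gca)" unfolding ylist_def by (rule 2) (use R in auto)
 then show "kap t R (Hz t R (gw u)) = (gw u :: 'k mat_gca)"
 unfolding Hz_gw Hw_def using 1 u by (simp add: ghom_mult[OF ghom_kap] kq_def)
qed

text \<open>A repeated theta would put two arcs on one row. Koszul words with such a repetition are
  zero, and \<open>Hz_gsp\<close> treats them apart.\<close>

lemma Hw_at:
 assumes u: "kq (mset u)" and d: "distinct (filter (%a. ~ isl a) u)"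
 shows "aw (mset (Hw t R u))"
proof -
 let ?th = "filter (%l. kd l = KT) u"
 have lets: "klet R P l" if "l : set u" for l using u that by (simp add: kq_def)
 have ndg: "~ dgx (mk KT p q)" "~ dgx (mk KY p q)" for p q by (simp_all add: dgx_def)
 have o1: "odm (mset (map (tgr t) v)) = mset (map (tgr t) (filter (%l. kd l = KT) v))"
 if "\<forall>l\<in>set v. klet R P l" for v using that
 proof (induction v)
 case (Cons a v)
 then have IH: "odm (mset (map (tgr t) v)) = mset (map (tgr t) (filter (%l. kd l = KT) v))" and a: "klet R P a" by simp_all
 have "dgx (tgr t a) \<longleftrightarrow> kd a ~= KT" using a by (auto simp: tgr_def dgx_def klet_def simp del: mk.simps)
 then show ?case using IH by simp
 qed simp
 have o2: "odm (mset (ylist t S)) = mset (ylist t S)" for S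
 unfolding odm_def by (rule filter_mset_eq_conv[THEN iffD2]) (auto simp: ylist_def dgx_def simp del: mk.simps)
 have od: "odm (mset (Hw t R u)) = mset (map (tgr t) ?th) + mset (ylist t (R - trows u))"
 unfolding Hw_def mset_append odm_simps o2 using o1[of u] lets by simp
 have th: "?th = filter (%a. ~ isl a) u" by (simp add: isl_kd)
 have inj: "inj_on rw (set ?th)"
 proof (rule inj_onI)
 fix l l' assume "l : set ?th" "l' : set ?th" "rw l = rw l'"
 then show "l = l'" using lets[of l] lets[of l'] by (intro letter_eqI) (auto simp: klet_def)
 qed
 have "distinct (map rw ?th)" using d inj unfolding th[symmetric] by (simp add: distinct_map)
 then have rth: "image_mset rw (mset ?th) = mset_set (trows u)"
 unfolding trows_def mset_map[symmetric] by (subst mset_set_set[symmetric]) (auto intro: arg_cong[where f = mset_set])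
 have trR: "trows u \<subseteq> R"
 proof
 fix p assume "p : trows u"
 then obtain l where "l : set u" "kd l = KT" "p = rw l" by (auto simp: trows_def)
 then show "p : R" using lets[of l] by (auto simp: klet_def)
 qed
 have fin: "finite (trows u)" by (simp add: trows_def)
 have "rws (mset (map (tgr t) ?th)) = image_mset rw (mset ?th)"
 by (simp add: image_mset.compositionality o_def) (rule image_mset_cong, simp add: tgr_def)
 moreover have "rws (mset (ylist t (R - trows u))) = mset_set (R - trows u)"
 using R by (simp add: ylist_def image_mset.compositionality o_def)
 ultimately have rows: "rws (odm (mset (Hw t R u))) = mset_set R" unfolding od image_mset_union rth using trR R fin
 by (metis Diff_disjoint Un_Diff_cancel finite_Diff mset_set_Union sup.absorb2)
 have arc: "cl l = t (rw l) & kd l ~= KX" if "l \<in># odm (mset (Hw t R u))" for l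
 using that unfolding od by (auto simp: tgr_def ylist_def simp del: mk.simps)
 have cols: "cls (odm (mset (Hw t R u))) = mset_set R"
 proof -
 have "cls (odm (mset (Hw t R u))) = image_mset t (rws (odm (mset (Hw t R u))))"
 unfolding image_mset.compositionality o_def by (rule image_mset_cong) (use arc in blast)
 also have "... = mset_set (t ` R)" unfolding rows by (rule image_mset_mset_set) (use permutes_inj_on[OF t] in auto)
 finally show ?thesis using permutes_image[OF t] by simp
 qed
 have set_o: "rw ` set_mset (odm (mset (Hw t R u))) = R" "cl ` set_mset (odm (mset (Hw t R u))) = R"
 using arg_cong[OF rows, of set_mset] arg_cong[OF cols, of set_mset] R by simp_all
 have "idxs (mset (Hw t R u)) = P"
 proof
 show "idxs (mset (Hw t R u)) \<subseteq> P"
 proof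
 fix p assume "p : idxs (mset (Hw t R u))"
 then obtain l where l: "l \<in># mset (Hw t R u)" "p = rw l \<or> p = cl l" by (auto simp: idxs_def)
 show "p : P"
 proof (cases "l \<in># odm (mset (Hw t R u))")
 case True
 then have "rw l : rw ` set_mset (odm (mset (Hw t R u)))" "cl l : cl ` set_mset (odm (mset (Hw t R u)))" by (rule imageI)+
 then have "rw l : R" "cl l : R" unfolding set_o .
 then show ?thesis using l(2) P(2) by blast
 next
 case False
 then have dg: "dgx l" using l(1) by (simp add: odm_def)
 then have "l : set (map (tgr t) u)" using l(1) ndg by (auto simp: Hw_def ylist_def simp del: mk.simps)
 then obtain l' where "l' : set u" "l = tgr t l'" by auto
 then have "l = l'" using dg ndg(1) by (metis tgr_def)
 then show ?thesis using lets[OF \<open>l' : set u\<close>] l(2) dg P(2) by (auto simp: klet_def dgx_def)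
 qed
 qed
 show "P \<subseteq> idxs (mset (Hw t R u))"
 proof
 fix p assume p: "p : P"
 show "p : idxs (mset (Hw t R u))"
 proof (cases "p : R")
 case True
 then have "p : rw ` set_mset (odm (mset (Hw t R u)))" unfolding set_o(1) .
 then obtain l where "l \<in># odm (mset (Hw t R u))" "rw l = p" by (elim imageE) simp
 then show ?thesis by (auto simp: odm_def idxs_def)
 next
 case False
 then have "mk KX p p : set u" using u p by (simp add: kq_def)
 moreover have "tgr t (mk KX p p) = mk KX p p" by (simp add: tgr_def)
 ultimately have "mk KX p p \<in># mset (Hw t R u)" unfolding Hw_def by (metis UnCI image_eqI list.set_map set_append set_mset_mset)
 then show ?thesis unfolding idxs_def by (metis UnI1 image_eqI mk_simps(2))
 qed
 qed
 qed
 moreover have "off (mset (Hw t R u)) = 0"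
 proof -
 have "~ isoff l" if "l \<in># mset (Hw t R u)" for l
 using that arc[of l] by (cases "dgx l") (auto simp: odm_def isoff_def dgx_def)
 then show ?thesis by (rule off_eq_0)
 qed
 moreover have "simple (mset_set R)" by (simp add: simple_def count_mset_set')
 ultimately show ?thesis unfolding aw_def pt_def pg_def using rows cols arc by simp
qed

lemma Hz_gsp: "f : gsp kq ==> Hz t R f : (gsp aw :: 'k::field_char_0 mat_gca set)"
proof (rule glin_maps_gsp[OF glin_Hz])
 fix u assume u: "kq (mset u)"
 show "Hz t R (gw u) : (gsp aw :: 'k mat_gca set)"
 proof (cases "distinct (filter (%a. ~ isl a) u)")
 case True
 then show ?thesis unfolding Hz_gw by (intro gsp_gw Hw_at[OF u])
 next
 case False
 then have "gw u = (0 :: 'k mat_gca)" by (rule gw_repeat)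
 then show ?thesis by (simp add: glin_0[OF glin_Hz])
 qed
qed

lemma kap_gsp: "f : gsp aw ==> kap t R f : (gsp kq :: 'k::field_char_0 mat_gca set)"
proof (rule glin_maps_gsp[OF glin_kap])
 fix w assume w: "aw (mset w)"
 let ?u = "map tdg (filter (%l. kd l ~= KY) w)"
 have "kap t R (gw w) = (gw ?u :: 'k mat_gca)" by (rule kap_word) (use at_letter[OF w] in auto)
 moreover have "kq (mset ?u)" unfolding kq_def
 proof (intro conjI ballI)
 fix l assume "l \<in># mset ?u"
 then obtain l' where "l' : set w" "kd l' ~= KY" "l = tdg l'" by auto
 then show "klet R P l" using at_letter[OF w, of l'] by (cases "kd l'") (auto simp: tdg_def klet_def dgx_def simp del: mk.simps)
 next
 fix p assume p: "p : P - R"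
 have "p : idxs (mset w)" using w p by (auto simp: aw_def pt_def pg_def)
 then obtain l where l: "l : set w" "p = rw l \<or> p = cl l" by (auto simp: idxs_def)
 then have "dgx l" using at_letter[OF w, of l] p tR by auto
 then have "l = mk KX p p" using l(2) mk_collapse[of l] by (auto simp: dgx_def)
 then have "mk KX p p : set (filter (%l. kd l ~= KY) w)" using l(1) by auto
 moreover have "tdg (mk KX p p) = mk KX p p" by (simp add: tdg_def)
 ultimately show "mk KX p p \<in># mset ?u" by (metis image_eqI list.set_map set_mset_mset)
 qed
 ultimately show "kap t R (gw w) : (gsp kq :: 'k mat_gca set)" by (simp add: gsp_gw del: gw_simps)
qed

lemma at_exchange: "r : {p, q} ==> aw (add_mset (mk KX r r) (add_mset (mk KY p q) K)) \<longleftrightarrow> aw (add_mset (mk KT p q) K)"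
 unfolding aw_def using pt_exchange[of r p q P K] by (simp add: dgx_def del: mk.simps)

lemma dB_at: "f : gsp aw ==> dB f : (gsp aw :: 'k::field_char_0 mat_gca set)" by (rule dB_gsp) (use at_exchange in blast)

lemma nu_gsp: "f : gsp kq ==> nu t R f : (gsp kq :: 'k::field_char_0 mat_gca set)"
proof (rule glin_maps_gsp[OF glin_nu])
 fix u assume u: "kq (mset u)"
 have "nu t R (gw v) : (gsp (%M. (\<forall>l\<in>#M. klet R P l) & (\<forall>l\<in>#mset v. bare l --> l \<in># M)) :: 'k mat_gca set)"
 if "\<forall>l\<in>set v. klet R P l" for v using that
 proof (induction v)
 case (Cons l v)
 have "avl t R l : (gsp (%M. (\<forall>l\<in>#M. klet R P l) & (bare l --> l \<in># M)) :: 'k mat_gca set)"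
 proof (cases "bare l")
 case True
 then have "avl t R l = (gl l :: 'k mat_gca)" by (intro avl_fixed) (auto simp: bare_def dgx_def t_fix)
 then show ?thesis using Cons.prems by (auto intro!: gl_gsp)
 next
 case False
 then show ?thesis using Cons.prems by (intro gsp_mono[OF avl_gsp]) auto
 qed
 from gsp_mult[OF this Cons.IH] Cons.prems show ?case
 unfolding gw_simps(2) ghom_mult[OF ghom_nu] nu_gl by (rule_tac gsp_mult[OF \<open>avl t R l : _\<close> Cons.IH]) auto
 qed (auto simp: ghom_1[OF ghom_nu] intro: gsp_1)
 from this[of u] have "nu t R (gw u) : (gsp (%M. (\<forall>l\<in>#M. klet R P l) & (\<forall>l\<in>#mset u. bare l --> l \<in># M)) :: 'k mat_gca set)"
 using u by (simp add: kq_def)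
 then show "nu t R (gw u) : (gsp kq :: 'k mat_gca set)"
 by (rule gsp_mono) (use u in \<open>auto simp: kq_def bare_def dgx_def simp del: mk.simps\<close>)
qed

text \<open>On the mean of the thetas of a cycle the differences of x telescope over a full period;
  means of x are killed anyway.\<close>

lemma dK_nu: "f : gsp kq ==> dK t (nu t R f) = (0 :: 'k::field_char_0 mat_gca)"
proof (rule glin_on_gsp[OF glin_comp[OF glin_dK glin_nu] glin_zero])
 fix u assume u: "kq (mset u)"
 have "dK t (nu t R (gw v)) = (0 :: 'k mat_gca)" if "\<forall>l\<in>set v. klet R P l" for v using that
 proof (induction v)
 case (Cons l v)
 have "dK t (avl t R l) = (0 :: 'k mat_gca)"
 proof (cases "kd l = KT")
 case False
 then show ?thesis unfolding avl_def glin_sum[OF glin_dK] glin_cs[OF glin_dK] dK_gl by simp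
 next
 case True
 then have rc: "rw l = cl l" using Cons.prems by (simp add: klet_def)
 let ?a = "%k. gl (mk KX ((t ^^ k) (rw l)) ((t ^^ k) (rw l))) :: 'k mat_gca"
 have "dK t (avl t R l) = (\<Sum>k<per R. cs (1 / of_nat (per R)) * (?a k - ?a (Suc k)))"
 unfolding avl_def glin_sum[OF glin_dK] glin_cs[OF glin_dK] dK_gl using True rc by simp
 also have "... = cs (1 / of_nat (per R)) * (?a 0 - ?a (per R))"
 using sum_lessThan_telescope'[of ?a "per R"] by (simp only: sum_distrib_left[symmetric])
 finally show ?thesis by (simp add: funpow_per[OF t R])
 qed
 then show ?case using Cons by (simp add: ghom_mult[OF ghom_nu] nu_gl dK_mult)
 qed (simp add: ghom_1[OF ghom_nu] dK_def gca_diff_1)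
 then show "dK t (nu t R (gw u)) = (0 :: 'k mat_gca)" using u by (simp add: kq_def)
qed

text \<open>Checked after \<open>kap\<close>, where it says that products of cycle means are cycles
  of the Koszul complex.\<close>

lemma dB_Hz_nu:
 assumes "g : gsp kq"
 shows "dB (Hz t R (nu t R g)) = (0 :: 'k::field_char_0 mat_gca)"
proof -
 have "dB (Hz t R (nu t R g)) = Hz t R (kap t R (dB (Hz t R (nu t R g))))"
 by (rule Hz_kap[symmetric]) (intro dB_at Hz_gsp nu_gsp assms)
 also have "... = 0" unfolding kap_dB kap_Hz[OF nu_gsp[OF assms]] dK_nu[OF assms] by (rule glin_0[OF glin_Hz])
 finally show ?thesis .
qed

text \<open>\<open>koszul_homology\<close>, transported by the mutually inverse maps
  \<open>kap\<close> and \<open>Hz\<close>, of which \<open>kap\<close> is a chain map.\<close>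

theorem at_homology:
 assumes m: "m : gsp aw" "dB m = (0 :: 'k::field_char_0 mat_gca)"
 shows "\<exists>g\<in>gsp kq. \<exists>b\<in>gsp (pt P). m = Hz t R (nu t R g) + dB b"
proof -
 have "dK t (kap t R m) = 0" unfolding kap_dB[symmetric] m(2) by (rule glin_0[OF glin_kap])
 from koszul_homology[OF kap_gsp[OF m(1)] this] obtain g H where
 gH: "g : gsp kq" "H : gsp kq" "kap t R m = nu t R g + dK t H" by blast
 have b: "Hz t R H : gsp aw" by (rule Hz_gsp[OF gH(2)])
 have "m = Hz t R (kap t R m)" by (rule Hz_kap[OF m(1), symmetric])
 also have "... = Hz t R (nu t R g) + Hz t R (kap t R (dB (Hz t R H)))"
 unfolding gH(3) kap_dB kap_Hz[OF gH(2)] glin_add[OF glin_Hz] ..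
 also have "Hz t R (kap t R (dB (Hz t R H))) = dB (Hz t R H)" by (rule Hz_kap[OF dB_at[OF b]])
 finally have "m = Hz t R (nu t R g) + dB (Hz t R H)" .
 moreover have "Hz t R H : gsp (pt P)" by (rule gsp_mono[OF b]) (simp add: aw_def)
 ultimately show ?thesis using gH(1) by blast
qed

end

text \<open>Sums of canonical cycles in which the permutation and its support may vary from summand
  to summand.\<close>

inductive canon :: "nat set => 'k::field_char_0 mat_gca => bool" for P where
 zero: "canon P 0"
| step: "permutation_graph t R P ==> g : gsp (permutation_graph.kq R P) ==> canon P f ==>
 canon P (Hz t R (nu t R g) + f)"

lemma canon_add: "canon P f ==> canon P g ==> canon P (f + g)"
 by (induction rule: canon.induct) (auto simp: add.assoc intro: canon.step)

text \<open>Rows and columns of the arcs are free of repetitions, so the arcs are the graph of a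
  bijection. It is determined by the arc set alone, hence is common to all words with that arc
  set.\<close>

lemma pt_arcs_graph:
 assumes M: "pt P M" "finite P"
 shows "EX t R. permutation_graph t R P & (ALL M'. pt P M' --> arcs M' = arcs M --> permutation_graph.aw t R P M')"
proof -
 define R where "R = fst ` arcs M"
 have sr: "simple (rws (odm N))" "simple (cls (odm N))" if "pt P N" for N using that unfolding pt_def pg_def by metis+
 have uniq: "l = l'" if u: "pt P N" "l \<in># odm N" "l' \<in># odm N" "rw l = rw l' \<or> cl l = cl l'" for N l l'
 proof (rule ccontr)
 assume ne: "l ~= l'"
 obtain K where K: "odm N = add_mset l (add_mset l' K)" using u(2,3) ne by (metis insert_DiffM insert_noteq_member)
 then show False using sr[OF u(1)] u(4) by (auto simp: simple_add)
 qed
 have fn: "q = q'" if "(p, q) : arcs M" "(p, q') : arcs M" for p q q' using that uniq[OF M(1)] unfolding arcs_def by auto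
 define t where "t p = (if p : R then (THE q. (p, q) : arcs M) else p)" for p
 have tq: "t p = q" if "(p, q) : arcs M" for p q using that fn by (auto simp: t_def R_def image_iff intro!: the_equality)
 have rc: "rws (odm M) = cls (odm M)" using M(1) by (simp add: pt_def pg_def)
 have Rs: "R = set_mset (rws (odm M))" "R = set_mset (cls (odm M))"
 unfolding rc[symmetric] by (auto simp: R_def arcs_def image_image)
 have arc: "EX q. (p, q) : arcs M" if "p : R" for p using that by (auto simp: R_def)
 have "t ` R = R"
 proof
 show "t ` R \<subseteq> R"
 proof
 fix q assume "q : t ` R"
 then obtain p where "(p, q) : arcs M" using arc tq by blast
 then show "q : R" unfolding Rs(2) by (auto simp: arcs_def)
 qed
 show "R \<subseteq> t ` R"
 proof
 fix q assume "q : R"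
 then obtain l where "l \<in># odm M" "cl l = q" unfolding Rs(2) by auto
 then have "(rw l, q) : arcs M" by (auto simp: arcs_def)
 then show "q : t ` R" using tq R_def by (metis fst_conv image_eqI)
 qed
 qed
 moreover have fR: "finite R" by (simp add: R_def arcs_def)
 ultimately have "bij_betw t R R" by (simp add: bij_betw_def eq_card_imp_inj_on)
 then have "t permutes R" by (rule bij_imp_permutes) (simp add: t_def)
 moreover have "R \<subseteq> P" using M(1) by (auto simp: R_def arcs_def pt_def pg_def idxs_def odm_def)
 ultimately have g: "permutation_graph t R P" using M(2) by unfold_locales
 interpret permutation_graph t R P by (rule g)
 have "aw M'" if M': "pt P M'" "arcs M' = arcs M" for M'
 proof -
 have "set_mset (rws (odm M')) = R" unfolding R_def M'(2)[symmetric] by (auto simp: arcs_def image_image)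
 then have "rws (odm M') = mset_set R" using sr(1)[OF M'(1)] fR by (intro multiset_eqI)
 (metis count_eq_zero_iff count_mset_set(1,3) le_neq_implies_less less_one simple_def)
 moreover have "cl l = t (rw l)" if "l \<in># odm M'" for l
 proof -
 have "(rw l, cl l) : arcs M'" using that by (auto simp: arcs_def)
 then show ?thesis using tq M'(2) by simp
 qed
 ultimately show ?thesis using M'(1) by (simp add: aw_def)
 qed
 then show ?thesis using g by blast
qed

text \<open>The differential preserves the arc set, so the complex splits over the finitely many
  graphs on \<open>P\<close>, and \<open>at_homology\<close> applies to each component.\<close>

theorem pt_homology:
 assumes m: "m : gsp (pt P)" "dB m = (0 :: 'k::field_char_0 mat_gca)" and P: "finite P"
 shows "EX v. canon P v & (\<exists>b\<in>gsp (pt P). m = v + dB b)"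
proof -
 let ?m = "%A. gfilter (%M. arcs M = A) m"
 have "EX v. canon P v & (\<exists>b\<in>gsp (pt P). ?m A = v + dB b)" for A
 proof -
 have mA: "?m A : gsp (%M. arcs M = A & pt P M)" by (rule gfilter_gsp[OF m(1)])
 show ?thesis
 proof (cases "EX M. pt P M & arcs M = A")
 case False
 then have "?m A : gsp (%_. False)" by (intro gsp_mono[OF mA]) auto
 then have "?m A = 0" using gfilter_eq_0[of "?m A" "%_. False" "%_. False"] by (auto simp: gsp_def)
 then show ?thesis using canon.zero[of P] by (intro exI[of _ 0]) (auto intro!: bexI[of _ 0] simp: glin_0[OF glin_dB])
 next
 case True
 then obtain t R where tR: "permutation_graph t R P"
 "!!M'. pt P M' ==> arcs M' = A ==> permutation_graph.aw t R P M'" using pt_arcs_graph[OF _ P] by metis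
 have "?m A : gsp (permutation_graph.aw t R P)" by (rule gsp_mono[OF mA]) (use tR(2) in blast)
 moreover have "dB (?m A) = 0"
 proof -
 have "dB (?m A) = gfilter (%M. arcs M = A) (dB m)" by (rule dB_gfilter[symmetric]) (simp only: arcs_exchange)
 then show ?thesis unfolding m(2) by simp
 qed
 ultimately obtain g b where "g : gsp (permutation_graph.kq R P)" "b : gsp (pt P)"
 "?m A = Hz t R (nu t R g) + dB b" using permutation_graph.at_homology[OF tR(1)] by blast
 then show ?thesis using canon.step[OF tR(1) _ canon.zero] by fastforce
 qed
 qed
 then obtain v b where vb: "!!A. canon P (v A)" "!!A. b A : gsp (pt P)" "!!A. ?m A = v A + dB (b A)" by metis
 have "m : gsp (%M. arcs M : Pow (P \<times> P))"
 by (rule gsp_mono[OF m(1)]) (auto simp: arcs_def pt_def pg_def idxs_def odm_def)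
 then have "m = (\<Sum>A\<in>Pow (P \<times> P). ?m A)" by (rule gfilter_partition) (simp add: P)
 also have "... = (\<Sum>A\<in>Pow (P \<times> P). v A) + dB (\<Sum>A\<in>Pow (P \<times> P). b A)"
 unfolding vb(3) sum.distrib glin_sum[OF glin_dB] ..
 finally have "m = (\<Sum>A\<in>Pow (P \<times> P). v A) + dB (\<Sum>A\<in>Pow (P \<times> P). b A)" .
 moreover have "canon P (sum v S)" for S
 by (induction S rule: infinite_finite_induct) (auto intro: canon.zero canon_add vb(1))
 moreover have "(\<Sum>A\<in>Pow (P \<times> P). b A) : gsp (pt P)" by (intro gsp_sum vb(2))
 ultimately show ?thesis by blast
qed

section \<open>Canonical cycles and the diagonal\<close>

definition isdiag :: "letter => bool" where "isdiag l \<longleftrightarrow> rw l = cl l"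

text \<open>The diagonal part, computed inside the matrix algebra: by \<open>io_hc\<close> it is the
  Harish-Chandra map followed by the embedding of the diagonal algebra.\<close>

definition Dg :: "'k::field_char_0 mat_gca => 'k mat_gca" where
 "Dg = gfilter (%M. \<forall>l\<in>#M. isdiag l)"

lemma glin_Dg: "glin Dg" unfolding Dg_def by (rule glin_gf)

lemma Dg_gw: "Dg (gw w) = (if \<forall>l\<in>set w. isdiag l then gw w else 0)" unfolding Dg_def gfilter_gw by simp

lemma Dg_res: "Dg (res f) = Dg f"
proof (rule glin_eqI[OF glin_comp[OF glin_Dg glin_res] glin_Dg])
 fix w :: "letter list"
 show "Dg (res (gw w)) = Dg (gw w :: 'a mat_gca)"
 proof (cases "off (mset w) = 0")
 case False
 then obtain l where "l \<in># mset w" "isoff l" using off_eq_0[of "mset w"] by (rule_tac ccontr) auto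
 then have "~ (\<forall>l\<in>set w. isdiag l)" by (auto simp: isoff_def isdiag_def)
 then have "Dg (gw w) = (0 :: 'a mat_gca)" unfolding Dg_gw by (simp only: if_False)
 then show ?thesis using False by (simp add: res_gw glin_0[OF glin_Dg] del: gw_simps)
 qed (simp add: res_gw del: gw_simps)
qed

lemma trows_simps: "trows [] = {}" "trows (l # u) = (if kd l = KT then insert (rw l) (trows u) else trows u)"
 "trows (u @ v) = trows u \<union> trows v" by (auto simp: trows_def)

text \<open>Averaging and the insertion of arcs use nothing but the permutation and its support, and
  \<open>per\<close> only the number of points, so the construction is natural under bijections that
  conjugate \<open>s\<close> to \<open>t\<close>.\<close>

lemma permutation_graph_intertwine:
 assumes s: "permutation_graph s S Q" and t: "permutation_graph t R P"
 and b: "bij_betw \<phi> Q P" and S: "\<phi> ` S = R" and st: "!!q. q : S ==> \<phi> (s q) = t (\<phi> q)"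
 and v: "v : gsp (permutation_graph.kq S Q)"
 shows "relabel \<phi> (Hz s S (nu s S v)) = Hz t R (nu t R (relabel \<phi> (v :: 'k::field_char_0 mat_gca)))"
proof -
 interpret s: permutation_graph s S Q by (rule s)
 interpret t: permutation_graph t R P by (rule t)
 have inj: "inj_on \<phi> Q" using b by (simp add: bij_betw_def)
 have stQ: "\<phi> (s q) = t (\<phi> q)" if "q : Q" for q
 proof (cases "q : S")
 case False
 then have "\<phi> q ~: R" using S inj that s.P(2) by (metis (no_types, lifting) imageE inj_onD subsetD)
 then show ?thesis using False s.t_fix t.t_fix by simp
 qed (rule st)
 have sQ: "s q : Q" if "q : Q" for q using that s.tR s.t_fix s.P(2) by (cases "q : S") auto
 have skQ: "(s ^^ k) q : Q" if "q : Q" for q k by (induction k) (use that sQ in auto)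
 have stk: "\<phi> ((s ^^ k) q) = (t ^^ k) (\<phi> q)" if "q : Q" for q k by (induction k) (use that skQ stQ in auto)
 have per: "per S = per R" using card_image[OF inj_on_subset[OF inj s.P(2)]] S by (simp add: per_def)
 have kl: "rw l = cl l & rw l : Q & cl l : Q" if "klet S Q l" for l using that s.P(2) by (auto simp: klet_def)
 have n: "relabel \<phi> (avl s S l) = (avl t R (rl \<phi> l) :: 'k mat_gca)" if "klet S Q l" for l
 unfolding avl_def glin_sum[OF glin_rlb] glin_cs[OF glin_rlb] relabel_gl per
 using kl[OF that] by (intro sum.cong refl arg_cong2[where f = "(*)"] arg_cong[where f = gl])
 (simp add: rl_def stk)
 have 1: "relabel \<phi> (nu s S h) = nu t R (relabel \<phi> h)" if "h : gsp (%M. \<forall>l\<in>#M. klet S Q l)" for h :: "'k mat_gca"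
 proof (rule glin_on_gsp[OF glin_comp[OF glin_rlb glin_nu] glin_comp[OF glin_nu glin_rlb] that])
 fix u assume "\<forall>l\<in>#mset u. klet S Q l"
 then show "relabel \<phi> (nu s S (gw u)) = nu t R (relabel \<phi> (gw u :: 'k mat_gca))"
 by (induction u) (simp_all add: ghom_1[OF ghom_rlb] ghom_1[OF ghom_nu] ghom_mult[OF ghom_rlb]
 ghom_mult[OF ghom_nu] nu_gl relabel_gl n)
 qed
 have 2: "relabel \<phi> (Hz s S h) = Hz t R (relabel \<phi> h)" if "h : gsp s.kq" for h :: "'k mat_gca"
 proof (rule glin_on_gsp[OF glin_comp[OF glin_rlb glin_Hz] glin_comp[OF glin_Hz glin_rlb] that])
 fix u assume u: "s.kq (mset u)"
 have m: "map (rl \<phi>) (map (tgr s) u) = map (tgr t) (map (rl \<phi>) u)" unfolding map_map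
 proof (rule map_cong[OF refl])
 fix l assume "l : set u"
 then have "klet S Q l" using u by (simp add: s.kq_def)
 then have "rw l : Q" using kl by blast
 then show "(rl \<phi> \<circ> tgr s) l = (tgr t \<circ> rl \<phi>) l" by (simp add: tgr_def stQ del: mk.simps)
 qed
 have tr: "trows (map (rl \<phi>) u) = \<phi> ` trows u" by (induction u) (auto simp: trows_simps)
 have trS: "trows u \<subseteq> S"
 proof
 fix p assume "p : trows u"
 then obtain l where "l : set u" "kd l = KT" "p = rw l" by (auto simp: trows_def)
 moreover from this have "klet S Q l" using u by (simp add: s.kq_def)
 ultimately show "p : S" by (auto simp: klet_def)
 qed
 have im: "\<phi> ` (S - trows u) = R - trows (map (rl \<phi>) u)"
 unfolding tr using inj_on_image_set_diff[OF inj, of S "trows u"] s.P(2) trS S by auto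
 have "gw (map (rl \<phi>) (ylist s (S - trows u))) = (gw (ylist t (R - trows (map (rl \<phi>) u))) :: 'k mat_gca)"
 proof (rule gw_even_mset)
 show "\<forall>x\<in>set (map (rl \<phi>) (ylist s (S - trows u))). isl x" by (auto simp: ylist_def)
 have "mset (map (rl \<phi>) (ylist s (S - trows u))) = image_mset (%q. mk KY (\<phi> q) (\<phi> (s q))) (mset_set (S - trows u))"
 by (simp add: ylist_def image_mset.compositionality o_def del: mk.simps)
 also have "... = image_mset (%p. mk KY p (t p)) (image_mset \<phi> (mset_set (S - trows u)))"
 unfolding image_mset.compositionality o_def by (rule image_mset_cong) (use s.R st in auto)
 also have "image_mset \<phi> (mset_set (S - trows u)) = mset_set (R - trows (map (rl \<phi>) u))"
 unfolding im[symmetric] by (rule image_mset_mset_set) (rule inj_on_subset[OF inj], use s.P(2) in blast)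
 finally show "mset (map (rl \<phi>) (ylist s (S - trows u))) = mset (ylist t (R - trows (map (rl \<phi>) u)))"
 by (simp add: ylist_def)
 qed
 then show "relabel \<phi> (Hz s S (gw u)) = Hz t R (relabel \<phi> (gw u :: 'k mat_gca))"
 unfolding Hz_gw relabel_gw Hw_def map_append m unfolding gw_simps(3) by (simp only:)
 qed
 have "v : gsp (%M. \<forall>l\<in>#M. klet S Q l)" by (rule gsp_mono[OF v]) (simp add: s.kq_def)
 then show ?thesis using 2[OF s.nu_gsp[OF v]] 1 by (simp only:)
qed

context permutation_graph
begin

text \<open>The diagonal word to be expected: the relabelled Koszul letters and one diagonal y for
  each index of \<open>R\<close> without a theta.\<close>

definition Ti :: "(nat => nat) => letter list => 'k::field_char_0 mat_gca" where
 "Ti i u = gw (map (rl i) u) * gw (map (%p. mk KY (i p) (i p)) (sorted_list_of_set (R - trows u)))"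

text \<open>An arc from p to \<open>t p\<close> becomes diagonal exactly if \<open>i\<close> has the
  same value at both ends, so only maps that are constant on cycles survive.\<close>

lemma Dg_relabel_Hz:
 assumes u: "\<forall>l\<in>set u. klet R P l"
 shows "Dg (relabel i (Hz t R (gw u))) = (if \<forall>p\<in>R. i (t p) = i p then Ti i u else (0 :: 'k::field_char_0 mat_gca))"
proof (cases "\<forall>p\<in>R. i (t p) = i p")
 case True
 have m: "map (rl i) (map (tgr t) u) = map (rl i) u" unfolding map_map
 proof (rule map_cong[OF refl])
 fix l assume "l : set u"
 then have "klet R P l" using u by blast
 then show "(rl i \<circ> tgr t) l = rl i l" using True mk_collapse[of l]
 by (auto simp: tgr_def klet_def rl_def simp del: mk.simps)
 qed
 have y: "map (rl i) (ylist t (R - trows u)) = map (%p. mk KY (i p) (i p)) (sorted_list_of_set (R - trows u))"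
 unfolding ylist_def map_map by (rule map_cong[OF refl]) (use True R in \<open>simp del: mk.simps\<close>)
 have d: "\<forall>l\<in>set (map (rl i) u @ map (%p. mk KY (i p) (i p)) (sorted_list_of_set (R - trows u))). isdiag l"
 using u by (auto simp: isdiag_def klet_def simp del: mk.simps)
 show ?thesis unfolding Hz_gw relabel_gw Hw_def map_append m y Ti_def if_P[OF True] unfolding Dg_gw if_P[OF d] unfolding gw_simps(3) ..
next
 case False
 then obtain p where p: "p : R" "i (t p) ~= i p" by blast
 have "\<exists>l\<in>set (Hw t R u). rw l = p & cl l = t p"
 proof (cases "p : trows u")
 case True
 then obtain l where l: "l : set u" "kd l = KT" "rw l = p" by (auto simp: trows_def)
 then have "tgr t l : set (Hw t R u)" by (simp add: Hw_def)
 moreover have "rw (tgr t l) = p & cl (tgr t l) = t p" using l by (simp add: tgr_def del: mk.simps)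
 ultimately show ?thesis by blast
 next
 case F: False
 then have "mk KY p (t p) : set (Hw t R u)" using p R by (auto simp: Hw_def ylist_def)
 then show ?thesis by (intro bexI[of _ "mk KY p (t p)"]) (simp_all del: mk.simps)
 qed
 then obtain l where "l : set (Hw t R u)" "rw l = p" "cl l = t p" by blast
 then have "~ (\<forall>l\<in>set (map (rl i) (Hw t R u)). isdiag l)" using p(2) unfolding isdiag_def set_map by (metis imageI rl_simps(2,3))
 then show ?thesis using False unfolding Hz_gw relabel_gw Dg_gw by (simp only: if_False)
qed

text \<open>As \<open>i\<close> is constant on cycles, a letter that moves along its cycle keeps its
  label. For a theta the index without a y moves along with it, and the labels of the supplied y
  letters have to be compared.\<close>

lemma Ti_shift:
 assumes i: "\<forall>p\<in>R. i (t p) = i p" and l: "klet R P l" and pu: "\<forall>x\<in>set (pre @ u). klet R P x"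
 shows "Ti i (pre @ rl (t ^^ k) l # u) = (Ti i (pre @ l # u) :: 'k::field_char_0 mat_gca)"
proof -
 have it: "i ((t ^^ k) p) = i p" for p k
 proof (induction k)
 case (Suc k)
 show ?case
 proof (cases "p : R")
 case True
 then show ?thesis using Suc i tk[of k p] by simp
 next
 case False
 then show ?thesis using Suc t_fix tk[of k p] by simp
 qed
 qed simp
 have rl: "rl i (rl (t ^^ k) l) = rl i l" by (simp add: rl_def it)
 have m: "map (rl i) (pre @ rl (t ^^ k) l # u) = map (rl i) (pre @ l # u)" by (simp add: rl)
 show ?thesis
 proof (cases "kd l = KT")
 case False
 then have "trows (pre @ rl (t ^^ k) l # u) = trows (pre @ l # u)" by (auto simp: trows_def)
 then show ?thesis unfolding Ti_def m by (simp only:)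
 next
 case True
 let ?T = "trows (pre @ u)" and ?p = "rw l" and ?q = "(t ^^ k) (rw l)"
 have tr: "trows (pre @ rl (t ^^ k) l # u) = insert ?q ?T" "trows (pre @ l # u) = insert ?p ?T"
 using True by (simp_all add: trows_simps)
 have pq: "?p : R" "?q : R" "i ?q = i ?p" using l True it tk by (auto simp: klet_def)
 show ?thesis
 \<comment> \<open>If another theta already has this label, the relabelled word has a repeated theta
   and both sides are 0. Otherwise the freed index and the newly used one have the same label, so
   the same y letters are supplied.\<close>
 proof (cases "i ?p : i ` ?T")
 case True
 then obtain x where "x : ?T" "i x = i ?p" by (metis imageE)
 then obtain l' where l': "l' : set (pre @ u)" "kd l' = KT" "i (rw l') = i ?p" by (auto simp: trows_def)
 have "klet R P l'" using l'(1) pu by blast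
 then have e: "rl i l' = rl i l" using l' l \<open>kd l = KT\<close> by (intro letter_eqI) (auto simp: klet_def)
 have "~ isl (rl i l)" using \<open>kd l = KT\<close> by (simp add: isl_kd)
 moreover have "rl i l : rl i ` set pre \<or> rl i l : rl i ` set u" using l'(1) e[symmetric] by auto
 ultimately have "~ distinct (filter (%a. ~ isl a) (map (rl i) (pre @ l # u)))" by auto
 then have z: "gw (map (rl i) (pre @ l # u)) = (0 :: 'k mat_gca)" by (rule gw_repeat)
 show ?thesis unfolding Ti_def m z mult_zero_left ..
 next
 case False
 have nT: "?p ~: ?T" using False by blast
 moreover have "?q ~: ?T"
 proof
 assume "?q : ?T"
 then have "i ?q : i ` ?T" by (rule imageI)
 then show False using False unfolding pq(3) by blast
 qed
 ultimately have nT: "?p ~: ?T" "?q ~: ?T" by blast+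
 have "gw (map (%p. mk KY (i p) (i p)) (sorted_list_of_set (R - insert ?q ?T))) =
 (gw (map (%p. mk KY (i p) (i p)) (sorted_list_of_set (R - insert ?p ?T))) :: 'k mat_gca)"
 proof (rule gw_even_mset)
 have e: "image_mset i (mset_set (R - insert x ?T)) = image_mset i (mset_set (R - ?T)) - {#i x#}"
 if "x : R" "x ~: ?T" for x
 proof -
 have "R - ?T = insert x (R - insert x ?T)" using that by auto
 then have "mset_set (R - ?T) = add_mset x (mset_set (R - insert x ?T))" using R by (metis Diff_iff finite_Diff insertI1 mset_set.insert)
 then show ?thesis by simp
 qed
 have e2: "image_mset (%p. mk KY (i p) (i p)) A = image_mset (%a. mk KY a a) (image_mset i A)" for A
 by (simp add: image_mset.compositionality o_def)
 show "mset (map (%p. mk KY (i p) (i p)) (sorted_list_of_set (R - insert ?q ?T))) =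
 mset (map (%p. mk KY (i p) (i p)) (sorted_list_of_set (R - insert ?p ?T)))"
 unfolding mset_map mset_sorted_list_of_set e2 e[OF pq(1) nT(1)] e[OF pq(2) nT(2)] pq(3) ..
 qed auto
 then show ?thesis unfolding Ti_def m tr by (simp only:)
 qed
 qed
qed

text \<open>Averaging replaces letters by translates along their cycles, which \<open>Ti\<close>
  does not see. The induction averages one letter at a time, behind a prefix that is already dealt
  with.\<close>

lemma Dg_relabel_Hz_nu:
 assumes u: "kq (mset u)"
 shows "Dg (relabel i (Hz t R (nu t R (gw u)))) = (if \<forall>p\<in>R. i (t p) = i p then Ti i u else (0 :: 'k::field_char_0 mat_gca))"
proof -
 define L where "L f = Dg (relabel i (Hz t R f))" for f :: "'k mat_gca"
 have L: "glin L" unfolding L_def[abs_def] by (intro glin_comp[OF glin_Dg] glin_comp[OF glin_rlb glin_Hz])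
 have "L (gw pre * nu t R (gw v)) = L (gw (pre @ v))" if "\<forall>l\<in>set (pre @ v). klet R P l" for pre v using that
 proof (induction v arbitrary: pre)
 case Nil
 then show ?case by (simp add: ghom_1[OF ghom_nu])
 next
 case (Cons l v)
 have l: "klet R P l" using Cons.prems by simp
 let ?c = "1 / of_nat (per R) :: 'k"
 have kk: "\<forall>x\<in>set ((pre @ [rl (t ^^ k) l]) @ v). klet R P x" for k using Cons.prems klet_rl[OF l] by auto
 have e: "gw pre * nu t R (gw (l # v)) = (\<Sum>k<per R. cs ?c * (gw (pre @ [rl (t ^^ k) l]) * nu t R (gw v)))"
 unfolding gw_simps ghom_mult[OF ghom_nu] nu_gl avl_def sum_distrib_left sum_distrib_right
 by (intro sum.cong refl) (simp only: poly_left_comm mult.assoc mult_1_right)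
 have "L (gw pre * nu t R (gw (l # v))) = (\<Sum>k<per R. cs ?c * L (gw ((pre @ [rl (t ^^ k) l]) @ v)))"
 unfolding e glin_sum[OF L] glin_cs[OF L] Cons.IH[OF kk] ..
 also have "... = (\<Sum>k<per R. cs ?c * L (gw (pre @ l # v)))"
 proof (intro sum.cong refl arg_cong2[where f = "(*)"])
 fix k
 have k1: "\<forall>x\<in>set (pre @ rl (t ^^ k) l # v). klet R P x" using kk[of k] by simp
 have "L (gw (pre @ rl (t ^^ k) l # v)) = L (gw (pre @ l # v))"
 unfolding L_def Dg_relabel_Hz[OF k1] Dg_relabel_Hz[OF Cons.prems] using Ti_shift[of i l pre v k] l Cons.prems by auto
 then show "L (gw ((pre @ [rl (t ^^ k) l]) @ v)) = L (gw (pre @ l # v))" by (simp only: append_assoc append_Cons append_Nil)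
 qed
 also have "... = L (gw (pre @ l # v))"
 proof -
 have "(\<Sum>k<per R. cs ?c * x) = x" for x :: "'k mat_gca"
 using per_pos[of R] by (simp add: cs_of_nat[symmetric] mult.assoc[symmetric] cs_mult[symmetric])
 then show ?thesis .
 qed
 finally show ?case .
 qed
 from this[of "[]" u] have "L (nu t R (gw u)) = L (gw u)" using u by (simp add: kq_def)
 then show ?thesis using Dg_relabel_Hz[of u i] u unfolding kq_def L_def by simp
qed

end

section \<open>Standard canonical cycles\<close>

text \<open>Indices have to be natural numbers; this one stands for position k on cycle p.\<close>

definition code :: "nat => nat => nat" where "code p k = prod_encode (p, k)"

lemma code_eq [simp]: "code p k = code p' k' \<longleftrightarrow> p = p' & k = k'" by (simp add: code_def prod_encode_eq)

lemma decode_code [simp]: "prod_decode (code p k) = (p, k)" by (simp add: code_def)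

lemma code_cases: obtains p k where "q = code p k" by (metis code_def prod_decode_inverse surj_pair)

text \<open>The length of the cycle that will represent index p: one arc for each y and theta, while
  x letters sit at vertices and do not count.\<close>

definition ell :: "letter multiset => nat => nat" where
 "ell M p = size (filter_mset (%l. kd l ~= KX & rw l = p) M)"

text \<open>The \<open>max 1\<close> keeps one point, a bare one, for an index of cycle length
  0.\<close>

definition SP :: "nat => (nat => nat) => nat set" where
 "SP c e = (%(p, k). code p k) ` (SIGMA p:{..<c}. {..<max 1 (e p)})"

definition SR :: "nat => (nat => nat) => nat set" where
 "SR c e = (%(p, k). code p k) ` (SIGMA p:{..<c}. {..<e p})"

text \<open>A permutation with cycles of lengths \<open>e 0, \<dots>, e (c - 1)\<close>; a cycle of length 0 is a bare point.\<close>

definition sst :: "nat => (nat => nat) => nat => nat" where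
 "sst c e q = (case prod_decode q of (p, k) => if p < c & k < e p then code p (Suc k mod e p) else q)"

lemma code_SP [simp]: "code p k : SP c e \<longleftrightarrow> p < c & k < max 1 (e p)"
 and code_SR [simp]: "code p k : SR c e \<longleftrightarrow> p < c & k < e p"
 and sst_code: "sst c e (code p k) = (if p < c & k < e p then code p (Suc k mod e p) else code p k)"
 by (auto simp: SP_def SR_def sst_def image_iff)

lemma finite_SP: "finite (SP c e)" by (simp add: SP_def)

lemma SR_sub: "SR c e \<subseteq> SP c e" by (auto simp: SP_def SR_def image_iff)

lemma standard_graph: "permutation_graph (sst c e) (SR c e) (SP c e)"
proof
 have fin: "finite (SR c e)" by (rule finite_subset[OF SR_sub finite_SP])
 have "sst c e ` SR c e = SR c e"
 proof
 show "sst c e ` SR c e \<subseteq> SR c e"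
 proof
 fix q assume "q : sst c e ` SR c e"
 then obtain r where r: "r : SR c e" "q = sst c e r" by blast
 obtain p k where "r = code p k" by (rule code_cases)
 then show "q : SR c e" using r by (auto simp: sst_code)
 qed
 show "SR c e \<subseteq> sst c e ` SR c e"
 proof
 fix q assume q: "q : SR c e"
 obtain p k where pk: "q = code p k" by (rule code_cases)
 then have lt: "p < c" "k < e p" using q by simp_all
 \<comment> \<open>The predecessor of k on the cycle; adding \<open>e p\<close> first avoids
   truncation at k = 0.\<close>
 let ?k = "(k + e p - 1) mod e p"
 have "Suc ?k mod e p = Suc (k + e p - 1) mod e p" by (rule mod_Suc_eq)
 also have "... = k" using lt by simp
 finally have "sst c e (code p ?k) = q" using lt pk by (simp add: sst_code)
 moreover have "code p ?k : SR c e" using lt by simp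
 ultimately show "q : sst c e ` SR c e" by (metis imageI)
 qed
 qed
 then have "bij_betw (sst c e) (SR c e) (SR c e)" using fin by (simp add: bij_betw_def eq_card_imp_inj_on)
 then show "sst c e permutes SR c e"
 proof (rule bij_imp_permutes)
 fix q assume q: "q ~: SR c e"
 obtain p k where "q = code p k" by (rule code_cases)
 then show "sst c e q = q" using q by (auto simp: sst_code)
 qed
qed (simp_all add: finite_SP SR_sub)

lemma good_drop: "good (%l. if kd l = KY then 1 else gl (rl (%p. code p 0) l) :: 'k::field_char_0 mat_gca)"
 unfolding good_def
proof (intro conjI allI impI)
 fix a :: letter and f :: "'k mat_gca"
 show "(if kd a = KY then 1 else gl (rl (%p. code p 0) a)) * f = f * (if kd a = KY then 1 else gl (rl (%p. code p 0) a))" if "isl a"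
 using that gl_comm_even[of "rl (%p. code p 0) a" f] by simp
 show "(if kd a = KY then 1 else gl (rl (%p. code p 0) a) :: 'k mat_gca) : deg1" if "~ isl a"
 using that good_gl(2)[of "rl (%p. code p 0) a" a] by (simp add: isl_kd)
qed

text \<open>All x and theta letters are put at position 0 of their cycle, which is harmless since
  averaging follows; the y letters survive in the cycle length alone.\<close>

definition scode :: "letter list => letter list" where
 "scode w = map (rl (%p. code p 0)) (filter (%l. kd l ~= KY) w)"

definition drp :: "'k::field_char_0 mat_gca => 'k mat_gca" where
 "drp = lhom (%l. if kd l = KY then 1 else gl (rl (%p. code p 0) l))"

lemma drp_gw: "drp (gw w) = (gw (scode w) :: 'k::field_char_0 mat_gca)"
 unfolding drp_def lhom_gw[OF good_drop] scode_def by (induction w) simp_all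

definition dg :: "nat => letter multiset => bool" where
 "dg c M \<longleftrightarrow> (\<forall>l\<in>#M. isdiag l) & idxs M = {..<c}"

definition Le :: "nat => nat => (nat => nat) => 'k::field_char_0 mat_gca => 'k mat_gca" where
 "Le c n e f = rsum (SP c e) n (Hz (sst c e) (SR c e) (nu (sst c e) (SR c e) (drp f)))"

lemma glin_Le: "glin (Le c n e)" unfolding Le_def[abs_def] drp_def
 by (intro glin_comp[OF glin_rsum] glin_comp[OF glin_Hz] glin_comp[OF glin_nu] glin_lhom)

text \<open>The cycle lengths depend on the word, so this is not a composite of fixed maps.
  \<open>Le\<close> freezes them; as they are read off from the multiset of letters, swaps do not
  change them.\<close>

definition L :: "nat => nat => 'k::field_char_0 mat_gca => 'k mat_gca" where
 "L c n = glift (%w. if dg c (mset w) then Le c n (ell (mset w)) (gw w) else 0)"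

lemma glin_L: "glin (L c n)" unfolding L_def by (rule glin_glift)

lemma L_gw: "L c n (gw w) = (if dg c (mset w) then Le c n (ell (mset w)) (gw w) else (0 :: 'k::field_char_0 mat_gca))"
 unfolding L_def
proof (rule glift_gw, rule supersymI)
 fix u v and a b :: letter
 have m: "mset (u @ a # b # v) = mset (u @ b # a # v)" by simp
 have s: "supersym (%w. Le c n e (gw w) :: 'k mat_gca)" for e by (rule supersym_glin[OF glin_Le])
 show "(if dg c (mset (u @ a # b # v)) then Le c n (ell (mset (u @ a # b # v))) (gw (u @ a # b # v)) else 0) =
 (if dg c (mset (u @ b # a # v)) then Le c n (ell (mset (u @ b # a # v))) (gw (u @ b # a # v)) else (0 :: 'k mat_gca))"
 if "isl a \<or> isl b" unfolding m supersym_even[OF s that] ..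
 show "(if dg c (mset (u @ a # b # v)) then Le c n (ell (mset (u @ a # b # v))) (gw (u @ a # b # v)) else 0) =
 - (if dg c (mset (u @ b # a # v)) then Le c n (ell (mset (u @ b # a # v))) (gw (u @ b # a # v)) else (0 :: 'k mat_gca))"
 if "~ isl a" "~ isl b" unfolding m supersym_odd[OF s that] by (simp del: gw_simps)
qed

lemma L_dg: "dg c (mset w) ==> L c n (gw w) = (rsum (SP c (ell (mset w))) n (Hz (sst c (ell (mset w))) (SR c (ell (mset w)))
 (nu (sst c (ell (mset w))) (SR c (ell (mset w))) (gw (scode w)))) :: 'k::field_char_0 mat_gca)"
 unfolding L_gw Le_def drp_gw by (simp only: if_True)

lemma ell_pos: "ell M p > 0 \<longleftrightarrow> (\<exists>l\<in>#M. kd l ~= KX & rw l = p)"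
 unfolding ell_def nonempty_has_size[symmetric] set_mset_eq_empty_iff[symmetric] by auto

lemma scode_kq:
 assumes "dg c (mset w)"
 shows "permutation_graph.kq (SR c (ell (mset w))) (SP c (ell (mset w))) (mset (scode w))"
proof -
 let ?e = "ell (mset w)"
 interpret permutation_graph "sst c ?e" "SR c ?e" "SP c ?e" by (rule standard_graph)
 have lt: "rw l < c" "cl l = rw l" if "l : set w" for l using assms that by (auto simp: dg_def isdiag_def idxs_def)
 have "klet (SR c ?e) (SP c ?e) (rl (%p. code p 0) l)" if "l : set w" "kd l ~= KY" for l
 proof (cases "kd l")
 case KT
 then have "?e (rw l) > 0" unfolding ell_pos using that(1) by (intro bexI[of _ l]) auto
 then show ?thesis using lt[OF that(1)] KT by (simp add: klet_def)
 qed (use lt[OF that(1)] that(2) in \<open>simp_all add: klet_def\<close>)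
 moreover have "mk KX q q : set (scode w)" if "q : SP c ?e - SR c ?e" for q
 proof -
 obtain p k where q: "q = code p k" by (rule code_cases)
 then have p: "p < c" "k = 0" "?e p = 0" using that by auto
 then obtain l where l: "l : set w" "rw l = p" using assms lt unfolding dg_def idxs_def
 by (metis (no_types, lifting) UnE imageE lessThan_iff set_mset_mset)
 have "kd l = KX" using l p(3) ell_pos[of "mset w" p] by auto
 then have "rl (%p. code p 0) l = mk KX q q" using l lt[OF l(1)] p(2) q by (intro letter_eqI) simp_all
 moreover have "rl (%p. code p 0) l : set (scode w)" using l(1) \<open>kd l = KX\<close> unfolding scode_def by simp
 ultimately show ?thesis by (simp only:)
 qed
 ultimately show ?thesis unfolding kq_def by (auto simp: scode_def)
qed

section \<open>Every canonical cycle is a combination of standard ones\<close>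

context permutation_graph
begin

lemma funpow_in: "q : P ==> (t ^^ k) q : P"
proof -
 assume q: "q : P"
 show ?thesis
 proof (cases "q : R")
 case True then show ?thesis using tk[of k q] P(2) by blast
 next
 case False
 then have "(t ^^ k) q = q" by (induction k) (simp_all add: t_fix)
 then show ?thesis using q by simp
 qed
qed

text \<open>A return after d > 0 steps bounds the orbit by d points, so the first m iterates are
  distinct, and the m-th one can only be the starting point.\<close>

lemma orbit_enum:
 assumes O: "card (range (%k. (t ^^ k) b)) = m"
 shows "bij_betw (%k. (t ^^ k) b) {..<m} (range (%k. (t ^^ k) b))" "(t ^^ m) b = b"
proof -
 have ret: "(t ^^ (c - a)) b = b" if "a < c" "(t ^^ a) b = (t ^^ c) b" for a c
 proof -
 have "(t ^^ c) b = (t ^^ a) ((t ^^ (c - a)) b)" using that(1) funpow_add[of a "c - a" t] by (simp add: o_def)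
 then have "(t ^^ a) ((t ^^ (c - a)) b) = (t ^^ a) b" using that(2) by simp
 then show ?thesis using inj_fn[OF permutes_inj[OF t], of a] by (simp add: inj_eq)
 qed
 have bound: "m <= d" and fin: "finite (range (%k. (t ^^ k) b))" if d: "d > 0" "(t ^^ d) b = b" for d
 proof -
 have s: "range (%k. (t ^^ k) b) \<subseteq> (%k. (t ^^ k) b) ` {..<d}"
 proof
 fix x assume "x : range (%k. (t ^^ k) b)"
 then obtain k where "x = (t ^^ k) b" by blast
 then have "x = (t ^^ (k mod d)) b" using funpow_mod_eq[OF d(2), of k] by simp
 then show "x : (%k. (t ^^ k) b) ` {..<d}" using d(1) by auto
 qed
 then show "finite (range (%k. (t ^^ k) b))" by (rule finite_subset) simp
 show "m <= d" using surj_card_le[OF _ s] O by simp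
 qed
 have f: "finite (range (%k. (t ^^ k) b))" by (rule fin[OF per_pos funpow_per[OF t R]])
 have inj: "inj_on (%k. (t ^^ k) b) {..<m}"
 proof (rule linorder_inj_onI)
 fix a c assume "a < c" "a : {..<m}" "c : {..<m}"
 then show "(t ^^ a) b ~= (t ^^ c) b" using ret[of a c] bound[of "c - a"] by auto
 qed auto
 have "(%k. (t ^^ k) b) ` {..<m} = range (%k. (t ^^ k) b)" using card_image[OF inj] O by (intro card_subset_eq[OF f]) auto
 with inj show bij: "bij_betw (%k. (t ^^ k) b) {..<m} (range (%k. (t ^^ k) b))" by (simp add: bij_betw_def)
 then have "(t ^^ m) b : (%k. (t ^^ k) b) ` {..<m}" by (simp add: bij_betw_def)
 then obtain k where k: "k < m" "(t ^^ k) b = (t ^^ m) b" by auto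
 then have "(t ^^ (m - k)) b = b" by (intro ret)
 then have "m <= m - k" using k(1) by (intro bound) simp_all
 then have "k = 0" using k(1) by simp
 then show "(t ^^ m) b = b" using k(2) by simp
qed

text \<open>A letter and its translates along the cycle have the same mean, so within an orbit the
  position of a letter is lost.\<close>

lemma nu_orbit:
 assumes "\<forall>l\<in>set u. klet R P l" "!!p. p : P ==> EX k. f p = (t ^^ k) p"
 shows "nu t R (gw (map (rl f) u)) = (nu t R (gw u) :: 'k::field_char_0 mat_gca)" using assms(1)
proof (induction u)
 case (Cons l u)
 then have l: "rw l = cl l" "rw l : P" using P(2) by (auto simp: klet_def)
 then obtain k where "f (rw l) = (t ^^ k) (rw l)" using assms(2) by blast
 then have e: "rl f l = rl (t ^^ k) l" using l(1) by (intro rl_cong) simp_all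
 show ?case using Cons unfolding list.map gw_simps ghom_mult[OF ghom_nu] nu_gl e avl_rl[OF t R] by simp
qed simp

text \<open>\<open>\<beta>\<close> numbers the orbits. With a base point in each orbit the standard
  permutation is conjugate to \<open>t\<close>, and by \<open>nu_orbit\<close> all letters may be
  moved to the base points.\<close>

lemma compare_standard:
 assumes u: "kq (mset u)" and img: "\<beta> ` P = {..<c}" and inv: "!!p. p : R ==> \<beta> (t p) = \<beta> p"
 and orb: "!!p q. p : P ==> q : P ==> \<beta> p = \<beta> q ==> EX k. q = (t ^^ k) p"
 and e: "!!p. p < c ==> e p = card {q : R. \<beta> q = p}"
 shows "rsum P n (Hz t R (nu t R (gw u))) =
 (rsum (SP c e) n (Hz (sst c e) (SR c e) (nu (sst c e) (SR c e) (gw (map (rl (%p. code (\<beta> p) 0)) u)))) :: 'k::field_char_0 mat_gca)"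
proof -
 interpret s: permutation_graph "sst c e" "SR c e" "SP c e" by (rule standard_graph)
 have bk: "\<beta> ((t ^^ k) p) = \<beta> p" for k p
 proof (induction k)
 case (Suc k)
 then show ?case using inv[of "(t ^^ k) p"] t_fix[of "(t ^^ k) p"] by (cases "(t ^^ k) p : R") simp_all
 qed simp
 have "EX q. p < c --> q : P & \<beta> q = p" for p using img by (metis imageE lessThan_iff)
 then obtain b where b: "!!p. p < c ==> b p : P" "!!p. p < c ==> \<beta> (b p) = p" by metis
 define \<phi> where "\<phi> q = (case prod_decode q of (p, k) => (t ^^ k) (b p))" for q
 have \<phi>: "\<phi> (code p k) = (t ^^ k) (b p)" for p k by (simp add: \<phi>_def)
 have fib: "range (%k. (t ^^ k) (b p)) = {q : P. \<beta> q = p}" if "p < c" for p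
 proof
 show "range (%k. (t ^^ k) (b p)) \<subseteq> {q : P. \<beta> q = p}" using b[OF that] funpow_in bk by auto
 show "{q : P. \<beta> q = p} \<subseteq> range (%k. (t ^^ k) (b p))"
 proof
 fix q assume "q : {q : P. \<beta> q = p}"
 then have "EX k. q = (t ^^ k) (b p)" using orb[OF b(1)[OF that], of q] b(2)[OF that] by simp
 then show "q : range (%k. (t ^^ k) (b p))" by blast
 qed
 qed
 have bR: "b p : R" if "p < c" "q : R" "\<beta> q = p" for p q
 proof -
 have "q : range (%k. (t ^^ k) (b p))" unfolding fib[OF that(1)] using that P(2) by blast
 then obtain k where "q = (t ^^ k) (b p)" by blast
 then show ?thesis using that(2) tk by simp
 qed
 \<comment> \<open>A bare point is an orbit of size 1 with cycle length 0; hence the orbit is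
   enumerated up to \<open>max 1 (e p)\<close>, while the return time is \<open>e p\<close>.\<close>
 have E: "bij_betw (%k. (t ^^ k) (b p)) {..<max 1 (e p)} {q : P. \<beta> q = p} & (e p > 0 \<longleftrightarrow> b p : R) & (t ^^ e p) (b p) = b p"
 if p: "p < c" for p
 proof (cases "b p : R")
 case True
 have "range (%k. (t ^^ k) (b p)) \<subseteq> R" using True tk by auto
 then have "{q : R. \<beta> q = p} = range (%k. (t ^^ k) (b p))" using fib[OF p] P(2) by blast
 then have ep: "card (range (%k. (t ^^ k) (b p))) = e p" using e[OF p] by simp
 have "b p : {q : R. \<beta> q = p}" using True b(2)[OF p] by simp
 then have "e p > 0" using e[OF p] R by (auto simp: card_gt_0_iff)
 then show ?thesis using orbit_enum[OF ep] True fib[OF p] by (simp add: max_absorb2)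
 next
 case False
 then have "{q : R. \<beta> q = p} = {}" using bR[OF p] by blast
 then have ep: "e p = 0" unfolding e[OF p] by (simp only: card.empty)
 have "(t ^^ k) (b p) = b p" for k using False by (induction k) (simp_all add: t_fix)
 then have "{q : P. \<beta> q = p} = {b p}" using fib[OF p] by auto
 then show ?thesis using ep False by (simp add: bij_betw_def lessThan_Suc)
 qed
 have phi_in: "\<phi> q : P" "\<beta> (\<phi> q) = fst (prod_decode q)" if "q : SP c e" for q
 proof -
 obtain p k where q: "q = code p k" by (rule code_cases)
 then have "p < c" using that by simp
 then show "\<phi> q : P" "\<beta> (\<phi> q) = fst (prod_decode q)" using b funpow_in bk by (simp_all add: q \<phi>)
 qed
 have bij: "bij_betw \<phi> (SP c e) P"
 proof (rule bij_betw_imageI)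
 show "inj_on \<phi> (SP c e)"
 proof (rule inj_onI)
 fix x y assume xy: "x : SP c e" "y : SP c e" "\<phi> x = \<phi> y"
 obtain p k where x: "x = code p k" by (rule code_cases)
 obtain p' k' where y: "y = code p' k'" by (rule code_cases)
 have "p = p'" using phi_in(2)[OF xy(1)] phi_in(2)[OF xy(2)] xy(3) x y by simp
 moreover have "k = k'"
 proof (rule inj_onD)
 show "inj_on (%k. (t ^^ k) (b p)) {..<max 1 (e p)}" using E[of p] xy(1) x by (simp add: bij_betw_def)
 show "(t ^^ k) (b p) = (t ^^ k') (b p)" using xy(3) \<open>p = p'\<close> by (simp add: x y \<phi>)
 show "k : {..<max 1 (e p)}" "k' : {..<max 1 (e p)}" using xy(1,2) \<open>p = p'\<close> by (simp_all add: x y)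
 qed
 ultimately show "x = y" using x y by simp
 qed
 show "\<phi> ` SP c e = P"
 proof
 show "\<phi> ` SP c e \<subseteq> P" using phi_in by blast
 show "P \<subseteq> \<phi> ` SP c e"
 proof
 fix q assume q: "q : P"
 then have p: "\<beta> q < c" using img by auto
 have "q : (%k. (t ^^ k) (b (\<beta> q))) ` {..<max 1 (e (\<beta> q))}" using E[OF p] q by (auto simp: bij_betw_def)
 then obtain k where "k < max 1 (e (\<beta> q))" "q = \<phi> (code (\<beta> q) k)" by (auto simp: \<phi>)
 then show "q : \<phi> ` SP c e" using p by (metis code_SP imageI)
 qed
 qed
 qed
 have SRim: "\<phi> ` SR c e = R"
 proof
 show "\<phi> ` SR c e \<subseteq> R"
 proof
 fix x assume "x : \<phi> ` SR c e"
 then obtain q where q: "q : SR c e" "x = \<phi> q" by blast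
 obtain p k where pk: "q = code p k" by (rule code_cases)
 then have "p < c" "e p > 0" using q by auto
 then show "x : R" using E[of p] q pk tk by (simp add: \<phi>)
 qed
 show "R \<subseteq> \<phi> ` SR c e"
 proof
 fix x assume x: "x : R"
 then have "x : \<phi> ` SP c e" using bij P(2) by (auto simp: bij_betw_def)
 then obtain q where q: "q : SP c e" "x = \<phi> q" by blast
 obtain p k where pk: "q = code p k" by (rule code_cases)
 then have p: "p < c" "k < max 1 (e p)" "b p : R" using q x tk by (auto simp: \<phi>)
 then have "q : SR c e" using E[of p] pk by (auto simp: max_def split: if_splits)
 then show "x : \<phi> ` SR c e" using q by blast
 qed
 qed
 have st: "\<phi> (sst c e q) = t (\<phi> q)" if "q : SR c e" for q
 proof -
 obtain p k where pk: "q = code p k" by (rule code_cases)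
 then have p: "p < c" "k < e p" using that by simp_all
 have "(t ^^ (Suc k mod e p)) (b p) = (t ^^ Suc k) (b p)" using E[OF p(1)] by (intro funpow_mod_eq) simp
 then show ?thesis using p pk by (simp add: sst_code \<phi>)
 qed
 let ?u = "map (rl (%p. code (\<beta> p) 0)) u"
 have kl: "\<forall>l\<in>set u. klet R P l" using u by (simp add: kq_def)
 have bl: "\<beta> p < c" if "p : P" for p using that img by auto
 have "klet (SR c e) (SP c e) (rl (%p. code (\<beta> p) 0) l)" if "l : set u" for l
 proof -
 have l: "klet R P l" using kl that by blast
 show ?thesis
 proof (cases "kd l = KX")
 case True
 then show ?thesis using l bl by (auto simp: klet_def)
 next
 case False
 then have l': "kd l = KT" "rw l : R" "rw l = cl l" using l by (auto simp: klet_def)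
 have bc: "\<beta> (rw l) < c" using l'(2) P(2) bl by blast
 then have "e (\<beta> (rw l)) > 0" using E[OF bc] bR[OF bc l'(2)] by simp
 then show ?thesis using l' bc by (simp add: klet_def)
 qed
 qed
 moreover have "mk KX q q : set ?u" if "q : SP c e - SR c e" for q
 proof -
 obtain p k where q: "q = code p k" by (rule code_cases)
 then have p: "p < c" "k = 0" "e p = 0" using that by auto
 then have "b p : P - R" using E[of p] b by simp
 then have "mk KX (b p) (b p) : set u" using u unfolding kq_def by simp
 then have "rl (%p. code (\<beta> p) 0) (mk KX (b p) (b p)) : set ?u" unfolding set_map by (rule imageI)
 then show ?thesis using b(2)[OF p(1)] q p(2) by (simp del: mk.simps)
 qed
 ultimately have kq': "s.kq (mset ?u)" unfolding s.kq_def by auto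
 have zk: "gw ?u : (gsp s.kq :: 'k mat_gca set)" by (rule gsp_gw) (rule kq')
 let ?z = "Hz (sst c e) (SR c e) (nu (sst c e) (SR c e) (gw ?u)) :: 'k mat_gca"
 have z: "?z : gsp s.aw" by (intro s.Hz_gsp s.nu_gsp zk)
 have zi: "?z : gsp (%M. idxs M \<subseteq> SP c e)" by (rule gsp_mono[OF z]) (simp add: s.aw_def pt_def pg_def)
 have "rsum (SP c e) n ?z = rsum P n (relabel \<phi> ?z)" by (rule rsum_reindex[OF zi bij, symmetric])
 also have "relabel \<phi> ?z = Hz t R (nu t R (relabel \<phi> (gw ?u)))"
 by (rule permutation_graph_intertwine[OF s.permutation_graph_axioms permutation_graph_axioms bij SRim st zk])
 also have "nu t R (relabel \<phi> (gw ?u)) = (nu t R (gw u) :: 'k mat_gca)"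
 proof -
 have "map (rl \<phi>) ?u = map (rl (%p. b (\<beta> p))) u"
 unfolding map_map by (intro map_cong refl) (simp add: rl_rl o_def \<phi>)
 then have "relabel \<phi> (gw ?u) = (gw (map (rl (%p. b (\<beta> p))) u) :: 'k mat_gca)" unfolding relabel_gw by (simp only:)
 moreover have "EX k. b (\<beta> p) = (t ^^ k) p" if "p : P" for p
 using orb[OF that b(1)[OF bl[OF that]]] b(2)[OF bl[OF that]] by simp
 ultimately show ?thesis using nu_orbit[OF kl, of "%p. b (\<beta> p)"] by simp
 qed
 finally show ?thesis ..
qed

end

lemma count_image_size: "count (image_mset f M) p = size (filter_mset (%x. f x = p) M)" by (induction M) auto

lemma size_odd_le_1:
 assumes "distinct (filter (%l. ~ isl l) v)" "\<forall>l\<in>set v. isdiag l"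
 shows "size (filter_mset (%l. kd l = KT & rw l = p) (mset v)) <= 1"
proof -
 let ?f = "filter (%l. kd l = KT & rw l = p) v"
 have e: "?f = filter (%l. kd l = KT & rw l = p) (filter (%l. ~ isl l) v)"
 by (simp add: isl_kd filter_filter cong: conj_cong)
 have "distinct ?f" unfolding e by (rule distinct_filter[OF assms(1)])
 then have "length ?f = card (set ?f)" by (rule distinct_card[symmetric])
 also have "... <= card {mk KT p p}"
 proof (rule card_mono)
 show "set ?f \<subseteq> {mk KT p p}"
 proof
 fix l assume "l : set ?f"
 then have "l = mk KT p p" using assms(2) by (intro letter_eqI) (auto simp: isdiag_def simp del: mk.simps)
 then show "l : {mk KT p p}" by blast
 qed
 qed simp
 finally have "length ?f <= 1" by simp
 then show ?thesis unfolding mset_filter[symmetric] size_mset .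
qed

context permutation_graph
begin

text \<open>Letters are labelled by their orbits, and diagonal y letters are added until the number
  of y and theta letters at a label is the orbit length. The standard cycle of this diagonal word is
  the given one.\<close>

lemma canonical_standard:
 assumes u: "kq (mset u)"
 shows "\<exists>c\<le>card P. \<exists>g\<in>gsp (dg c). rsum P n (Hz t R (nu t R (gw u))) = (L c n g :: 'k::field_char_0 mat_gca)"
proof -
 let ?O = "%p. range (%k. (t ^^ k) p)"
 define c where "c = card (?O ` P)"
 have cP: "c <= card P" unfolding c_def by (rule card_image_le[OF P(1)])
 obtain h where h: "bij_betw h (?O ` P) {0..<c}" using ex_bij_betw_finite_nat[of "?O ` P"] P(1) unfolding c_def by blast
 define \<beta> where "\<beta> p = h (?O p)" for p
 have img: "\<beta> ` P = {..<c}" using h by (simp add: \<beta>_def bij_betw_def image_image atLeast0LessThan)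
 have inv: "\<beta> (t p) = \<beta> p" for p
 proof -
 have "?O (t p) = ?O p"
 proof
 show "?O (t p) \<subseteq> ?O p"
 proof
 fix x assume "x : ?O (t p)"
 then obtain k where "x = (t ^^ k) (t p)" by blast
 then have "x = (t ^^ Suc k) p" by (simp add: funpow_swap1)
 then show "x : ?O p" by blast
 qed
 show "?O p \<subseteq> ?O (t p)"
 proof
 fix x assume "x : ?O p"
 then obtain k where k: "x = (t ^^ k) p" by blast
 have "(t ^^ per R) p = (t ^^ (per R - 1)) (t p)" using per_pos[of R] by (metis Suc_diff_1 comp_apply funpow_Suc_right)
 then have "p = (t ^^ (per R - 1)) (t p)" using funpow_per[OF t R] by simp
 then have "x = (t ^^ (k + (per R - 1))) (t p)" unfolding k funpow_add by simp
 then show "x : ?O (t p)" by blast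
 qed
 qed
 then show ?thesis by (simp add: \<beta>_def)
 qed
 have orb: "EX k. q = (t ^^ k) p" if "p : P" "q : P" "\<beta> p = \<beta> q" for p q
 proof -
 have "?O p = ?O q" using that h unfolding \<beta>_def bij_betw_def by (auto dest: inj_onD)
 moreover have "q : ?O q" by (rule range_eqI[of _ _ 0]) simp
 ultimately show ?thesis by blast
 qed
 define d where "d p = card {q : R. \<beta> q = p}" for p
 define v where "v = map (rl \<beta>) u"
 have std: "rsum P n (Hz t R (nu t R (gw u))) =
 (rsum (SP c d) n (Hz (sst c d) (SR c d) (nu (sst c d) (SR c d) (gw (map (rl (%p. code (\<beta> p) 0)) u)))) :: 'k mat_gca)"
 by (rule compare_standard[OF u img inv orb]) (simp_all add: d_def)
 have cv: "map (rl (%p. code (\<beta> p) 0)) u = map (rl (%p. code p 0)) v"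
 unfolding v_def map_map by (intro map_cong refl) (simp add: rl_rl o_def)
 have kl: "klet R P l" if "l : set u" for l using u that by (simp add: kq_def)
 have vl: "kd l ~= KY & isdiag l & rw l < c" if lv: "l : set v" for l
 proof -
 obtain l' where l': "l' : set u" "l = rl \<beta> l'" using lv by (auto simp: v_def)
 have k: "klet R P l'" using kl[OF l'(1)] .
 then have "rw l' : P" using P(2) by (auto simp: klet_def)
 then have "\<beta> (rw l') < c" using img by auto
 then show ?thesis using k l'(2) by (auto simp: klet_def isdiag_def)
 qed
 show ?thesis
 \<comment> \<open>Two thetas in one orbit become the same letter once labelled, and then the
   canonical element vanishes.\<close>
 proof (cases "distinct (filter (%l. ~ isl l) v)")
 case False
 have "filter (%l. ~ isl l) (map (rl (%p. code p 0)) v) = map (rl (%p. code p 0)) (filter (%l. ~ isl l) v)"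
 by (simp add: filter_map o_def)
 then have "~ distinct (filter (%l. ~ isl l) (map (rl (%p. code p 0)) v))" using False by (simp add: distinct_map)
 from gw_repeat[OF this] have "gw (map (rl (%p. code p 0)) v) = (0 :: 'k mat_gca)" .
 then have "rsum P n (Hz t R (nu t R (gw u))) = (0 :: 'k mat_gca)"
 unfolding std cv by (simp add: glin_0[OF glin_nu] glin_0[OF glin_Hz] glin_0[OF glin_rsum])
 then show ?thesis by (intro exI[of _ 0]) (auto intro!: bexI[of _ 0] simp: glin_0[OF glin_L])
 next
 case True
 define \<theta> where "\<theta> p = size (filter_mset (%l. kd l = KT & rw l = p) (mset v))" for p
 \<comment> \<open>The y letters supply what the thetas leave of each orbit; by \<open>th1\<close>
   the subtraction is not truncated.\<close>
 define w where "w = v @ concat (map (%p. replicate (d p - \<theta> p) (mk KY p p)) [0..<c])"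
 have th1: "\<theta> p <= d p" for p
 proof (cases "\<theta> p = 0")
 case False
 then have "filter_mset (%l. kd l = KT & rw l = p) (mset v) ~= {#}" by (auto simp: \<theta>_def)
 then obtain l where "l : set v" "kd l = KT" "rw l = p" unfolding set_mset_eq_empty_iff[symmetric] by auto
 then obtain l' where l': "l' : set u" "kd l' = KT" "\<beta> (rw l') = p" by (auto simp: v_def)
 then have "rw l' : {q : R. \<beta> q = p}" using kl[OF l'(1)] by (auto simp: klet_def)
 then have "{q : R. \<beta> q = p} ~= {}" by blast
 then have "d p \<ge> 1" unfolding d_def One_nat_def Suc_le_eq card_gt_0_iff using R by simp
 moreover have "\<theta> p <= 1" unfolding \<theta>_def using vl by (intro size_odd_le_1[OF True]) blast
 ultimately show ?thesis by simp
 qed simp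
 have el: "ell (mset w) p = d p" if "p < c" for p
 proof -
 have a: "size (filter_mset (%l. kd l ~= KX & rw l = p) (mset v)) = \<theta> p"
 proof -
 have "kd l ~= KX \<longleftrightarrow> kd l = KT" if "l : set v" for l using vl[OF that] by (cases "kd l") simp_all
 then show ?thesis unfolding \<theta>_def by (intro arg_cong[where f = size] filter_mset_cong refl) simp
 qed
 have b: "size (filter_mset (%l. kd l ~= KX & rw l = p) (mset (concat (map (%p. replicate (f p) (mk KY p p)) [0..<m])))) =
 (if p < m then f p else 0)" for f m
 unfolding mset_filter[symmetric] size_mset by (induction m) (auto simp: less_Suc_eq simp del: mk.simps)
 show ?thesis unfolding ell_def w_def mset_append filter_union_mset size_union a b using that th1[of p] by simp
 qed
 have wl: "isdiag l & rw l < c" if "l : set w" for l using that vl by (auto simp: w_def isdiag_def simp del: mk.simps)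
 have dgw: "dg c (mset w)"
 proof -
 have "{..<c} \<subseteq> idxs (mset w)"
 proof
 fix p assume p: "p : {..<c}"
 then obtain q where q: "q : P" "\<beta> q = p" using img by (metis imageE)
 have "\<exists>l\<in>set w. rw l = p"
 proof (cases "q : R")
 case True
 then have "q : {q : R. \<beta> q = p}" using q by simp
 then have "d p > 0" unfolding d_def using R by (auto simp: card_gt_0_iff)
 then have "ell (mset w) p > 0" using el p by simp
 then show ?thesis unfolding ell_pos by auto
 next
 case False
 then have "mk KX q q : set u" using q u by (simp add: kq_def)
 then have "rl \<beta> (mk KX q q) : set w" unfolding w_def v_def set_append set_map by blast
 then show ?thesis using q(2) by (intro bexI[of _ "rl \<beta> (mk KX q q)"]) (simp_all del: mk.simps)
 qed
 then show "p : idxs (mset w)" by (auto simp: idxs_def)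
 qed
 moreover have "rw l < c & cl l < c" if "l : set w" for l using wl[OF that] by (simp add: isdiag_def)
 then have "idxs (mset w) \<subseteq> {..<c}" by (auto simp: idxs_def)
 ultimately show ?thesis using wl by (auto simp: dg_def)
 qed
 have "filter (%l. kd l ~= KY) w = v"
 proof -
 have "filter (%l. kd l ~= KY) v = v" using vl by (intro filter_True) blast
 moreover have "filter (%l. kd l ~= KY) (concat (map (%p. replicate (d p - \<theta> p) (mk KY p p)) [0..<c])) = []"
 by (auto simp: filter_empty_conv simp del: mk.simps)
 ultimately show ?thesis by (simp add: w_def del: mk.simps)
 qed
 then have sc: "scode w = map (rl (%p. code (\<beta> p) 0)) u" unfolding scode_def cv by simp
 have "L c n (gw w) = (rsum (SP c (ell (mset w))) n (Hz (sst c (ell (mset w))) (SR c (ell (mset w)))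
 (nu (sst c (ell (mset w))) (SR c (ell (mset w))) (gw (map (rl (%p. code (\<beta> p) 0)) u)))) :: 'k mat_gca)"
 unfolding L_dg[OF dgw] sc ..
 also have "... = rsum P n (Hz t R (nu t R (gw u)))"
 by (rule compare_standard[OF u img inv orb, symmetric]) (simp_all add: el d_def)
 finally show ?thesis using cP gsp_gw[of "dg c" w] dgw by metis
 qed
qed

end

text \<open>The number c of cycles, bare points included, varies from summand to summand but is at
  most \<open>card P\<close>; the summands are grouped by it.\<close>

lemma canon_L:
 assumes "canon P v" "finite P"
 shows "EX g. (ALL c. g c : gsp (dg c)) & rsum P n v = (\<Sum>c\<le>card P. L c n (g c) :: 'k::field_char_0 mat_gca)"
 using assms(1)
proof induction
 case zero
 then show ?case by (intro exI[of _ "%_. 0"]) (simp add: glin_0[OF glin_L] glin_0[OF glin_rsum])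
next
 case (step t R g f)
 let ?Q = "%v. EX g. (ALL c. g c : gsp (dg c)) & rsum P n v = (\<Sum>c\<le>card P. L c n (g c) :: 'k mat_gca)"
 have add: "?Q (a + b)" if ab: "?Q a" "?Q b" for a b
 proof -
 obtain g h where "ALL c. g c : gsp (dg c)" "rsum P n a = (\<Sum>c\<le>card P. L c n (g c))"
 "ALL c. h c : gsp (dg c)" "rsum P n b = (\<Sum>c\<le>card P. L c n (h c))" using ab by blast
 then show ?thesis
 by (intro exI[of _ "%c. g c + h c"]) (simp add: gsp_add glin_add[OF glin_L] glin_add[OF glin_rsum] sum.distrib)
 qed
 have "?Q (Hz t R (nu t R g))" using step(2)
 proof (induction rule: gsp_induct)
 case (add f g)
 then show ?case unfolding glin_add[OF glin_nu] glin_add[OF glin_Hz] by (rule \<open>?Q _ ==> ?Q _ ==> ?Q _\<close>)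
 next
 case (word a u)
 obtain c g where c: "c <= card P" "g : gsp (dg c)" "rsum P n (Hz t R (nu t R (gw u))) = L c n (g :: 'k mat_gca)"
 using permutation_graph.canonical_standard[OF step(1) word, where n = n] by blast
 have "(\<Sum>x\<le>card P. L x n (if x = c then cs a * g else 0)) = cs a * L c n g"
 using c(1) by (subst sum.remove[of _ c]) (simp_all add: glin_0[OF glin_L] glin_cs[OF glin_L])
 then show ?case using c by (intro exI[of _ "%x. if x = c then cs a * g else 0"])
 (simp add: gsp_cs glin_cs[OF glin_nu] glin_cs[OF glin_Hz] glin_cs[OF glin_rsum] del: gw_simps)
 next
 show "?Q (Hz t R (nu t R 0))" by (intro exI[of _ "%_. 0"]) (simp add: glin_0[OF glin_L] glin_0[OF glin_rsum] glin_0[OF glin_nu] glin_0[OF glin_Hz])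
 qed
 then show ?case using step(4) by (rule add)
qed

section \<open>Symmetry and diagonal part of the standard cycles\<close>

lemma card_SR_fibre: "card {q : SR c e. fst (prod_decode q) = p} = (if p < c then e p else 0)"
proof -
 have "{q : SR c e. fst (prod_decode q) = p} = (if p < c then code p ` {..<e p} else {})" by (auto simp: SR_def image_iff)
 moreover have "inj_on (code p) {..<e p}" by (auto intro: inj_onI)
 ultimately show ?thesis by (simp add: card_image)
qed

text \<open>Renaming the cycles changes the standard graph by a conjugation, which
  \<open>compare_standard\<close> absorbs. By this invariance \<open>L\<close> sees only the
  symmetrisation of its argument.\<close>

lemma L_relabel:
 assumes g: "g : gsp (dg c)" and \<pi>: "\<pi> permutes {..<c}"
 shows "L c n (relabel \<pi> g) = (L c n g :: 'k::field_char_0 mat_gca)"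
proof (rule glin_on_gsp[OF glin_comp[OF glin_L glin_rlb] glin_L g])
 fix w assume w: "dg c (mset w)"
 let ?w = "map (rl \<pi>) w"
 let ?e = "ell (mset w)" and ?e' = "ell (mset ?w)"
 have inj: "\<pi> p = \<pi> q \<longleftrightarrow> p = q" for p q using permutes_inj[OF \<pi>] by (simp add: inj_eq)
 have "idxs (mset ?w) = \<pi> ` idxs (mset w)" by (auto simp: idxs_def image_image image_Un)
 then have w': "dg c (mset ?w)" using w permutes_image[OF \<pi>] by (auto simp: dg_def isdiag_def)
 have ee: "?e' (\<pi> p) = ?e p" for p unfolding ell_def by (simp add: filter_mset_image_mset inj)
 interpret permutation_graph "sst c ?e'" "SR c ?e'" "SP c ?e'" by (rule standard_graph)
 \<comment> \<open>This numbering of the orbits undoes \<open>\<pi>\<close>, so that the comparison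
   leads to the standard graph of the original word.\<close>
 define \<beta> where "\<beta> q = inv_into UNIV \<pi> (fst (prod_decode q))" for q
 have \<pi>': "inv_into UNIV \<pi> permutes {..<c}" by (rule permutes_inv[OF \<pi>])
 have img: "\<beta> ` SP c ?e' = {..<c}"
 proof -
 have "(%q. fst (prod_decode q)) ` SP c ?e' = {..<c}"
 by (auto simp: SP_def image_image split_beta intro!: image_eqI[of _ _ "(_, 0)"])
 then have "inv_into UNIV \<pi> ` (%q. fst (prod_decode q)) ` SP c ?e' = {..<c}" using permutes_image[OF \<pi>'] by simp
 then show ?thesis by (simp add: \<beta>_def image_image)
 qed
 have inv: "\<beta> (sst c ?e' q) = \<beta> q" for q
 proof -
 obtain p k where "q = code p k" by (rule code_cases)
 then show ?thesis by (simp add: \<beta>_def sst_code)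
 qed
 have it: "(sst c e ^^ k) (code p 0) = code p k" if "p < c" "k < max 1 (e p)" for p k e using that(2)
 proof (induction k)
 case (Suc k)
 then show ?case using that(1) by (auto simp: sst_code)
 qed simp
 have orb: "EX k. y = (sst c ?e' ^^ k) x" if xy: "x : SP c ?e'" "y : SP c ?e'" "\<beta> x = \<beta> y" for x y
 proof -
 obtain p k where x: "x = code p k" by (rule code_cases)
 obtain p' k' where y: "y = code p' k'" by (rule code_cases)
 have p: "p' = p" "p < c" using xy x y permutes_inj[OF \<pi>'] by (auto simp: \<beta>_def inj_eq)
 have kx: "x = (sst c ?e' ^^ k) (code p 0)" and ky: "y = (sst c ?e' ^^ k') (code p 0)"
 using it[of p _ ?e'] x y p xy by simp_all
 \<comment> \<open>To undo k steps, k full periods are completed, which amount to at least k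
   steps.\<close>
 have "(sst c ?e' ^^ (per (SR c ?e') * k)) z = z" for z
 proof (induction k)
 case (Suc k)
 then show ?case using funpow_per[OF t R, of z] by (simp add: funpow_add)
 qed simp
 moreover have "k <= per (SR c ?e') * k" using per_pos[of "SR c ?e'"] by simp
 ultimately have "(sst c ?e' ^^ (per (SR c ?e') * k - k)) x = code p 0"
 unfolding kx by (metis comp_apply funpow_add le_add_diff_inverse2)
 then have "y = (sst c ?e' ^^ (k' + (per (SR c ?e') * k - k))) x" unfolding ky funpow_add by simp
 then show ?thesis by blast
 qed
 have fib: "?e p = card {q : SR c ?e'. \<beta> q = p}" if "p < c" for p
 proof -
 have "{q : SR c ?e'. \<beta> q = p} = {q : SR c ?e'. fst (prod_decode q) = \<pi> p}"
 unfolding \<beta>_def using permutes_inverses[OF \<pi>] by metis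
 moreover have "\<pi> p < c" using permutes_in_image[OF \<pi>, of p] that by simp
 ultimately show ?thesis by (simp only: card_SR_fibre if_True ee)
 qed
 have sc: "map (rl (%q. code (\<beta> q) 0)) (scode ?w) = scode w" unfolding scode_def filter_map map_map
 proof (rule map_cong)
 show "filter ((%l. kd l ~= KY) \<circ> rl \<pi>) w = filter (%l. kd l ~= KY) w" by (simp add: o_def)
 show "(rl (%q. code (\<beta> q) 0) \<circ> (rl (%p. code p 0) \<circ> rl \<pi>)) l = rl (%p. code p 0) l" for l
 by (simp add: rl_rl o_def \<beta>_def permutes_inverses[OF \<pi>])
 qed
 have "rsum (SP c ?e') n (Hz (sst c ?e') (SR c ?e') (nu (sst c ?e') (SR c ?e') (gw (scode ?w)))) =
 (rsum (SP c ?e) n (Hz (sst c ?e) (SR c ?e) (nu (sst c ?e) (SR c ?e) (gw (map (rl (%q. code (\<beta> q) 0)) (scode ?w))))) :: 'k mat_gca)"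
 by (rule compare_standard[OF scode_kq[OF w'] img inv orb fib])
 then show "L c n (relabel \<pi> (gw w)) = (L c n (gw w) :: 'k mat_gca)" unfolding relabel_gw L_dg[OF w'] L_dg[OF w] sc .
qed

lemma mset_eq_countI: "(!!p. size (filter_mset (%x. f x = p) M) = size (filter_mset (%x. g x = p) N)) ==>
 image_mset f M = image_mset g N" by (rule multiset_eqI) (simp add: count_image_size)

text \<open>The source of the triangularity. An index map contributes only if it is constant on
  cycles, hence is given by its values on the c labels; each cycle then returns its x and theta
  letters together with the y letters encoded in its length, so \<open>w\<close> itself comes
  back.\<close>

lemma Dg_L_word:
 assumes w: "dg c (mset w)"
 shows "Dg (L c n (gw w)) = (rsum {..<c} n (gw w) :: 'k::field_char_0 mat_gca)"
proof -
 let ?e = "ell (mset w)"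
 let ?f = "%q. fst (prod_decode q)"
 interpret permutation_graph "sst c ?e" "SR c ?e" "SP c ?e" by (rule standard_graph)
 have wd: "isdiag l" "rw l < c" "cl l = rw l" if "l : set w" for l using w that by (auto simp: dg_def idxs_def isdiag_def)
 let ?v = "filter (%l. kd l ~= KY) w"
 \<comment> \<open>A repeated theta makes both sides vanish. Otherwise at most one of the arcs of a
   cycle is a theta, and the remaining ones become y letters with its label.\<close>
 have Ti: "Ti (%q. j (?f q)) (scode w) = (gw (map (rl j) w) :: 'k mat_gca)" for j
 proof -
 have m: "map (rl (%q. j (?f q))) (scode w) = map (rl j) ?v"
 unfolding scode_def map_map by (intro map_cong refl) (simp add: rl_rl o_def)
 show ?thesis
 proof (cases "distinct (filter (%l. ~ isl l) w)")
 case False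
 have fe: "filter (%l. ~ isl l) ?v = filter (%l. ~ isl l) w"
 unfolding filter_filter by (rule filter_cong) (auto simp: isl_kd)
 have "filter (%l. ~ isl l) (map (rl j) v) = map (rl j) (filter (%l. ~ isl l) v)" for v by (simp add: filter_map o_def)
 then have "~ distinct (filter (%l. ~ isl l) (map (rl j) ?v))" "~ distinct (filter (%l. ~ isl l) (map (rl j) w))"
 using False fe by (simp_all add: distinct_map)
 from this[THEN gw_repeat] have "gw (map (rl j) ?v) = (0 :: 'k mat_gca)" "gw (map (rl j) w) = (0 :: 'k mat_gca)" .
 then show ?thesis unfolding Ti_def m by (simp only: mult_zero_left)
 next
 case True
 define T where "T = trows (scode w)"
 have T: "T = (%l. code (rw l) 0) ` {l : set w. kd l = KT}"
 unfolding T_def scode_def by (induction w) (auto simp: trows_simps)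
 have TR: "T \<subseteq> SR c ?e"
 proof
 fix q assume "q : T"
 then obtain l where l: "l : set w" "kd l = KT" "q = code (rw l) 0" unfolding T by blast
 then have "?e (rw l) > 0" unfolding ell_pos by (intro bexI[of _ l]) simp_all
 then show "q : SR c ?e" using l wd by simp
 qed
 have ct: "card {q : T. ?f q = p} = size (filter_mset (%l. kd l = KT & rw l = p) (mset w))" for p
 proof -
 let ?s = "size (filter_mset (%l. kd l = KT & rw l = p) (mset w))"
 have s1: "?s <= 1" using wd by (intro size_odd_le_1[OF True]) blast
 show ?thesis
 proof (cases "\<exists>l\<in>set w. kd l = KT & rw l = p")
 case True
 then have "{q : T. ?f q = p} = {code p 0}" unfolding T by auto
 moreover have "filter_mset (%l. kd l = KT & rw l = p) (mset w) ~= {#}"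
 using True unfolding set_mset_eq_empty_iff[symmetric] by auto
 then have "?s > 0" unfolding nonempty_has_size[symmetric] .
 ultimately show ?thesis using s1 by simp
 next
 case False
 then have "{q : T. ?f q = p} = {}" unfolding T by auto
 moreover have "filter_mset (%l. kd l = KT & rw l = p) (mset w) = {#}"
 using False unfolding set_mset_eq_empty_iff[symmetric] by auto
 ultimately show ?thesis by (simp only: card.empty size_empty)
 qed
 qed
 \<comment> \<open>Label by label, the cycle length minus the number of thetas is the number of y
   letters in \<open>w\<close>.\<close>
 have im: "image_mset ?f (mset_set (SR c ?e - T)) = image_mset rw (filter_mset (%l. kd l = KY) (mset w))"
 proof (rule mset_eq_countI)
 fix p
 have finT: "finite T" using TR R by (rule finite_subset)
 have "{q : SR c ?e - T. ?f q = p} = {q : SR c ?e. ?f q = p} - {q : T. ?f q = p}" using TR by blast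
 then have "card {q : SR c ?e - T. ?f q = p} = card {q : SR c ?e. ?f q = p} - card {q : T. ?f q = p}"
 using TR finT by (simp only:) (rule card_Diff_subset, auto)
 also have "... = ?e p - size (filter_mset (%l. kd l = KT & rw l = p) (mset w))"
 proof (cases "p < c")
 case False
 then have "~ ?e p > 0" unfolding ell_pos using wd by auto
 then show ?thesis unfolding card_SR_fibre ct using False by simp
 qed (simp add: card_SR_fibre ct)
 also have "?e p = size (filter_mset (%l. kd l = KT & rw l = p) (mset w)) + size (filter_mset (%l. kd l = KY & rw l = p) (mset w))"
 proof -
 have "size (filter_mset (%l. kd l ~= KX & rw l = p) M) =
 size (filter_mset (%l. kd l = KT & rw l = p) M) + size (filter_mset (%l. kd l = KY & rw l = p) M)" for M
 proof (induction M)
 case (add l M)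
 then show ?case by (cases "kd l") auto
 qed simp
 then show ?thesis by (simp add: ell_def)
 qed
 finally have "card {q : SR c ?e - T. ?f q = p} = size (filter_mset (%l. kd l = KY & rw l = p) (mset w))" by simp
 moreover have "size (filter_mset (%q. ?f q = p) (mset_set (SR c ?e - T))) = card {q : SR c ?e - T. ?f q = p}"
 using R by simp
 moreover have "filter_mset (%l. rw l = p) (filter_mset (%l. kd l = KY) (mset w)) = filter_mset (%l. kd l = KY & rw l = p) (mset w)"
 by (simp add: filter_filter_mset conj_commute)
 ultimately show "size (filter_mset (%q. ?f q = p) (mset_set (SR c ?e - T))) =
 size (filter_mset (%l. rw l = p) (filter_mset (%l. kd l = KY) (mset w)))" by (simp only:)
 qed
 let ?y = "filter (%l. ~ kd l ~= KY) w"
 have "gw (map (%p. mk KY (j (?f p)) (j (?f p))) (sorted_list_of_set (SR c ?e - T))) = (gw (map (rl j) ?y) :: 'k mat_gca)"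
 proof (rule gw_even_mset)
 have "mset (map (%p. mk KY (j (?f p)) (j (?f p))) (sorted_list_of_set (SR c ?e - T))) =
 image_mset (%p. mk KY (j p) (j p)) (image_mset ?f (mset_set (SR c ?e - T)))"
 by (simp add: image_mset.compositionality o_def del: mk.simps)
 also have "... = image_mset (%l. mk KY (j (rw l)) (j (rw l))) (filter_mset (%l. kd l = KY) (mset w))"
 unfolding im by (simp add: image_mset.compositionality o_def del: mk.simps)
 also have "... = image_mset (rl j) (filter_mset (%l. kd l = KY) (mset w))"
 by (rule image_mset_cong) (use wd in \<open>auto intro!: letter_eqI simp del: mk.simps\<close>)
 finally show "mset (map (%p. mk KY (j (?f p)) (j (?f p))) (sorted_list_of_set (SR c ?e - T))) = mset (map (rl j) ?y)"
 by (simp del: mk.simps)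
 qed auto
 moreover have "gw (map (rl j) w) = gw (map (rl j) ?v) * (gw (map (rl j) ?y) :: 'k mat_gca)"
 proof -
 have "gw (map (rl j) w) = gw (filter (%l. ~ kd l = KY) (map (rl j) w)) * (gw (filter (%l. kd l = KY) (map (rl j) w)) :: 'k mat_gca)"
 by (rule gw_partition_even) (auto simp: isl_kd)
 then show ?thesis by (simp add: filter_map o_def)
 qed
 ultimately show ?thesis unfolding Ti_def m T_def[symmetric] by (simp only:)
 qed
 qed
 let ?P = "SP c ?e" and ?R = "SR c ?e" and ?t = "sst c ?e"
 let ?C = "%i. \<forall>p\<in>?R. i (?t p) = i p"
 have ib: "i q = i (code (?f q) 0)" if "?C i" "q : ?P" for i :: "nat => nat" and q
 proof -
 obtain p k where q: "q = code p k" by (rule code_cases)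
 have "k < max 1 (?e p) --> i (code p k) = i (code p 0)"
 proof (induction k)
 case (Suc k)
 show ?case
 proof
 assume k: "Suc k < max 1 (?e p)"
 then have "code p k : ?R" "?t (code p k) = code p (Suc k)" using that(2) q by (auto simp: sst_code)
 then show "i (code p (Suc k)) = i (code p 0)" using Suc k that(1) by (metis Suc_lessD)
 qed
 qed simp
 then show ?thesis using that(2) q by simp
 qed
 \<comment> \<open>Maps constant on cycles correspond to maps on labels: \<open>?F\<close> spreads a
   value over its cycle, \<open>?G\<close> reads it off at position 0.\<close>
 let ?F = "%j. restrict (%q. j (?f q)) ?P" and ?G = "%i. restrict (%p. i (code p 0)) {..<c}"
 have Pf: "?f q < c" "code (?f q) 0 : ?P" if "q : ?P" for q
 proof -
 obtain p k where q: "q = code p k" by (rule code_cases)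
 show "?f q < c" "code (?f q) 0 : ?P" using that by (simp_all add: q)
 qed
 have tP: "?t q : ?P" "?f (?t q) = ?f q" if "q : ?R" for q
 proof -
 show "?t q : ?P" using tR[OF that] P(2) by blast
 obtain p k where q: "q = code p k" by (rule code_cases)
 show "?f (?t q) = ?f q" by (simp add: q sst_code)
 qed
 have "Dg (L c n (gw w)) = (\<Sum>i\<in>?P \<rightarrow>\<^sub>E {..<n}. if ?C i then Ti i (scode w) else (0 :: 'k mat_gca))"
 unfolding L_dg[OF w] rsum_def glin_sum[OF glin_Dg] by (intro sum.cong refl Dg_relabel_Hz_nu scode_kq w)
 also have "... = (\<Sum>i\<in>{i : ?P \<rightarrow>\<^sub>E {..<n}. ?C i}. Ti i (scode w))"
 by (rule sum.inter_filter[symmetric]) (simp add: finite_SP)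
 also have "... = (\<Sum>j\<in>{..<c} \<rightarrow>\<^sub>E {..<n}. gw (map (rl j) w))"
 proof (rule sum.reindex_bij_witness[where i = ?F and j = ?G])
 fix i assume i: "i : {i : ?P \<rightarrow>\<^sub>E {..<n}. ?C i}"
 show G: "?G i : {..<c} \<rightarrow>\<^sub>E {..<n}"
 proof (rule restrict_PiE_iff[THEN iffD2], rule ballI)
 fix p assume "p : {..<c}"
 then have "code p 0 : ?P" by simp
 then show "i (code p 0) : {..<n}" using i by blast
 qed
 have e: "?G i (?f q) = i q" if "q : ?P" for q using Pf[OF that] ib[of i q] i that by simp
 show "?F (?G i) = i"
 proof
 fix q show "?F (?G i) q = i q" using e[of q] i by (cases "q : ?P") (auto simp: PiE_def extensional_def)
 qed
 have "Ti i (scode w) = (Ti (%q. ?G i (?f q)) (scode w) :: 'k mat_gca)"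
 proof -
 have "idxs (mset (scode w)) \<subseteq> ?P" using scode_kq[OF w] P(2) unfolding kq_def klet_def idxs_def by fastforce
 then have "map (rl i) (scode w) = map (rl (%q. ?G i (?f q))) (scode w)"
 by (intro map_rl_cong) (use e in \<open>simp add: subset_iff\<close>)
 moreover have "map (%p. mk KY (i p) (i p)) (sorted_list_of_set (?R - T)) =
 map (%p. mk KY (?G i (?f p)) (?G i (?f p))) (sorted_list_of_set (?R - T))" for T
 by (rule map_cong[OF refl]) (use e P(2) R in \<open>simp add: subset_iff del: mk.simps\<close>)
 ultimately show ?thesis unfolding Ti_def by (simp only:)
 qed
 then show "gw (map (rl (?G i)) w) = (Ti i (scode w) :: 'k mat_gca)" unfolding Ti by (simp only:)
 next
 fix j assume j: "j : {..<c} \<rightarrow>\<^sub>E {..<n}"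
 show "?G (?F j) = j"
 proof
 fix p show "?G (?F j) p = j p" using j by (cases "p < c") (auto simp: PiE_def extensional_def)
 qed
 have "?F j : ?P \<rightarrow>\<^sub>E {..<n}" by (rule restrict_PiE_iff[THEN iffD2], rule ballI) (use Pf(1) j in blast)
 moreover have "?C (?F j)" using tP P(2) by auto
 ultimately show "?F j : {i : ?P \<rightarrow>\<^sub>E {..<n}. ?C i}" by blast
 qed
 also have "... = rsum {..<c} n (gw w)" by (rule rsum_gw[symmetric])
 finally show ?thesis .
qed

lemma Dg_L:
 assumes "g : gsp (dg c)"
 shows "Dg (L c n g) = (rsum {..<c} n g :: 'k::field_char_0 mat_gca)"
proof (rule glin_on_gsp[OF glin_comp[OF glin_Dg glin_L] glin_rsum assms])
 show "Dg (L c n (gw w)) = (rsum {..<c} n (gw w) :: 'k mat_gca)" if "dg c (mset w)" for w by (rule Dg_L_word[OF that])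
qed

lemma GL_0: "0 : GL_invariants n" and GL_add: "f : GL_invariants n ==> g : GL_invariants n ==> f + g : GL_invariants n"
 and GL_cs: "f : GL_invariants n ==> cs c * f : GL_invariants n"
 by (auto simp: GL_invariants_def glin_0[OF glin_ca] glin_add[OF glin_ca] glin_cs[OF glin_ca])

lemma GL_sum: "(!!a. a : A ==> f a : GL_invariants n) ==> sum f A : GL_invariants n"
 by (induction A rule: infinite_finite_induct) (auto intro: GL_0 GL_add)

lemma res_rsum:
 assumes "z : gsp (pt P)"
 shows "res (rsum P n z) = rsum P n z"
proof (rule res_id, rule glin_maps_gsp[OF glin_rsum assms])
 fix w assume w: "pt P (mset w)"
 have "off (mset (map (rl i) w)) = 0" for i
 proof (rule off_eq_0)
 fix l assume "l \<in># mset (map (rl i) w)"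
 then obtain l' where "l' \<in># mset w" "l = rl i l'" by auto
 moreover from this have "~ isoff l'" using w by (auto simp: pt_def dest: not_isoff)
 ultimately show "~ isoff l" by (auto simp: isoff_def)
 qed
 then show "rsum P n (gw w) : gsp (%M. off M = 0)" unfolding rsum_gw by (intro gsp_sum gsp_gw)
qed

lemma pt_lift:
 assumes "z : gsp (pt P)" "finite P"
 shows "EX F. F : GL_invariants n & F : gsp (below n) & res F = (rsum P n z :: 'k::field_char_0 mat_gca)"
proof -
 have "EX F. F : GL_invariants n & F : gsp (below n) & res F = res (rsum P n z)" using assms(1)
 proof (induction rule: gsp_induct)
 case (add f g)
 then obtain F G where "F : GL_invariants n & F : gsp (below n) & res F = res (rsum P n f)"
 "G : GL_invariants n & G : gsp (below n) & res G = res (rsum P n g)" by blast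
 then show ?case by (intro exI[of _ "F + G"]) (simp add: GL_add gsp_add glin_add[OF glin_res] glin_add[OF glin_rsum])
 next
 case (word c w)
 obtain F where "F : GL_invariants n" "F : gsp (below n)" "res F = (res (rsum P n (gw w)) :: 'k mat_gca)"
 using pg_lift[OF assms(2), of w n] word by (auto simp: pt_def)
 then show ?case
 by (intro exI[of _ "cs c * F"]) (simp add: GL_cs gsp_cs glin_cs[OF glin_res] glin_cs[OF glin_rsum] del: gw_simps)
 next
 show "EX F. F : GL_invariants n & F : gsp (below n) & res F = (res (rsum P n 0) :: 'k mat_gca)"
 by (intro exI[of _ 0]) (simp add: GL_0 glin_0[OF glin_res] glin_0[OF glin_rsum])
 qed
 then show ?thesis unfolding res_rsum[OF assms(1)] .
qed

lemma L_lift_word: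
 assumes w: "dg c (mset w)"
 shows "EX F. F : GL_invariants n & F : gsp (below n) & res F = (L c n (gw w) :: 'k::field_char_0 mat_gca)"
 and "dB (L c n (gw w)) = (0 :: 'k mat_gca)"
proof -
 let ?e = "ell (mset w)"
 interpret permutation_graph "sst c ?e" "SR c ?e" "SP c ?e" by (rule standard_graph)
 have k: "gw (scode w) : (gsp kq :: 'k mat_gca set)" by (rule gsp_gw) (rule scode_kq[OF w])
 let ?z = "Hz (sst c ?e) (SR c ?e) (nu (sst c ?e) (SR c ?e) (gw (scode w))) :: 'k mat_gca"
 have z: "?z : gsp (pt (SP c ?e))" by (rule gsp_mono[OF Hz_gsp[OF nu_gsp[OF k]]]) (simp add: aw_def)
 show "EX F. F : GL_invariants n & F : gsp (below n) & res F = (L c n (gw w) :: 'k mat_gca)"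
 unfolding L_dg[OF w] by (rule pt_lift[OF z finite_SP])
 show "dB (L c n (gw w)) = (0 :: 'k mat_gca)"
 unfolding L_dg[OF w] rsum_dB[symmetric] dB_Hz_nu[OF k] by (rule glin_0[OF glin_rsum])
qed

lemma L_lift:
 assumes "g : gsp (dg c)"
 shows "EX F. F : GL_invariants n & F : gsp (below n) & res F = (L c n g :: 'k::field_char_0 mat_gca)" (is "?Q g")
 and "dB (L c n g) = (0 :: 'k mat_gca)"
proof -
 show "?Q g" using assms
 proof (induction rule: gsp_induct)
 case (add f g)
 then obtain F G where "F : GL_invariants n & F : gsp (below n) & res F = L c n f"
 "G : GL_invariants n & G : gsp (below n) & res G = L c n g" by blast
 then show ?case by (intro exI[of _ "F + G"]) (simp add: GL_add gsp_add glin_add[OF glin_res] glin_add[OF glin_L])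
 next
 case (word a w)
 obtain F where "F : GL_invariants n" "F : gsp (below n)" "res F = (L c n (gw w) :: 'k mat_gca)"
 using L_lift_word(1)[OF word] by blast
 then show ?case
 by (intro exI[of _ "cs a * F"]) (simp add: GL_cs gsp_cs glin_cs[OF glin_res] glin_cs[OF glin_L] del: gw_simps)
 next
 show "?Q 0" by (intro exI[of _ 0]) (simp add: GL_0 glin_0[OF glin_res] glin_0[OF glin_L])
 qed
 have "dB (L c n g) = (%_. 0) g"
 by (rule glin_on_gsp[OF glin_comp[OF glin_dB glin_L] _ assms]) (simp_all add: glin_def L_lift_word(2) del: gw_simps)
 then show "dB (L c n g) = (0 :: 'k mat_gca)" .
qed

section \<open>Equivariance of the differential\<close>

abbreviation dD :: "nat => 'k::field_char_0 mat_gca => 'k mat_gca" where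
 "dD n \<equiv> gca_diff (DRep_diff n)"

lemma dval_DRep: "dval (DRep_diff n) a = (if kd a = KT then
 (\<Sum>l<n. gl (mk KX (rw a) l) * gl (mk KY l (cl a)) - gl (mk KY (rw a) l) * gl (mk KX l (cl a)))
 else (0 :: 'k::field_char_0 mat_gca))"
 by (cases a rule: kd.cases) (auto simp: DRep_diff_def gca_poly_sum gca_poly_diff gca_poly_mult gl_poly)

text \<open>Index range, degree and weight are followed through one induction;
  \<open>Suc (nod M)\<close> expresses the drop of the degree without subtraction.\<close>

lemma dD_gw_gsp:
 "gca_diff (DRep_diff n) (gw w) : (gsp (%M. (below n (mset w) --> below n M) & Suc (nod M) = nod (mset w) &
 nev M + 2 * nod M = nev (mset w) + 2 * nod (mset w)) :: 'k::field_char_0 mat_gca set)"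
proof (induction w)
 case (Cons a w)
 let ?Q = "%w M. (below n (mset w) --> below n M) & Suc (nod M) = nod (mset w) &
 nev M + 2 * nod M = nev (mset w) + 2 * nod (mset w)"
 have "dval (DRep_diff n) a * gw w : (gsp (?Q (a # w)) :: 'k mat_gca set)"
 proof (cases "kd a = KT")
 case True
 have g: "gl x * gl y : (gsp (%M. M = {#x, y#}) :: 'k mat_gca set)" for x y :: letter
 using gsp_gw[of "%M. M = {#x, y#}" "[x, y]"] by simp
 have "dval (DRep_diff n) a : (gsp (%M. ({rw a, cl a} \<subseteq> {..<n} --> below n M) & nod M = 0 & nev M = 2) :: 'k mat_gca set)"
 unfolding dval_DRep if_P[OF True] by (intro gsp_sum gsp_diff; rule gsp_mono[OF g]) (auto simp: isl_mk)
 then show ?thesis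
 by (rule gsp_mult[OF _ gsp_gw[of "%M. M = mset w" w, OF refl]]) (use True in \<open>auto simp: isl_kd\<close>)
 qed (simp add: dval_DRep)
 moreover have "gi (gl a) * gca_diff (DRep_diff n) (gw w) : (gsp (?Q (a # w)) :: 'k mat_gca set)"
 proof (rule gsp_mult[OF _ Cons])
 show "gi (gl a) : gsp (%M. M = {#a#})" unfolding gi_gl by (auto intro!: gsp_uminus gl_gsp)
 qed auto
 ultimately show ?case unfolding gw_simps gca_diff_mult gca_diff_gl by (rule gsp_add)
qed (simp add: gca_diff_1)

lemma dD_below: "f : gsp (below n) ==> dD n f : (gsp (below n) :: 'k::field_char_0 mat_gca set)"
 by (erule glin_maps_gsp[OF glin_gd]) (rule gsp_mono[OF dD_gw_gsp], blast)

abbreviation wt :: "('v + 'o) multiset => nat" where "wt M \<equiv> nev M + 2 * nod M"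

lemma dD_bidegree: "f : gsp (%M. nod M = i & wt M = w) ==>
 dD n f : (gsp (%M. Suc (nod M) = i & wt M = w) :: 'k::field_char_0 mat_gca set)"
proof (erule glin_maps_gsp[OF glin_gd])
 fix u :: "letter list" assume "nod (mset u) = i & wt (mset u) = w"
 then show "gca_diff (DRep_diff n) (gw u) : (gsp (%M. Suc (nod M) = i & wt M = w) :: 'k mat_gca set)"
 by (intro gsp_mono[OF dD_gw_gsp]) simp
qed

lemma dD_gfilter: "gfilter (%M. nod M = i & wt M = w) (dD n f) =
 dD n (gfilter (%M. nod M = Suc i & wt M = w) (f :: 'k::field_char_0 mat_gca))"
proof (rule glin_eqI[OF glin_comp[OF glin_gf glin_gd] glin_comp[OF glin_gd glin_gf]])
 fix u :: "letter list"
 let ?Q = "%M. nod M = i & wt M = w"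
 show "gfilter ?Q (dD n (gw u)) = dD n (gfilter (%M. nod M = Suc i & wt M = w) (gw u :: 'k mat_gca))"
 proof (cases "nod (mset u) = Suc i & wt (mset u) = w")
 case True
 have "gfilter ?Q (dD n (gw u)) = dD n (gw u :: 'k mat_gca)" by (rule gfilter_eq_self[OF dD_gw_gsp]) (use True in simp)
 moreover have "gfilter (%M. nod M = Suc i & wt M = w) (gw u) = (gw u :: 'k mat_gca)" unfolding gfilter_gw if_P[OF True] ..
 ultimately show ?thesis by (simp only:)
 next
 case False
 have "gfilter ?Q (dD n (gw u)) = (0 :: 'k mat_gca)" by (rule gfilter_eq_0[OF dD_gw_gsp]) (use False in auto)
 moreover have "gfilter (%M. nod M = Suc i & wt M = w) (gw u) = (0 :: 'k mat_gca)" unfolding gfilter_gw if_not_P[OF False] ..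
 ultimately show ?thesis by (simp only: glin_0[OF glin_gd])
 qed
qed

text \<open>The rule (g A h)(g B h) = g (A B) h for scalar matrices g and h: the inner product h g
  is the identity.\<close>

lemma matrix_product_sum:
 fixes A B :: "nat => nat => 'k::field_char_0 mat_gca"
 assumes "!!m k. m < n ==> k < n ==> (\<Sum>l<n. H m l * G l k) = (if m = k then 1 else 0)"
 shows "(\<Sum>l<n. (\<Sum>k<n. \<Sum>m<n. cs (G r k * H m l) * A k m) * (\<Sum>k<n. \<Sum>m<n. cs (G l k * H m c) * B k m)) =
 (\<Sum>k<n. \<Sum>m<n. cs (G r k * H m c) * (\<Sum>l<n. A k l * B l m))"
proof -
 let ?N = "{..<n}"
 have prod: "cs a * x * (cs b * y) = cs (a * b) * (x * y)" for a b and x y :: "'k mat_gca"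
 proof -
 have "x * (cs b * y) = cs b * (x * y)" by (rule poly_left_comm)
 then show ?thesis by (simp only: mult.assoc cs_mult)
 qed
 have "(\<Sum>l<n. (\<Sum>k<n. \<Sum>m<n. cs (G r k * H m l) * A k m) * (\<Sum>k<n. \<Sum>m<n. cs (G l k * H m c) * B k m)) =
 (\<Sum>l<n. \<Sum>k'<n. \<Sum>m'<n. \<Sum>k<n. \<Sum>m<n. cs (G r k * H m l * (G l k' * H m' c)) * (A k m * B k' m'))"
 unfolding sum_distrib_right sum_distrib_left prod ..
 also have "... = (\<Sum>k'<n. \<Sum>m'<n. \<Sum>k<n. \<Sum>m<n. \<Sum>l<n. cs (G r k * H m l * (G l k' * H m' c)) * (A k m * B k' m'))"
 by (subst sum.swap, rule sum.cong[OF refl], subst sum.swap, rule sum.cong[OF refl],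
 subst sum.swap, rule sum.cong[OF refl], rule sum.swap)
 also have "... = (\<Sum>k'<n. \<Sum>m'<n. \<Sum>k<n. \<Sum>m<n. if m = k' then cs (G r k * H m' c) * (A k k' * B k' m') else 0)"
 proof (intro sum.cong refl)
 fix k m k' m' assume "m : ?N" "k' : ?N"
 then have "(\<Sum>l<n. H m l * G l k') = (if m = k' then 1 else 0)" using assms[of m k'] by simp
 moreover have "(\<Sum>l<n. G r k * H m l * (G l k' * H m' c)) = G r k * H m' c * (\<Sum>l<n. H m l * G l k')"
 unfolding sum_distrib_left by (rule sum.cong[OF refl]) (simp add: mult_ac)
 ultimately have e: "(\<Sum>l<n. G r k * H m l * (G l k' * H m' c)) = (if m = k' then G r k * H m' c else 0)" by simp
 have "(\<Sum>l<n. cs (G r k * H m l * (G l k' * H m' c)) * (A k m * B k' m')) =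
 cs (\<Sum>l<n. G r k * H m l * (G l k' * H m' c)) * (A k m * B k' m')" unfolding cs_sum sum_distrib_right ..
 then show "(\<Sum>l<n. cs (G r k * H m l * (G l k' * H m' c)) * (A k m * B k' m')) =
 (if m = k' then cs (G r k * H m' c) * (A k k' * B k' m') else 0)" unfolding e by simp
 qed
 also have "... = (\<Sum>k'<n. \<Sum>m'<n. \<Sum>k<n. cs (G r k * H m' c) * (A k k' * B k' m'))"
 by (intro sum.cong refl) (simp add: sum.delta)
 also have "... = (\<Sum>k'<n. \<Sum>k<n. \<Sum>m'<n. cs (G r k * H m' c) * (A k k' * B k' m'))"
 by (rule sum.cong[OF refl], rule sum.swap)
 also have "... = (\<Sum>k<n. \<Sum>k'<n. \<Sum>m'<n. cs (G r k * H m' c) * (A k k' * B k' m'))" by (rule sum.swap)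
 also have "... = (\<Sum>k<n. \<Sum>m'<n. \<Sum>k'<n. cs (G r k * H m' c) * (A k k' * B k' m'))"
 by (rule sum.cong[OF refl], rule sum.swap)
 finally show ?thesis unfolding sum_distrib_left .
qed

lemma conj_act_dD:
 assumes gh: "g : carrier_mat n n" "h : carrier_mat n n" "inverts_mat g h" "inverts_mat h g"
 and f: "f : gsp (below n)"
 shows "conj_act n g h (dD n f) = dD n (conj_act n g h (f :: 'k::field_char_0 mat_gca))"
proof (rule glin_on_gsp[OF glin_comp[OF glin_ca glin_gd] glin_comp[OF glin_gd glin_ca] f])
 fix w assume w: "idxs (mset w) \<subseteq> {..<n}"
 let ?G = "%i j. g $$ (i, j)" and ?H = "%i j. h $$ (i, j)"
 show "conj_act n g h (dD n (gw w)) = dD n (conj_act n g h (gw w :: 'k mat_gca))"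
 proof (rule chain_map[OF ghom_ca, where A = "{a. rw a < n & cl a < n}"])
 fix a :: letter
 have "gi (cj n ?G ?H a) = (if isl a then cj n ?G ?H a else - cj n ?G ?H a :: 'k mat_gca)"
 unfolding cj_def glin_sum[OF glin_gi] glin_cs[OF glin_gi] gi_gl by (auto simp: isl_kd isl_mk sum_negf)
 then show "conj_act n g h (gi (gl a)) = gi (conj_act n g h (gl a :: 'k mat_gca))"
 by (intro ghom_gi_commute[OF ghom_ca]) (simp_all add: conj_act_gl cj_def glin_sum[OF glin_gi] glin_cs[OF glin_gi] gi_gl isl_mk isl_kd sum_negf)
 next
 fix a :: letter assume a: "a : {a. rw a < n & cl a < n}"
 show "conj_act n g h (dval (DRep_diff n) a) = dD n (conj_act n g h (gl a :: 'k mat_gca))"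
 proof (cases "kd a = KT")
 case True
 have hg: "(\<Sum>l<n. h $$ (m, l) * g $$ (l, k)) = (if m = k then 1 else 0)" if "m < n" "k < n" for m k
 using inverts_mat_sum[OF gh(2,1,4) that] .
 let ?M = "%K k m. gl (mk K k m) :: 'k mat_gca"
 let ?c = "%k m. cs (g $$ (rw a, k) * h $$ (m, cl a))"
 have "conj_act n g h (dval (DRep_diff n) a) =
 (\<Sum>l<n. (\<Sum>k<n. \<Sum>m<n. cs (g $$ (rw a, k) * h $$ (m, l)) * ?M KX k m) * (\<Sum>k<n. \<Sum>m<n. cs (g $$ (l, k) * h $$ (m, cl a)) * ?M KY k m)) -
 (\<Sum>l<n. (\<Sum>k<n. \<Sum>m<n. cs (g $$ (rw a, k) * h $$ (m, l)) * ?M KY k m) * (\<Sum>k<n. \<Sum>m<n. cs (g $$ (l, k) * h $$ (m, cl a)) * ?M KX k m))"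
 unfolding dval_DRep if_P[OF True] glin_sum[OF glin_ca] glin_diff[OF glin_ca] ghom_mult[OF ghom_ca]
 conj_act_gl cj_def mk_simps sum_subtractf ..
 also have "... = (\<Sum>k<n. \<Sum>m<n. ?c k m * (\<Sum>l<n. ?M KX k l * ?M KY l m)) - (\<Sum>k<n. \<Sum>m<n. ?c k m * (\<Sum>l<n. ?M KY k l * ?M KX l m))"
 using matrix_product_sum[where G = ?G and H = ?H and r = "rw a" and c = "cl a" and A = "?M KX" and B = "?M KY" and n = n, OF hg]
 matrix_product_sum[where G = ?G and H = ?H and r = "rw a" and c = "cl a" and A = "?M KY" and B = "?M KX" and n = n, OF hg]
 by (simp only:)
 also have "... = dD n (conj_act n g h (gl a))"
 unfolding conj_act_gl cj_def glin_sum[OF glin_gd] glin_cs[OF glin_gd] gca_diff_gl dval_DRep mk_simps True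
 by (simp only: simp_thms if_True sum_subtractf right_diff_distrib)
 finally show ?thesis .
 next
 case False
 then show ?thesis
 by (simp add: dval_DRep glin_0[OF glin_ca] conj_act_gl cj_def glin_sum[OF glin_gd] glin_cs[OF glin_gd] gca_diff_gl
 del: mk.simps)
 qed
 qed (use w in \<open>auto simp: idxs_def\<close>)
qed

lemma GL_dD:
 assumes "f : GL_invariants n" "f : gsp (below n)"
 shows "dD n f : GL_invariants n" unfolding GL_invariants_def
proof (rule CollectI, intro ballI impI)
 fix g h :: "'a mat" assume gh: "g : carrier_mat n n" "h : carrier_mat n n" "inverts_mat g h & inverts_mat h g"
 then have "conj_act n g h f = f" using assms(1) by (simp add: GL_invariants_def)
 moreover have "conj_act n g h (dD n f) = dD n (conj_act n g h f)" using gh assms(2) by (intro conj_act_dD) simp_all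
 ultimately show "conj_act n g h (dD n f) = dD n f" by simp
qed

text \<open>The differential of \<open>F\<close> is again invariant and restricts to
  \<open>dB (res F)\<close>, so it vanishes by \<open>res_injective\<close>.\<close>

lemma lift_cycle:
 assumes "F : GL_invariants n" "F : gsp (below n)" "dB (res F) = 0"
 shows "dD n F = (0 :: 'k::field_char_0 mat_gca)"
 using res_injective[OF GL_dD[OF assms(1,2)] dD_below[OF assms(2)]] assms(3) by (simp add: res_diff[OF assms(2)])

lemma ghom_Dg: "ghom (Dg :: 'k::field_char_0 mat_gca => _)"
proof (rule ghomI[OF glin_Dg])
 show "Dg 1 = (1 :: 'k mat_gca)" using Dg_gw[of "[]"] by simp
 fix u v :: "letter list"
 show "Dg (gw u * gw v) = Dg (gw u) * (Dg (gw v) :: 'k mat_gca)"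
 unfolding gw_simps(3)[symmetric] Dg_gw by (simp add: ball_Un)
qed

text \<open>For p different from q the factor y_pq is off the diagonal, and for p = q the factor x_p
  - x_q is zero.\<close>

lemma Dg_dB: "Dg (dB f) = (0 :: 'k::field_char_0 mat_gca)"
proof (rule glin_eqI[where L = "%f. Dg (dB f)" and M = "%_. 0"])
 fix w :: "letter list"
 have v: "Dg (dval (%(p, q). (pvar (X (p, p)) - pvar (X (q, q))) * pvar (Y (p, q))) a) = (0 :: 'k mat_gca)" for a
 proof -
 have "Dg (gl (mk KY p q)) = (0 :: 'k mat_gca)" if "p ~= q" for p q
 using Dg_gw[of "[mk KY p q]"] that by (simp add: isdiag_def del: mk.simps)
 then show ?thesis unfolding dval_dB
 by (cases "rw a = cl a") (simp_all add: ghom_mult[OF ghom_Dg] glin_0[OF glin_Dg] del: mk.simps)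
 qed
 show "Dg (dB (gw w)) = (0 :: 'k mat_gca)"
 proof (induction w)
 case (Cons a w)
 then show ?case unfolding dB_def by (simp add: gca_diff_mult gca_diff_gl glin_add[OF glin_Dg] ghom_mult[OF ghom_Dg] v)
 qed (simp add: dB_def gca_diff_1 glin_0[OF glin_Dg])
qed (intro glin_zero glin_comp[OF glin_Dg glin_dB])+

lemma Dg_dD: "f : gsp (below n) ==> Dg (dD n f) = (0 :: 'k::field_char_0 mat_gca)"
 using Dg_dB[of "res f"] by (simp add: res_diff[symmetric] Dg_res)

section \<open>Surjectivity\<close>

lemma rsum_symmetric:
 assumes f: "f : gsp (%M. idxs M \<subseteq> P)" and \<rho>: "\<rho> permutes {..<n}"
 shows "relabel \<rho> (rsum P n f) = (rsum P n f :: 'k::field_char_0 mat_gca)"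
proof -
 have "relabel \<rho> (rsum P n f) = (\<Sum>i\<in>P \<rightarrow>\<^sub>E {..<n}. relabel (restrict (\<rho> \<circ> i) P) f)"
 unfolding rsum_def glin_sum[OF glin_rlb] relabel_relabel by (intro sum.cong refl relabel_cong[OF f]) simp
 also have "... = (\<Sum>i\<in>P \<rightarrow>\<^sub>E {..<n}. relabel i f)"
 proof (rule sum.reindex_bij_witness[where i = "%i. restrict (inv_into UNIV \<rho> \<circ> i) P" and j = "%i. restrict (\<rho> \<circ> i) P"])
 fix i assume i: "i : P \<rightarrow>\<^sub>E {..<n}"
 show "restrict (inv_into UNIV \<rho> \<circ> restrict (\<rho> \<circ> i) P) P = i" "restrict (\<rho> \<circ> restrict (inv_into UNIV \<rho> \<circ> i) P) P = i"
 using i by (auto simp: fun_eq_iff permutes_inverses[OF \<rho>] PiE_def extensional_def)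
 show "restrict (\<rho> \<circ> i) P : P \<rightarrow>\<^sub>E {..<n}" "restrict (inv_into UNIV \<rho> \<circ> i) P : P \<rightarrow>\<^sub>E {..<n}"
 using i permutes_in_image[OF \<rho>] permutes_in_image[OF permutes_inv[OF \<rho>]] by (auto simp: PiE_def Pi_def)
 qed auto
 finally show ?thesis unfolding rsum_def .
qed

lemma extend_to_permutation:
 assumes "Q \<subseteq> {..<n}" "card Q = s"
 shows "\<exists>\<rho>. \<rho> permutes {..<n} & \<rho> ` {..<s} = Q"
proof -
 have fQ: "finite Q" using assms(1) by (rule finite_subset) simp
 have sn: "s <= n" using card_mono[OF _ assms(1)] assms(2) by simp
 obtain f where f: "bij_betw f {..<s} Q" using finite_same_card_bij[of "{..<s}" Q] fQ assms(2) by auto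
 have "card ({..<n} - {..<s}) = card ({..<n} - Q)" using sn assms fQ by (simp add: card_Diff_subset)
 then obtain g where g: "bij_betw g ({..<n} - {..<s}) ({..<n} - Q)"
 using finite_same_card_bij[of "{..<n} - {..<s}" "{..<n} - Q"] by auto
 define \<rho> where "\<rho> x = (if x : {..<s} then f x else if x : {..<n} then g x else x)" for x
 have "bij_betw \<rho> ({..<s} \<union> ({..<n} - {..<s})) (Q \<union> ({..<n} - Q))"
 proof (rule bij_betw_combine)
 show "bij_betw \<rho> {..<s} Q" using f by (rule bij_betw_cong[THEN iffD1, rotated]) (simp add: \<rho>_def)
 show "bij_betw \<rho> ({..<n} - {..<s}) ({..<n} - Q)" using g by (rule bij_betw_cong[THEN iffD1, rotated]) (simp add: \<rho>_def)
 qed blast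
 moreover have "{..<s} \<union> ({..<n} - {..<s}) = {..<n}" "Q \<union> ({..<n} - Q) = {..<n}" using sn assms(1) by auto
 ultimately have "bij_betw \<rho> {..<n} {..<n}" by simp
 then have "\<rho> permutes {..<n}" by (rule bij_imp_permutes) (use sn in \<open>auto simp: \<rho>_def\<close>)
 moreover have "\<rho> ` {..<s} = Q" using f by (auto simp: bij_betw_def \<rho>_def)
 ultimately show ?thesis by blast
qed

lemma idxs_mset_map: "idxs (mset (map (rl i) w)) = i ` idxs (mset w)" by (auto simp: idxs_def image_image image_Un)

lemma gfilter_relabel:
 assumes "inj \<rho>"
 shows "gfilter (%M. idxs M = \<rho> ` Q) (relabel \<rho> f) = relabel \<rho> (gfilter (%M. idxs M = Q) (f :: 'k::field_char_0 mat_gca))"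
proof (rule glin_eqI[OF glin_comp[OF glin_gf glin_rlb] glin_comp[OF glin_rlb glin_gf]])
 fix w :: "letter list"
 have e: "idxs (mset (map (rl \<rho>) w)) = \<rho> ` Q \<longleftrightarrow> idxs (mset w) = Q" unfolding idxs_mset_map by (rule inj_image_eq_iff[OF assms])
 show "gfilter (%M. idxs M = \<rho> ` Q) (relabel \<rho> (gw w)) = relabel \<rho> (gfilter (%M. idxs M = Q) (gw w :: 'k mat_gca))"
 proof (cases "idxs (mset w) = Q")
 case True
 then have r: "idxs (mset (map (rl \<rho>) w)) = \<rho> ` Q" using e by blast
 show ?thesis unfolding relabel_gw gfilter_gw if_P[OF True] if_P[OF r] ..
 next
 case False
 then have r: "idxs (mset (map (rl \<rho>) w)) ~= \<rho> ` Q" using e by blast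
 show ?thesis unfolding relabel_gw gfilter_gw if_not_P[OF False] if_not_P[OF r] glin_0[OF glin_rlb] ..
 qed
qed

text \<open>Induction on a bound for the number of indices in a monomial. The part with s indices is
  hit by the standard cycles with s labels, up to terms with fewer indices, and the remainder is
  again symmetric.\<close>

theorem Dg_surjective:
 assumes "G : gsp (%M. (\<forall>l\<in>#M. isdiag l) & below n M)" "!!\<pi>. \<pi> permutes {..<n} ==> relabel \<pi> G = G"
 shows "EX u. u : GL_invariants n & u : gsp (below n) & dD n u = 0 & Dg u = (G :: 'k::field_char_0 mat_gca)"
proof -
 let ?D = "%M. (\<forall>l\<in>#M. isdiag l) & below n M"
 have "EX u. u : GL_invariants n & u : gsp (below n) & dD n u = 0 & Dg u = G"
 if "G : gsp (%M. ?D M & card (idxs M) < s)" "!!\<pi>. \<pi> permutes {..<n} ==> relabel \<pi> G = G" for s and G :: "'k mat_gca"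
 using that
 proof (induction s arbitrary: G)
 case 0
 then have "G : gsp (%_. False)" by simp
 then have "G = 0" using gfilter_eq_0[of G "%_. False" "%_. False"] by (simp add: gsp_def)
 then show ?case by (intro exI[of _ 0]) (simp add: GL_0 glin_0[OF glin_gd] glin_0[OF glin_Dg])
 next
 case (Suc s)
 show ?case
 proof (cases "s <= n")
 \<comment> \<open>With s > n no monomial has s indices, so there is nothing to remove.\<close>
 case False
 have "G : gsp (%M. ?D M & card (idxs M) < s)"
 proof (rule gsp_mono[OF Suc.prems(1)])
 fix M assume M: "?D M & card (idxs M) < Suc s"
 then have "card (idxs M) <= n" using card_mono[of "{..<n}" "idxs M"] by simp
 then show "?D M & card (idxs M) < s" using M False by simp
 qed
 then show ?thesis using Suc by blast
 next
 case True
 let ?P = "{..<s}"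
 define g where "g = gfilter (%M. idxs M = ?P) G"
 have g1: "g : gsp (%M. idxs M = ?P & ?D M & card (idxs M) < Suc s)" unfolding g_def by (rule gfilter_gsp[OF Suc.prems(1)])
 have gd: "g : gsp (dg s)" by (rule gsp_mono[OF g1]) (simp add: dg_def)
 have gP: "g : gsp (%M. idxs M = ?P)" by (rule gsp_mono[OF g1]) simp
 have gP': "g : gsp (%M. idxs M \<subseteq> ?P)" by (rule gsp_mono[OF g1]) simp
 \<comment> \<open>By symmetry of \<open>G\<close> all s! permutations of \<open>{..<s}\<close> fix
   \<open>g\<close>, so symmetrising multiplies it by s!.\<close>
 let ?c = "inverse (of_nat (fact s)) :: 'k"
 define D where "D = G - cs ?c * rsum ?P n g"
 have Dsym: "relabel \<pi> D = D" if "\<pi> permutes {..<n}" for \<pi>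
 unfolding D_def glin_diff[OF glin_rlb] glin_cs[OF glin_rlb] rsum_symmetric[OF gP' that] Suc.prems(2)[OF that] ..
 have sub: "rsum ?P n g : gsp (%M. ?D M & card (idxs M) < Suc s)"
 proof (rule glin_maps_gsp[OF glin_rsum g1])
 fix w assume w: "idxs (mset w) = ?P & ?D (mset w) & card (idxs (mset w)) < Suc s"
 have "idxs (mset (map (rl i) w)) = i ` ?P" for i unfolding idxs_mset_map using w by simp
 moreover have "card (i ` ?P) < Suc s" for i :: "nat => nat" using card_image_le[of ?P i] by simp
 ultimately show "rsum ?P n (gw w) : gsp (%M. ?D M & card (idxs M) < Suc s)"
 unfolding rsum_gw using w by (intro gsp_sum gsp_gw) (auto simp: isdiag_def dest: PiE_mem)
 qed
 have D1: "D : gsp (%M. ?D M & card (idxs M) < Suc s)" unfolding D_def by (intro gsp_diff gsp_cs Suc.prems(1) sub)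
 have top: "gfilter (%M. idxs M = ?P) D = 0"
 proof -
 have "relabel \<pi> g = g" if "\<pi> permutes ?P" for \<pi>
 proof -
 have p: "\<pi> permutes {..<n}" using that by (rule permutes_subset) (use True in auto)
 show ?thesis unfolding g_def using gfilter_relabel[OF permutes_inj[OF p], of ?P G] permutes_image[OF that] Suc.prems(2)[OF p] by simp
 qed
 then have "gfilter (%M. idxs M = ?P) (rsum ?P n g) = (\<Sum>\<pi> | \<pi> permutes ?P. g)"
 using True by (subst rsum_filter_top[OF gP]) auto
 also have "... = cs (of_nat (fact s)) * g" using card_permutations[of ?P s] by (simp add: cs_of_nat del: of_nat_fact)
 finally show ?thesis unfolding D_def gfilter_diff gfilter_cs g_def[symmetric] using cs_inverse[of "of_nat (fact s)" g] by (simp del: of_nat_fact)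
 qed
 \<comment> \<open>The remainder is symmetric and any set of s indices is the image of
   \<open>{..<s}\<close> under a permutation of \<open>{..<n}\<close>, so the one set
   \<open>{..<s}\<close> decides.\<close>
 have topQ: "gfilter (%M. idxs M = Q) D = 0" if "Q \<subseteq> {..<n}" "card Q = s" for Q
 proof -
 from extend_to_permutation[OF that] obtain \<rho> where \<rho>: "\<rho> permutes {..<n}" "\<rho> ` ?P = Q" by blast
 show ?thesis using gfilter_relabel[OF permutes_inj[OF \<rho>(1)], of ?P D] top unfolding \<rho>(2) Dsym[OF \<rho>(1)]
 by (simp add: glin_0[OF glin_rlb])
 qed
 have D2: "D : gsp (%M. ?D M & card (idxs M) < s)"
 proof -
 have "D : gsp (%M. idxs M : Pow {..<n})" by (rule gsp_mono[OF D1]) simp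
 then have D': "D = (\<Sum>Q\<in>Pow {..<n}. gfilter (%M. idxs M = Q) D)" by (rule gfilter_partition) simp
 have "gfilter (%M. idxs M = Q) D : gsp (%M. ?D M & card (idxs M) < s)" if "Q : Pow {..<n}" for Q
 proof (cases "card Q = s")
 case False
 show ?thesis by (rule gsp_mono[OF gfilter_gsp[OF D1]]) (use False in auto)
 qed (use topQ that in simp)
 then have "(\<Sum>Q\<in>Pow {..<n}. gfilter (%M. idxs M = Q) D) : gsp (%M. ?D M & card (idxs M) < s)" by (rule gsp_sum)
 then show ?thesis unfolding D'[symmetric] .
 qed
 obtain u where u: "u : GL_invariants n" "u : gsp (below n)" "dD n u = 0" "Dg u = D" using Suc.IH[OF D2 Dsym] by blast
 obtain F where F: "F : GL_invariants n" "F : gsp (below n)" "res F = L s n g" using L_lift(1)[OF gd] by blast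
 have "dD n F = 0" using lift_cycle[OF F(1,2)] F(3) L_lift(2)[OF gd] by simp
 moreover have "Dg F = rsum ?P n g" using Dg_res[of F] Dg_L[OF gd] F(3) by simp
 ultimately show ?thesis using u F by (intro exI[of _ "u + cs ?c * F"])
 (simp add: GL_add GL_cs gsp_add gsp_cs glin_add[OF glin_gd] glin_cs[OF glin_gd] glin_add[OF glin_Dg] glin_cs[OF glin_Dg] D_def)
 qed
 qed
 note this[where s = "Suc n" and G = G]
 moreover have "G : gsp (%M. ?D M & card (idxs M) < Suc n)"
 proof (rule gsp_mono[OF assms(1)])
 fix M assume M: "?D M"
 then show "?D M & card (idxs M) < Suc n" using card_mono[of "{..<n}" "idxs M"] by simp
 qed
 ultimately show ?thesis using assms(2) by blast
qed

section \<open>Stable injectivity on homology\<close>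

lemma pt_relabel:
 assumes "pt P (mset w)" "inj_on \<phi> P"
 shows "pt (\<phi> ` P) (mset (map (rl \<phi>) w))"
proof -
 have P: "idxs (mset w) = P" "rws (odm (mset w)) = cls (odm (mset w))" "simple (rws (odm (mset w)))" "off (mset w) = 0"
 using assms(1) by (auto simp: pt_def pg_def)
 have in': "rw l : P" "cl l : P" if "l : set w" for l using that P(1) by (auto simp: idxs_def)
 have dx: "dgx (rl \<phi> l) \<longleftrightarrow> dgx l" if "l : set w" for l
 using in'[OF that] assms(2) by (auto simp: dgx_def inj_on_eq_iff)
 have o: "odm (mset (map (rl \<phi>) w)) = image_mset (rl \<phi>) (odm (mset w))"
 unfolding odm_def mset_map filter_mset_image_mset by (rule arg_cong[where f = "image_mset (rl \<phi>)"], rule filter_mset_cong) (use dx in auto)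
 have r: "rws (odm (mset (map (rl \<phi>) w))) = image_mset \<phi> (rws (odm (mset w)))"
 "cls (odm (mset (map (rl \<phi>) w))) = image_mset \<phi> (cls (odm (mset w)))"
 unfolding o image_mset.compositionality by (rule image_mset_cong, simp)+
 have si: "simple (image_mset \<phi> A)" if "simple A" "set_mset A \<subseteq> P" for A using that
 proof (induction A)
 case (add a A)
 then have "\<phi> a ~: \<phi> ` set_mset A" using assms(2) by (auto simp: simple_add inj_on_def)
 then show ?case using add by (simp add: simple_add)
 qed (simp add: simple_def)
 have "set_mset (rws (odm (mset w))) \<subseteq> P" using in' by (auto simp: odm_def)
 then have "simple (rws (odm (mset (map (rl \<phi>) w))))" unfolding r by (intro si P(3))
 moreover have "off (mset (map (rl \<phi>) w)) = 0"
 proof (rule off_eq_0)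
 fix l assume "l \<in># mset (map (rl \<phi>) w)"
 then obtain l' where "l' \<in># mset w" "l = rl \<phi> l'" by auto
 moreover from this have "~ isoff l'" using P(4) by (auto dest: not_isoff)
 ultimately show "~ isoff l" by (auto simp: isoff_def)
 qed
 moreover have "idxs (mset (map (rl \<phi>) w)) = \<phi> ` P" unfolding idxs_mset_map P(1) ..
 ultimately show ?thesis unfolding pt_def pg_def using r P(2) by simp
qed

text \<open>Merging x arcs changes the number of indices from word to word; the results are sorted
  by that number, with index sets renamed to initial segments.\<close>

lemma res_decomposition:
 assumes G: "G : gsp (pg {..<m})"
 shows "EX M. (ALL k. M k : gsp (pt {..<k})) & res (rsum {..<m} n G) = (\<Sum>k\<le>m. rsum {..<k} n (M k) :: 'k::field_char_0 mat_gca)" (is "?Q G")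
 using G
proof (induction rule: gsp_induct)
 case (add f g)
 then obtain M N where "ALL k. M k : gsp (pt {..<k})" "res (rsum {..<m} n f) = (\<Sum>k\<le>m. rsum {..<k} n (M k))"
 "ALL k. N k : gsp (pt {..<k})" "res (rsum {..<m} n g) = (\<Sum>k\<le>m. rsum {..<k} n (N k))" by blast
 then show ?case
 by (intro exI[of _ "%k. M k + N k"]) (simp add: gsp_add glin_add[OF glin_rsum] glin_add[OF glin_res] sum.distrib)
next
 case (word c w)
 obtain P w' where P: "finite P" "card P <= m" "pt P (mset w')"
 "res (rsum {..<m} n (gw w)) = (res (rsum P n (gw w')) :: 'k mat_gca)" using pg_merge[OF _ word, of n] by auto
 let ?s = "card P"
 obtain h where h: "bij_betw h P {..<?s}" using ex_bij_betw_finite_nat[OF P(1)] atLeast0LessThan by metis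
 then have hp: "inj_on h P" "h ` P = {..<?s}" by (auto simp: bij_betw_def)
 let ?g = "gw (map (rl h) w') :: 'k mat_gca"
 have g: "?g : gsp (pt {..<?s})" by (rule gsp_gw) (use pt_relabel[OF P(3) hp(1)] hp(2) in simp)
 have "gw w' : (gsp (%M. idxs M \<subseteq> P) :: 'k mat_gca set)" by (rule gsp_gw) (use P(3) in \<open>simp add: pt_def pg_def\<close>)
 then have e: "rsum P n (gw w') = rsum {..<?s} n ?g" using rsum_reindex[OF _ h, of "gw w' :: 'k mat_gca" n] unfolding relabel_gw by simp
 have e2: "res (rsum {..<m} n (gw w)) = rsum {..<?s} n ?g" unfolding P(4) e by (rule res_rsum[OF g])
 have "(\<Sum>k\<le>m. rsum {..<k} n (if k = ?s then cs c * ?g else 0)) = cs c * rsum {..<?s} n ?g"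
 using P(2) by (subst sum.remove[of _ ?s]) (simp_all add: glin_0[OF glin_rsum] glin_cs[OF glin_rsum] del: gw_simps)
 then show ?case using g e2 by (intro exI[of _ "%k. if k = ?s then cs c * ?g else 0"])
 (simp add: gsp_cs glin_cs[OF glin_rsum] glin_cs[OF glin_res] del: gw_simps)
next
 show "?Q 0" by (intro exI[of _ "%_. 0"]) (simp add: glin_0[OF glin_rsum] glin_0[OF glin_res])
qed

lemma rsum_relabel_sum:
 assumes "g : gsp (%M. idxs M \<subseteq> {..<N})"
 shows "rsum {..<N} n (\<Sum>\<pi> | \<pi> permutes {..<N}. relabel \<pi> g) = cs (of_nat (fact N)) * rsum {..<N} n (g :: 'k::field_char_0 mat_gca)"
proof -
 have "rsum {..<N} n (relabel \<pi> g) = rsum {..<N} n g" if "\<pi> permutes {..<N}" for \<pi>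
 by (rule rsum_reindex[OF assms permutes_imp_bij[OF that]])
 then have "rsum {..<N} n (\<Sum>\<pi> | \<pi> permutes {..<N}. relabel \<pi> g) = (\<Sum>\<pi> | \<pi> permutes {..<N}. rsum {..<N} n g)"
 unfolding glin_sum[OF glin_rsum] by (intro sum.cong refl) simp
 then show ?thesis using card_permutations[of "{..<N}" N] by (simp add: cs_of_nat del: of_nat_fact)
qed

text \<open>Contractions over fewer indices cannot fill all N, and the one over N indices is
  symmetrised.\<close>

lemma top_component:
 assumes M: "!!k. k <= N ==> M k : gsp (%A. idxs A = {..<k})" and N: "N <= n"
 shows "gfilter (%A. idxs A = {..<N}) (\<Sum>k\<le>N. rsum {..<k} n (M k)) =
 (\<Sum>\<pi> | \<pi> permutes {..<N}. relabel \<pi> (M N) :: 'k::field_char_0 mat_gca)"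
proof -
 have "gfilter (%A. idxs A = {..<N}) (rsum {..<k} n (M k)) = 0" if "k < N" for k
 by (rule rsum_filter_small) (use that gsp_mono[OF M[of k], of "%A. idxs A \<subseteq> {..<k}"] in auto)
 then have "gfilter (%A. idxs A = {..<N}) (\<Sum>k\<le>N. rsum {..<k} n (M k)) =
 (\<Sum>k\<le>N. if k = N then gfilter (%A. idxs A = {..<N}) (rsum {..<N} n (M N)) else 0)"
 unfolding gfilter_sum by (intro sum.cong refl) auto
 also have "... = gfilter (%A. idxs A = {..<N}) (rsum {..<N} n (M N))" by simp
 also have "... = (\<Sum>\<pi> | \<pi> permutes {..<N}. relabel \<pi> (M N))"
 by (rule rsum_filter_top) (use M[of N] N in auto)
 finally show ?thesis .
qed

text \<open>The symmetrised top part of \<open>res f\<close> is a cycle for \<open>dB\<close>, and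
  \<open>pt_homology\<close> makes it canonical up to a boundary. Subtracting invariant lifts of
  both leaves an invariant cycle with contributions from fewer indices only.\<close>

lemma canonical_reduction:
 assumes "f : GL_invariants n" "f : gsp (below n)" "dD n f = 0"
 and "!!k. M k : gsp (pt {..<k})" "res f = (\<Sum>k<N. rsum {..<k} n (M k))" "N <= Suc n"
 shows "EX h g. h : GL_invariants n & h : gsp (below n) & (ALL c. g c : gsp (dg c)) &
 res (f - dD n h) = (\<Sum>c<N. L c n (g c) :: 'k::field_char_0 mat_gca)" using assms
proof (induction N arbitrary: f M)
 case 0
 then show ?case by (intro exI[of _ 0] exI[of _ "%_. 0"]) (simp add: GL_0 glin_0[OF glin_gd])
next
 case (Suc N)
 let ?P = "{..<N}" and ?c = "inverse (of_nat (fact N)) :: 'k"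
 have c0: "of_nat (fact N) ~= (0 :: 'k)" by (simp del: of_nat_fact)
 have Mi: "M k : gsp (%A. idxs A = {..<k})" for k by (rule gsp_mono[OF Suc.prems(4)]) (simp add: pt_def pg_def)
 have Mi': "M k : gsp (%A. idxs A \<subseteq> {..<k})" for k by (rule gsp_mono[OF Mi]) simp
 define m where "m = (\<Sum>\<pi> | \<pi> permutes ?P. relabel \<pi> (M N))"
 have rf: "res f = (\<Sum>k\<le>N. rsum {..<k} n (M k))" using Suc.prems(5) by (simp add: lessThan_Suc_atMost)
 have mf: "m = gfilter (%A. idxs A = ?P) (res f)"
 unfolding rf m_def by (rule top_component[OF Mi, symmetric]) (use Suc.prems(6) in simp)
 have dBr: "dB (res f) = 0" using res_diff[OF Suc.prems(2)] Suc.prems(3) glin_0[OF glin_res] by metis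
 \<comment> \<open>The differential keeps the index set of a word, so the top part of a cycle is a
   cycle.\<close>
 have "dB m = gfilter (%A. idxs A = ?P) (dB (res f))" unfolding mf by (rule dB_gfilter[symmetric]) (auto simp del: mk.simps)
 then have dm: "dB m = 0" using dBr glin_0[OF glin_gf] by simp
 have mp: "m : gsp (pt ?P)" unfolding m_def
 proof (rule gsp_sum)
 fix \<pi> assume "\<pi> : {\<pi>. \<pi> permutes ?P}"
 then have \<pi>: "\<pi> permutes ?P" by simp
 show "relabel \<pi> (M N) : gsp (pt ?P)"
 proof (rule glin_maps_gsp[OF glin_rlb Suc.prems(4)])
 fix w assume "pt ?P (mset w)"
 then have "pt (\<pi> ` ?P) (mset (map (rl \<pi>) w))" using permutes_inj_on[OF \<pi>] by (rule pt_relabel)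
 then show "relabel \<pi> (gw w) : gsp (pt ?P)" unfolding relabel_gw permutes_image[OF \<pi>] by (rule gsp_gw)
 qed
 qed
 obtain v b where vb: "canon ?P v" "b : gsp (pt ?P)" "m = v + dB b" using pt_homology[OF mp dm] by auto
 obtain g where g: "!!c. g c : gsp (dg c)" "rsum ?P n v = (\<Sum>c\<le>N. L c n (g c))" using canon_L[OF vb(1), of n] by auto
 obtain F where F: "F : GL_invariants n" "F : gsp (below n)" "res F = rsum ?P n b" using pt_lift[OF vb(2)] by blast
 have "EX C. C : GL_invariants n & C : gsp (below n) & res C = L c n (g c) & dD n C = 0" for c
 using L_lift[OF g(1)[of c], where n = n] lift_cycle by metis
 then obtain C where C: "!!c. C c : GL_invariants n" "!!c. C c : gsp (below n)" "!!c. res (C c) = L c n (g c)" "!!c. dD n (C c) = 0"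
 by metis
 \<comment> \<open>Contraction is blind to the symmetrisation, apart from the factor N!.\<close>
 have top: "rsum ?P n (M N) = cs ?c * (\<Sum>c\<le>N. L c n (g c)) + cs ?c * res (dD n F)"
 proof -
 have "cs (of_nat (fact N)) * rsum ?P n (M N) = rsum ?P n m" unfolding m_def by (rule rsum_relabel_sum[OF Mi', symmetric])
 also have "... = (\<Sum>c\<le>N. L c n (g c)) + res (dD n F)"
 unfolding vb(3) glin_add[OF glin_rsum] g(2) rsum_dB res_diff[OF F(2)] F(3) ..
 finally have "cs ?c * (cs (of_nat (fact N)) * rsum ?P n (M N)) = cs ?c * ((\<Sum>c\<le>N. L c n (g c)) + res (dD n F))" by (simp only:)
 then show ?thesis unfolding cs_inverse[OF c0] distrib_left .
 qed
 let ?f = "f - dD n (cs ?c * F) - cs ?c * (\<Sum>c\<le>N. C c)"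
 have minus: "x - y = x + cs (- 1) * y" for x y :: "'k mat_gca" by (simp add: cs_uminus)
 have G: "?f : GL_invariants n" unfolding minus by (intro GL_add GL_cs GL_sum Suc.prems GL_dD F C gsp_cs)
 have B: "?f : gsp (below n)" by (intro gsp_diff gsp_cs gsp_sum Suc.prems dD_below F C)
 have d: "dD n ?f = 0"
 by (simp add: glin_diff[OF glin_gd] glin_cs[OF glin_gd] glin_sum[OF glin_gd] gca_diff_diff Suc.prems C)
 have r: "res ?f = (\<Sum>k<N. rsum {..<k} n (M k))"
 unfolding glin_diff[OF glin_res] glin_cs[OF glin_res] glin_cs[OF glin_gd] glin_sum[OF glin_res] C(3) Suc.prems(5) sum.lessThan_Suc top
 by simp
 obtain h' g' where h': "h' : GL_invariants n" "h' : gsp (below n)" "ALL c. g' c : gsp (dg c)"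
 "res (?f - dD n h') = (\<Sum>c<N. L c n (g' c))" using Suc.IH[OF G B d Suc.prems(4) r] Suc.prems(6) by auto
 let ?h = "cs ?c * F + h'" and ?g = "%c. (if c < N then g' c else 0) + cs ?c * g c"
 have "f - dD n ?h = (?f - dD n h') + cs ?c * (\<Sum>c\<le>N. C c)" by (simp add: glin_add[OF glin_gd])
 then have "res (f - dD n ?h) = (\<Sum>c<N. L c n (g' c)) + cs ?c * (\<Sum>c\<le>N. L c n (g c))"
 by (simp only: glin_add[OF glin_res] h'(4) glin_cs[OF glin_res] glin_sum[OF glin_res] C(3))
 also have "... = (\<Sum>c<Suc N. L c n (?g c))"
 proof -
 have "(\<Sum>c<N. L c n (g' c)) = (\<Sum>c<Suc N. L c n (if c < N then g' c else 0))" by (simp add: glin_0[OF glin_L])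
 then show ?thesis unfolding glin_add[OF glin_L] glin_cs[OF glin_L] sum.distrib sum_distrib_left lessThan_Suc_atMost by (simp only:)
 qed
 finally have "res (f - dD n ?h) = (\<Sum>c<Suc N. L c n (?g c))" .
 moreover have "?h : GL_invariants n" "?h : gsp (below n)" by (intro GL_add GL_cs gsp_add gsp_cs F h')+
 moreover have "ALL c. ?g c : gsp (dg c)" using h'(3) g(1) by (auto intro!: gsp_add gsp_cs)
 ultimately show ?case by (intro exI[of _ ?h] exI[of _ ?g]) blast
qed

lemma canonical_cancellation:
 assumes "!!c. g c : gsp (dg c)" "(\<Sum>c<N. rsum {..<c} n (g c)) = 0" "N <= Suc n" "c < N"
 shows "L c n (g c) = (0 :: 'k::field_char_0 mat_gca)" using assms(2-4)
proof (induction N arbitrary: c)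
 case (Suc N)
 let ?m = "\<Sum>\<pi> | \<pi> permutes {..<N}. relabel \<pi> (g N)"
 have gi: "g k : gsp (%A. idxs A = {..<k})" for k by (rule gsp_mono[OF assms(1)]) (simp add: dg_def)
 have c0: "of_nat (fact N) ~= (0 :: 'k)" by (simp del: of_nat_fact)
 have "?m = gfilter (%A. idxs A = {..<N}) (\<Sum>k\<le>N. rsum {..<k} n (g k))"
 by (rule top_component[OF gi, symmetric]) (use Suc.prems(2) in simp)
 then have m0: "?m = 0" using Suc.prems(1) glin_0[OF glin_gf] by (simp add: lessThan_Suc_atMost)
 have "cs (of_nat (fact N)) * rsum {..<N} n (g N) = 0"
 proof -
 have "g N : gsp (%A. idxs A \<subseteq> {..<N})" by (rule gsp_mono[OF gi]) simp
 from rsum_relabel_sum[OF this, of n] show ?thesis unfolding m0 by (simp add: glin_0[OF glin_rsum] del: of_nat_fact)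
 qed
 then have r0: "rsum {..<N} n (g N) = 0" using cs_inverse[OF c0, of "rsum {..<N} n (g N)"] by simp
 have "L N n ?m = cs (of_nat (fact N)) * L N n (g N)"
 proof -
 have "L N n ?m = (\<Sum>\<pi> | \<pi> permutes {..<N}. L N n (g N))"
 unfolding glin_sum[OF glin_L] by (intro sum.cong refl L_relabel[OF assms(1)]) simp
 then show ?thesis using card_permutations[of "{..<N}" N] by (simp add: cs_of_nat del: of_nat_fact)
 qed
 then have "cs (of_nat (fact N)) * L N n (g N) = 0" unfolding m0 by (simp add: glin_0[OF glin_L])
 then have L0: "L N n (g N) = 0" using cs_inverse[OF c0, of "L N n (g N)"] by simp
 show ?case
 proof (cases "c = N")
 case False
 have "(\<Sum>c<N. rsum {..<c} n (g c)) = 0" using Suc.prems(1) r0 by simp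
 then show ?thesis using Suc False by simp
 qed (use L0 in simp)
qed simp

text \<open>Subtracting a boundary leaves standard cycles, and their diagonal parts determine them.
  The bound on m is the stable range: \<open>stable_fft\<close> needs as many indices as there are
  letters.\<close>

theorem Dg_injective:
 assumes f: "f : GL_invariants n" "f : gsp (%M. below n M & size M = m)" and mn: "m <= n"
 and d: "dD n f = 0" and D: "Dg f = 0"
 shows "EX h. h : GL_invariants n & h : gsp (below n) & f = dD n (h :: 'k::field_char_0 mat_gca)"
proof -
 have fb: "f : gsp (below n)" by (rule gsp_mono[OF f(2)]) simp
 let ?G = "cs (inverse (of_nat (card (arr m)))) * dist_part m f"
 have Gd: "?G : gsp (dist {..<m})" by (intro gsp_cs dist_part_dist[OF f mn])
 have G: "?G : gsp (pg {..<m})" by (rule gsp_mono[OF Gd]) (simp add: dist_pg)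
 have fG: "f = rsum {..<m} n ?G" by (rule stable_fft[OF f mn])
 obtain M where M: "!!k. M k : gsp (pt {..<k})" "res f = (\<Sum>k<Suc m. rsum {..<k} n (M k))"
 using res_decomposition[OF G, of n] unfolding fG[symmetric] lessThan_Suc_atMost by blast
 obtain h g where h: "h : GL_invariants n" "h : gsp (below n)" "!!c. g c : gsp (dg c)"
 "res (f - dD n h) = (\<Sum>c<Suc m. L c n (g c))" using canonical_reduction[OF f(1) fb d M] mn by auto
 have "Dg (f - dD n h) = 0" unfolding glin_diff[OF glin_Dg] D Dg_dD[OF h(2)] by simp
 moreover have "Dg (f - dD n h) = (\<Sum>c<Suc m. rsum {..<c} n (g c))"
 unfolding Dg_res[of "f - dD n h", symmetric] h(4) glin_sum[OF glin_Dg] by (intro sum.cong refl Dg_L h(3))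
 ultimately have z: "(\<Sum>c<Suc m. rsum {..<c} n (g c)) = 0" by simp
 have "L c n (g c) = 0" if "c < Suc m" for c by (rule canonical_cancellation[OF h(3) z _ that]) (use mn in simp)
 then have r: "res (f - dD n h) = 0" unfolding h(4) by simp
 have G: "f - dD n h : GL_invariants n"
 proof -
 have "f - dD n h = f + cs (- 1) * dD n h" by (simp add: cs_uminus)
 then show ?thesis using f(1) GL_dD[OF h(1,2)] by (simp only: GL_add GL_cs)
 qed
 have "f - dD n h : gsp (below n)" by (intro gsp_diff fb dD_below h)
 then have "f - dD n h = 0" by (rule res_injective[OF G _ r])
 then show ?thesis using h by (intro exI[of _ h]) simp
qed

section \<open>Homology of DG algebras whose operations are those of a type\<close>

text \<open>The operations are those of a type, so the ring laws are inherited and only closure is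
  assumed. The graded Leibniz rule is represented by \<open>cyc\<close> and \<open>bd\<close>:
  cycles are closed under products, and boundaries form a two-sided ideal among them.\<close>

locale hdga =
 fixes A :: "('k, 'a::ring_1) bgdga"
 assumes ops: "monoid.mult A = (*)" "monoid.one A = 1" "ring.zero A = 0" "ring.add A = (+)"
 and C: "0 : carrier A" "1 : carrier A" "!!x y. x : carrier A ==> y : carrier A ==> x + y : carrier A"
 "!!x y. x : carrier A ==> y : carrier A ==> x - y : carrier A"
 "!!x y. x : carrier A ==> y : carrier A ==> x * y : carrier A"
 "!!c x. x : carrier A ==> module.smult A c x : carrier A"
 and sm: "!!c x y. module.smult A c (x + y) = module.smult A c x + module.smult A c y"
 and d: "!!x. x : carrier A ==> diff A x : carrier A" "!!x y. diff A (x + y) = diff A x + diff A y" "diff A 1 = 0"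
 "!!c x. diff A (module.smult A c x) = module.smult A c (diff A x)" "!!x. diff A (diff A x) = 0"
 and cyc: "!!x y. diff A x = 0 ==> diff A y = 0 ==> diff A (x * y) = 0"
 and bd: "!!x a. x : carrier A ==> diff A x = 0 ==> a : carrier A ==> x * diff A a : diff A ` carrier A"
 "!!x a. x : carrier A ==> diff A x = 0 ==> a : carrier A ==> diff A a * x : diff A ` carrier A"
 and bi: "!!i w. bicomp A i w \<subseteq> carrier A"
begin

lemma d_0: "diff A 0 = 0" using d(2)[of 0 0] by simp

lemma d_minus: "diff A (x - y) = diff A x - diff A y" using d(2)[of "x - y" y] by simp

lemma sm_0: "module.smult A c 0 = 0" using sm[of c 0 0] by simp

lemma sm_minus: "module.smult A c (x - y) = module.smult A c x - module.smult A c y" using sm[of c "x - y" y] by simp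

lemma Z: "x : cycles A \<longleftrightarrow> x : carrier A & diff A x = 0" by (simp add: cycles_def ops)

lemma B: "b : boundaries A \<longleftrightarrow> (\<exists>a\<in>carrier A. b = diff A a)" by (auto simp: boundaries_def)

lemma B_0: "0 : boundaries A" unfolding B using C(1) d_0 by force

lemma B_add: "a : boundaries A ==> b : boundaries A ==> a + b : boundaries A" unfolding B using C(3) d(2) by metis

lemma B_diff: "a : boundaries A ==> b : boundaries A ==> a - b : boundaries A" unfolding B using C(4) d_minus by metis

lemma B_Z: "b : boundaries A ==> b : cycles A" unfolding B Z using d by auto

lemma B_smult: "b : boundaries A ==> module.smult A c b : boundaries A" unfolding B using C(6) d(4) by metis

lemma B_mult: "z : cycles A ==> b : boundaries A ==> z * b : boundaries A"
 "z : cycles A ==> b : boundaries A ==> b * z : boundaries A" using bd unfolding Z B boundaries_def[symmetric] by blast+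

lemma Z_add: "x : cycles A ==> y : cycles A ==> x + y : cycles A"
 and Z_mult: "x : cycles A ==> y : cycles A ==> x * y : cycles A"
 and Z_smult: "x : cycles A ==> module.smult A c x : cycles A"
 and Z_01: "0 : cycles A" "1 : cycles A" unfolding Z using C d cyc sm_0 d_0 by simp_all

lemma Z_sum: "(!!a. a : F ==> z a : cycles A) ==> sum z F : cycles A"
 by (induction F rule: infinite_finite_induct) (auto intro: Z_01 Z_add)

lemma hc_mem: "x : homology_class A z \<longleftrightarrow> x - z : boundaries A"
proof -
 have "homology_class A z = (%b. b + z) ` boundaries A" by (auto simp: homology_class_def a_r_coset_def r_coset_def ops)
 then show ?thesis by (force simp: image_iff algebra_simps)
qed

lemma hc_self: "z : homology_class A z" by (simp add: hc_mem B_0)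

lemma hc_eq: "homology_class A x = homology_class A y \<longleftrightarrow> x - y : boundaries A"
proof
 assume "homology_class A x = homology_class A y"
 then show "x - y : boundaries A" using hc_self[of x] by (simp add: hc_mem)
next
 assume e: "x - y : boundaries A"
 have "v - x : boundaries A \<longleftrightarrow> v - y : boundaries A" for v
 using B_add[OF _ e, of "v - x"] B_diff[OF _ e, of "v - y"] by auto
 then show "homology_class A x = homology_class A y" by (auto simp: hc_mem)
qed

lemma hc_Z: "z : cycles A ==> x : homology_class A z ==> x : cycles A"
 using Z_add[of z "x - z"] B_Z[of "x - z"] by (simp add: hc_mem)

lemma H_carrier: "carrier (homology A) = homology_class A ` cycles A"
 by (auto simp: homology_def Let_def FactRing_def A_RCOSETS_def RCOSETS_def homology_class_def a_r_coset_def r_coset_def)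

lemma H_bicomp: "bicomp (homology A) i w = homology_class A ` (cycles A \<inter> bicomp A i w)"
 by (simp add: homology_def Let_def)

lemma H_mult:
 assumes "x : cycles A" "y : cycles A"
 shows "monoid.mult (homology A) (homology_class A x) (homology_class A y) = homology_class A (x * y)"
proof -
 have m: "monoid.mult (homology A) U V = (\<Union>a\<in>U. \<Union>b\<in>V. homology_class A (a * b))" for U V
 by (simp add: homology_def Let_def FactRing_def rcoset_mult_def homology_class_def a_r_coset_def r_coset_def ops)
 have "homology_class A (a * b) = homology_class A (x * y)" if "a : homology_class A x" "b : homology_class A y" for a b
 proof -
 have "a * b - x * y = (a - x) * b + x * (b - y)" by (simp add: algebra_simps)
 moreover have "(a - x) * b : boundaries A" using that assms hc_Z by (intro B_mult) (auto simp: hc_mem)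
 moreover have "x * (b - y) : boundaries A" using that assms by (intro B_mult) (auto simp: hc_mem)
 ultimately show ?thesis unfolding hc_eq by (simp add: B_add)
 qed
 then show ?thesis unfolding m using hc_self[of x] hc_self[of y] by blast
qed

lemma H_add: "ring.add (homology A) (homology_class A x) (homology_class A y) = homology_class A (x + y)"
proof -
 have m: "ring.add (homology A) U V = (\<Union>a\<in>U. \<Union>b\<in>V. {a + b})" for U V
 by (simp add: homology_def Let_def FactRing_def set_add_def set_mult_def ops)
 show ?thesis unfolding m
 proof (intro equalityI subsetI)
 fix v assume "v : (\<Union>a\<in>homology_class A x. \<Union>b\<in>homology_class A y. {a + b})"
 then obtain a b where ab: "a - x : boundaries A" "b - y : boundaries A" "v = a + b" by (auto simp: hc_mem)
 then show "v : homology_class A (x + y)" using B_add[OF ab(1,2)] by (simp add: hc_mem algebra_simps)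
 next
 fix v assume "v : homology_class A (x + y)"
 then have "v - y : homology_class A x" by (simp add: hc_mem algebra_simps)
 then show "v : (\<Union>a\<in>homology_class A x. \<Union>b\<in>homology_class A y. {a + b})"
 using hc_self[of y] by (intro UN_I[of "v - y"] UN_I[of y]) simp_all
 qed
qed

lemma H_one: "monoid.one (homology A) = homology_class A 1"
 by (simp add: homology_def Let_def FactRing_def homology_class_def a_r_coset_def r_coset_def ops)

lemma H_zero: "ring.zero (homology A) = homology_class A 0" by (auto simp: homology_def Let_def FactRing_def hc_mem)

lemma H_smult: "module.smult (homology A) c (homology_class A x) = homology_class A (module.smult A c x)"
proof -
 have "homology_class A (module.smult A c z) = homology_class A (module.smult A c x)" if "z : homology_class A x" for z
 using that B_smult[of "z - x" c] by (simp add: hc_eq hc_mem sm_minus)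
 note e = this
 have m: "module.smult (homology A) c (homology_class A x) = (\<Union>z\<in>homology_class A x. homology_class A (module.smult A c z))"
 by (simp add: homology_def Let_def)
 show ?thesis unfolding m
 proof (rule SUP_eq_const)
 show "homology_class A x ~= {}" using hc_self[of x] by auto
 qed (rule e)
qed

lemma H_monoid: "abelian_monoid (homology A)"
proof (rule abelian_monoidI)
 fix U V W assume "U : carrier (homology A)" "V : carrier (homology A)" "W : carrier (homology A)"
 then obtain x y z where "U = homology_class A x" "x : cycles A" "V = homology_class A y" "y : cycles A"
 "W = homology_class A z" "z : cycles A" by (auto simp: H_carrier)
 then show "ring.add (homology A) (ring.add (homology A) U V) W = ring.add (homology A) U (ring.add (homology A) V W)"
 by (simp add: H_add add.assoc)
next
 fix U V assume "U : carrier (homology A)" "V : carrier (homology A)"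
 then obtain x y where xy: "U = homology_class A x" "x : cycles A" "V = homology_class A y" "y : cycles A"
 by (auto simp: H_carrier)
 then show "ring.add (homology A) U V : carrier (homology A)" by (simp add: H_add H_carrier Z_add)
 show "ring.add (homology A) U V = ring.add (homology A) V U" using xy by (simp add: H_add add.commute)
next
 fix U assume "U : carrier (homology A)"
 then show "ring.add (homology A) (ring.zero (homology A)) U = U" by (auto simp: H_carrier H_zero H_add)
qed (simp add: H_zero H_carrier Z_01)

lemma H_finsum:
 assumes "finite W" "!!w. w : W ==> z w : cycles A"
 shows "finsum (homology A) (%w. homology_class A (z w)) W = homology_class A (sum z W)"
proof -
 interpret H: abelian_monoid "homology A" by (rule H_monoid)
 show ?thesis using assms
 proof (induction W rule: finite_induct)
 case (insert a W)
 then have "finsum (homology A) (%w. homology_class A (z w)) (insert a W) =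
 ring.add (homology A) (homology_class A (z a)) (finsum (homology A) (%w. homology_class A (z w)) W)"
 by (intro H.finsum_insert) (auto simp: H_carrier)
 then show ?case using insert by (simp add: H_add)
 qed (simp add: H_zero)
qed

text \<open>Classes in a homogeneous component have bihomogeneous cycles as representatives, so the
  direct sum over weights can be formed on representatives.\<close>

lemma H_degree_part:
 "degree_part (homology A) i =
 {homology_class A (sum z W) | W z. finite W & (\<forall>w\<in>W. z w : cycles A & z w : bicomp A i w)}"
proof (intro equalityI subsetI)
 fix v assume "v : degree_part (homology A) i"
 then obtain W s where W: "finite W" "!!w. w : W ==> s w : bicomp (homology A) i w" "v = finsum (homology A) s W"
 unfolding degree_part_def by blast
 have "EX z. w : W --> z : cycles A & z : bicomp A i w & s w = homology_class A z" for w
 using W(2)[of w] unfolding H_bicomp by blast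
 then obtain z where z: "!!w. w : W ==> z w : cycles A & z w : bicomp A i w & s w = homology_class A (z w)" by metis
 have "v = finsum (homology A) (%w. homology_class A (z w)) W"
 unfolding W(3) by (rule abelian_monoid.finsum_cong'[OF H_monoid]) (use z in \<open>auto simp: H_carrier\<close>)
 then have "v = homology_class A (sum z W)" using H_finsum[OF W(1), of z] z by simp
 then show "v : {homology_class A (sum z W) | W z. finite W & (\<forall>w\<in>W. z w : cycles A & z w : bicomp A i w)}"
 using W(1) z by blast
next
 fix v assume "v : {homology_class A (sum z W) | W z. finite W & (\<forall>w\<in>W. z w : cycles A & z w : bicomp A i w)}"
 then obtain W z where W: "finite W" "!!w. w : W ==> z w : cycles A & z w : bicomp A i w" "v = homology_class A (sum z W)" by blast
 then have "v = finsum (homology A) (%w. homology_class A (z w)) W" using H_finsum[OF W(1), of z] by simp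
 moreover have "\<forall>w\<in>W. homology_class A (z w) : bicomp (homology A) i w" using W(2) unfolding H_bicomp by blast
 ultimately show "v : degree_part (homology A) i" unfolding degree_part_def using W(1) by blast
qed

lemma finsum_sum:
 assumes "finite F" "!!a. a : F ==> s a : carrier A"
 shows "finsum A s F = sum s F"
proof -
 interpret M: abelian_monoid A by (rule abelian_monoidI) (simp_all add: ops C add.assoc add.commute)
 show ?thesis using assms
 proof (induction F rule: finite_induct)
 case (insert a F)
 then have "finsum A s (insert a F) = ring.add A (s a) (finsum A s F)" by (intro M.finsum_insert) auto
 then show ?case using insert by (simp add: ops)
 qed (simp add: ops)
qed

end

text \<open>The target has zero differential, so its classes are singletons. The assumption with
  content is the last one: bihomogeneous elements lift to bihomogeneous cycles.\<close>

locale hhom = A: hdga A + B: hdga B for A :: "('k, 'a::ring_1) bgdga" and B :: "('k, 'b::ring_1) bgdga" +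
 fixes f :: "'a => 'b"
 assumes f: "!!x. x : carrier A ==> f x : carrier B" "!!x y. f (x + y) = f x + f y" "!!x y. f (x * y) = f x * f y"
 "f 1 = 1" "!!c x. f (module.smult A c x) = module.smult B c (f x)"
 and fd: "!!x. x : carrier A ==> f (diff A x) = 0" and dB: "!!y. y : carrier B ==> diff B y = 0"
 and fb: "!!i w x. x : bicomp A i w ==> f x : bicomp B i w"
 and surj: "!!i w y. y : bicomp B i w ==> EX z. z : bicomp A i w & diff A z = 0 & f z = y"
begin

lemma f_0: "f 0 = 0" using f(2)[of 0 0] by simp

lemma f_minus: "f (x - y) = f x - f y" using f(2)[of "x - y" y] by simp

lemma f_sum: "f (sum z W) = (\<Sum>w\<in>W. f (z w))" by (induction W rule: infinite_finite_induct) (simp_all add: f_0 f(2))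

lemma ZB: "cycles B = carrier B" using dB B.Z by blast

lemma BB: "y : boundaries B \<longleftrightarrow> y = 0" using dB B.B B.C(1) by (metis B.B_0)

lemma f_Z: "x : cycles A ==> f x : cycles B" unfolding ZB by (rule f(1)) (simp add: A.Z)

lemma f_B: "b : boundaries A ==> f b = 0" by (auto simp: A.B fd)

lemma map: "homology_map A B f (homology_class A z) = homology_class B (f z)"
proof -
 have "homology_class B (f x) = homology_class B (f z)" if "x : homology_class A z" for x
 using f_B[of "x - z"] that by (simp add: B.hc_eq A.hc_mem BB f_minus)
 note e = this
 show ?thesis unfolding homology_map_def
 proof (rule SUP_eq_const)
 show "homology_class A z ~= {}" using A.hc_self[of z] by auto
 qed (rule e)
qed

theorem degreewise: "degreewise_surjective (homology A) (homology B) (homology_map A B f)"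
 unfolding degreewise_surjective_def
proof (intro allI equalityI subsetI)
 fix i v assume "v : homology_map A B f ` degree_part (homology A) i"
 then obtain W z where W: "finite W" "!!w. w : W ==> z w : cycles A & z w : bicomp A i w"
 "v = homology_map A B f (homology_class A (sum z W))" unfolding A.H_degree_part by blast
 have "v = homology_class B (\<Sum>w\<in>W. f (z w))" unfolding W(3) map f_sum ..
 moreover have "\<forall>w\<in>W. f (z w) : cycles B & f (z w) : bicomp B i w" using W(2) f_Z fb by blast
 ultimately show "v : degree_part (homology B) i" unfolding B.H_degree_part using W(1) by blast
next
 fix i v assume "v : degree_part (homology B) i"
 then obtain W y where W: "finite W" "!!w. w : W ==> y w : bicomp B i w" "v = homology_class B (sum y W)"
 unfolding B.H_degree_part by blast
 have "EX z. w : W --> z : bicomp A i w & diff A z = 0 & f z = y w" for w using surj W(2) by blast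
 then obtain z where z: "!!w. w : W ==> z w : bicomp A i w & diff A (z w) = 0 & f (z w) = y w" by metis
 have "v = homology_map A B f (homology_class A (sum z W))" unfolding W(3) map f_sum using z by simp
 moreover have "homology_class A (sum z W) : degree_part (homology A) i"
 unfolding A.H_degree_part using W(1) z A.bi A.Z by blast
 ultimately show "v : homology_map A B f ` degree_part (homology A) i" by blast
qed

theorem iso:
 assumes inj: "!!z. z : carrier A ==> diff A z = 0 ==> f z = 0 ==> z : boundaries A"
 and sur: "!!y. y : carrier B ==> \<exists>z\<in>cycles A. f z = y"
 shows "bigraded_algebra_iso (homology A) (homology B) (homology_map A B f)"
proof -
 let ?h = "homology_map A B f"
 have "?h : Ring.ring_hom (homology A) (homology B)"
 proof (rule ring_hom_memI)
 fix U assume "U : carrier (homology A)"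
 then show "?h U : carrier (homology B)" by (auto simp: A.H_carrier B.H_carrier map f_Z)
 next
 fix U V assume "U : carrier (homology A)" "V : carrier (homology A)"
 then obtain x y where xy: "U = homology_class A x" "x : cycles A" "V = homology_class A y" "y : cycles A"
 by (auto simp: A.H_carrier)
 show "?h (monoid.mult (homology A) U V) = monoid.mult (homology B) (?h U) (?h V)"
 unfolding xy A.H_mult[OF xy(2,4)] map B.H_mult[OF f_Z[OF xy(2)] f_Z[OF xy(4)]] f(3) ..
 show "?h (ring.add (homology A) U V) = ring.add (homology B) (?h U) (?h V)" unfolding xy A.H_add map B.H_add f(2) ..
 qed (simp add: A.H_one B.H_one map f(4))
 moreover have "bij_betw ?h (carrier (homology A)) (carrier (homology B))"
 proof (rule bij_betw_imageI)
 show "inj_on ?h (carrier (homology A))"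
 proof (rule inj_onI)
 fix U V assume UV: "U : carrier (homology A)" "V : carrier (homology A)" "?h U = ?h V"
 then obtain x y where xy: "U = homology_class A x" "x : cycles A" "V = homology_class A y" "y : cycles A"
 by (auto simp: A.H_carrier)
 then have "f (x - y) = 0" using UV(3) by (simp add: map B.hc_eq BB f_minus)
 moreover have "x - y : carrier A" "diff A (x - y) = 0" using xy by (simp_all add: A.Z A.C A.d_minus)
 ultimately have "x - y : boundaries A" by (intro inj)
 then show "U = V" using xy by (simp add: A.hc_eq)
 qed
 show "?h ` carrier (homology A) = carrier (homology B)"
 proof (intro equalityI subsetI)
 fix V assume "V : ?h ` carrier (homology A)"
 then show "V : carrier (homology B)" by (auto simp: A.H_carrier B.H_carrier map f_Z)
 next
 fix V assume "V : carrier (homology B)"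
 then obtain y where y: "y : carrier B" "V = homology_class B y" by (auto simp: B.H_carrier ZB)
 then obtain z where "z : cycles A" "f z = y" using sur by blast
 then show "V : ?h ` carrier (homology A)" using y(2) map[of z] by (auto simp: A.H_carrier intro!: image_eqI)
 qed
 qed
 moreover have "?h (module.smult (homology A) c U) = module.smult (homology B) c (?h U)" if "U : carrier (homology A)" for c U
 using that by (auto simp: A.H_carrier A.H_smult B.H_smult map f(5))
 moreover have "?h ` bicomp (homology A) i w = bicomp (homology B) i w" for i w
 proof (intro equalityI subsetI)
 fix V assume "V : ?h ` bicomp (homology A) i w"
 then show "V : bicomp (homology B) i w" by (auto simp: A.H_bicomp B.H_bicomp map f_Z fb)
 next
 fix V assume "V : bicomp (homology B) i w"
 then obtain y where y: "y : bicomp B i w" "V = homology_class B y" by (auto simp: B.H_bicomp)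
 then obtain z where z: "z : bicomp A i w" "diff A z = 0" "f z = y" using surj by blast
 then have "z : cycles A" using A.bi A.Z by blast
 then show "V : ?h ` bicomp (homology A) i w" using y(2) z map[of z] by (auto simp: A.H_bicomp intro!: image_eqI)
 qed
 ultimately show ?thesis unfolding bigraded_algebra_iso_def ring_iso_def by blast
qed

end

section \<open>The algebras at level \<open>n\<close>\<close>

abbreviation cmp :: "nat => nat => ('v, 'o::linorder, 'k::field_char_0) gca => ('v, 'o, 'k) gca" where
 "cmp i w \<equiv> gfilter (%M. nod M = i & wt M = w)"

definition galg :: "('v, 'o::linorder, 'k::field_char_0) gca set => ('o => ('v, 'k) mpoly) => ('k, ('v, 'o, 'k) gca) bgdga" where
 "galg C \<delta> = \<lparr>carrier = C, monoid.mult = (*), monoid.one = 1, ring.zero = 0, ring.add = (+), module.smult = gca_smult,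
 bgdga.diff = gca_diff \<delta>, bicomp = (%i w. C \<inter> gca_bihomogeneous i w)\<rparr>"

text \<open>Closure under the parity automorphism puts the product of a cycle and a boundary among
  the boundaries (\<open>gca_diff_cycle_mult\<close>); closure under \<open>cmp\<close> allows
  splitting into bihomogeneous parts.\<close>

definition subdga :: "('v, 'o::linorder, 'k::field_char_0) gca set => ('o => ('v, 'k) mpoly) => bool" where
 "subdga C \<delta> \<longleftrightarrow> 1 : C & (\<forall>x\<in>C. \<forall>y\<in>C. x + y : C & x * y : C) & (ALL c. \<forall>x\<in>C. cs c * x : C) &
 (\<forall>x\<in>C. gi x : C & gca_diff \<delta> x : C & (ALL i w. cmp i w x : C))"

lemma subdgaD:
 assumes "subdga C \<delta>"
 shows "1 : C" "x : C ==> y : C ==> x + y : C" "x : C ==> y : C ==> x * y : C" "x : C ==> cs c * x : C"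
 "x : C ==> gi x : C" "x : C ==> gca_diff \<delta> x : C" "x : C ==> cmp i w x : C" "0 : C"
 "x : C ==> y : C ==> x - y : C"
proof -
 show "1 : C" "x : C ==> y : C ==> x + y : C" "x : C ==> y : C ==> x * y : C" "x : C ==> cs c * x : C" for x y c
 using assms by (auto simp: subdga_def)
 note r = this
 show "x : C ==> gi x : C" "x : C ==> gca_diff \<delta> x : C" "x : C ==> cmp i w x : C"
 using assms by (auto simp: subdga_def)
 show "0 : C" using r(4)[OF r(1), of 0] by simp
 show "x - y : C" if "x : C" "y : C" using r(2)[OF that(1) r(4)[OF that(2), of "- 1"]] by (simp add: cs_uminus)
qed

text \<open>Applying the parity automorphism to x beforehand cancels the one in the Leibniz
  rule.\<close>

lemma gca_diff_cycle_mult: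
 assumes "gca_diff \<delta> x = 0"
 shows "x * gca_diff \<delta> a = gca_diff \<delta> (gi x * a)" "gca_diff \<delta> a * x = gca_diff \<delta> (a * x)"
 using assms by (simp_all add: gca_diff_mult gca_diff_gi gi_gi glin_0[OF glin_gi])

lemma hdga_galg: "subdga C \<delta> ==> hdga (galg C \<delta>)"
proof -
 assume s: "subdga C \<delta>"
 note D = subdgaD[OF s]
 show ?thesis
 proof
 show "bgdga.diff (galg C \<delta>) (x * y) = 0" if "bgdga.diff (galg C \<delta>) x = 0" "bgdga.diff (galg C \<delta>) y = 0" for x y
 using that by (simp add: galg_def gca_diff_mult)
 show "x * bgdga.diff (galg C \<delta>) a : bgdga.diff (galg C \<delta>) ` carrier (galg C \<delta>)"
 "bgdga.diff (galg C \<delta>) a * x : bgdga.diff (galg C \<delta>) ` carrier (galg C \<delta>)"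
 if "x : carrier (galg C \<delta>)" "bgdga.diff (galg C \<delta>) x = 0" "a : carrier (galg C \<delta>)" for x a
 proof -
 have x: "x : C" "gca_diff \<delta> x = 0" "a : C" using that by (simp_all add: galg_def)
 have "gi x * a : C" "a * x : C" by (rule D(3)[OF D(5)[OF x(1)] x(3)], rule D(3)[OF x(3,1)])
 then show "x * bgdga.diff (galg C \<delta>) a : bgdga.diff (galg C \<delta>) ` carrier (galg C \<delta>)"
 "bgdga.diff (galg C \<delta>) a * x : bgdga.diff (galg C \<delta>) ` carrier (galg C \<delta>)"
 using gca_diff_cycle_mult[OF x(2), of a] by (auto simp: galg_def)
 qed
 qed (simp_all add: galg_def D gca_smult_eq distrib_left glin_add[OF glin_gd] glin_cs[OF glin_gd]
 gca_diff_1 gca_diff_diff)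
qed

lemma gw_bidegree:
 fixes L :: "('v, 'o::linorder, 'k::field_char_0) gca => ('u, 'p::linorder, 'k) gca"
 assumes "ghom L" "!!a. L (gl a) : gsp (%M. nev M = nev {#a#} & nod M = nod {#a#})"
 shows "L (gw u) : gsp (%M. nev M = nev (mset u) & nod M = nod (mset u))"
proof (induction u)
 case Nil
 show ?case unfolding gw_simps ghom_1[OF assms(1)] by (rule gsp_1) simp
next
 case (Cons a u)
 show ?case unfolding gw_simps ghom_mult[OF assms(1)] by (rule gsp_mult[OF assms(2) Cons]) simp
qed

lemma cmp_ghom:
 fixes L :: "('v, 'o::linorder, 'k::field_char_0) gca => ('u, 'p::linorder, 'k) gca"
 assumes L: "ghom L" "!!a. L (gl a) : gsp (%M. nev M = nev {#a#} & nod M = nod {#a#})"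
 shows "cmp i w (L f) = L (cmp i w f)"
proof (rule glin_eqI[OF glin_comp[OF glin_gf ghom_glin[OF L(1)]] glin_comp[OF ghom_glin[OF L(1)] glin_gf]])
 fix u :: "('v + 'o) list"
 note g = gw_bidegree[OF L, of u]
 show "cmp i w (L (gw u)) = L (cmp i w (gw u))"
 proof (cases "nod (mset u) = i & wt (mset u) = w")
 case True
 have "cmp i w (L (gw u)) = L (gw u)" by (rule gfilter_eq_self[OF g]) (use True in auto)
 then show ?thesis unfolding gfilter_gw if_P[OF True] .
 next
 case False
 have "cmp i w (L (gw u)) = 0" by (rule gfilter_eq_0[OF g]) (use False in auto)
 then show ?thesis unfolding gfilter_gw if_not_P[OF False] glin_0[OF ghom_glin[OF L(1)]] .
 qed
qed

lemma gi_ghom: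
 fixes L :: "('v, 'o::linorder, 'k::field_char_0) gca => ('u, 'p::linorder, 'k) gca"
 shows "ghom L ==> (!!a. L (gi (gl a)) = gi (L (gl a))) ==> gi (L f) = L (gi f)"
 by (rule ghom_eqI[OF ghom_comp[OF ghom_gi] ghom_comp[OF _ ghom_gi]]) simp_all

lemma gi_gsp: "f : gsp Q ==> gi f : gsp Q"
proof (erule glin_maps_gsp[OF glin_gi])
 fix w :: "('a + 'b) list" assume "Q (mset w)"
 moreover have "gi (gw w) = (gw w :: ('a, 'b, 'c) gca) \<or> gi (gw w) = (- gw w :: ('a, 'b, 'c) gca)"
 proof (induction w)
 case (Cons a w)
 then show ?case by (elim disjE; cases "isl a"; simp add: ghom_mult[OF ghom_gi] gi_gl)
 qed (simp add: ghom_1[OF ghom_gi])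
 moreover have "cs (- 1) * gw w : (gsp Q :: ('a, 'b, 'c) gca set)" by (intro gsp_cs gsp_gw) fact
 then have "- gw w : (gsp Q :: ('a, 'b, 'c) gca set)" by (simp add: cs_uminus)
 moreover have "gw w : (gsp Q :: ('a, 'b, 'c) gca set)" by (rule gsp_gw) fact
 ultimately show "gi (gw w) : (gsp Q :: ('a, 'b, 'c) gca set)" by (elim disjE) (simp_all only:)
qed

lemma gl_bideg: "isl b = isl a ==> gl b : gsp (%M. nev M = nev {#a#} & nod M = nod {#a#})" by (rule gl_gsp) simp

lemma cmp_gsp: "f : gsp Q ==> cmp i w f : gsp Q" by (rule gsp_mono[OF gfilter_gsp]) auto

section \<open>The GL-invariants as a DG algebra of words\<close>

lemma below_gca_on: "gca_on (xy_vars ({..<n} \<times> {..<n})) ({..<n} \<times> {..<n}) = gsp (below n)"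
proof -
 have "l : Inl ` xy_vars ({..<n} \<times> {..<n}) \<union> Inr ` ({..<n} \<times> {..<n}) \<longleftrightarrow> rw l < n & cl l < n" for l
 by (cases l rule: kd.cases) (auto simp: xy_vars_def)
 then have "set_mset M \<subseteq> Inl ` xy_vars ({..<n} \<times> {..<n}) \<union> Inr ` ({..<n} \<times> {..<n}) \<longleftrightarrow> idxs M \<subseteq> {..<n}" for M
 unfolding idxs_def by blast
 then show ?thesis unfolding gca_on_eq by simp
qed

definition CD :: "nat => 'k::field_char_0 mat_gca set" where
 "CD n = gsp (below n) \<inter> GL_invariants n"

lemma DRep_GL_eq: "DRep_GL n = galg (CD n) (DRep_diff n)"
 unfolding DRep_GL_def restrict_to_def DRep_def free_bgdga_def galg_def CD_def below_gca_on[symmetric]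
 by (auto simp: fun_eq_iff)

lemma subdga_D: "subdga (CD n) (DRep_diff n :: _ => (_, 'k::field_char_0) mpoly)"
proof -
 have bid: "conj_act n g h (gl a) : (gsp (%M. nev M = nev {#a#} & nod M = nod {#a#}) :: 'k mat_gca set)" for g h a
 unfolding conj_act_gl cj_def by (intro gsp_sum gsp_cs gl_bideg) (simp add: isl_kd)
 have gi: "gi (conj_act n g h f) = conj_act n g h (gi (f :: 'k mat_gca))" for g h f by (rule gi_ghom[OF ghom_ca])
 (simp add: gi_gl conj_act_gl cj_def glin_sum[OF glin_gi] glin_cs[OF glin_gi] glin_uminus[OF glin_ca] isl_mk isl_kd sum_negf)
 show ?thesis unfolding subdga_def CD_def
 proof (intro conjI ballI allI IntI)
 show "(1 :: 'k mat_gca) : gsp (below n)" by (rule gsp_1) simp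
 show "(1 :: 'k mat_gca) : GL_invariants n" by (simp add: GL_invariants_def ghom_1[OF ghom_ca])
 next
 fix x y :: "'k mat_gca" assume xy: "x : gsp (below n) \<inter> GL_invariants n" "y : gsp (below n) \<inter> GL_invariants n"
 show "x + y : gsp (below n)" using xy by (auto intro: gsp_add)
 show "x * y : gsp (below n)" by (rule gsp_mult[of x "below n" y "below n"]) (use xy in auto)
 show "x + y : GL_invariants n" "x * y : GL_invariants n"
 using xy by (auto simp: GL_add GL_invariants_def ghom_mult[OF ghom_ca] glin_add[OF glin_ca])
 next
 fix x :: "'k mat_gca" assume "x : gsp (below n) \<inter> GL_invariants n"
 then have x: "x : gsp (below n)" "x : GL_invariants n" by simp_all
 show "cs c * x : gsp (below n)" "cs c * x : GL_invariants n" for c using x by (auto intro: gsp_cs GL_cs)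
 show "gi x : gsp (below n)" by (rule gi_gsp[OF x(1)])
 show "gi x : GL_invariants n" using x(2) by (simp add: GL_invariants_def gi[symmetric])
 show "dD n x : gsp (below n)" "dD n x : GL_invariants n" using x by (auto intro: dD_below GL_dD)
 show "cmp i w x : gsp (below n)" for i w by (rule cmp_gsp[OF x(1)])
 show "cmp i w x : GL_invariants n" for i w using x(2) by (simp add: GL_invariants_def cmp_ghom[OF ghom_ca bid, symmetric])
 qed
qed

text \<open>The diagonal algebra is embedded into the matrix algebra by doubling indices;
  \<open>ud\<close> is defined on all letters and inverts \<open>dl\<close> on the diagonal
  ones.\<close>

fun dl :: "nat xy + nat => letter" where
 "dl (Inl (X p)) = Inl (X (p, p))" | "dl (Inl (Y p)) = Inl (Y (p, p))" | "dl (Inr p) = Inr (p, p)"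

fun ud :: "letter => nat xy + nat" where
 "ud (Inl (X i)) = Inl (X (fst i))" | "ud (Inl (Y i)) = Inl (Y (fst i))" | "ud (Inr i) = Inr (fst i)"

lemma ud_dl [simp]: "ud (dl a) = a" and isdiag_dl [simp]: "isdiag (dl a)" and isl_dl [simp]: "isl (dl a) = isl a"
 by (cases a rule: dl.cases; simp add: isdiag_def)+

lemma dl_ud: "isdiag l ==> dl (ud l) = l" and isl_ud [simp]: "isl (ud l) = isl l"
 by (cases l rule: kd.cases; auto simp: isdiag_def)+

definition io :: "'k::field_char_0 diag_gca => 'k mat_gca" where "io = lmap dl"

lemma ghom_io: "ghom io" unfolding io_def by (rule ghom_lmap) simp
lemma io_gw: "io (gw w) = gw (map dl w)" unfolding io_def by (rule lmap_gw) simp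
lemma io_gl: "io (gl a) = gl (dl a)" using io_gw[of "[a]"] by simp
lemmas glin_io = ghom_glin[OF ghom_io]

lemma deg1_zero: "0 : deg1" by (simp add: deg1_def)

lemma hc_anticomm: "anticomm (%(i, j). if i = j then theta i else 0 :: 'k::field_char_0 diag_gca)"
 by (rule anticommI) (auto simp: deg1_zero split: prod.split)

lemma ghom_hc: "ghom harish_chandra" unfolding harish_chandra_def by (rule ghom_gca_hom[OF hc_anticomm])

lemma hc_gl: "harish_chandra (gl a) = (if isdiag a then gl (ud a) else 0)"
 unfolding harish_chandra_def gca_hom_gl[OF hc_anticomm]
 by (cases a rule: kd.cases) (auto simp: isdiag_def gl_def hl_def pconst_def[symmetric] gca_poly_0 split: prod.split)

lemmas glin_hc = ghom_glin[OF ghom_hc]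

lemma perm_anticomm: "anticomm (%i. theta ((\<pi> :: nat => nat) i) :: 'k::field_char_0 diag_gca)" by (rule anticommI) simp

lemma ghom_perm: "ghom (perm_act \<pi>)" unfolding perm_act_def by (rule ghom_gca_hom[OF perm_anticomm])

lemma perm_gl: "perm_act \<pi> (gl a) = gl (ud (rl \<pi> (dl a)))" unfolding perm_act_def gca_hom_gl[OF perm_anticomm]
 by (cases a rule: dl.cases) (auto simp: gl_def rl_def)

lemma dt_anticomm: "anticomm (%i. if i = n then 0 else theta i :: 'k::field_char_0 diag_gca)"
 by (rule anticommI) (simp add: deg1_zero)

lemma ghom_dt: "ghom (Diag_trans n)" unfolding Diag_trans_def by (rule ghom_gca_hom[OF dt_anticomm])

lemma dt_gl: "Diag_trans n (gl a) = (if rw (dl a) = n then 0 else gl a)" unfolding Diag_trans_def gca_hom_gl[OF dt_anticomm]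
 by (cases a rule: dl.cases) (auto simp: gl_def gca_poly_0)

lemma mt_anticomm: "anticomm (%(i, j). if i = n \<or> j = n then 0 else theta (i, j) :: 'k::field_char_0 mat_gca)"
 by (rule anticommI) (auto simp: deg1_zero split: prod.split)

lemma ghom_mt: "ghom (DRep_trans n)" unfolding DRep_trans_def by (rule ghom_gca_hom[OF mt_anticomm])

lemma mt_gl: "DRep_trans n (gl a) = (if rw a = n \<or> cl a = n then 0 else gl a)"
 unfolding DRep_trans_def gca_hom_gl[OF mt_anticomm]
 by (cases a rule: kd.cases) (auto simp: gl_def gca_poly_0 split: prod.split)

lemma mt_eq: "DRep_trans n f = gfilter (%M. n ~: idxs M) f"
proof (rule glin_eqI[OF ghom_glin[OF ghom_mt] glin_gf])
 fix w :: "letter list"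
 show "DRep_trans n (gw w) = gfilter (%M. n ~: idxs M) (gw w :: 'a mat_gca)"
 unfolding gfilter_gw by (induction w) (auto simp: ghom_1[OF ghom_mt] ghom_mult[OF ghom_mt] mt_gl)
qed

lemma hc_io: "harish_chandra (io y) = y" by (rule ghom_eqI[OF ghom_comp[OF ghom_hc ghom_io] ghom_id]) (simp add: io_gl hc_gl)

lemma io_hc: "io (harish_chandra f) = Dg f"
proof (rule ghom_eqI[OF ghom_comp[OF ghom_io ghom_hc] ghom_Dg])
 fix a :: letter
 show "io (harish_chandra (gl a)) = Dg (gl a :: 'a mat_gca)"
 using Dg_gw[of "[a]"] by (cases "isdiag a") (simp_all add: hc_gl io_gl dl_ud glin_0[OF glin_io])
qed

lemma io_perm: "io (perm_act \<pi> y) = relabel \<pi> (io y)"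
 by (rule ghom_eqI[OF ghom_comp[OF ghom_io ghom_perm] ghom_comp[OF ghom_rlb ghom_io]])
 (simp add: io_gl perm_gl relabel_gl dl_ud isdiag_def[of "rl \<pi> _"] isdiag_dl[unfolded isdiag_def])

lemma hc_relabel:
 assumes "inj \<pi>"
 shows "harish_chandra (relabel \<pi> f) = perm_act \<pi> (harish_chandra f)"
proof (rule ghom_eqI[OF ghom_comp[OF ghom_hc ghom_rlb] ghom_comp[OF ghom_perm ghom_hc]])
 fix a :: letter
 have "isdiag (rl \<pi> a) \<longleftrightarrow> isdiag a" using assms by (simp add: isdiag_def inj_eq)
 then show "harish_chandra (relabel \<pi> (gl a)) = perm_act \<pi> (harish_chandra (gl a :: 'a mat_gca))"
 by (simp add: relabel_gl hc_gl perm_gl dl_ud glin_0[OF ghom_glin[OF ghom_perm]])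
qed

lemma io_dt: "io (Diag_trans n y) = DRep_trans n (io y)"
 by (rule ghom_eqI[OF ghom_comp[OF ghom_io ghom_dt] ghom_comp[OF ghom_mt ghom_io]])
 (use isdiag_dl in \<open>simp add: io_gl dt_gl mt_gl glin_0[OF glin_io] isdiag_def\<close>)

lemma hc_mt: "harish_chandra (DRep_trans n f) = Diag_trans n (harish_chandra f)"
proof (rule ghom_eqI[OF ghom_comp[OF ghom_hc ghom_mt] ghom_comp[OF ghom_dt ghom_hc]])
 fix a :: letter
 show "harish_chandra (DRep_trans n (gl a)) = Diag_trans n (harish_chandra (gl a :: 'a mat_gca))"
 proof (cases "isdiag a")
 case True
 then have "dl (ud a) = a" "cl a = rw a" by (simp_all add: dl_ud isdiag_def)
 then show ?thesis using True by (simp add: mt_gl hc_gl dt_gl glin_0[OF glin_hc])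
 qed (simp add: mt_gl hc_gl glin_0[OF glin_hc] glin_0[OF ghom_glin[OF ghom_dt]])
qed

lemma hc_bid: "harish_chandra (gl a) : gsp (%M. nev M = nev {#a#} & nod M = nod {#a#})"
proof (cases "isdiag a")
 case True
 show ?thesis unfolding hc_gl if_P[OF True] by (rule gl_bideg) simp
qed (simp add: hc_gl)

lemma io_bid: "io (gl a) : gsp (%M. nev M = nev {#a#} & nod M = nod {#a#})" unfolding io_gl by (rule gl_bideg) simp

lemmas cmp_hc = cmp_ghom[OF ghom_hc hc_bid]
lemmas cmp_io = cmp_ghom[OF ghom_io io_bid]

lemma cmp_self_iff: "f : gca_bihomogeneous i w \<longleftrightarrow> cmp i w f = f"
 unfolding gca_bihomogeneous_eq gsp_def by simp

section \<open>The symmetric invariants and the comparison map\<close>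

abbreviation dbelow :: "nat => (nat xy + nat) multiset => bool" where
 "dbelow n M \<equiv> idxs (image_mset dl M) \<subseteq> {..<n}"

lemma dbelow_gca_on: "gca_on (xy_vars {..<n}) {..<n} = gsp (dbelow n)"
proof -
 have "a : Inl ` xy_vars {..<n} \<union> Inr ` {..<n} \<longleftrightarrow> rw (dl a) < n & cl (dl a) < n" for a
 by (cases a rule: dl.cases) (auto simp: xy_vars_def)
 then have "set_mset M \<subseteq> Inl ` xy_vars {..<n} \<union> Inr ` {..<n} \<longleftrightarrow> dbelow n M" for M
 unfolding idxs_def set_image_mset by blast
 then show ?thesis unfolding gca_on_eq by simp
qed

definition CS :: "nat => 'k::field_char_0 diag_gca set" where
 "CS n = gsp (dbelow n) \<inter> S_invariants n"

lemma Diag_S_eq: "Diag_S n = galg (CS n) (%_. 0)"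
 unfolding Diag_S_def restrict_to_def free_bgdga_def galg_def CS_def dbelow_gca_on[symmetric] by (auto simp: fun_eq_iff)

lemma gca_diff_zero: "gca_diff (%_. 0) f = 0" by (simp add: gca_diff_def gca_poly_0)

lemma subdga_S: "subdga (CS n) (%_. 0 :: (_, 'k::field_char_0) mpoly)"
proof -
 have bid: "perm_act \<pi> (gl a) : (gsp (%M. nev M = nev {#a#} & nod M = nod {#a#}) :: 'k diag_gca set)" for \<pi> a
 unfolding perm_gl by (rule gl_bideg) simp
 have gi: "gi (perm_act \<pi> f) = perm_act \<pi> (gi (f :: 'k diag_gca))" for \<pi> f
 by (rule gi_ghom[OF ghom_perm]) (simp add: gi_gl perm_gl glin_uminus[OF ghom_glin[OF ghom_perm]])
 show ?thesis unfolding subdga_def CS_def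
 proof (intro conjI ballI allI IntI)
 show "(1 :: 'k diag_gca) : gsp (dbelow n)" by (rule gsp_1) simp
 show "(1 :: 'k diag_gca) : S_invariants n" by (simp add: S_invariants_def ghom_1[OF ghom_perm])
 next
 fix x y :: "'k diag_gca" assume xy: "x : gsp (dbelow n) \<inter> S_invariants n" "y : gsp (dbelow n) \<inter> S_invariants n"
 show "x + y : gsp (dbelow n)" using xy by (auto intro: gsp_add)
 show "x * y : gsp (dbelow n)" by (rule gsp_mult[of x "dbelow n" y "dbelow n"]) (use xy in auto)
 show "x + y : S_invariants n" "x * y : S_invariants n"
 using xy by (auto simp: S_invariants_def ghom_mult[OF ghom_perm] glin_add[OF ghom_glin[OF ghom_perm]])
 next
 fix x :: "'k diag_gca" assume "x : gsp (dbelow n) \<inter> S_invariants n"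
 then have x: "x : gsp (dbelow n)" "x : S_invariants n" by simp_all
 show "cs c * x : gsp (dbelow n)" "cs c * x : S_invariants n" for c
 using x by (auto intro: gsp_cs simp: S_invariants_def glin_cs[OF ghom_glin[OF ghom_perm]])
 show "gi x : gsp (dbelow n)" by (rule gi_gsp[OF x(1)])
 show "gi x : S_invariants n" using x(2) by (simp add: S_invariants_def gi[symmetric])
 show "gca_diff (%_. 0) x : gsp (dbelow n)" "gca_diff (%_. 0) x : S_invariants n"
 by (simp_all add: gca_diff_zero S_invariants_def glin_0[OF ghom_glin[OF ghom_perm]])
 show "cmp i w x : gsp (dbelow n)" for i w by (rule cmp_gsp[OF x(1)])
 show "cmp i w x : S_invariants n" for i w using x(2) by (simp add: S_invariants_def cmp_ghom[OF ghom_perm bid, symmetric])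
 qed
qed

text \<open>Conjugation by a permutation matrix is a relabelling of the indices.\<close>

lemma GL_relabel:
 assumes f: "f : GL_invariants n" "f : gsp (below n)" and \<pi>: "\<pi> permutes {..<n}"
 shows "relabel \<pi> f = (f :: 'k::field_char_0 mat_gca)"
proof -
 let ?g = "mat n n (%(i, k). if k = \<pi> i then 1 else 0) :: 'k mat"
 let ?h = "mat n n (%(l, j). if l = \<pi> j then 1 else 0) :: 'k mat"
 have lt: "\<pi> i < n" if "i < n" for i using permutes_in_image[OF \<pi>, of i] that by simp
 have inj: "\<pi> i = \<pi> j \<longleftrightarrow> i = j" for i j using permutes_inj[OF \<pi>] by (simp add: inj_eq)
 have ite: "(if Q then 1 else 0) * q = (if Q then q else 0)" for Q and q :: 'k by simp
 have gh: "?g * ?h = 1\<^sub>m n" by (rule eq_matI) (auto simp: scalar_prod_def ite lt inj sum.delta)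
 have hg: "?h * ?g = 1\<^sub>m n"
 proof (rule mat_mult_left_right_inverse[OF _ _ gh]) qed simp_all
 have "conj_act n ?g ?h f = f" using f(1) gh hg unfolding GL_invariants_def by (simp add: inverts_mat_def)
 moreover have "conj_act n ?g ?h f = relabel \<pi> f"
 proof (rule ghom_eq_on_idxs[OF ghom_ca ghom_rlb f(2)])
 fix a assume a: "rw a : {..<n}" "cl a : {..<n}"
 have "conj_act n ?g ?h (gl a) = (\<Sum>k<n. \<Sum>l<n. if k = \<pi> (rw a) then if l = \<pi> (cl a) then gl (mk (kd a) k l) else 0 else (0 :: 'k mat_gca))"
 unfolding conj_act_gl cj_def using a by (intro sum.cong refl) simp
 also have "... = (\<Sum>k<n. if k = \<pi> (rw a) then \<Sum>l<n. if l = \<pi> (cl a) then gl (mk (kd a) k l) else 0 else 0)"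
 by (intro sum.cong refl) simp
 also have "... = gl (mk (kd a) (\<pi> (rw a)) (\<pi> (cl a)))" using a lt by (simp add: sum.delta)
 finally show "conj_act n ?g ?h (gl a) = relabel \<pi> (gl a :: 'k mat_gca)" by (simp add: relabel_gl rl_def)
 qed
 ultimately show ?thesis by simp
qed

lemma hc_gw: "harish_chandra (gw w) = (if \<forall>l\<in>set w. isdiag l then gw (map ud w) else 0)"
 by (induction w) (auto simp: ghom_1[OF ghom_hc] ghom_mult[OF ghom_hc] hc_gl)

lemma hc_below:
 assumes "f : gsp (below n)"
 shows "harish_chandra f : gsp (dbelow n)"
proof (rule glin_maps_gsp[OF glin_hc assms])
 fix w assume w: "idxs (mset w) \<subseteq> {..<n}"
 have e: "image_mset dl (mset (map ud w)) = mset w" if "\<forall>l\<in>set w. isdiag l" using that by (induction w) (auto simp: dl_ud)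
 show "harish_chandra (gw w) : gsp (dbelow n)"
 proof (cases "\<forall>l\<in>set w. isdiag l")
 case True
 show ?thesis unfolding hc_gw if_P[OF True] by (rule gsp_gw) (use w in \<open>simp only: e[OF True]\<close>)
 next
 case False
 show ?thesis unfolding hc_gw if_not_P[OF False] by simp
 qed
qed

lemma hc_CD: "f : CD n ==> harish_chandra f : CS n"
proof -
 assume f: "f : CD n"
 have "harish_chandra f : gsp (dbelow n)" by (rule hc_below) (use f in \<open>simp add: CD_def\<close>)
 moreover have "perm_act \<pi> (harish_chandra f) = harish_chandra f" if "\<pi> permutes {..<n}" for \<pi>
 using hc_relabel[OF permutes_inj[OF that], of f] GL_relabel[OF _ _ that, of f] f by (simp add: CD_def)
 ultimately show ?thesis by (simp add: CS_def S_invariants_def)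
qed

lemma hc_dD: "f : gsp (below n) ==> harish_chandra (dD n f) = 0"
 using hc_io[of "harish_chandra (dD n f)"] by (simp add: io_hc Dg_dD glin_0[OF glin_hc])

lemma io_CS:
 assumes y: "y : CS n"
 shows "io y : gsp (%M. (\<forall>l\<in>#M. isdiag l) & below n M)" "\<pi> permutes {..<n} ==> relabel \<pi> (io y) = io y"
proof -
 show "io y : gsp (%M. (\<forall>l\<in>#M. isdiag l) & below n M)"
 proof (rule glin_maps_gsp[OF glin_io])
 show "y : gsp (dbelow n)" using y by (simp add: CS_def)
 fix w assume w: "dbelow n (mset w)"
 show "io (gw w) : gsp (%M. (\<forall>l\<in>#M. isdiag l) & below n M)" unfolding io_gw by (rule gsp_gw) (use w in auto)
 qed
 show "\<pi> permutes {..<n} ==> relabel \<pi> (io y) = io y"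
 using y io_perm[of \<pi> y] by (simp add: CS_def S_invariants_def)
qed

theorem hc_surjective:
 assumes y: "y : CS n" "y : gca_bihomogeneous i w"
 shows "EX u. u : CD n & u : gca_bihomogeneous i w & dD n u = 0 & harish_chandra u = (y :: 'k::field_char_0 diag_gca)"
proof -
 obtain v where v: "v : GL_invariants n" "v : gsp (below n)" "dD n v = 0" "Dg v = io y"
 using Dg_surjective[OF io_CS[OF y(1)]] by blast
 \<comment> \<open>The preimage need not be bihomogeneous. Its part in bidegree (i, w) is still an
   invariant cycle and has the same image, because y is bihomogeneous.\<close>
 let ?u = "cmp i w v"
 have "v : CD n" using v by (simp add: CD_def)
 then have "?u : CD n" by (rule subdgaD(7)[OF subdga_D])
 moreover have "?u : gca_bihomogeneous i w" unfolding gca_bihomogeneous_eq by (rule gfilter_in_gsp)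
 moreover have "dD n ?u = 0"
 proof (cases i)
 case 0
 have "dD n ?u : gsp (%M. Suc (nod M) = i & wt M = w)" by (rule dD_bidegree[OF gfilter_in_gsp])
 then show ?thesis using 0 gfilter_eq_0[of "dD n ?u" "%_. False" "%_. False"] by (simp add: gsp_def)
 next
 case (Suc j)
 then show ?thesis using dD_gfilter[of j w n v] v(3) by (simp add: glin_0[OF glin_gf])
 qed
 moreover have "harish_chandra v = y" using hc_io[of "harish_chandra v"] unfolding io_hc v(4) hc_io by simp
 then have "harish_chandra ?u = y" using y(2) unfolding cmp_hc[symmetric] cmp_self_iff by simp
 ultimately show ?thesis by blast
qed

section \<open>Stability in \<open>n\<close>\<close>

lemma mt_bid: "DRep_trans n (gl a) : gsp (%M. nev M = nev {#a#} & nod M = nod {#a#})"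
 unfolding mt_gl by (simp add: gl_bideg[of a a, simplified])

lemma dt_bid: "Diag_trans n (gl a) : gsp (%M. nev M = nev {#a#} & nod M = nod {#a#})"
 unfolding dt_gl by (simp add: gl_bideg[of a a, simplified])

lemmas cmp_mt = cmp_ghom[OF ghom_mt mt_bid]
lemmas cmp_dt = cmp_ghom[OF ghom_dt dt_bid]

lemma gi_mt: "gi (DRep_trans n f) = DRep_trans n (gi f)"
 by (rule gi_ghom[OF ghom_mt]) (simp add: gi_gl mt_gl glin_uminus[OF ghom_glin[OF ghom_mt]] glin_0[OF glin_gi])

lemma gi_dt: "gi (Diag_trans n f) = Diag_trans n (gi f)"
 by (rule gi_ghom[OF ghom_dt]) (simp add: gi_gl dt_gl glin_uminus[OF ghom_glin[OF ghom_dt]] glin_0[OF glin_gi])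

definition ext :: "nat => 'k::field_char_0 mat => nat => nat => 'k" where
 "ext n A i j = (if i < n & j < n then A $$ (i, j) else if i = j then 1 else 0)"

text \<open>The summand with middle index n in the differential of level n + 1 is killed by the
  transition map.\<close>

lemma mt_dD:
 assumes "f : gsp (below (Suc n))"
 shows "DRep_trans n (dD (Suc n) f) = dD n (DRep_trans n (f :: 'k::field_char_0 mat_gca))"
proof (rule glin_on_gsp[OF glin_comp[OF ghom_glin[OF ghom_mt] glin_gd] glin_comp[OF glin_gd ghom_glin[OF ghom_mt]] assms])
 fix w assume "idxs (mset w) \<subseteq> {..<Suc n}"
 show "DRep_trans n (dD (Suc n) (gw w)) = dD n (DRep_trans n (gw w :: 'k mat_gca))"
 proof (rule chain_map[OF ghom_mt _ _ subset_UNIV])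
 fix a :: letter
 show "DRep_trans n (gi (gl a)) = gi (DRep_trans n (gl a :: 'k mat_gca))" by (rule gi_mt[symmetric])
 show "DRep_trans n (dval (DRep_diff (Suc n)) a) = dD n (DRep_trans n (gl a :: 'k mat_gca))"
 proof (cases "kd a = KT")
 case True
 have "DRep_trans n (dval (DRep_diff (Suc n)) a) = (\<Sum>l<Suc n.
 DRep_trans n (gl (mk KX (rw a) l)) * DRep_trans n (gl (mk KY l (cl a))) -
 DRep_trans n (gl (mk KY (rw a) l)) * DRep_trans n (gl (mk KX l (cl a))) :: 'k mat_gca)"
 unfolding dval_DRep if_P[OF True] glin_sum[OF ghom_glin[OF ghom_mt]] glin_diff[OF ghom_glin[OF ghom_mt]] ghom_mult[OF ghom_mt] ..
 also have "... = (\<Sum>l<n. if rw a = n \<or> cl a = n then 0 else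
 gl (mk KX (rw a) l) * gl (mk KY l (cl a)) - gl (mk KY (rw a) l) * gl (mk KX l (cl a)))"
 unfolding sum.lessThan_Suc mt_gl mk_simps by (simp del: mk.simps) (intro sum.cong refl, auto simp del: mk.simps)
 also have "... = dD n (DRep_trans n (gl a))"
 unfolding mt_gl using True by (auto simp: glin_0[OF glin_gd] gca_diff_gl dval_DRep simp del: mk.simps)
 finally show ?thesis .
 qed (simp add: dval_DRep mt_gl gca_diff_gl glin_0[OF ghom_glin[OF ghom_mt]] glin_0[OF glin_gd])
 qed
qed

lemma size_nev_nod: "size M = nev M + nod M" by (induction M) auto

lemma nev_nod_rl: "nev (mset (map (rl i) u)) = nev (mset u)" "nod (mset (map (rl i) u)) = nod (mset u)"
 by (induction u) simp_all

text \<open>The multilinear part uses the indices below s only, so with s <= n it is untouched when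
  the variables with index n are set to 0; by \<open>stable_fft\<close> it determines x.\<close>

lemma kill_inj_D:
 assumes x: "x : CD (Suc n)" "x : gsp (%M. size M = s)" "s <= n" "DRep_trans n x = 0"
 shows "x = 0"
proof -
 have xb: "x : gsp (%M. below (Suc n) M & size M = s)" by (rule gsp_conj) (use x in \<open>simp_all add: CD_def\<close>)
 have xG: "x : GL_invariants (Suc n)" using x by (simp add: CD_def)
 have d: "dist_part s x : gsp (dist {..<s})" by (rule dist_part_dist[OF xG xb]) (use x(3) in simp)
 have "dist_part s x = gfilter (%M. n ~: idxs M) (dist_part s x)"
 by (rule gfilter_eq_self[OF d, symmetric]) (use x(3) in \<open>auto dest: dist_idxs\<close>)
 also have "... = dist_part s (gfilter (%M. n ~: idxs M) x)"
 unfolding dist_part_def gfilter_gfilter by (simp only: conj_commute)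
 also have "... = 0" using x(4) unfolding mt_eq dist_part_def by (simp add: glin_0[OF glin_gf])
 finally have "dist_part s x = 0" .
 then show ?thesis using stable_fft[OF xG xb] x(3) by (simp add: glin_0[OF glin_rsum])
qed

text \<open>A monomial of bidegree (i, w) has w - i letters, hence at most n different indices. By
  symmetry its index set can be moved to an initial segment, which avoids the index n, and there the
  transition map changes nothing.\<close>

lemma kill_inj_S:
 assumes y: "y : CS (Suc n)" "y : gsp (%M. nod M = i & wt M = w)" "w - i <= n" "Diag_trans n y = 0"
 shows "y = 0"
proof -
 let ?x = "io y"
 have iy: "?x : gsp (below (Suc n))" by (rule gsp_mono[OF io_CS(1)[OF y(1)]]) simp
 have D: "?x : gsp (%M. \<forall>l\<in>#M. isdiag l)" by (rule gsp_mono[OF io_CS(1)[OF y(1)]]) simp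
 have "cmp i w ?x = ?x" using y(2) unfolding cmp_io gsp_def by simp
 then have B: "?x : gsp (%M. nod M = i & wt M = w)" by (simp add: gsp_def)
 have sm: "?x : gsp (%M. below (Suc n) M & (\<forall>l\<in>#M. isdiag l) & nod M = i & wt M = w)" by (intro gsp_conj iy D B)
 have card: "?x : gsp (%M. idxs M : Pow {..<Suc n} & card (idxs M) <= n)"
 proof (rule gsp_mono[OF sm])
 fix M assume M: "below (Suc n) M & (\<forall>l\<in>#M. isdiag l) & nod M = i & wt M = w"
 have "cl ` set_mset M = rw ` set_mset M" using M by (intro image_cong refl) (simp add: isdiag_def)
 then have "idxs M = rw ` set_mset M" by (simp add: idxs_def)
 then have "card (idxs M) <= card (set_mset M)" by (simp add: card_image_le)
 also have "... <= size M"
 proof -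
 have "(\<Sum>x\<in>set_mset M. 1) <= (\<Sum>x\<in>set_mset M. count M x)" by (rule sum_mono) (simp add: Suc_le_eq)
 then show ?thesis by (simp add: size_multiset_overloaded_eq)
 qed
 also have "... <= n" using M y(3) size_nev_nod[of M] by linarith
 finally show "idxs M : Pow {..<Suc n} & card (idxs M) <= n" using M by simp
 qed
 have k: "gfilter (%M. n ~: idxs M) ?x = 0" using io_dt[of n y] y(4) by (simp add: mt_eq glin_0[OF glin_io])
 have z: "gfilter (%M. idxs M = Q) ?x = 0" if Q: "Q : Pow {..<Suc n}" for Q
 proof (cases "card Q <= n")
 case False
 show ?thesis by (rule gfilter_eq_0[OF card]) (use False in auto)
 next
 case True
 have low: "gfilter (%M. idxs M = {..<card Q}) ?x = 0"
 proof -
 have e: "idxs M = {..<card Q} & n ~: idxs M \<longleftrightarrow> idxs M = {..<card Q}" for M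
 using True by (cases "idxs M = {..<card Q}") simp_all
 show ?thesis using gfilter_gfilter[of "%M. idxs M = {..<card Q}" "%M. n ~: idxs M" ?x] unfolding e k by (simp add: glin_0[OF glin_gf])
 qed
 from extend_to_permutation[of Q "Suc n" "card Q"] Q obtain \<rho> where \<rho>: "\<rho> permutes {..<Suc n}" "\<rho> ` {..<card Q} = Q" by auto
 show ?thesis using gfilter_relabel[OF permutes_inj[OF \<rho>(1)], of "{..<card Q}" ?x] low
 unfolding \<rho>(2) io_CS(2)[OF y(1) \<rho>(1)] by (simp add: glin_0[OF glin_rlb])
 qed
 have "?x : gsp (%M. idxs M : Pow {..<Suc n})" by (rule gsp_mono[OF card]) simp
 then have "?x = (\<Sum>Q\<in>Pow {..<Suc n}. gfilter (%M. idxs M = Q) ?x)" by (rule gfilter_partition) simp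
 also have "... = 0" by (rule sum.neutral) (use z in blast)
 finally show ?thesis using hc_io[of y] by (simp add: glin_0[OF glin_hc])
qed

text \<open>Setting the variables with index m to 0 leaves the index maps that avoid m, and these
  are the maps into \<open>{..<m}\<close>.\<close>

lemma mt_rsum:
 assumes G: "G : gsp (dist P)" and P: "finite P"
 shows "DRep_trans m (rsum P (Suc m) G) = rsum P m (G :: 'k::field_char_0 mat_gca)"
proof (rule glin_on_gsp[OF glin_comp[OF ghom_glin[OF ghom_mt] glin_rsum] glin_rsum G])
 fix w assume w: "dist P (mset w)"
 have id: "idxs (mset (map (rl i) w)) = i ` P" for i unfolding idxs_mset_map dist_idxs[OF w P] ..
 have "DRep_trans m (rsum P (Suc m) (gw w)) = (\<Sum>i\<in>P \<rightarrow>\<^sub>E {..<Suc m}. if m ~: i ` P then gw (map (rl i) w) else (0 :: 'k mat_gca))"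
 unfolding rsum_gw mt_eq gfilter_sum gfilter_gw id ..
 also have "... = (\<Sum>i\<in>{i : P \<rightarrow>\<^sub>E {..<Suc m}. m ~: i ` P}. gw (map (rl i) w))"
 by (rule sum.inter_filter[symmetric]) (simp add: P)
 also have "{i : P \<rightarrow>\<^sub>E {..<Suc m}. m ~: i ` P} = P \<rightarrow>\<^sub>E {..<m}"
 by (auto simp: PiE_def Pi_def less_Suc_eq)
 finally show "DRep_trans m (rsum P (Suc m) (gw w)) = rsum P m (gw w :: 'k mat_gca)" unfolding rsum_gw .
qed

text \<open>In the stable range u is the contraction of its multilinear part, up to a constant; the
  same multilinear part contracted at every level gives the sequence.\<close>

lemma extend_sequence:
 assumes u: "u : CD n" "u : gca_bihomogeneous i w" "w - i <= n"
 shows "EX z. (ALL m. z m : CD m & z m : gca_bihomogeneous i w & DRep_trans m (z (Suc m)) = z m) & z n = (u :: 'k::field_char_0 mat_gca)"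
proof -
 let ?s = "w - i" and ?Q = "%M. nod M = i & wt M = w"
 have uG: "u : GL_invariants n" "u : gsp (below n)" using u by (simp_all add: CD_def)
 have uQ: "u : gsp ?Q" using u(2) by (simp add: gca_bihomogeneous_eq)
 have ub: "u : gsp (%M. below n M & size M = ?s)"
 proof (rule gsp_conj[OF uG(2)], rule gsp_mono[OF uQ])
 show "size M = ?s" if "?Q M" for M using that size_nev_nod[of M] by linarith
 qed
 define G where "G = cs (inverse (of_nat (card (arr ?s)))) * dist_part ?s u"
 have G: "G : gsp (dist {..<?s})" unfolding G_def by (intro gsp_cs dist_part_dist[OF uG(1) ub u(3)])
 have GQ: "G : gsp ?Q" unfolding G_def dist_part_def by (intro gsp_cs, rule gsp_mono[OF gfilter_gsp[OF uQ]]) simp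
 have Gi: "G : gsp (%M. idxs M \<subseteq> {..<?s})" by (rule gsp_mono[OF G]) (auto dest: dist_idxs)
 have "rsum {..<?s} m G : gsp ?Q" for m
 proof (rule glin_maps_gsp[OF glin_rsum GQ])
 fix v :: "letter list" assume v: "?Q (mset v)"
 show "rsum {..<?s} m (gw v) : gsp ?Q" unfolding rsum_gw by (intro gsp_sum gsp_gw) (unfold nev_nod_rl, rule v)
 qed
 moreover have "rsum {..<?s} m G : CD m" for m unfolding CD_def using rsum_idxs[OF Gi] rsum_GL_invariant[OF G] by simp
 moreover have "DRep_trans m (rsum {..<?s} (Suc m) G) = rsum {..<?s} m G" for m by (rule mt_rsum[OF G]) simp
 moreover have "rsum {..<?s} n G = u" unfolding G_def by (rule stable_fft[OF uG(1) ub u(3), symmetric])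
 ultimately show ?thesis by (intro exI[of _ "%m. rsum {..<?s} m G"]) (simp add: gca_bihomogeneous_eq)
qed

text \<open>Zero at level N passes down by the transition maps and up by their injectivity.\<close>

lemma stable_zero:
 assumes "!!m. T m (c (Suc m)) = c m" "!!m. T m 0 = 0" "c N = 0" "!!m. m \<ge> N ==> T m (c (Suc m)) = 0 ==> c (Suc m) = 0"
 shows "c (m :: nat) = (0 :: 'x::zero)"
proof (cases "m <= N")
 case True
 then show ?thesis
 proof (induction rule: inc_induct)
 case (step k)
 then show ?case using assms(1)[of k] assms(2)[of k] by simp
 qed (rule assms(3))
next
 case False
 then have "N <= m" by simp
 then show ?thesis
 proof (induction rule: dec_induct)
 case (step k)
 then show ?case using assms(1)[of k] assms(4)[of k] by simp
 qed (rule assms(3))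
qed

section \<open>Inverse limits\<close>

lemma sum_fun_apply: "(\<Sum>p\<in>F. s p) m = (\<Sum>p\<in>F. s p m)" for s :: "'p => 'm => 'a::comm_monoid_add"
 by (induction F rule: infinite_finite_induct) (simp_all add: zero_fun_def plus_fun_def)

lemma (in hdga) carrier_sum: "(!!p. p : F ==> s p : carrier A) ==> sum s F : carrier A"
 by (induction F rule: infinite_finite_induct) (auto intro: C(1,3))

text \<open>The common properties of the two towers. Degrees are natural numbers, so the effect of
  the differential on bidegrees is split into \<open>dcmp\<close> and the degree 0 case
  \<open>d0\<close>.\<close>

locale tower =
 fixes C :: "nat => ('v, 'o::linorder, 'k::field_char_0) gca set" and \<delta> :: "nat => 'o => ('v, 'k) mpoly"
 and t :: "nat => ('v, 'o, 'k) gca => ('v, 'o, 'k) gca"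
 assumes sub: "subdga (C m) (\<delta> m)" and ght: "ghom (t m)" and tcmp: "cmp i w (t m x) = t m (cmp i w x)"
 and tgi: "gi (t m x) = t m (gi x)"
 and td: "x : C (Suc m) ==> t m (gca_diff (\<delta> (Suc m)) x) = gca_diff (\<delta> m) (t m x)"
 and dcmp: "cmp i w (gca_diff (\<delta> m) x) = gca_diff (\<delta> m) (cmp (Suc i) w x)"
 and d0: "gca_diff (\<delta> m) (cmp 0 w x) = 0"
begin

lemmas CD' = subdgaD[OF sub]
lemmas glt = ghom_glin[OF ght]

lemma C_sum: "(!!p. p : F ==> s p : C m) ==> sum s F : C m"
 by (induction F rule: infinite_finite_induct) (auto intro: CD'(2,8))

definition IL :: "('k, nat => ('v, 'o, 'k) gca) bgdga" where
 "IL = inverse_limit (%m. galg (C m) (\<delta> m)) t"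

lemma IL_simps:
 "monoid.mult IL = (*)" "monoid.one IL = 1" "ring.zero IL = 0" "ring.add IL = (+)"
 "module.smult IL c f = (%m. cs c * f m)" "bgdga.diff IL f = (%m. gca_diff (\<delta> m) (f m))"
 by (simp_all add: IL_def inverse_limit_def galg_def fun_eq_iff times_fun_def plus_fun_def one_fun_def zero_fun_def gca_smult_eq)

lemma IL_bi: "f : bicomp IL i w \<longleftrightarrow> (ALL m. f m : C m & cmp i w (f m) = f m & t m (f (Suc m)) = f m)"
 by (simp add: IL_def inverse_limit_def lim_bicomp_def galg_def cmp_self_iff conj_assoc)

text \<open>One finite set of bidegrees serves all levels at once; this is the finiteness in a limit
  formed bidegree by bidegree.\<close>

definition bsup :: "(nat \<times> nat) set => (nat => ('v, 'o, 'k) gca) => bool" where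
 "bsup F f \<longleftrightarrow> finite F & (ALL m. f m : gsp (%M. (nod M, wt M) : F))"

lemma bsup_decompose:
 assumes "bsup F f"
 shows "f m = (\<Sum>p\<in>F. cmp (fst p) (snd p) (f m))"
proof -
 have "f m = (\<Sum>p\<in>F. gfilter (%M. (nod M, wt M) = p) (f m))"
 using assms gfilter_partition[of "f m" "%M. (nod M, wt M)" F] by (simp add: bsup_def)
 moreover have "(%M :: ('v + 'o) multiset. (nod M, wt M) = p) = (%M. nod M = fst p & wt M = snd p)" for p
 by (auto simp: fun_eq_iff prod_eq_iff)
 ultimately show ?thesis by simp
qed

lemma cmp_bsup:
 fixes x :: "('v, 'o, 'k) gca"
 shows "cmp i w x = x ==> (i, w) : F ==> x : gsp (%M. (nod M, wt M) : F)"
proof -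
 assume e: "cmp i w x = x" and F: "(i, w) : F"
 have "cmp i w x : gsp (%M. (nod M, wt M) : F)"
 proof (rule gsp_mono[OF gfilter_in_gsp])
 fix M :: "('v + 'o) multiset" assume "nod M = i & wt M = w"
 then have "(nod M, wt M) = (i, w)" unfolding prod.inject .
 then show "(nod M, wt M) : F" using F by (simp only:)
 qed
 then show "x : gsp (%M. (nod M, wt M) : F)" unfolding e .
qed

text \<open>The transition maps commute with the projections to bidegrees, so the bihomogeneous
  parts of a compatible sequence are themselves compatible.\<close>

lemma IL_carrier: "f : carrier IL \<longleftrightarrow> (ALL m. f m : C m & t m (f (Suc m)) = f m) & (EX F. bsup F f)"
proof
 assume "f : carrier IL"
 then obtain F s where F: "finite F" "\<forall>(i, w)\<in>F. s (i, w) : bicomp IL i w"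
 "f = (%m. finsum (galg (C m) (\<delta> m)) (%p. s p m) F)" unfolding IL_def inverse_limit_def by auto
 have b: "s p m : C m & cmp (fst p) (snd p) (s p m) = s p m & t m (s p (Suc m)) = s p m" if "p : F" for p m
 proof -
 have "s p : bicomp IL (fst p) (snd p)" using F(2) that by (cases p) auto
 then show ?thesis unfolding IL_bi by blast
 qed
 have fm: "f m = (\<Sum>p\<in>F. s p m)" for m
 unfolding F(3) by (rule hdga.finsum_sum[OF hdga_galg[OF sub] F(1)]) (use b in \<open>simp add: galg_def\<close>)
 have "f m : C m" for m unfolding fm by (rule C_sum) (use b in blast)
 moreover have "t m (f (Suc m)) = f m" for m unfolding fm glin_sum[OF glt] by (rule sum.cong) (use b in auto)
 moreover have "bsup F f" unfolding bsup_def fm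
 proof (intro conjI allI gsp_sum F(1))
 fix m p assume "p : F"
 then show "s p m : gsp (%M. (nod M, wt M) : F)" using b[of p m] by (intro cmp_bsup[of "fst p" "snd p"]) auto
 qed
 ultimately show "(ALL m. f m : C m & t m (f (Suc m)) = f m) & (EX F. bsup F f)" by blast
next
 assume f: "(ALL m. f m : C m & t m (f (Suc m)) = f m) & (EX F. bsup F f)"
 then obtain F where F: "bsup F f" by blast
 let ?s = "%p m. cmp (fst p) (snd p) (f m)"
 have "?s p : bicomp IL (fst p) (snd p)" for p
 unfolding IL_bi using f by (auto simp: gfilter_gfilter tcmp[symmetric] intro: CD'(7))
 then have s: "\<forall>(i, w)\<in>F. ?s (i, w) : lim_bicomp (%m. galg (C m) (\<delta> m)) t i w"
 by (auto simp: IL_def inverse_limit_def)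
 have "finsum (galg (C m) (\<delta> m)) (%p. ?s p m) F = (\<Sum>p\<in>F. ?s p m)" for m
 by (rule hdga.finsum_sum[OF hdga_galg[OF sub]]) (use F f in \<open>auto simp: bsup_def galg_def intro: CD'(7)\<close>)
 then have e: "f = (%m. finsum (galg (C m) (\<delta> m)) (%p. ?s p m) F)" using bsup_decompose[OF F] by (simp add: fun_eq_iff)
 have fin: "finite F" using F by (simp add: bsup_def)
 show "f : carrier IL" unfolding IL_def inverse_limit_def partial_object.select_convs
 by (rule CollectI, rule exI[of _ F], rule exI[of _ ?s], rule conjI, rule e, rule conjI, rule fin, rule s)
qed

lemma bi_carrier: "bicomp IL i w \<subseteq> carrier IL"
proof
 fix f assume f: "f : bicomp IL i w"
 have b: "f m : gsp (%M. (nod M, wt M) : {(i, w)})" for m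
 by (rule cmp_bsup[of i w]) (use f in \<open>simp_all add: IL_bi\<close>)
 have "bsup {(i, w)} f" unfolding bsup_def by (rule conjI, simp, rule allI, rule b)
 then show "f : carrier IL" using f unfolding IL_carrier IL_bi by blast
qed

lemma cmp_bi: "f : carrier IL ==> (%m. cmp i w (f m)) : bicomp IL i w"
 unfolding IL_bi IL_carrier by (auto simp: gfilter_gfilter tcmp[symmetric] intro: CD'(7))

lemma carrier_unary:
 assumes f: "f : carrier IL" and "!!m. g m : C m" "!!m. t m (g (Suc m)) = g m"
 and "!!F. bsup F f ==> EX F'. bsup F' g"
 shows "g : carrier IL" using assms unfolding IL_carrier by blast

lemma carrier_binary:
 assumes "f : carrier IL" "g : carrier IL" "!!m. h m : C m" "!!m. t m (h (Suc m)) = h m"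
 and "!!F G. bsup F f ==> bsup G g ==> EX F'. bsup F' h"
 shows "h : carrier IL" using assms unfolding IL_carrier by blast

lemma carrierD: "f : carrier IL ==> f m : C m" "f : carrier IL ==> t m (f (Suc m)) = f m" unfolding IL_carrier by blast+

lemma carrier_mult:
 assumes f: "f : carrier IL" and g: "g : carrier IL"
 shows "(%m. f m * g m) : carrier IL"
proof (rule carrier_binary[OF f g])
 show "f m * g m : C m" for m by (intro CD'(3) carrierD f g)
 show "t m (f (Suc m) * g (Suc m)) = f m * g m" for m by (simp add: ghom_mult[OF ght] carrierD f g)
 fix F G assume "bsup F f" "bsup G g"
 then have "bsup ((%((a, b), (c, d)). (a + c, b + d)) ` (F \<times> G)) (%m. f m * g m)"
 unfolding bsup_def by (auto intro!: gsp_mult simp: image_iff) (auto intro!: bexI simp: algebra_simps)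
 then show "EX F'. bsup F' (%m. f m * g m)" by blast
qed

lemma carrier_add:
 assumes f: "f : carrier IL" and g: "g : carrier IL"
 shows "(%m. f m + g m) : carrier IL"
proof (rule carrier_binary[OF f g])
 show "f m + g m : C m" for m by (intro CD'(2) carrierD f g)
 show "t m (f (Suc m) + g (Suc m)) = f m + g m" for m by (simp add: glin_add[OF glt] carrierD f g)
 fix F G assume b: "bsup F f" "bsup G g"
 have "f m : gsp (%M. (nod M, wt M) : F \<union> G)" "g m : gsp (%M. (nod M, wt M) : F \<union> G)" for m
 using b by (auto simp: bsup_def elim!: allE[of _ m] gsp_mono)
 then have "bsup (F \<union> G) (%m. f m + g m)" using b unfolding bsup_def by (auto intro: gsp_add)
 then show "EX F'. bsup F' (%m. f m + g m)" by blast
qed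

lemma carrier_cs:
 assumes f: "f : carrier IL"
 shows "(%m. cs c * f m) : carrier IL"
proof (rule carrier_unary[OF f])
 show "cs c * f m : C m" for m by (intro CD'(4) carrierD f)
 show "t m (cs c * f (Suc m)) = cs c * f m" for m by (simp add: glin_cs[OF glt] carrierD f)
 show "EX F'. bsup F' (%m. cs c * f m)" if "bsup F f" for F using that unfolding bsup_def by (auto intro: gsp_cs)
qed

lemma carrier_gi:
 assumes f: "f : carrier IL"
 shows "(%m. gi (f m)) : carrier IL"
proof (rule carrier_unary[OF f])
 show "gi (f m) : C m" for m by (intro CD'(5) carrierD f)
 show "t m (gi (f (Suc m))) = gi (f m)" for m unfolding tgi[symmetric] by (simp add: carrierD f)
 show "EX F'. bsup F' (%m. gi (f m))" if "bsup F f" for F using that unfolding bsup_def by (auto intro: gi_gsp)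
qed

lemma carrier_d:
 assumes f: "f : carrier IL"
 shows "(%m. gca_diff (\<delta> m) (f m)) : carrier IL"
proof (rule carrier_unary[OF f])
 show "gca_diff (\<delta> m) (f m) : C m" for m by (intro CD'(6) carrierD f)
 show "t m (gca_diff (\<delta> (Suc m)) (f (Suc m))) = gca_diff (\<delta> m) (f m)" for m
 using td[OF carrierD(1)[OF f, of "Suc m"]] carrierD(2)[OF f, of m] by simp
 fix F assume F: "bsup F f"
 \<comment> \<open>The truncated \<open>i - 1\<close> in degree 0 is harmless: that part has zero
   differential.\<close>
 let ?F = "(%(i, w). (i - 1, w)) ` F"
 have "gca_diff (\<delta> m) (f m) : gsp (%M. (nod M, wt M) : ?F)" for m
 proof -
 have e: "gca_diff (\<delta> m) (f m) = (\<Sum>p\<in>F. gca_diff (\<delta> m) (cmp (fst p) (snd p) (f m)))"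
 using bsup_decompose[OF F, of m] glin_sum[OF glin_gd, of "\<delta> m" "%p. cmp (fst p) (snd p) (f m)" F] by simp
 show ?thesis unfolding e
 proof (rule gsp_sum)
 fix p assume p: "p : F"
 obtain i w where iw: "p = (i, w)" by (cases p)
 show "gca_diff (\<delta> m) (cmp (fst p) (snd p) (f m)) : gsp (%M. (nod M, wt M) : ?F)"
 proof (cases i)
 case 0
 then show ?thesis using iw by (simp add: d0)
 next
 case (Suc j)
 have "(j, w) : ?F" using p iw Suc by force
 then have "cmp j w (gca_diff (\<delta> m) (f m)) : gsp (%M. (nod M, wt M) : ?F)"
 by (intro cmp_bsup[of j w]) (simp_all add: gfilter_gfilter)
 then show ?thesis unfolding dcmp using iw Suc by simp
 qed
 qed
 qed
 then have "bsup ?F (%m. gca_diff (\<delta> m) (f m))" using F unfolding bsup_def by blast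
 then show "EX F'. bsup F' (%m. gca_diff (\<delta> m) (f m))" by blast
qed

lemma carrier_1: "(%m. 1) : carrier IL"
proof -
 have "1 : gsp (%M :: ('v + 'o) multiset. (nod M, wt M) : {(0, 0)})" by (rule gsp_1) simp
 then have "bsup {(0, 0)} (%m. 1)" by (simp add: bsup_def)
 then show ?thesis unfolding IL_carrier using CD'(1) ghom_1[OF ght] by blast
qed

lemma hdga_IL: "hdga IL"
proof
 show "1 : carrier IL" using carrier_1 by (simp add: one_fun_def)
 show "0 : carrier IL" using carrier_cs[OF carrier_1, of 0] by (simp add: zero_fun_def)
 fix x y :: "nat => ('v, 'o, 'k) gca" and a c
 show "x + y : carrier IL" "x * y : carrier IL" if "x : carrier IL" "y : carrier IL"
 using carrier_add[OF that] carrier_mult[OF that] by (simp_all add: plus_fun_def times_fun_def)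
 show "x - y : carrier IL" if "x : carrier IL" "y : carrier IL"
 using carrier_add[OF that(1) carrier_cs[OF that(2), of "- 1"]] by (simp add: cs_uminus fun_diff_def)
 show "module.smult IL c x : carrier IL" if "x : carrier IL" using carrier_cs[OF that] by (simp add: IL_simps)
 show "bgdga.diff IL x : carrier IL" if "x : carrier IL" using carrier_d[OF that] by (simp add: IL_simps)
 show "module.smult IL c (x + y) = module.smult IL c x + module.smult IL c y"
 by (simp add: IL_simps plus_fun_def distrib_left)
 show "bgdga.diff IL (x + y) = bgdga.diff IL x + bgdga.diff IL y" by (simp add: IL_simps plus_fun_def glin_add[OF glin_gd])
 show "bgdga.diff IL 1 = 0" by (simp add: IL_simps one_fun_def zero_fun_def gca_diff_1)
 show "bgdga.diff IL (module.smult IL c x) = module.smult IL c (bgdga.diff IL x)" by (simp add: IL_simps glin_cs[OF glin_gd])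
 show "bgdga.diff IL (bgdga.diff IL x) = 0" by (simp add: IL_simps zero_fun_def gca_diff_diff)
 show "bgdga.diff IL (x * y) = 0" if "bgdga.diff IL x = 0" "bgdga.diff IL y = 0"
 using that by (simp add: IL_simps zero_fun_def fun_eq_iff times_fun_def gca_diff_mult)
 show "x * bgdga.diff IL a : bgdga.diff IL ` carrier IL" "bgdga.diff IL a * x : bgdga.diff IL ` carrier IL"
 if x: "x : carrier IL" "bgdga.diff IL x = 0" "a : carrier IL"
 proof -
 have x0: "gca_diff (\<delta> m) (x m) = 0" for m using x(2) by (simp add: IL_simps zero_fun_def fun_eq_iff)
 have "x * bgdga.diff IL a = bgdga.diff IL (%m. gi (x m) * a m)" "bgdga.diff IL a * x = bgdga.diff IL (%m. a m * x m)"
 by (simp_all add: IL_simps times_fun_def gca_diff_cycle_mult[OF x0])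
 then show "x * bgdga.diff IL a : bgdga.diff IL ` carrier IL" "bgdga.diff IL a * x : bgdga.diff IL ` carrier IL"
 using carrier_mult[OF carrier_gi[OF x(1)] x(3)] carrier_mult[OF x(3,1)] by simp_all
 qed
 show "bicomp IL i w \<subseteq> carrier IL" for i w by (rule bi_carrier)
qed (simp_all add: IL_simps)

end

section \<open>Lifting through the towers\<close>

lemma dD_cmp_0: "dD n (cmp 0 w x) = 0"
proof -
 have "dD n (cmp 0 w x) : gsp (%M. Suc (nod M) = 0 & wt M = w)" by (rule dD_bidegree[OF gfilter_in_gsp])
 then show ?thesis using gfilter_eq_0[of "dD n (cmp 0 w x)" "%_. False" "%_. False"] by (simp add: gsp_def)
qed

lemma CD_below: "f : CD n ==> f : gsp (below n)" by (simp add: CD_def)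

lemma tower_D: "tower (%m. CD (Suc m)) (%m. DRep_diff (Suc m)) (%m. DRep_trans (Suc m))"
 by unfold_locales (rule subdga_D ghom_mt cmp_mt gi_mt dD_gfilter dD_cmp_0 mt_dD[OF CD_below], assumption?)+

lemma tower_S: "tower (%m. CS (Suc m)) (%_ _. 0) (%m. Diag_trans (Suc m))"
 by unfold_locales (auto intro: subdga_S ghom_dt cmp_dt gi_dt simp: gca_diff_zero glin_0[OF glin_gf] glin_0[OF ghom_glin[OF ghom_dt]])

text \<open>Level w + 1 is in the stable range for all bidegrees of weight w, as these have w - i
  letters. A preimage found there extends by \<open>extend_sequence\<close>, and
  \<open>stable_zero\<close> carries both properties, being a cycle and lying over y, to all
  levels.\<close>

lemma limit_surjective:
 assumes y: "!!m. y m : CS (Suc m)" "!!m. cmp i w (y m) = y m" "!!m. Diag_trans (Suc m) (y (Suc m)) = y m"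
 shows "EX z. ALL m. z m : CD (Suc m) & cmp i w (z m) = z m & DRep_trans (Suc m) (z (Suc m)) = z m &
 dD (Suc m) (z m) = 0 & harish_chandra (z m) = (y m :: 'k::field_char_0 diag_gca)"
proof -
 have yb: "y w : gca_bihomogeneous i w" using y(2) by (simp add: cmp_self_iff)
 obtain u where u: "u : CD (Suc w)" "u : gca_bihomogeneous i w" "dD (Suc w) u = 0" "harish_chandra u = y w"
 using hc_surjective[OF y(1) yb] by blast
 obtain z where z: "!!m. z m : CD m" "!!m. z m : gca_bihomogeneous i w" "!!m. DRep_trans m (z (Suc m)) = z m" "z (Suc w) = u"
 using extend_sequence[OF u(1,2) le_SucI[OF diff_le_self]] by auto
 have zQ: "z m : gsp (%M. nod M = i & wt M = w)" for m using z(2) by (simp add: gca_bihomogeneous_eq)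
 have zb: "z m : gsp (below m)" for m using z(1) by (simp add: CD_def)
 have "dD (Suc m) (z (Suc m)) = 0" for m
 proof (rule stable_zero[where T = "%m. DRep_trans (Suc m)" and c = "%m. dD (Suc m) (z (Suc m))" and N = w])
 show "DRep_trans (Suc m) (dD (Suc (Suc m)) (z (Suc (Suc m)))) = dD (Suc m) (z (Suc m))" for m unfolding mt_dD[OF zb] z(3) ..
 show "dD (Suc w) (z (Suc w)) = 0" unfolding z(4) by (rule u(3))
 show "dD (Suc (Suc m)) (z (Suc (Suc m))) = 0" if m: "m \<ge> w" "DRep_trans (Suc m) (dD (Suc (Suc m)) (z (Suc (Suc m)))) = 0" for m
 proof (rule kill_inj_D[OF _ _ _ m(2)])
 show "dD (Suc (Suc m)) (z (Suc (Suc m))) : CD (Suc (Suc m))" by (rule subdgaD(6)[OF subdga_D z(1)])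
 \<comment> \<open>The differential trades one theta for an x and a y, so there is one letter more
   than in z.\<close>
 show "dD (Suc (Suc m)) (z (Suc (Suc m))) : gsp (%M. size M = Suc w - i)"
 proof (rule gsp_mono[OF dD_bidegree[OF zQ]])
 show "size M = Suc w - i" if "Suc (nod M) = i & wt M = w" for M using that size_nev_nod[of M] by linarith
 qed
 show "Suc w - i <= Suc m" using m by simp
 qed
 qed (simp add: glin_0[OF ghom_glin[OF ghom_mt]])
 moreover have "harish_chandra (z (Suc m)) - y m = 0" for m
 proof (rule stable_zero[where T = "%m. Diag_trans (Suc m)" and c = "%m. harish_chandra (z (Suc m)) - y m" and N = w])
 show "Diag_trans (Suc m) (harish_chandra (z (Suc (Suc m))) - y (Suc m)) = harish_chandra (z (Suc m)) - y m" for m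
 unfolding glin_diff[OF ghom_glin[OF ghom_dt]] y(3) hc_mt[symmetric] z(3) ..
 show "harish_chandra (z (Suc w)) - y w = 0" by (simp add: z(4) u(4))
 show "harish_chandra (z (Suc (Suc m))) - y (Suc m) = 0"
 if m: "m \<ge> w" "Diag_trans (Suc m) (harish_chandra (z (Suc (Suc m))) - y (Suc m)) = 0" for m
 proof (rule kill_inj_S[OF _ _ _ m(2)])
 show "harish_chandra (z (Suc (Suc m))) - y (Suc m) : CS (Suc (Suc m))" by (intro subdgaD(9)[OF subdga_S] hc_CD z(1) y(1))
 have "cmp i w (harish_chandra (z (Suc (Suc m)))) = harish_chandra (z (Suc (Suc m)))"
 using z(2)[of "Suc (Suc m)"] unfolding cmp_hc cmp_self_iff by simp
 then show "harish_chandra (z (Suc (Suc m))) - y (Suc m) : gsp (%M. nod M = i & wt M = w)"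
 using y(2)[of "Suc m"] by (intro gsp_diff) (simp_all add: gsp_def)
 show "w - i <= Suc m" using m by simp
 qed
 qed (simp add: glin_0[OF ghom_glin[OF ghom_dt]])
 ultimately show ?thesis using z by (intro exI[of _ "%m. z (Suc m)"]) (simp add: cmp_self_iff[symmetric])
qed

text \<open>\<open>Dg_injective\<close> at level w + 1 gives a primitive. It is projected to
  bidegree (i + 1, w) and extended to all levels, and \<open>stable_zero\<close> propagates the
  equation for its differential.\<close>

lemma limit_injective:
 assumes z: "!!m. z m : CD (Suc m)" "!!m. cmp i w (z m) = z m" "!!m. DRep_trans (Suc m) (z (Suc m)) = z m"
 and d: "!!m. dD (Suc m) (z m) = 0" and hc: "!!m. harish_chandra (z m) = (0 :: 'k::field_char_0 diag_gca)"
 shows "EX h. ALL m. h m : CD (Suc m) & cmp (Suc i) w (h m) = h m & DRep_trans (Suc m) (h (Suc m)) = h m & dD (Suc m) (h m) = z m"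
proof -
 have sz: "z m : gsp (%M. size M = w - i)" for m
 proof -
 have zQ: "z m : gsp (%M. nod M = i & wt M = w)" using z(2) by (simp add: gsp_def)
 show ?thesis
 proof (rule gsp_mono[OF zQ])
 show "size M = w - i" if "nod M = i & wt M = w" for M using that size_nev_nod[of M] by linarith
 qed
 qed
 have zw: "z w : GL_invariants (Suc w)" "z w : gsp (below (Suc w))" using z(1)[of w] by (simp_all add: CD_def)
 have Dz: "Dg (z w) = 0" unfolding io_hc[symmetric] hc by (rule glin_0[OF glin_io])
 obtain g where g: "g : GL_invariants (Suc w)" "g : gsp (below (Suc w))" "z w = dD (Suc w) g"
 using Dg_injective[OF zw(1) gsp_conj[OF zw(2) sz] le_SucI[OF diff_le_self] d Dz] by blast
 let ?u = "cmp (Suc i) w g"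
 have gC: "g : CD (Suc w)" using g by (simp add: CD_def)
 have u: "?u : CD (Suc w)" by (rule subdgaD(7)[OF subdga_D gC])
 have ub: "?u : gca_bihomogeneous (Suc i) w" unfolding gca_bihomogeneous_eq by (rule gfilter_in_gsp)
 have du: "dD (Suc w) ?u = z w" unfolding dD_gfilter[symmetric] g(3)[symmetric] by (rule z(2))
 obtain h where h: "!!m. h m : CD m" "!!m. h m : gca_bihomogeneous (Suc i) w" "!!m. DRep_trans m (h (Suc m)) = h m" "h (Suc w) = ?u"
 using extend_sequence[OF u ub le_SucI[OF diff_le_self]] by auto
 have hb: "h m : gsp (below m)" for m using h(1) by (simp add: CD_def)
 have "dD (Suc m) (h (Suc m)) - z m = 0" for m
 proof (rule stable_zero[where T = "%m. DRep_trans (Suc m)" and c = "%m. dD (Suc m) (h (Suc m)) - z m" and N = w])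
 show "DRep_trans (Suc m) (dD (Suc (Suc m)) (h (Suc (Suc m))) - z (Suc m)) = dD (Suc m) (h (Suc m)) - z m" for m
 unfolding glin_diff[OF ghom_glin[OF ghom_mt]] mt_dD[OF hb] h(3) z(3) ..
 show "dD (Suc w) (h (Suc w)) - z w = 0" by (simp add: h(4) du)
 show "dD (Suc (Suc m)) (h (Suc (Suc m))) - z (Suc m) = 0"
 if m: "m \<ge> w" "DRep_trans (Suc m) (dD (Suc (Suc m)) (h (Suc (Suc m))) - z (Suc m)) = 0" for m
 proof (rule kill_inj_D[OF _ _ _ m(2)])
 show "dD (Suc (Suc m)) (h (Suc (Suc m))) - z (Suc m) : CD (Suc (Suc m))"
 by (intro subdgaD(9)[OF subdga_D] subdgaD(6)[OF subdga_D] h(1) z(1))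
 have hQ: "h (Suc (Suc m)) : gsp (%M. nod M = Suc i & wt M = w)" using h(2) by (simp add: gca_bihomogeneous_eq)
 show "dD (Suc (Suc m)) (h (Suc (Suc m))) - z (Suc m) : gsp (%M. size M = w - i)"
 proof (rule gsp_diff[OF gsp_mono[OF dD_bidegree[OF hQ]] sz])
 show "size M = w - i" if "Suc (nod M) = Suc i & wt M = w" for M using that size_nev_nod[of M] by linarith
 qed
 show "w - i <= Suc m" using m by simp
 qed
 qed (simp add: glin_0[OF ghom_glin[OF ghom_mt]])
 then show ?thesis using h by (intro exI[of _ "%m. h (Suc m)"]) (simp add: cmp_self_iff[symmetric])
qed

lemma finite_level: "hhom (DRep_GL n) (Diag_S n) (harish_chandra :: 'k::field_char_0 mat_gca => _)"
 unfolding DRep_GL_eq Diag_S_eq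
proof (rule hhom.intro[OF hdga_galg[OF subdga_D] hdga_galg[OF subdga_S]], unfold_locales)
 fix i w and y :: "'k diag_gca" assume "y : bicomp (galg (CS n) (%_. 0)) i w"
 then show "EX z. z : bicomp (galg (CD n) (DRep_diff n)) i w & bgdga.diff (galg (CD n) (DRep_diff n)) z = 0 &
 harish_chandra z = (y :: 'k diag_gca)" using hc_surjective[of y n i w] by (auto simp: galg_def)
next
 fix i w and x :: "'k mat_gca" assume "x : bicomp (galg (CD n) (DRep_diff n)) i w"
 then show "harish_chandra x : bicomp (galg (CS n) (%_. 0)) i w"
 using hc_CD[of x n] cmp_hc[of i w x] by (simp add: galg_def cmp_self_iff)
next
 fix x y :: "'k mat_gca"
 show "harish_chandra (x * y) = harish_chandra x * harish_chandra y" by (rule ghom_mult[OF ghom_hc])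
qed (simp_all add: galg_def hc_CD glin_add[OF glin_hc] ghom_1[OF ghom_hc] gca_smult_eq glin_cs[OF glin_hc]
 gca_diff_zero hc_dD CD_def)


theorem theorem4p2:
  shows "(\<forall>n\<ge>1. degreewise_surjective
            (homology (DRep_GL n :: ('k::field_char_0, 'k mat_gca) bgdga))
            (homology (Diag_S n :: ('k, 'k diag_gca) bgdga))
            (homology_map (DRep_GL n) (Diag_S n) harish_chandra)) \<and>
         bigraded_algebra_iso
            (homology (DRep_GL_infinity :: ('k, nat \<Rightarrow> 'k mat_gca) bgdga))
            (homology (Diag_S_infinity :: ('k, nat \<Rightarrow> 'k diag_gca) bgdga))
            (homology_map DRep_GL_infinity Diag_S_infinity harish_chandra_infinity)"

proof
 show "\<forall>n\<ge>1. degreewise_surjective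
 (homology (DRep_GL n :: ('k::field_char_0, 'k mat_gca) bgdga)) (homology (Diag_S n :: ('k, 'k diag_gca) bgdga))
 (homology_map (DRep_GL n) (Diag_S n) harish_chandra)" using hhom.degreewise[OF finite_level] by blast
 interpret D: tower "%m. CD (Suc m) :: 'k mat_gca set" "%m. DRep_diff (Suc m)" "%m. DRep_trans (Suc m)" by (rule tower_D)
 interpret S: tower "%m. CS (Suc m) :: 'k diag_gca set" "%_ _. 0" "%m. Diag_trans (Suc m)" by (rule tower_S)
 have eqD: "DRep_GL_infinity = D.IL" unfolding DRep_GL_infinity_def DRep_GL_eq D.IL_def ..
 have eqS: "Diag_S_infinity = S.IL" unfolding Diag_S_infinity_def Diag_S_eq S.IL_def ..
 note hci = harish_chandra_infinity_def
 \<comment> \<open>The comparison map preserves bidegrees, so a finite support is carried over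
   unchanged.\<close>
 have sup: "S.bsup F (%m. harish_chandra (f m))" if "D.bsup F f" for F f
 proof -
 have "harish_chandra (f m) : gsp (%M. (nod M, wt M) : F)" for m
 proof -
 have "harish_chandra (f m) = (\<Sum>p\<in>F. cmp (fst p) (snd p) (harish_chandra (f m)))"
 using D.bsup_decompose[OF that, of m] glin_sum[OF glin_hc, of "%p. cmp (fst p) (snd p) (f m)" F] unfolding cmp_hc by simp
 moreover have "(\<Sum>p\<in>F. cmp (fst p) (snd p) (harish_chandra (f m))) : gsp (%M. (nod M, wt M) : F)"
 by (rule gsp_sum, rule gsp_mono[OF gfilter_in_gsp]) auto
 ultimately show ?thesis by (simp only:)
 qed
 then show ?thesis using that by (simp add: S.bsup_def D.bsup_def)
 qed
 have h: "hhom D.IL S.IL harish_chandra_infinity"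
 proof (rule hhom.intro[OF D.hdga_IL S.hdga_IL], unfold_locales)
 fix x y :: "nat => 'k mat_gca" and c
 show "harish_chandra_infinity x : carrier S.IL" if x: "x : carrier D.IL"
 using x sup[of _ x] unfolding S.IL_carrier D.IL_carrier hci by (auto simp: hc_CD hc_mt[symmetric])
 show "harish_chandra_infinity (x + y) = harish_chandra_infinity x + harish_chandra_infinity y"
 "harish_chandra_infinity (x * y) = harish_chandra_infinity x * harish_chandra_infinity y"
 by (simp_all add: hci plus_fun_def times_fun_def glin_add[OF glin_hc] ghom_mult[OF ghom_hc])
 show "harish_chandra_infinity (module.smult D.IL c x) = module.smult S.IL c (harish_chandra_infinity x)"
 by (simp add: hci D.IL_simps S.IL_simps glin_cs[OF glin_hc])
 show "harish_chandra_infinity (bgdga.diff D.IL x) = 0" if "x : carrier D.IL"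
 by (simp add: hci D.IL_simps zero_fun_def hc_dD CD_below D.carrierD(1)[OF that])
 show "harish_chandra_infinity x : bicomp S.IL i w" if "x : bicomp D.IL i w" for i w
 using that unfolding S.IL_bi D.IL_bi hci by (auto simp: hc_CD hc_mt[symmetric] cmp_hc)
 next
 fix i w and y :: "nat => 'k diag_gca" assume "y : bicomp S.IL i w"
 then obtain z where "ALL m. z m : CD (Suc m) & cmp i w (z m) = z m & DRep_trans (Suc m) (z (Suc m)) = z m &
 dD (Suc m) (z m) = 0 & harish_chandra (z m) = y m" using limit_surjective[of y i w] unfolding S.IL_bi by blast
 then show "EX z. z : bicomp D.IL i w & bgdga.diff D.IL z = 0 & harish_chandra_infinity z = y"
 by (intro exI[of _ z]) (simp add: D.IL_bi D.IL_simps zero_fun_def hci fun_eq_iff)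
 qed (simp_all add: hci one_fun_def ghom_1[OF ghom_hc] S.IL_simps zero_fun_def gca_diff_zero)
 interpret hhom D.IL S.IL harish_chandra_infinity by (rule h)
 have "bigraded_algebra_iso (homology D.IL) (homology S.IL) (homology_map D.IL S.IL harish_chandra_infinity)"
 proof (rule iso)
 fix z assume z: "z : carrier D.IL" "bgdga.diff D.IL z = 0" "harish_chandra_infinity z = 0"
 have dz: "dD (Suc m) (z m) = 0" and hz: "harish_chandra (z m) = 0" for m
 using z(2,3) by (simp_all add: D.IL_simps zero_fun_def hci fun_eq_iff)
 obtain F where F: "D.bsup F z" using z(1) unfolding D.IL_carrier by blast
 \<comment> \<open>The bihomogeneous parts of z are shown to be boundaries separately; there are
   finitely many, so the sum of the primitives lies in the limit.\<close>
 have "EX h. h : carrier D.IL & (ALL m. dD (Suc m) (h m) = cmp (fst p) (snd p) (z m))" for p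
 proof -
 obtain i w where p: "p = (i, w)" by (cases p)
 let ?z = "%m. cmp i w (z m)"
 have zb: "?z : bicomp D.IL i w" by (rule D.cmp_bi[OF z(1)])
 have "dD (Suc m) (?z m) = 0" for m
 proof (cases i)
 case (Suc j)
 then show ?thesis using D.dcmp[of j w m "z m"] dz by (simp add: glin_0[OF glin_gf])
 qed (simp add: dD_cmp_0)
 moreover have "harish_chandra (?z m) = 0" for m unfolding cmp_hc[symmetric] hz by (rule glin_0[OF glin_gf])
 ultimately obtain h where h: "ALL m. h m : CD (Suc m) & cmp (Suc i) w (h m) = h m & DRep_trans (Suc m) (h (Suc m)) = h m & dD (Suc m) (h m) = ?z m"
 using limit_injective[of ?z i w] zb unfolding D.IL_bi by blast
 then have "h : bicomp D.IL (Suc i) w" unfolding D.IL_bi by blast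
 then have "h : carrier D.IL" using D.bi_carrier by blast
 then show ?thesis using h unfolding p fst_conv snd_conv by blast
 qed
 then obtain h where h: "!!p. h p : carrier D.IL" "!!p m. dD (Suc m) (h p m) = cmp (fst p) (snd p) (z m)" by metis
 have "(\<Sum>p\<in>F. h p) : carrier D.IL" by (rule A.carrier_sum) (rule h(1))
 moreover have "z = bgdga.diff D.IL (\<Sum>p\<in>F. h p)"
 using D.bsup_decompose[OF F] by (simp add: D.IL_simps fun_eq_iff sum_fun_apply glin_sum[OF glin_gd] h(2))
 ultimately show "z : boundaries D.IL" unfolding A.B by blast
 next
 fix y assume y: "y : carrier S.IL"
 obtain F where F: "S.bsup F y" using y unfolding S.IL_carrier by blast
 \<comment> \<open>Likewise each bihomogeneous part of y is lifted to a cycle, and the finitely many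
   lifts are added.\<close>
 have "EX z. z : cycles D.IL & harish_chandra_infinity z = (%m. cmp (fst p) (snd p) (y m))" for p
 using surj[OF S.cmp_bi[OF y]] A.bi unfolding A.Z by blast
 then obtain z where z: "!!p. z p : cycles D.IL" "!!p. harish_chandra_infinity (z p) = (%m. cmp (fst p) (snd p) (y m))" by metis
 have "harish_chandra_infinity (\<Sum>p\<in>F. z p) = y"
 unfolding f_sum z(2) using S.bsup_decompose[OF F] by (simp add: fun_eq_iff sum_fun_apply)
 then show "\<exists>z\<in>cycles D.IL. harish_chandra_infinity z = y" using A.Z_sum[of F z] z(1) by blast
 qed
 then show "bigraded_algebra_iso (homology (DRep_GL_infinity :: ('k, nat => 'k mat_gca) bgdga))
 (homology (Diag_S_infinity :: ('k, nat => 'k diag_gca) bgdga))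
 (homology_map DRep_GL_infinity Diag_S_infinity harish_chandra_infinity)" unfolding eqD eqS .
qed

end
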